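(* Let $M:[0,\infty)\to[0,\infty)$ be continuous, put $\mathscr M(t)=\int_0^t M(\tau)\,d\tau$, and assume: (i) there exists $\theta\in[1,p^*/q)$ such that $tM(t)\le\theta\mathscr M(t)$ for any $t\in[0,\infty)$; (ii) for any $\tau>0$ there exists $\kappa=\kappa(\tau)>0$ such that $M(t)\ge\kappa$ for any $t\ge\tau$. Let $f:\Omega\times\mathbb R\to\mathbb R$ be a Carathéodory function, put $F(x,t)=\int_0^t f(x,\tau)\,d\tau$, and assume (with the $\theta$ of (i)): (iii) there exists an exponent $r\in(q\theta,p^* )$ such that for any $\varepsilon>0$ there exists $\delta_\varepsilon=\delta(\varepsilon)>0$ such that $|f(x,t)|\le q\theta\varepsilon|t|^{q\theta-1}+r\delta_\varepsilon|t|^{r-1}$ for a.e. $x\in\Omega$ and any $t\in\mathbb R$; (iv) there exist $\sigma\in(q\theta,p^* )$, $c>0$ and $t_0\ge0$ such that $c\le\sigma F(x,t)\le tf(x,t)$ for a.e. $x\in\Omega$ and any $|t|\ge t_0$. Then the problem $$-M\left[\int_\Omega\left(\frac{|\nabla u|^p}{p}+a(x)\frac{|\nabla u|^q}{q}\right)dx\right]\mathrm{div}\left(|\nabla u|^{p-2}\nabla u+a(x)|\nabla u|^{q-2}\nabla u\right)=f(x,u)\ \text{in }\Omega,\qquad u=0\ \text{on }\partial\Omega,$$ admits a non-trivial weak solution $u\in W^{1,\mathcal H}_0(\Omega)$.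
   Context: Standing assumptions: $\Omega\subset\mathbb R^N$ is an open, bounded set with Lipschitz boundary, $N\ge2$, $1<p<q<N$, $\frac qp<1+\frac1N$, and $a:\overline\Omega\to[0,\infty)$ is Lipschitz continuous. $p^*=Np/(N-p)$. Function spaces: $\mathcal H(x,t)=t^p+a(x)t^q$ for $x\in\Omega$, $t\ge0$; $\varrho_{\mathcal H}(u)=\int_\Omega(|u|^p+a(x)|u|^q)\,dx$; $L^{\mathcal H}(\Omega)$ is the space of measurable $u:\Omega\to\mathbb R$ with $\varrho_{\mathcal H}(u)<\infty$, with the Luxemburg norm $\|u\|_{\mathcal H}=\inf\{\lambda>0:\varrho_{\mathcal H}(u/\lambda)\le1\}$. $W^{1,\mathcal H}(\Omega)=\{u\in L^{\mathcal H}(\Omega):|\nabla u|\in L^{\mathcal H}(\Omega)\}$ with norm $\|u\|_{\mathcal H}+\|\,|\nabla u|\,\|_{\mathcal H}$, and $W^{1,\mathcal H}_0(\Omega)$ is the completion (closure) of $C_0^\infty(\Omega)$ in $W^{1,\mathcal H}(\Omega)$, endowed with the equivalent norm $\|u\|=\|\,|\nabla u|\,\|_{\mathcal H}$. Weak solution: $u\in W^{1,\mathcal H}_0(\Omega)$ is a weak solution of the problem if, for any $\varphi\in W^{1,\mathcal H}_0(\Omega)$, $$M\left[\int_\Omega\left(\frac{|\nabla u|^p}{p}+a(x)\frac{|\nabla u|^q}{q}\right)dx\right]\int_\Omega\left(|\nabla u|^{p-2}+a(x)|\nabla u|^{q-2}\right)\nabla u\cdot\nabla\varphi\,dx=\int_\Omega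 f(x,u)\varphi\,dx.$$ *)

theory Defs
  imports "HOL-Analysis.Analysis"
begin

text \<open>
  The space R^N is a type of class \<open>euclidean_space\<close>, with N = \<open>DIM('a)\<close>. Functions on an open set
  \<open>\<Omega>\<close> are total functions on the type of which only the values on \<open>\<Omega>\<close> matter; measurability and
  ``almost everywhere'' refer to the Lebesgue measure on \<open>\<Omega>\<close>.
\<close>

section \<open>Domains\<close>

text \<open>
  Near every boundary point, and after a rotation taking \<open>\<nu>\<close> to the last coordinate direction,
  \<open>\<Omega>\<close> is the part of a ball lying above the graph of a Lipschitz function \<open>\<gamma>\<close> on the hyperplane
  orthogonal to \<open>\<nu>\<close>; \<open>y - (y \<bullet> \<nu>) *\<^sub>R \<nu>\<close> is the orthogonal projection of \<open>y\<close> to that hyperplane.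
\<close>
definition lipschitz_boundary :: "'a::euclidean_space set \<Rightarrow> bool" where
  "lipschitz_boundary \<Omega> \<longleftrightarrow>
    (\<forall>z\<in>frontier \<Omega>. \<exists>\<nu> \<rho> L. \<exists>\<gamma> :: 'a \<Rightarrow> real.
       norm \<nu> = 1 \<and> 0 < \<rho> \<and> L-lipschitz_on {y. y \<bullet> \<nu> = 0} \<gamma> \<and>
       \<Omega> \<inter> ball z \<rho> = {y \<in> ball z \<rho>. \<gamma> (y - (y \<bullet> \<nu>) *\<^sub>R \<nu>) < y \<bullet> \<nu>})"

definition critical_exponent :: "real \<Rightarrow> real \<Rightarrow> real" where
  "critical_exponent N p = N * p / (N - p)"

section \<open>Test functions and weak gradients\<close>

fun Ck :: "nat \<Rightarrow> ('a::euclidean_space \<Rightarrow> real) \<Rightarrow> bool" where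
  "Ck 0 g \<longleftrightarrow> continuous_on UNIV g"
| "Ck (Suc k) g \<longleftrightarrow> (\<forall>x. g differentiable (at x)) \<and>
     (\<forall>i\<in>Basis. Ck k (\<lambda>x. frechet_derivative g (at x) i))"

text \<open>The space \<open>C\<^sub>0\<^sup>\<infinity>(\<Omega>)\<close>, each function being extended by zero to the whole space.\<close>
definition test_functions :: "'a::euclidean_space set \<Rightarrow> ('a \<Rightarrow> real) set" where
  "test_functions \<Omega> = {\<phi>. (\<forall>k. Ck k \<phi>) \<and>
     compact (closure {x. \<phi> x \<noteq> 0}) \<and> closure {x. \<phi> x \<noteq> 0} \<subseteq> \<Omega>}"

definition is_weak_gradient ::
  "'a::euclidean_space set \<Rightarrow> ('a \<Rightarrow> real) \<Rightarrow> ('a \<Rightarrow> 'a) \<Rightarrow> bool" where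
  "is_weak_gradient \<Omega> u G \<longleftrightarrow>
    (\<forall>K. compact K \<and> K \<subseteq> \<Omega> \<longrightarrow> u absolutely_integrable_on K \<and> G absolutely_integrable_on K) \<and>
    (\<forall>\<phi>\<in>test_functions \<Omega>. \<forall>i\<in>Basis.
       (LINT x|lebesgue_on \<Omega>. u x * frechet_derivative \<phi> (at x) i) =
       - (LINT x|lebesgue_on \<Omega>. (G x \<bullet> i) * \<phi> x))"

text \<open>
  A weak gradient is determined only up to a null set; \<open>wgrad\<close> selects one representative, and is
  meaningful only if a weak gradient exists.
\<close>
definition wgrad :: "'a::euclidean_space set \<Rightarrow> ('a \<Rightarrow> real) \<Rightarrow> 'a \<Rightarrow> 'a" where
  "wgrad \<Omega> u = (SOME G. is_weak_gradient \<Omega> u G)"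

section \<open>Musielak-Orlicz and Musielak-Orlicz-Sobolev spaces\<close>

definition modular ::
  "'a::euclidean_space set \<Rightarrow> ('a \<Rightarrow> real) \<Rightarrow> real \<Rightarrow> real \<Rightarrow> ('a \<Rightarrow> real) \<Rightarrow> ennreal" where
  "modular \<Omega> a p q u =
    (\<integral>\<^sup>+ x. ennreal (\<bar>u x\<bar> powr p + a x * \<bar>u x\<bar> powr q) \<partial>lebesgue_on \<Omega>)"

definition LH :: "'a::euclidean_space set \<Rightarrow> ('a \<Rightarrow> real) \<Rightarrow> real \<Rightarrow> real \<Rightarrow> ('a \<Rightarrow> real) set" where
  "LH \<Omega> a p q = {u \<in> borel_measurable (lebesgue_on \<Omega>). modular \<Omega> a p q u < \<infinity>}"

definition LH_norm ::
  "'a::euclidean_space set \<Rightarrow> ('a \<Rightarrow> real) \<Rightarrow> real \<Rightarrow> real \<Rightarrow> ('a \<Rightarrow> real) \<Rightarrow> real" where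
  "LH_norm \<Omega> a p q u = Inf {l. 0 < l \<and> modular \<Omega> a p q (\<lambda>x. u x / l) \<le> 1}"

definition W1H :: "'a::euclidean_space set \<Rightarrow> ('a \<Rightarrow> real) \<Rightarrow> real \<Rightarrow> real \<Rightarrow> ('a \<Rightarrow> real) set" where
  "W1H \<Omega> a p q = {u \<in> LH \<Omega> a p q.
     (\<exists>G. is_weak_gradient \<Omega> u G) \<and> (\<lambda>x. norm (wgrad \<Omega> u x)) \<in> LH \<Omega> a p q}"

definition W1H_norm ::
  "'a::euclidean_space set \<Rightarrow> ('a \<Rightarrow> real) \<Rightarrow> real \<Rightarrow> real \<Rightarrow> ('a \<Rightarrow> real) \<Rightarrow> real" where
  "W1H_norm \<Omega> a p q u = LH_norm \<Omega> a p q u + LH_norm \<Omega> a p q (\<lambda>x. norm (wgrad \<Omega> u x))"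

definition W1H0 :: "'a::euclidean_space set \<Rightarrow> ('a \<Rightarrow> real) \<Rightarrow> real \<Rightarrow> real \<Rightarrow> ('a \<Rightarrow> real) set" where
  "W1H0 \<Omega> a p q = {u \<in> W1H \<Omega> a p q.
     \<forall>\<epsilon>>0. \<exists>\<phi>\<in>test_functions \<Omega>. W1H_norm \<Omega> a p q (\<lambda>x. u x - \<phi> x) < \<epsilon>}"

section \<open>The Kirchhoff double phase problem\<close>

text \<open>The oriented integral from 0 to t, so that it is minus the integral over [t, 0] for t < 0.\<close>
definition primitive :: "(real \<Rightarrow> real) \<Rightarrow> real \<Rightarrow> real" where
  "primitive g t = (LBINT s=ereal 0..ereal t. g s)"

definition caratheodory :: "'a::euclidean_space set \<Rightarrow> ('a \<Rightarrow> real \<Rightarrow> real) \<Rightarrow> bool" where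
  "caratheodory \<Omega> f \<longleftrightarrow>
    (\<forall>t. (\<lambda>x. f x t) \<in> borel_measurable (lebesgue_on \<Omega>)) \<and>
    (AE x in lebesgue_on \<Omega>. continuous_on UNIV (f x))"

definition energy ::
  "'a::euclidean_space set \<Rightarrow> ('a \<Rightarrow> real) \<Rightarrow> real \<Rightarrow> real \<Rightarrow> ('a \<Rightarrow> real) \<Rightarrow> real" where
  "energy \<Omega> a p q u =
    (LINT x|lebesgue_on \<Omega>.
       norm (wgrad \<Omega> u x) powr p / p + a x * (norm (wgrad \<Omega> u x) powr q / q))"

text \<open>
  Since \<open>0 powr s = 0\<close>, the flux \<open>|v|\<^bsup>p-2\<^esup> v + a(x) |v|\<^bsup>q-2\<^esup> v\<close> vanishes at \<open>v = 0\<close> also for exponents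
  below 2.
\<close>
definition flux :: "('a::euclidean_space \<Rightarrow> real) \<Rightarrow> real \<Rightarrow> real \<Rightarrow> 'a \<Rightarrow> 'a \<Rightarrow> 'a" where
  "flux a p q x v = (norm v powr (p - 2) + a x * norm v powr (q - 2)) *\<^sub>R v"

text \<open>
  As the Bochner integral of a non-integrable function is 0 by convention, integrability of the
  two sides is required explicitly. The integrand of \<open>energy\<close> is integrable for every \<open>u\<close> in
  \<open>W1H0\<close> by definition of that space.
\<close>
definition weak_solution ::
  "'a::euclidean_space set \<Rightarrow> ('a \<Rightarrow> real) \<Rightarrow> real \<Rightarrow> real \<Rightarrow> (real \<Rightarrow> real) \<Rightarrow> ('a \<Rightarrow> real \<Rightarrow> real)
    \<Rightarrow> ('a \<Rightarrow> real) \<Rightarrow> bool" where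
  "weak_solution \<Omega> a p q M f u \<longleftrightarrow> u \<in> W1H0 \<Omega> a p q \<and>
    (\<forall>\<phi>\<in>W1H0 \<Omega> a p q.
       integrable (lebesgue_on \<Omega>) (\<lambda>x. flux a p q x (wgrad \<Omega> u x) \<bullet> wgrad \<Omega> \<phi> x) \<and>
       integrable (lebesgue_on \<Omega>) (\<lambda>x. f x (u x) * \<phi> x) \<and>
       M (energy \<Omega> a p q u) *
         (LINT x|lebesgue_on \<Omega>. flux a p q x (wgrad \<Omega> u x) \<bullet> wgrad \<Omega> \<phi> x) =
       (LINT x|lebesgue_on \<Omega>. f x (u x) * \<phi> x))"

end

theory Submission
  imports Defs "HOL-Library.Diagonal_Subsequence"
begin

text \<open>
  The energy functional \<open>J(u) = \<M>(E(u)) - \<integral> F(x, u)\<close> is treated by a Galerkin method, without weak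
  compactness. On the span of finitely many members of a countable dense set of test functions \<open>J\<close> is
  a differentiable function of finitely many variables with mountain pass geometry. It has critical
  points \<open>U\<^sub>n\<close> there whose levels are bounded and bounded away from 0, uniformly in the dimension. The
  superlinearity condition bounds their energies, so that after passing to a subsequence they converge
  in \<open>L\<^sup>p\<close> by Rellich's theorem, hence in \<open>L\<^bsup>q\<theta>\<^esup>\<close> and \<open>L\<^sup>r\<close> by interpolation with the subcritical Sobolev
  inequality, and also the numbers \<open>E(U\<^sub>n)\<close> converge. For \<open>m \<le> n\<close> both \<open>U\<^sub>m\<close> and \<open>U\<^sub>n\<close> are admissible in
  the equation of \<open>U\<^sub>n\<close>, which makes \<open>\<langle>E'(U\<^sub>n), U\<^sub>n - U\<^sub>m\<rangle>\<close> small; as the energies stay away from 0, \<open>M\<close> is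
  bounded below along the sequence. Uniform convexity of \<open>E\<close> then shows that the gradients form a Cauchy
  sequence for the modular. The limit solves the equation, first for the dense set and then for all of
  \<open>W\<^sub>0\<close>, and it is not zero because its energy is positive.
\<close>

section \<open>Inequalities for powers\<close>

text \<open>The obstacle is that \<open>M\<close> may vanish at 0: at such a point the equation
  carries no information on the gradients. The energies of the approximations are kept away from 0
  by the fixed mountain pass level, because \<open>J\<close> is small wherever the energy is small.
  Compactness is needed only for the source term. For two approximations \<open>u\<close> and
  \<open>v\<close>, let \<open>Z\<close> be the pairing of the flux of \<open>u\<close> with the
  difference of the gradients. The tangent inequality puts the energy of the midpoint above the
  energy of \<open>u\<close> minus \<open>Z / 2\<close>; so if \<open>Z\<close> is small and the two
  energies nearly agree, the convexity gap is small, and no limit has to be known beforehand. This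
  is why convergence of the energies, which are mere real numbers, is arranged first. All embeddings
  in use are subcritical, so averages over a cubic grid suffice for them: the averages are bounded
  pointwise, take one value per cell, and differ from the function by an error of the order of the
  mesh times the gradient.\<close>

lemma young_small:
  fixes r \<eta> :: real
  assumes "1 < r" "0 < \<eta>"
  obtains C where "0 < C" "\<And>x y. 0 \<le> x \<Longrightarrow> 0 \<le> y \<Longrightarrow> x powr (r - 1) * y \<le> \<eta> * x powr r + C * y powr r"
proof
  show "0 < (1 / \<eta>) powr (r - 1)" using assms by simp
  fix x y :: real assume xy: "0 \<le> x" "0 \<le> y"
  have *: "z powr (r - 1) * z = z powr r" if "0 \<le> z" for z :: real
    using that powr_mult_base[of z "r - 1"] by (simp add: mult.commute)
  show "x powr (r - 1) * y \<le> \<eta> * x powr r + (1 / \<eta>) powr (r - 1) * y powr r"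
  \<comment> \<open>If \<open>y\<close> is at most \<open>\<eta> * x\<close>, the first summand
    absorbs the product; otherwise \<open>x\<close> is at most \<open>y / \<eta>\<close> and the
    second one does. No conjugate exponent is involved.\<close>
  proof (cases "y \<le> \<eta> * x")
    case True
    have "x powr (r - 1) * y \<le> x powr (r - 1) * (\<eta> * x)"
      using True by (intro mult_left_mono) auto
    also have "\<dots> = \<eta> * x powr r" using *[OF xy(1)] by (simp add: algebra_simps)
    finally show ?thesis by (simp add: add_increasing2)
  next
    case False
    then have "x \<le> (1 / \<eta>) * y" using assms by (simp add: field_simps)
    then have "x powr (r - 1) \<le> ((1 / \<eta>) * y) powr (r - 1)"
      using assms xy by (intro powr_mono2) auto
    then have "x powr (r - 1) * y \<le> ((1 / \<eta>) * y) powr (r - 1) * y"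
      using xy by (intro mult_right_mono) auto
    also have "\<dots> = (1 / \<eta>) powr (r - 1) * (y powr (r - 1) * y)"
      using assms xy by (subst powr_mult) auto
    also have "\<dots> = (1 / \<eta>) powr (r - 1) * y powr r" using *[OF xy(2)] by simp
    finally show ?thesis using assms by (simp add: add_increasing)
  qed
qed

lemma powr_interpolation:
  fixes p r s \<eta> :: real
  assumes "p < r" "r < s" "0 < \<eta>"
  obtains C where "0 < C" "\<And>w. 0 \<le> w \<Longrightarrow> w powr r \<le> \<eta> * w powr s + C * w powr p"
proof -
  \<comment> \<open>\<open>K\<close> is the point where \<open>K powr (r - s) = \<eta>\<close>:
    beyond it the power \<open>s\<close> dominates, before it the power \<open>p\<close>.\<close>
  define K where "K = \<eta> powr (- 1 / (s - r))"
  have K: "0 < K" using assms by (simp add: K_def)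
  show thesis
  proof (rule that)
    show "0 < K powr (r - p)" using K by simp
    fix w :: real assume w: "0 \<le> w"
    show "w powr r \<le> \<eta> * w powr s + K powr (r - p) * w powr p"
    proof (cases "w = 0")
      case False
      with w have w: "0 < w" by simp
      show ?thesis
      proof (cases "K \<le> w")
        case True
        have "w powr (r - s) \<le> K powr (r - s)" using K True assms by (intro powr_mono2') auto
        also have "\<dots> = \<eta>" using assms by (simp add: K_def powr_powr minus_divide_left[symmetric] minus_diff_eq[symmetric, of r s] del: minus_diff_eq)
        finally have "w powr s * w powr (r - s) \<le> w powr s * \<eta>" by (intro mult_left_mono) auto
        then have "w powr r \<le> \<eta> * w powr s" by (simp add: powr_add[symmetric] mult.commute)
        then show ?thesis by (simp add: add_increasing2)
      next
        case False
        then have "w powr (r - p) \<le> K powr (r - p)" using w assms by (intro powr_mono2) auto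
        then have "w powr p * w powr (r - p) \<le> w powr p * K powr (r - p)" by (intro mult_left_mono) auto
        then have "w powr r \<le> K powr (r - p) * w powr p" by (simp add: powr_add[symmetric] mult.commute)
        then show ?thesis using assms by (simp add: add_increasing)
      qed
    qed simp
  qed
qed

lemma powr_sum_le:
  fixes x y s :: real
  assumes "0 \<le> x" "0 \<le> y" "0 \<le> s"
  shows "(x + y) powr s \<le> 2 powr s * (x powr s + y powr s)"
proof -
  have "(x + y) powr s \<le> (2 * max x y) powr s" using assms by (intro powr_mono2) auto
  also have "\<dots> = 2 powr s * max x y powr s" using assms by (subst powr_mult) auto
  also have "\<dots> \<le> 2 powr s * (x powr s + y powr s)"
    by (intro mult_left_mono) (auto simp: max_def)
  finally show ?thesis .
qed

lemma norm_diff_powr_le: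
  fixes x y :: "'a::real_normed_vector"
  assumes "0 \<le> s"
  shows "norm (x - y) powr s \<le> 2 powr s * (norm x powr s + norm y powr s)"
proof -
  have "norm (x - y) powr s \<le> (norm x + norm y) powr s"
    using assms by (intro powr_mono2 norm_triangle_ineq4) auto
  also have "\<dots> \<le> 2 powr s * (norm x powr s + norm y powr s)"
    using assms by (intro powr_sum_le) auto
  finally show ?thesis .
qed

lemma norm_add_powr_le:
  fixes x y :: "'a::real_normed_vector"
  assumes "0 \<le> s"
  shows "norm (x + y) powr s \<le> 2 powr s * (norm x powr s + norm y powr s)"
  using norm_diff_powr_le[OF assms, of x "- y"] by simp

text \<open>The power minus its tangent is strictly decreasing before \<open>m\<close> and strictly
  increasing after it. The mean value theorem asks for the derivative at positive points only, so
  the endpoint 0 is covered by continuity.\<close>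

lemma powr_tangent_strict:
  fixes s m p :: real
  assumes "0 \<le> s" "0 \<le> m" "s \<noteq> m" "1 < p"
  shows "m powr p / p + m powr (p - 1) * (s - m) < s powr p / p"
proof -
  define h where "h s = s powr p / p - m powr (p - 1) * s" for s
  have cont: "continuous_on {x..y} h" if "0 \<le> x" for x y
    unfolding h_def using assms that by (intro continuous_intros continuous_on_powr') auto
  have der: "(h has_derivative (\<lambda>y. (x powr (p - 1) - m powr (p - 1)) * y)) (at x)" if "0 < x" for x
    unfolding h_def
    by (rule has_field_derivative_imp_has_derivative) (use assms that in \<open>auto intro!: derivative_eq_intros\<close>)
  consider "s < m" | "m < s" using assms by linarith
  then have "h m < h s"
  proof cases
    case 1
    obtain z where z: "s < z" "z < m" "h m - h s = (z powr (p - 1) - m powr (p - 1)) * (m - s)"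
      by (rule mvt[OF 1 cont[OF assms(1)] der]) (use assms in auto)
    moreover have "z powr (p - 1) < m powr (p - 1)" using z assms by (intro powr_less_mono2) auto
    ultimately have "h m - h s < 0" using 1 by (simp add: mult_neg_pos)
    then show ?thesis by simp
  next
    case 2
    obtain z where z: "m < z" "z < s" "h s - h m = (z powr (p - 1) - m powr (p - 1)) * (s - m)"
      by (rule mvt[OF 2 cont[OF assms(2)] der]) (use assms in auto)
    moreover have "m powr (p - 1) < z powr (p - 1)" using z assms by (intro powr_less_mono2) auto
    ultimately have "h s - h m > 0" using 2 by simp
    then show ?thesis by simp
  qed
  then show ?thesis unfolding h_def by (simp add: algebra_simps)
qed

text \<open>The inner product splits into a radial part, to which \<open>powr_tangent_strict\<close>
  applies, minus a multiple of the deficit in the Cauchy-Schwarz inequality. For distinct vectors of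
  equal norm the radial part is not strict, but the deficit is then half the square of
  \<open>norm (x - m)\<close>.\<close>

lemma norm_powr_tangent:
  fixes x m :: "'a::real_inner"
  assumes p: "1 < p"
  shows "norm m powr p / p + norm m powr (p - 2) * (m \<bullet> (x - m)) \<le> norm x powr p / p"
    and "x \<noteq> m \<Longrightarrow> norm m powr p / p + norm m powr (p - 2) * (m \<bullet> (x - m)) < norm x powr p / p"
proof -
  have *: "norm m powr (p - 2) * (m \<bullet> (x - m)) = norm m powr (p - 1) * (norm x - norm m) - norm m powr (p - 2) * (norm m * norm x - m \<bullet> x)"
  proof (cases "m = 0")
    case False
    have "norm m powr (p - 1) = norm m powr (p - 2) * norm m"
      using powr_mult_base[of "norm m" "p - 2"] by (simp add: mult.commute)
    then show ?thesis by (simp add: algebra_simps inner_diff_right dot_square_norm power2_eq_square)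
  qed simp
  have cs: "m \<bullet> x \<le> norm m * norm x" by (rule norm_cauchy_schwarz)
  then have pos: "0 \<le> norm m powr (p - 2) * (norm m * norm x - m \<bullet> x)" by simp
  show strict: "norm m powr p / p + norm m powr (p - 2) * (m \<bullet> (x - m)) < norm x powr p / p" if "x \<noteq> m"
  proof (cases "norm x = norm m")
    case False
    then show ?thesis using powr_tangent_strict[OF norm_ge_zero norm_ge_zero False p] pos * by linarith
  next
    case True
    with that have m: "m \<noteq> 0" by auto
    have "0 < (norm (x - m))\<^sup>2" using that by simp
    also have "(norm (x - m))\<^sup>2 = 2 * (norm m * norm x - m \<bullet> x)"
    proof -
      have "x \<bullet> x = m \<bullet> m" using True by (simp add: dot_square_norm)
      then have "(norm (x - m))\<^sup>2 = 2 * (m \<bullet> m - m \<bullet> x)"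
        by (simp add: power2_norm_eq_inner inner_diff_left inner_diff_right inner_commute[of x m])
      then show ?thesis using True by (simp add: dot_square_norm power2_eq_square)
    qed
    finally have "0 < norm m powr (p - 2) * (norm m * norm x - m \<bullet> x)" using m by simp
    then show ?thesis using * True by simp
  qed
  show "norm m powr p / p + norm m powr (p - 2) * (m \<bullet> (x - m)) \<le> norm x powr p / p"
    using strict by (cases "x = m") auto
qed

text \<open>The midpoint convexity defect of the \<open>p\<close>-th power of the norm.\<close>

definition powr_gap :: "real \<Rightarrow> 'a::real_inner \<Rightarrow> 'a \<Rightarrow> real" where
  "powr_gap p x y = (norm x powr p + norm y powr p) / 2 - norm ((1/2) *\<^sub>R (x + y)) powr p"

lemma powr_gap_nonneg: "1 < p \<Longrightarrow> 0 \<le> powr_gap p x y"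
  and powr_gap_pos: "1 < p \<Longrightarrow> x \<noteq> y \<Longrightarrow> 0 < powr_gap p x y"
proof -
  assume p: "1 < p"
  let ?m = "(1/2) *\<^sub>R (x + y)"
  \<comment> \<open>The linear terms of the two tangent inequalities at the midpoint cancel because
    \<open>x - ?m\<close> and \<open>y - ?m\<close> are opposite.\<close>
  have eq: "norm ?m powr (p - 2) * (?m \<bullet> (x - ?m)) + norm ?m powr (p - 2) * (?m \<bullet> (y - ?m)) = 0"
    unfolding distrib_left[symmetric] inner_add_right[symmetric]
    by (simp add: algebra_simps flip: scaleR_add_left)
  have gap: "powr_gap p x y = p / 2 * ((norm x powr p / p - norm ?m powr p / p) + (norm y powr p / p - norm ?m powr p / p))"
    using p by (simp add: powr_gap_def field_simps)
  have h: "norm ?m powr p / p + norm ?m powr (p - 2) * (?m \<bullet> (x - ?m)) \<le> norm x powr p / p"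
    "norm ?m powr p / p + norm ?m powr (p - 2) * (?m \<bullet> (y - ?m)) \<le> norm y powr p / p"
    by (rule norm_powr_tangent[OF p])+
  then show "0 \<le> powr_gap p x y" unfolding gap using p eq by (intro mult_nonneg_nonneg) auto
  assume "x \<noteq> y"
  then have "x \<noteq> ?m" by (metis (no_types, lifting) ext scaleR_half_double scaleR_add_right add_left_cancel)
  from norm_powr_tangent(2)[OF p this] h show "0 < powr_gap p x y"
    unfolding gap using p eq by (intro mult_pos_pos) auto
qed

lemma powr_gap_scale:
  assumes "0 \<le> c" shows "powr_gap p (c *\<^sub>R x) (c *\<^sub>R y) = c powr p * powr_gap p x y"
proof -
  have "norm ((1 / 2) *\<^sub>R (c *\<^sub>R x + c *\<^sub>R y)) = c * norm ((1/2) *\<^sub>R (x + y))"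
    using assms by (metis abs_of_nonneg norm_scaleR scaleR_add_right scaleR_left_commute)
  then show ?thesis using assms by (simp add: powr_gap_def powr_mult algebra_simps)
qed

text \<open>Both sides are homogeneous of degree \<open>p\<close>, so it is enough to consider the
  compact set where the powers sum to 1 and the \<open>p\<close>-th power of the distance is at
  least \<open>\<epsilon>\<close>; there the continuous gap has a positive minimum. Exponents below
  and above 2 need no separate treatment.\<close>

lemma powr_uniformly_convex:
  fixes p \<epsilon> :: real
  assumes p: "1 < p" and "0 < \<epsilon>"
  obtains C where "0 < C"
    "\<And>x y :: 'a::euclidean_space. norm (x - y) powr p \<le> \<epsilon> * (norm x powr p + norm y powr p) + C * powr_gap p x y"
proof -
  define T where "T = {z :: 'a \<times> 'a. norm (fst z) powr p + norm (snd z) powr p = 1 \<and> \<epsilon> \<le> norm (fst z - snd z) powr p}"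
  have "closed T" unfolding T_def
    using p by (intro closed_Collect_conj closed_Collect_eq closed_Collect_le continuous_intros continuous_on_powr') auto
  moreover have "T \<subseteq> cball 0 1 \<times> cball 0 1"
  proof
    fix z assume "z \<in> T"
    then have "norm (fst z) powr p \<le> 1" "norm (snd z) powr p \<le> 1"
      unfolding T_def by (auto simp: add_increasing intro: order_trans[rotated])
        (metis add_increasing2 order_refl powr_ge_zero, metis add_increasing order_refl powr_ge_zero)
    then have "norm (fst z) \<le> 1" "norm (snd z) \<le> 1" using p
      by (metis gr_one_powr linorder_not_less order_less_trans zero_less_one)+
    then show "z \<in> cball 0 1 \<times> cball 0 1" by (auto simp: mem_Times_iff)
  qed
  ultimately have T: "compact T"
    by (metis bounded_Times bounded_cball bounded_subset compact_eq_bounded_closed)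
  have contg: "continuous_on T (\<lambda>z. powr_gap p (fst z) (snd z))" unfolding powr_gap_def using p
    by (intro continuous_intros continuous_on_powr') auto
  obtain \<delta> where \<delta>: "0 < \<delta>" "\<And>z. z \<in> T \<Longrightarrow> \<delta> \<le> powr_gap p (fst z) (snd z)"
  proof (cases "T = {}")
    case True then show ?thesis using that[of 1] by auto
  next
    case False
    obtain z0 where z0: "z0 \<in> T" "\<forall>z\<in>T. powr_gap p (fst z0) (snd z0) \<le> powr_gap p (fst z) (snd z)"
      using continuous_attains_inf[OF T False contg] by auto
    have "fst z0 \<noteq> snd z0" using z0 assms by (auto simp: T_def)
    then show ?thesis using that[of "powr_gap p (fst z0) (snd z0)"] powr_gap_pos[OF p] z0 by auto
  qed
  show thesis
  proof (rule that)
    \<comment> \<open>The minimum \<open>\<delta>\<close> gives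
      \<open>S \<le> powr_gap p x y / \<delta>\<close>, and \<open>2 powr p * S\<close> bounds the
      \<open>p\<close>-th power of the distance.\<close>
    show "0 < 2 powr p / \<delta>" using \<delta> by simp
    fix x y :: 'a
    define S where "S = norm x powr p + norm y powr p"
    have S0: "0 \<le> S" by (simp add: S_def)
    show "norm (x - y) powr p \<le> \<epsilon> * (norm x powr p + norm y powr p) + 2 powr p / \<delta> * powr_gap p x y"
    proof (cases "norm (x - y) powr p \<le> \<epsilon> * S")
      case True
      then show ?thesis using powr_gap_nonneg[OF p, of x y] \<delta> unfolding S_def
        by (smt (verit) divide_nonneg_pos mult_nonneg_nonneg powr_ge_zero)
    next
      case False
      have S: "0 < S"
      proof (rule ccontr)
        assume "\<not> 0 < S"
        with S0 have "S = 0" by simp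
        then have "x = 0" "y = 0" unfolding S_def by (simp_all add: add_nonneg_eq_0_iff)
        then show False using False \<open>S = 0\<close> by simp
      qed
      \<comment> \<open>Rescaling by \<open>c\<close> brings the sum of the powers to 1 and hence
        the pair into \<open>T\<close>.\<close>
      define c where "c = S powr (- 1 / p)"
      have "c powr p = S powr (- 1)" unfolding c_def powr_powr using p by simp
      then have c: "0 < c" "c powr p = 1 / S" using S by (simp_all add: c_def powr_minus_divide)
      have "(c *\<^sub>R x, c *\<^sub>R y) \<in> T"
      proof -
        have n: "norm (c *\<^sub>R v) powr p = norm v powr p / S" for v :: 'a
          using c by (simp add: powr_mult)
        have "c *\<^sub>R x - c *\<^sub>R y = c *\<^sub>R (x - y)" by (simp add: scaleR_diff_right)
        moreover have "norm x powr p / S + norm y powr p / S = 1"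
          using S unfolding add_divide_distrib[symmetric] by (simp add: S_def)
        moreover have "\<epsilon> \<le> norm (x - y) powr p / S" using S False by (simp add: pos_le_divide_eq)
        ultimately show ?thesis unfolding T_def by (simp add: n del: norm_scaleR)
      qed
      from \<delta>(2)[OF this] have "\<delta> \<le> 1 / S * powr_gap p x y" using c by (simp add: powr_gap_scale)
      then have "S \<le> 1 / \<delta> * powr_gap p x y" using S \<delta> by (simp add: field_simps)
      then have "2 powr p * S \<le> 2 powr p * (1 / \<delta> * powr_gap p x y)" by (intro mult_left_mono) auto
      moreover have "norm (x - y) powr p \<le> 2 powr p * S" unfolding S_def using p by (intro norm_diff_powr_le) auto
      ultimately have "norm (x - y) powr p \<le> 2 powr p / \<delta> * powr_gap p x y" by (simp add: field_simps)
      then show ?thesis using assms S0 unfolding S_def by (smt (verit) mult_nonneg_nonneg)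
    qed
  qed
qed

section \<open>Test functions\<close>

text \<open>Assembled from the derivatives along the basis vectors, because \<open>Ck\<close> and
  \<open>is_weak_gradient\<close> speak of exactly these. It is the gradient proper only where
  \<open>g\<close> is differentiable.\<close>

definition grad :: "('a::euclidean_space \<Rightarrow> real) \<Rightarrow> 'a \<Rightarrow> 'a" where
  "grad g x = (\<Sum>i\<in>Basis. frechet_derivative g (at x) i *\<^sub>R i)"

lemma grad_inner_Basis: "i \<in> Basis \<Longrightarrow> grad g x \<bullet> i = frechet_derivative g (at x) i"
  unfolding grad_def by (simp add: inner_sum_left inner_Basis if_distrib cong: if_cong)

lemma frechet_derivative_eq_grad:
  assumes "g differentiable (at x)"
  shows "frechet_derivative g (at x) h = grad g x \<bullet> h"
proof -
  interpret linear "frechet_derivative g (at x)" using assms by (rule linear_frechet_derivative)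
  have "frechet_derivative g (at x) h = frechet_derivative g (at x) (\<Sum>i\<in>Basis. (h \<bullet> i) *\<^sub>R i)"
    by (simp add: euclidean_representation)
  also have "\<dots> = grad g x \<bullet> h"
    by (simp add: sum scale grad_def inner_sum_left inner_commute[of h] mult.commute)
  finally show ?thesis .
qed

lemma has_derivative_grad:
  assumes "g differentiable (at x)"
  shows "(g has_derivative (\<lambda>h. grad g x \<bullet> h)) (at x)"
proof -
  have "frechet_derivative g (at x) = (\<lambda>h. grad g x \<bullet> h)"
    by (rule ext) (rule frechet_derivative_eq_grad[OF assms])
  then show ?thesis using assms unfolding frechet_derivative_works by simp
qed

lemma grad_eqI:
  assumes "(g has_derivative (\<lambda>h. v \<bullet> h)) (at x)"
  shows "grad g x = v"
  unfolding grad_def frechet_derivative_at[OF assms, symmetric] by (rule euclidean_representation)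

lemma Ck_continuous_on: "Ck k g \<Longrightarrow> continuous_on S g"
proof (cases k)
  case 0 then show "Ck k g \<Longrightarrow> ?thesis" by (auto intro: continuous_on_subset)
next
  case (Suc m)
  then show "Ck k g \<Longrightarrow> ?thesis"
    by (auto intro!: continuous_at_imp_continuous_on differentiable_imp_continuous_within)
qed

lemma Ck_Suc_imp: "Ck (Suc k) g \<Longrightarrow> Ck k g"
proof (induction k arbitrary: g)
  case 0 then show ?case using Ck_continuous_on[of "Suc 0" g UNIV] by simp
next
  case (Suc k)
  have "\<forall>x. g differentiable (at x)" "\<forall>i\<in>Basis. Ck (Suc k) (\<lambda>x. frechet_derivative g (at x) i)"
    using Suc.prems unfolding Ck.simps(2)[of "Suc k"] by blast+
  then show ?case using Suc.IH by simp
qed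

lemma Ck_const: "Ck k (\<lambda>x::'a::euclidean_space. c)"
  by (induction k arbitrary: c) auto

lemma frechet_derivative_add:
  assumes "f differentiable (at x)" "g differentiable (at x)"
  shows "frechet_derivative (\<lambda>x. f x + g x) (at x) = (\<lambda>h. frechet_derivative f (at x) h + frechet_derivative g (at x) h)"
  using frechet_derivative_at[OF has_derivative_add[OF assms[unfolded frechet_derivative_works]]] by simp

lemma frechet_derivative_mult:
  fixes f g :: "'a::real_normed_vector \<Rightarrow> real"
  assumes "f differentiable (at x)" "g differentiable (at x)"
  shows "frechet_derivative (\<lambda>x. f x * g x) (at x) = (\<lambda>h. f x * frechet_derivative g (at x) h + frechet_derivative f (at x) h * g x)"
  using frechet_derivative_at[OF has_derivative_mult[OF assms[unfolded frechet_derivative_works]]] by simp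

lemma Ck_add: "Ck k f \<Longrightarrow> Ck k g \<Longrightarrow> Ck k (\<lambda>x. f x + g x)"
proof (induction k arbitrary: f g)
  case 0 then show ?case by (auto intro: continuous_on_add)
next
  case (Suc k) then show ?case by (simp add: frechet_derivative_add)
qed

lemma Ck_mult: "Ck k f \<Longrightarrow> Ck k g \<Longrightarrow> Ck k (\<lambda>x. f x * g x)"
proof (induction k arbitrary: f g)
  case 0 then show ?case by (auto intro: continuous_on_mult)
next
  case (Suc k)
  then have "Ck k f" "Ck k g" using Ck_Suc_imp by blast+
  with Suc show ?case by (simp add: frechet_derivative_mult Ck_add)
qed

lemma Ck_cmult: "Ck k f \<Longrightarrow> Ck k (\<lambda>x. c * f x)"
  by (intro Ck_mult Ck_const)

lemma Ck_prod: "finite I \<Longrightarrow> (\<And>i. i \<in> I \<Longrightarrow> Ck k (f i)) \<Longrightarrow> Ck k (\<lambda>x. \<Prod>i\<in>I. f i x)"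
  by (induction I rule: finite_induct) (auto intro: Ck_const Ck_mult)

section \<open>Smooth cut-offs of boxes\<close>

definition flat_exp :: "nat \<Rightarrow> real \<Rightarrow> real" where
  "flat_exp m t = (if 0 < t then inverse t ^ m * exp (- inverse t) else 0)"

lemma tendsto_flat_exp_0: "(flat_exp m \<longlongrightarrow> 0) (at 0)"
proof -
  have "((\<lambda>t::real. inverse t ^ m / exp (inverse t)) \<longlongrightarrow> 0) (at_right 0)"
    using filterlim_compose[OF tendsto_power_div_exp_0[where k=m] filterlim_inverse_at_top_right] by simp
  then have "(flat_exp m \<longlongrightarrow> 0) (at_right 0)"
    by (rule Lim_transform_eventually)
      (auto simp: flat_exp_def eventually_at_filter exp_minus divide_inverse)
  moreover have "(flat_exp m \<longlongrightarrow> 0) (at_left 0)"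
    by (rule Lim_transform_eventually[OF tendsto_const]) (auto simp: flat_exp_def eventually_at_filter)
  ultimately show ?thesis by (simp add: filterlim_split_at)
qed

text \<open>The derivative of one member of the family is a combination of two others, so a single
  induction on \<open>k\<close>, for all \<open>m\<close> at once, yields smoothness of every order.
  At 0 the difference quotient of member \<open>m\<close> is member \<open>Suc m\<close>, which
  tends to 0.\<close>

lemma DERIV_flat_exp:
  "(flat_exp m has_real_derivative (- real m * flat_exp (Suc m) t + flat_exp (m + 2) t)) (at t)"
proof -
  consider "0 < t" | "t < 0" | "t = 0" by linarith
  then show ?thesis
  proof cases
    case 1
    have "((\<lambda>t. inverse t ^ m * exp (- inverse t)) has_real_derivative
        real m * inverse t ^ (m - Suc 0) * (- (inverse t * inverse t)) * exp (- inverse t)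
        + inverse t ^ m * (exp (- inverse t) * (inverse t * inverse t))) (at t)"
      using 1 by (auto intro!: derivative_eq_intros simp: algebra_simps)
    moreover have "real m * inverse t ^ (m - Suc 0) * (- (inverse t * inverse t)) * exp (- inverse t)
        + inverse t ^ m * (exp (- inverse t) * (inverse t * inverse t))
        = - real m * flat_exp (Suc m) t + flat_exp (m + 2) t"
      using 1 by (cases m) (simp_all add: flat_exp_def algebra_simps)
    ultimately have "((\<lambda>t. inverse t ^ m * exp (- inverse t)) has_real_derivative
        (- real m * flat_exp (Suc m) t + flat_exp (m + 2) t)) (at t)"
      by simp
    then show ?thesis
      by (rule has_field_derivative_transform_within_open[of _ _ _ "{0<..}"]) (use 1 in \<open>auto simp: flat_exp_def\<close>)
  next
    case 2
    have "((\<lambda>t. 0) has_real_derivative (- real m * flat_exp (Suc m) t + flat_exp (m + 2) t)) (at t)"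
      using 2 by (auto simp: flat_exp_def)
    then show ?thesis
      by (rule has_field_derivative_transform_within_open[of _ _ _ "{..<0}"]) (use 2 in \<open>auto simp: flat_exp_def\<close>)
  next
    case 3
    have "(\<lambda>h. flat_exp m h / h) = flat_exp (Suc m)"
      by (auto simp: flat_exp_def divide_inverse)
    then have "((\<lambda>h. (flat_exp m (0 + h) - flat_exp m 0) / h) \<longlongrightarrow> 0) (at 0)"
      using tendsto_flat_exp_0[of "Suc m"] by (simp add: flat_exp_def[of m 0])
    then show ?thesis using 3 by (simp add: DERIV_def flat_exp_def)
  qed
qed

lemma Ck_flat_exp: "Ck k (\<lambda>x::'a::euclidean_space. flat_exp m (x \<bullet> v + c))"
proof (induction k arbitrary: m)
  case 0
  have "continuous_on UNIV (flat_exp m)"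
    by (rule DERIV_continuous_on) (rule DERIV_flat_exp[THEN DERIV_subset], simp)
  then show ?case by (auto intro!: continuous_on_compose2[of UNIV "flat_exp m"] continuous_intros)
next
  case (Suc k)
  have der: "((\<lambda>x. flat_exp m (x \<bullet> v + c)) has_derivative
      (\<lambda>h. (h \<bullet> v) * (- real m * flat_exp (Suc m) (x \<bullet> v + c) + flat_exp (m + 2) (x \<bullet> v + c)))) (at x)" for x :: 'a
  proof -
    have "((\<lambda>x. x \<bullet> v + c) has_derivative (\<lambda>h. h \<bullet> v)) (at x)" by (auto intro!: derivative_eq_intros)
    from has_derivative_compose[OF this DERIV_flat_exp[of m, unfolded has_field_derivative_def]]
    show ?thesis by (simp add: mult.commute)
  qed
  have "Ck k (\<lambda>x. (i \<bullet> v) * (- real m * flat_exp (Suc m) (x \<bullet> v + c) + flat_exp (m + 2) (x \<bullet> v + c)))" for i :: 'a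
    by (intro Ck_cmult Ck_add Suc.IH)
  then show ?case using der
    by (auto simp: frechet_derivative_at[OF der, symmetric] differentiable_def)
qed

text \<open>A product of one-dimensional cut-offs, two per coordinate. For positive \<open>t\<close>
  the factor \<open>exp (- 1 / (Suc k * t))\<close> increases to 1 with \<open>k\<close>, so these
  smooth functions approach the indicator of the open box from below.\<close>

definition bump :: "'a::euclidean_space \<Rightarrow> 'a \<Rightarrow> nat \<Rightarrow> 'a \<Rightarrow> real" where
  "bump a b k x = (\<Prod>i\<in>Basis. flat_exp 0 (real (Suc k) * ((x - a) \<bullet> i)) * flat_exp 0 (real (Suc k) * ((b - x) \<bullet> i)))"

lemma flat_exp_0_bounds: "0 \<le> flat_exp 0 t" "flat_exp 0 t \<le> 1"
  by (auto simp: flat_exp_def)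

lemma bump_bounds: "0 \<le> bump a b k x" "bump a b k x \<le> 1"
  unfolding bump_def by (auto intro!: prod_nonneg prod_le_1 mult_le_one flat_exp_0_bounds mult_nonneg_nonneg)

lemma bump_eq_0:
  assumes "x \<notin> box a b"
  shows "bump a b k x = 0"
proof -
  obtain i where i: "i \<in> Basis" "(x - a) \<bullet> i \<le> 0 \<or> (b - x) \<bullet> i \<le> 0"
    using assms by (auto simp: box_def inner_diff_left not_less)
  then have "flat_exp 0 (real (Suc k) * ((x - a) \<bullet> i)) * flat_exp 0 (real (Suc k) * ((b - x) \<bullet> i)) = 0"
    by (auto simp: flat_exp_def zero_less_mult_iff)
  with i(1) show ?thesis unfolding bump_def by (intro prod_zero) auto
qed

lemma bump_test_function:
  assumes "cbox a b \<subseteq> \<Omega>"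
  shows "bump a b k \<in> test_functions \<Omega>"
proof -
  have "Ck n (bump a b k)" for n
  proof -
    have eq: "bump a b k = (\<lambda>x. \<Prod>i\<in>Basis. flat_exp 0 (x \<bullet> (real (Suc k) *\<^sub>R i) + - real (Suc k) * (a \<bullet> i)) *
        flat_exp 0 (x \<bullet> (- real (Suc k) *\<^sub>R i) + real (Suc k) * (b \<bullet> i)))"
      by (auto simp: bump_def fun_eq_iff inner_diff_left algebra_simps)
    show ?thesis unfolding eq by (intro Ck_prod Ck_mult Ck_flat_exp finite_Basis)
  qed
  moreover have "closure {x. bump a b k x \<noteq> 0} \<subseteq> cbox a b"
    using bump_eq_0[of _ a b k] box_subset_cbox[of a b] by (intro closure_minimal) auto
  moreover from this have "bounded (closure {x. bump a b k x \<noteq> 0})" by (rule bounded_subset[OF bounded_cbox])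
  ultimately show ?thesis
    using assms unfolding test_functions_def by (auto simp: compact_eq_bounded_closed)
qed

lemma tendsto_bump: "(\<lambda>k. bump a b k x) \<longlonglongrightarrow> indicator (box a b) x"
proof (cases "x \<in> box a b")
  case True
  have 1: "(\<lambda>k. flat_exp 0 (real (Suc k) * t)) \<longlonglongrightarrow> 1" if "0 < t" for t
  proof -
    have "(\<lambda>k. inverse (real (Suc k)) * inverse t) \<longlonglongrightarrow> 0 * inverse t"
      by (intro tendsto_mult tendsto_const LIMSEQ_inverse_real_of_nat)
    then have "(\<lambda>k. exp (- (inverse (real (Suc k)) * inverse t))) \<longlonglongrightarrow> exp (- (0 * inverse t))"
      by (intro tendsto_exp tendsto_minus)
    then show ?thesis using that by (simp add: flat_exp_def inverse_mult_distrib)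
  qed
  have "(\<lambda>k. bump a b k x) \<longlonglongrightarrow> (\<Prod>i\<in>(Basis::'a set). 1 * 1)"
    unfolding bump_def using True
    by (intro tendsto_prod tendsto_mult 1) (auto simp: box_def algebra_simps)
  then show ?thesis using True by simp
qed (simp add: bump_eq_0)

lemma test_functionsD:
  assumes "\<phi> \<in> test_functions \<Omega>"
  shows "continuous_on S \<phi>" "continuous_on S (grad \<phi>)"
    "(\<phi> has_derivative (\<lambda>h. grad \<phi> x \<bullet> h)) (at x)"
proof -
  have k: "Ck k \<phi>" for k using assms by (simp add: test_functions_def)
  have d: "\<phi> differentiable (at x)" for x using k[of "Suc 0"] by simp
  show "continuous_on S \<phi>" using k Ck_continuous_on by blast
  show "continuous_on S (grad \<phi>)" unfolding grad_def using k[of "Suc 0"]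
    by (auto intro!: continuous_intros intro: continuous_on_subset)
  show "(\<phi> has_derivative (\<lambda>h. grad \<phi> x \<bullet> h)) (at x)" using d by (rule has_derivative_grad)
qed

lemma test_functions_support:
  assumes "\<phi> \<in> test_functions \<Omega>"
  obtains K where "compact K" "K \<subseteq> \<Omega>" "\<And>x. x \<notin> K \<Longrightarrow> \<phi> x = 0" "\<And>x. x \<notin> K \<Longrightarrow> grad \<phi> x = 0"
proof
  let ?K = "closure {x. \<phi> x \<noteq> 0}"
  show "compact ?K" "?K \<subseteq> \<Omega>" using assms by (auto simp: test_functions_def)
  show z: "\<phi> x = 0" if "x \<notin> ?K" for x using that closure_subset[of "{x. \<phi> x \<noteq> 0}"] by auto
  show "grad \<phi> x = 0" if "x \<notin> ?K" for x
  proof (rule grad_eqI)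
    have "((\<lambda>x. 0::real) has_derivative (\<lambda>h. 0 \<bullet> h)) (at x)" by simp
    then show "(\<phi> has_derivative (\<lambda>h. 0 \<bullet> h)) (at x)"
    proof (rule has_derivative_transform_within_open)
      show "open (- ?K)" "x \<in> - ?K" using that by (simp_all only: Compl_iff not_False_eq_True open_Compl closed_closure)
      show "0 = \<phi> y" if "y \<in> - ?K" for y using z[of y] that by simp
    qed
  qed
qed

lemma test_functions_zero_outside:
  assumes "\<phi> \<in> test_functions \<Omega>" "x \<notin> \<Omega>"
  shows "\<phi> x = 0" "grad \<phi> x = 0"
  using test_functions_support[OF assms(1)] assms(2) by (metis in_mono)+

section \<open>Bounds and algebraic operations for test functions\<close>

lemma continuous_compact_support_bounded:
  fixes g :: "'a::topological_space \<Rightarrow> 'b::real_normed_vector"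
  assumes "continuous_on UNIV g" "compact K" "\<And>x. x \<notin> K \<Longrightarrow> g x = 0"
  obtains B where "0 < B" "\<And>x. norm (g x) \<le> B"
proof -
  have "compact (g ` K)" using assms by (intro compact_continuous_image continuous_on_subset[OF assms(1)]) auto
  then obtain B where "0 < B" "\<forall>y\<in>g ` K. norm y \<le> B"
    using compact_imp_bounded bounded_pos by metis
  then show thesis using assms(3) that[of B] by (metis image_eqI norm_zero less_imp_le)
qed

lemma test_functions_bounded:
  assumes "\<phi> \<in> test_functions \<Omega>"
  obtains B where "0 < B" "\<And>x. \<bar>\<phi> x\<bar> \<le> B" "\<And>x. norm (grad \<phi> x) \<le> B"
proof -
  obtain K where K: "compact K" "\<And>x. x \<notin> K \<Longrightarrow> \<phi> x = 0" "\<And>x. x \<notin> K \<Longrightarrow> grad \<phi> x = 0"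
    by (rule test_functions_support[OF assms]) blast
  obtain B1 where "0 < B1" "\<And>x. norm (\<phi> x) \<le> B1"
    using continuous_compact_support_bounded[OF test_functionsD(1)[OF assms] K(1,2)] by metis
  moreover obtain B2 where "0 < B2" "\<And>x. norm (grad \<phi> x) \<le> B2"
    using continuous_compact_support_bounded[OF test_functionsD(2)[OF assms] K(1,3)] by metis
  ultimately show thesis
    by (intro that[of "max B1 B2"]) (auto simp: le_max_iff_disj)
qed

lemma test_functions_add:
  assumes f: "f \<in> test_functions \<Omega>" and g: "g \<in> test_functions \<Omega>"
  shows "(\<lambda>x. f x + g x) \<in> test_functions \<Omega>" "grad (\<lambda>x. f x + g x) x = grad f x + grad g x"
proof -
  have sub: "closure {x. f x + g x \<noteq> 0} \<subseteq> closure {x. f x \<noteq> 0} \<union> closure {x. g x \<noteq> 0}"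
    unfolding closure_Un[symmetric] by (intro closure_mono) auto
  have "bounded (closure {x. f x \<noteq> 0} \<union> closure {x. g x \<noteq> 0})"
    using f g by (auto simp: test_functions_def compact_eq_bounded_closed)
  then have "bounded (closure {x. f x + g x \<noteq> 0})" using sub by (rule bounded_subset)
  then have "compact (closure {x. f x + g x \<noteq> 0})" by (simp add: compact_eq_bounded_closed)
  then show "(\<lambda>x. f x + g x) \<in> test_functions \<Omega>" using f g sub
    by (auto simp: test_functions_def Ck_add)
  show "grad (\<lambda>x. f x + g x) x = grad f x + grad g x"
    by (rule grad_eqI)
      (use has_derivative_add[OF test_functionsD(3)[OF f] test_functionsD(3)[OF g]] in \<open>simp add: inner_add_left\<close>)
qed

lemma test_functions_cmult:
  assumes f: "f \<in> test_functions \<Omega>"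
  shows "(\<lambda>x. c * f x) \<in> test_functions \<Omega>" "grad (\<lambda>x. c * f x) x = c *\<^sub>R grad f x"
proof -
  have sub: "closure {x. c * f x \<noteq> 0} \<subseteq> closure {x. f x \<noteq> 0}" by (intro closure_mono) auto
  have "bounded (closure {x. f x \<noteq> 0})"
    using f by (auto simp: test_functions_def compact_eq_bounded_closed)
  then have "bounded (closure {x. c * f x \<noteq> 0})" using sub by (rule bounded_subset)
  then have "compact (closure {x. c * f x \<noteq> 0})" by (simp add: compact_eq_bounded_closed)
  then show "(\<lambda>x. c * f x) \<in> test_functions \<Omega>" using f sub
    by (auto simp: test_functions_def Ck_cmult)
  show "grad (\<lambda>x. c * f x) x = c *\<^sub>R grad f x"
    by (rule grad_eqI)
      (use has_derivative_mult_right[OF test_functionsD(3)[OF f], of c] in simp)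
qed

lemma test_functions_diff:
  assumes f: "f \<in> test_functions \<Omega>" and g: "g \<in> test_functions \<Omega>"
  shows "(\<lambda>x. f x - g x) \<in> test_functions \<Omega>" "grad (\<lambda>x. f x - g x) x = grad f x - grad g x"
  using test_functions_add[OF f test_functions_cmult(1)[OF g, of "-1"]] test_functions_cmult(2)[OF g, of "-1"]
  by simp_all

lemma test_functions_zero: "(\<lambda>x. 0) \<in> test_functions \<Omega>" "grad (\<lambda>x. 0) x = 0"
  by (auto simp: test_functions_def Ck_const intro: grad_eqI)

lemma test_functions_sum:
  assumes "finite I" "\<And>i. i \<in> I \<Longrightarrow> f i \<in> test_functions \<Omega>"
  shows "(\<lambda>x. \<Sum>i\<in>I. f i x) \<in> test_functions \<Omega> \<and> grad (\<lambda>x. \<Sum>i\<in>I. f i x) = (\<lambda>x. \<Sum>i\<in>I. grad (f i) x)"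
  using assms
proof (induction I rule: finite_induct)
  case empty then show ?case by (simp add: test_functions_zero fun_eq_iff)
next
  case (insert i I)
  then show ?case using test_functions_add[of "f i" \<Omega> "\<lambda>x. \<Sum>i\<in>I. f i x"] by (simp add: fun_eq_iff)
qed

lemma test_functions_lincomb:
  assumes "finite I" "\<And>i. i \<in> I \<Longrightarrow> f i \<in> test_functions \<Omega>"
  shows "(\<lambda>x. \<Sum>i\<in>I. c i * f i x) \<in> test_functions \<Omega>"
    "grad (\<lambda>x. \<Sum>i\<in>I. c i * f i x) x = (\<Sum>i\<in>I. c i *\<^sub>R grad (f i) x)"
proof -
  have 1: "(\<lambda>x. c i * f i x) \<in> test_functions \<Omega>" if "i \<in> I" for i
    using assms(2)[OF that] by (rule test_functions_cmult)
  note 2 = test_functions_sum[OF assms(1), of "\<lambda>i x. c i * f i x" \<Omega>, OF 1]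
  show "(\<lambda>x. \<Sum>i\<in>I. c i * f i x) \<in> test_functions \<Omega>" using 2 by simp
  show "grad (\<lambda>x. \<Sum>i\<in>I. c i * f i x) x = (\<Sum>i\<in>I. c i *\<^sub>R grad (f i) x)"
    using 2 test_functions_cmult(2)[OF assms(2)] by simp
qed

section \<open>Jensen's inequality and translation estimates\<close>

lemma integral_jensen_powr:
  fixes f k :: "'b \<Rightarrow> real"
  assumes p: "1 < p" and k: "integrable M k" "(\<integral>x. k x \<partial>M) = 1" "\<And>x. 0 \<le> k x"
    and f: "integrable M (\<lambda>x. k x * f x)" "integrable M (\<lambda>x. k x * \<bar>f x\<bar> powr p)"
  shows "\<bar>\<integral>x. k x * f x \<partial>M\<bar> powr p \<le> (\<integral>x. k x * \<bar>f x\<bar> powr p \<partial>M)"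
proof -
  define m where "m = (\<integral>x. k x * f x \<partial>M)"
  \<comment> \<open>The second summand integrates to 0 because \<open>k\<close> has mass 1 and
    \<open>m\<close> is the mean. With it the integrand becomes \<open>k\<close> times the tangent
    at \<open>m\<close>.\<close>
  have "\<bar>m\<bar> powr p / p = (\<integral>x. k x * (\<bar>m\<bar> powr p / p) + \<bar>m\<bar> powr (p - 2) * m * (k x * f x - k x * m) \<partial>M)"
    using k f by (simp add: m_def[symmetric])
  also have "\<dots> \<le> (\<integral>x. k x * \<bar>f x\<bar> powr p / p \<partial>M)"
  proof (rule integral_mono)
    fix x
    have "\<bar>m\<bar> powr p / p + \<bar>m\<bar> powr (p - 2) * (m * (f x - m)) \<le> \<bar>f x\<bar> powr p / p"
      using norm_powr_tangent(1)[OF p, of m "f x"] by simp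
    from mult_left_mono[OF this k(3)[of x]]
    show "k x * (\<bar>m\<bar> powr p / p) + \<bar>m\<bar> powr (p - 2) * m * (k x * f x - k x * m) \<le> k x * \<bar>f x\<bar> powr p / p"
      by (simp add: algebra_simps)
  qed (use k f in auto)
  also have "\<dots> = (\<integral>x. k x * \<bar>f x\<bar> powr p \<partial>M) / p" by simp
  finally show ?thesis using p by (simp add: m_def divide_le_cancel)
qed

text \<open>Jensen's inequality for the uniform weights \<open>1 / n\<close> on a finite
  set.\<close>

lemma mean_powr_le:
  fixes f :: "nat \<Rightarrow> real"
  assumes p: "1 < p" and n: "0 < n"
  shows "\<bar>\<Sum>j<n. f j\<bar> powr p \<le> real n powr (p - 1) * (\<Sum>j<n. \<bar>f j\<bar> powr p)"
proof -
  have k: "(\<Sum>j<n. 1 / real n) = 1" using n by simp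
  have "\<bar>\<integral>j. 1 / real n * f j \<partial>count_space {..<n}\<bar> powr p \<le> (\<integral>j. 1 / real n * \<bar>f j\<bar> powr p \<partial>count_space {..<n})"
    using k by (intro integral_jensen_powr[OF p]) (auto intro!: integrable_count_space simp: lebesgue_integral_count_space_finite)
  then have "\<bar>1 / real n * (\<Sum>j<n. f j)\<bar> powr p \<le> 1 / real n * (\<Sum>j<n. \<bar>f j\<bar> powr p)"
    by (simp add: lebesgue_integral_count_space_finite flip: sum_distrib_left sum_divide_distrib)
  then have "(1 / real n) powr p * \<bar>\<Sum>j<n. f j\<bar> powr p \<le> 1 / real n * (\<Sum>j<n. \<bar>f j\<bar> powr p)"
    by (simp add: abs_mult powr_mult powr_divide abs_divide)
  then have "real n powr p * ((1 / real n) powr p * \<bar>\<Sum>j<n. f j\<bar> powr p) \<le> real n powr p * (1 / real n * (\<Sum>j<n. \<bar>f j\<bar> powr p))"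
    by (intro mult_left_mono) auto
  then show ?thesis using n by (simp add: powr_divide powr_diff)
qed

lemma integrable_bounded_support:
  fixes g :: "'a::euclidean_space \<Rightarrow> 'b::euclidean_space"
  assumes "g \<in> borel_measurable borel" "bounded S" "\<And>x. x \<notin> S \<Longrightarrow> g x = 0" "\<And>x. norm (g x) \<le> B"
  shows "integrable lborel g"
proof -
  obtain a where "S \<subseteq> cbox (-a) a" using bounded_subset_cbox_symmetric[OF assms(2)] by auto
  then have "\<And>x. x \<notin> cbox (-a) a \<Longrightarrow> g x = 0" using assms(3) by auto
  then have eq: "g = (\<lambda>x. indicator (cbox (-a) a) x *\<^sub>R g x)" by (auto simp: fun_eq_iff indicator_def)
  have "integrable lborel (\<lambda>x. B * indicator (cbox (-a) a) x :: real)"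
    by (intro integrable_mult_right integrable_real_indicator) (auto simp: emeasure_lborel_cbox_eq)
  then have "integrable lborel (\<lambda>x. indicator (cbox (-a) a) x *\<^sub>R g x)"
  proof (rule Bochner_Integration.integrable_bound)
    have "norm (g x) \<le> \<bar>B\<bar>" for x using assms(4)[of x] by simp
    then show "AE x in lborel. norm (indicator (cbox (-a) a) x *\<^sub>R g x) \<le> norm (B * indicator (cbox (-a) a) x)"
      by (intro AE_I2) (simp add: indicator_def)
  qed (use assms(1) in measurable)
  then show ?thesis using eq by simp
qed

lemma integral_lborel_translation:
  fixes g :: "'a::euclidean_space \<Rightarrow> 'b::euclidean_space"
  assumes [measurable]: "g \<in> borel_measurable borel"
  shows "(\<integral>x. g (x + z) \<partial>lborel) = (\<integral>x. g x \<partial>lborel)"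
proof -
  have "(\<integral>x. g x \<partial>lborel) = (\<integral>x. g x \<partial>(distr lborel borel ((+) z)))" by (simp add: lborel_distr_plus)
  also have "\<dots> = (\<integral>x. g (z + x) \<partial>lborel)" by (rule integral_distr) auto
  finally show ?thesis by (simp add: add.commute)
qed

lemma test_functions_mult:
  assumes f: "f \<in> test_functions \<Omega>" and g: "g \<in> test_functions \<Omega>"
  shows "(\<lambda>x. f x * g x) \<in> test_functions \<Omega>" "grad (\<lambda>x. f x * g x) x = f x *\<^sub>R grad g x + g x *\<^sub>R grad f x"
proof -
  have sub: "closure {x. f x * g x \<noteq> 0} \<subseteq> closure {x. f x \<noteq> 0}" by (intro closure_mono) auto
  have "bounded (closure {x. f x \<noteq> 0})"
    using f by (auto simp: test_functions_def compact_eq_bounded_closed)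
  then have "bounded (closure {x. f x * g x \<noteq> 0})" using sub by (rule bounded_subset)
  then have "compact (closure {x. f x * g x \<noteq> 0})" by (simp add: compact_eq_bounded_closed)
  then show "(\<lambda>x. f x * g x) \<in> test_functions \<Omega>" using f g sub
    by (auto simp: test_functions_def Ck_mult)
  show "grad (\<lambda>x. f x * g x) x = f x *\<^sub>R grad g x + g x *\<^sub>R grad f x"
    by (rule grad_eqI)
      (use has_derivative_mult[OF test_functionsD(3)[OF f] test_functionsD(3)[OF g]] in \<open>simp add: inner_add_left mult.commute\<close>)
qed

lemma test_functions_measurable:
  assumes "\<phi> \<in> test_functions \<Omega>"
  shows "\<phi> \<in> borel_measurable borel" "grad \<phi> \<in> borel_measurable borel"
  using test_functionsD(1,2)[OF assms, of UNIV] by (auto intro: borel_measurable_continuous_onI)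

lemma test_functions_lipschitz:
  assumes \<phi>: "\<phi> \<in> test_functions \<Omega>" and B: "\<And>x. norm (grad \<phi> x) \<le> B"
  shows "\<bar>\<phi> (x + z) - \<phi> x\<bar> \<le> B * norm z"
proof -
  have "norm (\<phi> (x + z) - \<phi> x) \<le> B * norm (x + z - x)"
  proof (rule differentiable_bound[where S = UNIV and f' = "\<lambda>x h. grad \<phi> x \<bullet> h"])
    show "onorm (\<lambda>h. grad \<phi> x \<bullet> h) \<le> B" for x
      using B[of x] Cauchy_Schwarz_ineq2[of "grad \<phi> x"]
      by (intro onorm_bound) (auto intro: order_trans[OF _ mult_right_mono] order_trans[OF norm_ge_zero])
  qed (use test_functionsD(3)[OF \<phi>] in auto)
  then show ?thesis by simp
qed

lemma test_functions_difference_quotient: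
  assumes \<phi>: "\<phi> \<in> test_functions \<Omega>"
  shows "(\<lambda>n. real (Suc n) * (\<phi> (x + (1 / real (Suc n)) *\<^sub>R z) - \<phi> x)) \<longlonglongrightarrow> grad \<phi> x \<bullet> z"
proof -
  have "((\<lambda>t. \<phi> (x + t *\<^sub>R z)) has_real_derivative (grad \<phi> x \<bullet> z)) (at 0)"
    unfolding has_field_derivative_def
  proof -
    have 1: "((\<lambda>t. x + t *\<^sub>R z) has_derivative (\<lambda>t. t *\<^sub>R z)) (at 0)" by (auto intro!: derivative_eq_intros)
    have "(\<phi> has_derivative (\<lambda>h. grad \<phi> x \<bullet> h)) (at (x + 0 *\<^sub>R z))" using test_functionsD(3)[OF \<phi>] by simp
    from has_derivative_compose[OF 1 this]
    show "((\<lambda>t. \<phi> (x + t *\<^sub>R z)) has_derivative (*) (grad \<phi> x \<bullet> z)) (at 0)"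
      by (simp add: mult.commute[of _ "grad \<phi> x \<bullet> z"])
  qed
  then have "((\<lambda>t. (\<phi> (x + t *\<^sub>R z) - \<phi> x) / t) \<longlongrightarrow> grad \<phi> x \<bullet> z) (at 0)"
    by (simp add: DERIV_def)
  moreover have "filterlim (\<lambda>n. 1 / real (Suc n)) (at 0) sequentially"
    using LIMSEQ_inverse_real_of_nat by (auto simp: filterlim_at inverse_eq_divide)
  ultimately have "(\<lambda>n. (\<phi> (x + (1 / real (Suc n)) *\<^sub>R z) - \<phi> x) / (1 / real (Suc n))) \<longlonglongrightarrow> grad \<phi> x \<bullet> z"
    by (rule filterlim_compose)
  then show ?thesis by (simp add: mult.commute)
qed

lemma test_functions_difference_quotient_bounds:
  assumes \<phi>: "\<phi> \<in> test_functions \<Omega>" and \<Omega>: "bounded \<Omega>"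
  obtains B S where "0 < B" "bounded S" "closed S"
    "\<And>n x. \<bar>real (Suc n) * (\<phi> (x + (1 / real (Suc n)) *\<^sub>R z) - \<phi> x)\<bar> \<le> B * indicator S x"
proof -
  obtain B where B: "0 < B" "\<And>x. norm (grad \<phi> x) \<le> B" using test_functions_bounded[OF \<phi>] by metis
  obtain R where R: "\<And>x. x \<in> \<Omega> \<Longrightarrow> norm x \<le> R" using \<Omega> unfolding bounded_iff by blast
  show thesis
  \<comment> \<open>The summand 1 keeps the constant positive for \<open>z = 0\<close>. Outside the
    enlarged ball both \<open>x\<close> and the shifted point lie outside \<open>\<Omega>\<close>,
    as the shift is no longer than \<open>z\<close>.\<close>
  proof (rule that[of "B * norm z + 1" "cball 0 (R + norm z)"])
    show "0 < B * norm z + 1" using B by (simp add: add_nonneg_pos)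
    fix n and x :: 'a
    let ?y = "x + (1 / real (Suc n)) *\<^sub>R z"
    show "\<bar>real (Suc n) * (\<phi> ?y - \<phi> x)\<bar> \<le> (B * norm z + 1) * indicator (cball 0 (R + norm z)) x"
    proof (cases "x \<in> cball 0 (R + norm z)")
      case True
      have "\<bar>real (Suc n) * (\<phi> ?y - \<phi> x)\<bar> = real (Suc n) * \<bar>\<phi> ?y - \<phi> x\<bar>" by (simp add: abs_mult)
      also have "\<dots> \<le> real (Suc n) * (B * norm ((1 / real (Suc n)) *\<^sub>R z))"
        by (intro mult_left_mono test_functions_lipschitz[OF \<phi> B(2)]) auto
      also have "\<dots> = B * norm z" by (simp add: abs_div)
      finally show ?thesis using True by simp
    next
      case False
      have "norm ((1 / real (Suc n)) *\<^sub>R z) \<le> norm z"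
        using mult_right_mono[of "1 / real (Suc n)" 1 "norm z"] by (simp add: field_simps)
      then have "R < norm ?y" using False norm_triangle_ineq4[of ?y "(1 / real (Suc n)) *\<^sub>R z"] by simp
      moreover have "R < norm x" using False by (auto intro: order_trans less_le_trans simp: not_le) (smt (verit) norm_ge_zero)
      ultimately have "?y \<notin> \<Omega>" "x \<notin> \<Omega>" using R by force+
      then have "\<phi> ?y = 0" "\<phi> x = 0" using test_functions_zero_outside[OF \<phi>] by auto
      then show ?thesis using False by simp
    qed
  qed auto
qed

lemma integrable_bounded_indicator:
  assumes "bounded (S :: 'a::euclidean_space set)" "closed S"
  shows "integrable lborel (\<lambda>x. c * indicator S x :: real)"
proof -
  have [measurable]: "S \<in> sets borel" using assms by auto
  show ?thesis
    by (rule integrable_bounded_support[of _ S "\<bar>c\<bar>"]) (use assms in \<open>auto simp: indicator_def\<close>)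
qed

lemma test_functions_integrable:
  assumes \<phi>: "\<phi> \<in> test_functions \<Omega>" and \<Omega>: "bounded \<Omega>"
  shows "integrable lborel \<phi>" "integrable lborel (grad \<phi>)"
    "0 < s \<Longrightarrow> integrable lborel (\<lambda>x. \<bar>\<phi> x\<bar> powr s)"
    "0 < s \<Longrightarrow> integrable lborel (\<lambda>x. norm (grad \<phi> x) powr s)"
proof -
  note [measurable] = test_functions_measurable[OF \<phi>]
  obtain B where B: "0 < B" "\<And>x. \<bar>\<phi> x\<bar> \<le> B" "\<And>x. norm (grad \<phi> x) \<le> B"
    by (rule test_functions_bounded[OF \<phi>]) blast
  note z = test_functions_zero_outside[OF \<phi>]
  show "integrable lborel \<phi>" "integrable lborel (grad \<phi>)"
    by (rule integrable_bounded_support[OF _ \<Omega>, where B = B], simp_all add: z B)+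
  assume s: "0 < s"
  show "integrable lborel (\<lambda>x. \<bar>\<phi> x\<bar> powr s)" "integrable lborel (\<lambda>x. norm (grad \<phi> x) powr s)"
    by (rule integrable_bounded_support[OF _ \<Omega>, where B = "B powr s"], simp_all add: z B s powr_mono2 less_imp_le)+
qed

lemma integrable_lborel_translation:
  fixes g :: "'a::euclidean_space \<Rightarrow> 'b::euclidean_space"
  assumes "integrable lborel g"
  shows "integrable lborel (\<lambda>x. g (x + z))"
proof -
  have "integrable (distr lborel borel ((+) z)) g" using assms by (simp add: lborel_distr_plus)
  then show ?thesis by (subst (asm) integrable_distr_eq) (use assms in \<open>auto simp: add.commute\<close>)
qed

text \<open>Every difference quotient has integral 0 by translation invariance, and dominated
  convergence hands this on to the derivative.\<close>

lemma integral_grad_eq_0: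
  assumes \<phi>: "\<phi> \<in> test_functions \<Omega>" and \<Omega>: "bounded \<Omega>"
  shows "(\<integral>x. grad \<phi> x \<bullet> z \<partial>lborel) = 0"
proof -
  note [measurable] = test_functions_measurable[OF \<phi>]
  obtain B S where S: "0 < B" "bounded S" "closed S"
    "\<And>n x. \<bar>real (Suc n) * (\<phi> (x + (1 / real (Suc n)) *\<^sub>R z) - \<phi> x)\<bar> \<le> B * indicator S x"
    using test_functions_difference_quotient_bounds[OF \<phi> \<Omega>] by blast
  note int = test_functions_integrable(1)[OF \<phi> \<Omega>]
  note int2 = integrable_lborel_translation[OF int]
  have "(\<lambda>n. \<integral>x. real (Suc n) * (\<phi> (x + (1 / real (Suc n)) *\<^sub>R z) - \<phi> x) \<partial>lborel) \<longlonglongrightarrow> (\<integral>x. grad \<phi> x \<bullet> z \<partial>lborel)"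
  proof (rule integral_dominated_convergence)
    show "integrable lborel (\<lambda>x. B * indicator S x)"
      using S by (intro integrable_bounded_indicator) auto
  qed (use test_functions_difference_quotient[OF \<phi>] S(4) in auto)
  moreover have "(\<integral>x. real (Suc n) * (\<phi> (x + (1 / real (Suc n)) *\<^sub>R z) - \<phi> x) \<partial>lborel) = 0" for n
    using int int2 by (simp add: integral_lborel_translation)
  ultimately show ?thesis by (simp add: LIMSEQ_const_iff)
qed

text \<open>A shift by \<open>z\<close> is a chain of \<open>n\<close> shifts by
  \<open>z / n\<close>. By \<open>mean_powr_le\<close> and translation invariance the left side is
  at most the integral of the \<open>p\<close>-th power of the difference quotient with step
  \<open>1 / n\<close>. The powers of \<open>n\<close> cancel exactly, so \<open>n\<close> can tend
  to infinity, which leaves the directional derivative.\<close>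

lemma test_function_translation_estimate:
  assumes \<phi>: "\<phi> \<in> test_functions \<Omega>" and \<Omega>: "bounded \<Omega>" and p: "1 < p"
  shows "(\<integral>x. \<bar>\<phi> (x + z) - \<phi> x\<bar> powr p \<partial>lborel) \<le> norm z powr p * (\<integral>x. norm (grad \<phi> x) powr p \<partial>lborel)"
proof -
  note [measurable] = test_functions_measurable[OF \<phi>]
  obtain B where B: "0 < B" "\<And>x. \<bar>\<phi> x\<bar> \<le> B" "\<And>x. norm (grad \<phi> x) \<le> B" using test_functions_bounded[OF \<phi>] by metis
  obtain C S where S: "0 < C" "bounded S" "closed S"
    "\<And>n x. \<bar>real (Suc n) * (\<phi> (x + (1 / real (Suc n)) *\<^sub>R z) - \<phi> x)\<bar> \<le> C * indicator S x"
    using test_functions_difference_quotient_bounds[OF \<phi> \<Omega>] by blast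
  define g where "g n x = \<bar>real (Suc n) * (\<phi> (x + (1 / real (Suc n)) *\<^sub>R z) - \<phi> x)\<bar> powr p" for n x
  have gS: "norm (g n x) \<le> C powr p * indicator S x" for n x
  proof -
    have "g n x \<le> (C * indicator S x) powr p" unfolding g_def
      using S(4)[of n x] S(1) p by (intro powr_mono2) (auto simp: indicator_def split: if_splits)
    also have "\<dots> = C powr p * indicator S x" by (auto simp: indicator_def)
    finally show ?thesis by (simp add: g_def)
  qed
  have intd: "integrable lborel (\<lambda>x. C powr p * indicator S x)"
    using S by (intro integrable_bounded_indicator) auto
  have gm[measurable]: "g n \<in> borel_measurable borel" for n unfolding g_def by measurable
  have gint: "integrable lborel (g n)" for n
    by (rule Bochner_Integration.integrable_bound[OF intd]) (use gS[of n] in \<open>auto simp: indicator_def split: if_splits intro: order_trans[OF _ abs_ge_self]\<close>)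
  note gint2 = integrable_lborel_translation[OF gint]
  have lim: "(\<lambda>n. \<integral>x. g n x \<partial>lborel) \<longlonglongrightarrow> (\<integral>x. \<bar>grad \<phi> x \<bullet> z\<bar> powr p \<partial>lborel)"
  proof (rule integral_dominated_convergence[OF _ _ intd])
    show "AE x in lborel. (\<lambda>n. g n x) \<longlonglongrightarrow> \<bar>grad \<phi> x \<bullet> z\<bar> powr p"
      unfolding g_def using p
      by (intro AE_I2 tendsto_powr' tendsto_rabs test_functions_difference_quotient[OF \<phi>] tendsto_const) auto
    show "AE x in lborel. norm (g n x) \<le> C powr p * indicator S x" for n using gS by simp
  qed auto
  have le: "(\<integral>x. \<bar>\<phi> (x + z) - \<phi> x\<bar> powr p \<partial>lborel) \<le> (\<integral>x. g m x \<partial>lborel)" for m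
  proof -
    define n where "n = Suc m"
    define v where "v = (1 / real n) *\<^sub>R z"
    have n: "0 < n" by (simp add: n_def)
    have nv: "real n *\<^sub>R v = z" using n by (simp add: v_def)
    have tel: "\<phi> (x + z) - \<phi> x = (\<Sum>j<n. \<phi> (x + real (Suc j) *\<^sub>R v) - \<phi> (x + real j *\<^sub>R v))" for x
      using sum_lessThan_telescope[of "\<lambda>j. \<phi> (x + real j *\<^sub>R v)" n] nv by simp
    have g: "\<bar>\<phi> (x + real (Suc j) *\<^sub>R v) - \<phi> (x + real j *\<^sub>R v)\<bar> powr p = (1 / real n) powr p * g m (x + real j *\<^sub>R v)" for x j
    proof -
      have "x + real (Suc j) *\<^sub>R v = (x + real j *\<^sub>R v) + v" by (simp add: algebra_simps)
      moreover have "g m (x + real j *\<^sub>R v) = real n powr p * \<bar>\<phi> ((x + real j *\<^sub>R v) + v) - \<phi> (x + real j *\<^sub>R v)\<bar> powr p"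
        unfolding g_def n_def[symmetric] v_def[symmetric] abs_mult by (subst powr_mult) auto
      ultimately show ?thesis using n by (simp add: powr_divide add.assoc)
    qed
    have pw: "\<bar>\<phi> (x + z) - \<phi> x\<bar> powr p \<le> real n powr (p - 1) * (\<Sum>j<n. (1 / real n) powr p * g m (x + real j *\<^sub>R v))" for x
      unfolding tel g[symmetric] by (rule mean_powr_le[OF p n])
    have "(\<integral>x. \<bar>\<phi> (x + z) - \<phi> x\<bar> powr p \<partial>lborel) \<le> (\<integral>x. real n powr (p - 1) * (\<Sum>j<n. (1 / real n) powr p * g m (x + real j *\<^sub>R v)) \<partial>lborel)"
    proof (rule integral_mono'[OF _ pw])
      show "0 \<le> real n powr (p - 1) * (\<Sum>j<n. (1 / real n) powr p * g m (x + real j *\<^sub>R v))" for x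
        by (intro mult_nonneg_nonneg sum_nonneg) (auto simp: g_def)
    qed (auto intro!: integrable_mult_right Bochner_Integration.integrable_sum gint2)
    also have "\<dots> = real n powr (p - 1) * (\<Sum>j<n. (1 / real n) powr p * (\<integral>x. g m x \<partial>lborel))"
      by (simp add: gint2 integral_lborel_translation)
    also have "\<dots> = (real n powr (p - 1) * real n * (1 / real n) powr p) * (\<integral>x. g m x \<partial>lborel)" by simp
    also have "real n powr (p - 1) * real n * (1 / real n) powr p = 1"
      using n by (simp add: powr_diff powr_divide)
    finally show ?thesis by simp
  qed
  have gradint: "integrable lborel (\<lambda>x. norm (grad \<phi> x) powr p)"
    using p by (intro test_functions_integrable[OF \<phi> \<Omega>]) auto
  have "(\<integral>x. \<bar>\<phi> (x + z) - \<phi> x\<bar> powr p \<partial>lborel) \<le> (\<integral>x. \<bar>grad \<phi> x \<bullet> z\<bar> powr p \<partial>lborel)"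
    using lim le by (intro LIMSEQ_le_const) auto
  also have "\<dots> \<le> (\<integral>x. norm z powr p * norm (grad \<phi> x) powr p \<partial>lborel)"
  proof (rule integral_mono')
    show "integrable lborel (\<lambda>x. norm z powr p * norm (grad \<phi> x) powr p)" using gradint by simp
    show "\<bar>grad \<phi> x \<bullet> z\<bar> powr p \<le> norm z powr p * norm (grad \<phi> x) powr p" for x
      using p Cauchy_Schwarz_ineq2[of "grad \<phi> x" z] by (subst powr_mult[symmetric]) (auto intro!: powr_mono2 simp: mult.commute)
  qed auto
  finally show ?thesis by simp
qed

section \<open>Grid averages and the embedding theorems\<close>

text \<open>The half-open cube of side \<open>h\<close>, from the lattice of multiples of
  \<open>h\<close>, that contains \<open>x\<close>. Comparing floors makes the relation between
  \<open>x\<close> and \<open>y\<close> symmetric and jointly measurable at sight.\<close>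

definition grid_cell :: "real \<Rightarrow> 'a::euclidean_space \<Rightarrow> 'a set" where
  "grid_cell h x = {y. \<forall>i\<in>Basis. \<lfloor>(y \<bullet> i) / h\<rfloor> = \<lfloor>(x \<bullet> i) / h\<rfloor>}"

lemma grid_cell_measurable [measurable]: "grid_cell h x \<in> sets borel"
proof -
  have "{y \<in> space borel. \<forall>i\<in>Basis. \<lfloor>(y \<bullet> i) / h\<rfloor> = \<lfloor>(x \<bullet> i) / h\<rfloor>} \<in> sets (borel :: 'a measure)"
    by measurable
  then show ?thesis by (simp add: grid_cell_def)
qed

text \<open>The cell lies between an open and a closed box of the same measure.\<close>

lemma emeasure_grid_cell:
  assumes h: "0 < h"
  shows "emeasure lborel (grid_cell h (x :: 'a::euclidean_space)) = ennreal (h ^ DIM('a))"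
proof (rule antisym)
  define l where "l = (\<Sum>i\<in>Basis. (of_int \<lfloor>(x \<bullet> i) / h\<rfloor> * h) *\<^sub>R i :: 'a)"
  define r where "r = l + (\<Sum>i\<in>Basis. h *\<^sub>R i)"
  have l: "l \<bullet> i = of_int \<lfloor>(x \<bullet> i) / h\<rfloor> * h" if "i \<in> Basis" for i using that by (simp add: l_def)
  have r: "r \<bullet> i = of_int \<lfloor>(x \<bullet> i) / h\<rfloor> * h + h" if "i \<in> Basis" for i
    using that by (simp add: r_def l inner_add_left)
  have cell: "y \<in> grid_cell h x \<longleftrightarrow> (\<forall>i\<in>Basis. l \<bullet> i \<le> y \<bullet> i \<and> y \<bullet> i < r \<bullet> i)" for y
    using h by (auto simp: grid_cell_def l r floor_eq_iff field_simps)
  have m: "(\<Prod>b\<in>Basis. (r - l) \<bullet> b) = h ^ DIM('a)"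
    by (simp add: inner_diff_left l r)
  have lr: "l \<bullet> b \<le> r \<bullet> b" if "b \<in> Basis" for b using that h by (simp add: l r)
  have "emeasure lborel (grid_cell h x) \<le> emeasure lborel (cbox l r)"
    by (rule emeasure_mono) (auto simp: cell mem_box less_imp_le)
  then show "emeasure lborel (grid_cell h x) \<le> ennreal (h ^ DIM('a))" using lr by (simp add: m)
  have "emeasure lborel (box l r) \<le> emeasure lborel (grid_cell h x)"
    by (rule emeasure_mono) (auto simp: cell mem_box less_imp_le)
  then show "ennreal (h ^ DIM('a)) \<le> emeasure lborel (grid_cell h x)" using lr by (simp add: m)
qed

lemma grid_cell_diff:
  assumes h: "0 < h" and y: "y \<in> grid_cell h x" and i: "i \<in> Basis"
  shows "\<bar>(y - x) \<bullet> i\<bar> < h"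
proof -
  have "\<lfloor>(y \<bullet> i) / h\<rfloor> = \<lfloor>(x \<bullet> i) / h\<rfloor>" using y i by (simp add: grid_cell_def)
  then have "\<bar>(y \<bullet> i) / h - (x \<bullet> i) / h\<bar> < 1" by linarith
  then show ?thesis using h by (simp add: inner_diff_left diff_divide_distrib[symmetric] abs_divide)
qed

definition grid_kernel :: "real \<Rightarrow> 'a::euclidean_space \<Rightarrow> 'a \<Rightarrow> real" where
  "grid_kernel h x y = indicator (grid_cell h x) y / h ^ DIM('a)"

lemma grid_kernel:
  fixes x :: "'a::euclidean_space"
  assumes h: "0 < h"
  shows "integrable lborel (grid_kernel h x)" "(\<integral>y. grid_kernel h x y \<partial>lborel) = 1" "0 \<le> grid_kernel h x y"
  using h emeasure_grid_cell[OF h, of x]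
  by (auto simp: grid_kernel_def[abs_def] measure_def intro!: integrable_real_indicator integrable_divide)

text \<open>The conditional expectation of \<open>u\<close> with respect to the partition into
  cells. It takes the place of a mollification in the Sobolev inequality and in the compactness
  theorem.\<close>

definition grid_avg :: "real \<Rightarrow> ('a::euclidean_space \<Rightarrow> real) \<Rightarrow> 'a \<Rightarrow> real" where
  "grid_avg h u x = (\<integral>y. grid_kernel h x y * u y \<partial>lborel)"

lemma grid_kernel_mult_integrable:
  assumes "integrable lborel u"
  shows "integrable lborel (\<lambda>y. grid_kernel h x y * u y)"
proof -
  have "integrable lborel (\<lambda>y. (indicator (grid_cell h x) y *\<^sub>R u y) / h ^ DIM('a))"
    by (intro integrable_divide integrable_mult_indicator assms) simp
  then show ?thesis by (simp add: grid_kernel_def)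
qed

lemma grid_avg_measurable [measurable]:
  assumes [measurable]: "u \<in> borel_measurable borel"
  shows "grid_avg h u \<in> borel_measurable (borel :: 'a::euclidean_space measure)"
proof -
  have "{z \<in> space (borel \<Otimes>\<^sub>M borel). \<forall>i\<in>Basis. \<lfloor>(snd z \<bullet> i) / h\<rfloor> = \<lfloor>(fst z \<bullet> i) / h\<rfloor>} \<in> sets (borel \<Otimes>\<^sub>M (borel :: 'a measure))"
    by measurable
  then have [measurable]: "{z. snd z \<in> grid_cell h (fst z)} \<in> sets (borel \<Otimes>\<^sub>M (borel :: 'a measure))"
    by (simp add: grid_cell_def space_pair_measure)
  have "(\<lambda>x. \<integral>y. indicator {z. snd z \<in> grid_cell h (fst z)} (x, y) / h ^ DIM('a) * u y \<partial>lborel) \<in> borel_measurable (borel :: 'a measure)"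
    by (intro lborel.borel_measurable_lebesgue_integral) measurable
  then show ?thesis by (simp add: grid_avg_def[abs_def] grid_kernel_def indicator_def)
qed

lemma grid_avg_powr_le:
  fixes u :: "'a::euclidean_space \<Rightarrow> real"
  assumes h: "0 < h" and s: "1 < s" and u: "integrable lborel u" "integrable lborel (\<lambda>x. \<bar>u x\<bar> powr s)"
  shows "\<bar>grid_avg h u x\<bar> powr s \<le> (\<integral>x. \<bar>u x\<bar> powr s \<partial>lborel) / h ^ DIM('a)"
proof -
  have "\<bar>grid_avg h u x\<bar> powr s \<le> (\<integral>y. grid_kernel h x y * \<bar>u y\<bar> powr s \<partial>lborel)"
    unfolding grid_avg_def
    by (intro integral_jensen_powr[OF s] grid_kernel[OF h] grid_kernel_mult_integrable u)
  also have "\<dots> \<le> (\<integral>y. \<bar>u y\<bar> powr s / h ^ DIM('a) \<partial>lborel)"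
    using u h by (intro integral_mono grid_kernel_mult_integrable integrable_divide)
      (auto simp: grid_kernel_def indicator_def)
  finally show ?thesis by simp
qed

lemma norm_le_DIM:
  fixes z :: "'a::euclidean_space"
  assumes "\<And>i. i \<in> Basis \<Longrightarrow> \<bar>z \<bullet> i\<bar> \<le> h"
  shows "norm z \<le> real DIM('a) * h"
  using norm_le_l1[of z] sum_bounded_above[of Basis "\<lambda>i. \<bar>z \<bullet> i\<bar>" h] assms by (auto intro: order_trans)

text \<open>Jensen bounds the error at \<open>x\<close> by the mean of
  \<open>\<bar>u y - u x\<bar> powr p\<close> over the cell, and after Fubini the translation
  estimate applies to each shift \<open>y - x\<close>. The power \<open>h powr p\<close> is due to
  the length of the shifts, the factor \<open>2 ^ DIM('a)\<close> to the volume of a cube that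
  contains all of them.\<close>

lemma grid_avg_error:
  fixes u :: "'a::euclidean_space \<Rightarrow> real"
  assumes u: "u \<in> test_functions \<Omega>" and \<Omega>: "bounded \<Omega>" and h: "0 < h" and p: "1 < p"
  shows "integrable lborel (\<lambda>x. \<bar>u x - grid_avg h u x\<bar> powr p)"
    "(\<integral>x. \<bar>u x - grid_avg h u x\<bar> powr p \<partial>lborel)
      \<le> 2 ^ DIM('a) * real DIM('a) powr p * h powr p * (\<integral>x. norm (grad u x) powr p \<partial>lborel)"
proof -
  note [measurable] = test_functions_measurable[OF u]
  note int = test_functions_integrable[OF u \<Omega>]
  define n where "n = DIM('a)"
  define C where "C = cbox (- (\<Sum>i\<in>Basis. h *\<^sub>R i)) (\<Sum>i\<in>Basis. h *\<^sub>R i :: 'a)"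
  define G where "G = (\<integral>x. norm (grad u x) powr p \<partial>lborel)"
  have G0: "0 \<le> G" by (simp add: G_def)
  have C: "z \<in> C \<longleftrightarrow> (\<forall>i\<in>Basis. \<bar>z \<bullet> i\<bar> \<le> h)" for z
    by (auto simp: C_def mem_box abs_le_iff)
  have [measurable]: "C \<in> sets borel" by (simp add: C_def)
  have mC: "emeasure lborel C = ennreal ((2 * h) ^ n)"
  proof -
    let ?s = "\<Sum>i\<in>Basis. h *\<^sub>R i :: 'a"
    have "emeasure lborel C = ennreal (\<Prod>b\<in>Basis. (?s - - ?s) \<bullet> b)"
      unfolding C_def by (rule emeasure_lborel_cbox) (use h in simp)
    also have "(\<Prod>b\<in>Basis. (?s - - ?s) \<bullet> b) = (\<Prod>b\<in>(Basis :: 'a set). 2 * h)"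
      by (rule prod.cong) (simp_all add: inner_add_left)
    finally show ?thesis by (simp add: n_def)
  qed
  \<comment> \<open>The set of shifts within a cell depends on where \<open>x\<close> lies in it.
    Enlarging it to the fixed cube \<open>C\<close> of side \<open>2 * h\<close> decouples the two
    variables.\<close>
  define H where "H x z = indicator C z * \<bar>u (x + z) - u x\<bar> powr p / h ^ n" for x z
  have Hm[measurable]: "case_prod H \<in> borel_measurable (borel \<Otimes>\<^sub>M borel)"
    unfolding H_def by measurable
  obtain B where B: "0 < B" "\<And>x. \<bar>u x\<bar> \<le> B"
    by (rule test_functions_bounded[OF u]) blast
  have Bp: "\<bar>u y - u x\<bar> powr p \<le> (2 * B) powr p" for x y
    using B(2)[of x] B(2)[of y] p by (intro powr_mono2) auto
  have Hint: "integrable lborel (H x)" for x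
    by (rule integrable_bounded_support[of _ C "(2 * B) powr p / h ^ n"])
      (use Bp h in \<open>auto simp: H_def C_def indicator_def divide_right_mono\<close>)
  have pw: "ennreal (\<bar>u x - grid_avg h u x\<bar> powr p) \<le> (\<integral>\<^sup>+z. ennreal (H x z) \<partial>lborel)" for x
  proof -
    note k = grid_kernel[OF h, of x]
    have kint: "integrable lborel (\<lambda>y. grid_kernel h x y * (u y - u x))"
      using grid_kernel_mult_integrable[OF int(1), of h x] k(1) by (simp add: right_diff_distrib)
    have avg: "(\<integral>y. grid_kernel h x y * (u y - u x) \<partial>lborel) = grid_avg h u x - u x"
      using grid_kernel_mult_integrable[OF int(1), of h x] k(1,2) by (simp add: right_diff_distrib grid_avg_def)
    have Hint': "integrable lborel (\<lambda>y. H x (y - x))"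
      using integrable_lborel_translation[OF Hint, of x "- x"] by simp
    have kH: "grid_kernel h x y * \<bar>u y - u x\<bar> powr p \<le> H x (y - x)" for y
      using grid_cell_diff[OF h, of y x] h
      by (auto simp: grid_kernel_def H_def C n_def indicator_def divide_right_mono less_imp_le)
    have kint2: "integrable lborel (\<lambda>y. grid_kernel h x y * \<bar>u y - u x\<bar> powr p)"
    proof (rule Bochner_Integration.integrable_bound[OF Hint'])
      show "AE y in lborel. norm (grid_kernel h x y * \<bar>u y - u x\<bar> powr p) \<le> norm (H x (y - x))"
        using kH k(3) by (auto simp: abs_mult intro: order_trans[OF _ abs_ge_self])
    qed (simp add: grid_kernel_def)
    have "\<bar>\<integral>y. grid_kernel h x y * (u y - u x) \<partial>lborel\<bar> powr p \<le> (\<integral>y. grid_kernel h x y * \<bar>u y - u x\<bar> powr p \<partial>lborel)"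
      by (rule integral_jensen_powr[OF p k kint kint2])
    also have "\<dots> \<le> (\<integral>y. H x (y - x) \<partial>lborel)"
      by (rule integral_mono[OF kint2 Hint' kH])
    also have "\<dots> = (\<integral>z. H x z \<partial>lborel)"
      using integral_lborel_translation[of "H x" "- x"] borel_measurable_integrable[OF Hint[of x]] by simp
    finally have "\<bar>grid_avg h u x - u x\<bar> powr p \<le> (\<integral>z. H x z \<partial>lborel)" unfolding avg .
    moreover have "(\<integral>\<^sup>+z. ennreal (H x z) \<partial>lborel) = ennreal (\<integral>z. H x z \<partial>lborel)"
      by (rule nn_integral_eq_integral[OF Hint]) (use h in \<open>simp add: H_def\<close>)
    ultimately show ?thesis by (simp add: abs_minus_commute ennreal_leI)
  qed
  have inner: "(\<integral>\<^sup>+x. ennreal (H x z) \<partial>lborel) \<le> ennreal ((real n * h) powr p * G / h ^ n) * indicator C z" for z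
  proof (cases "z \<in> C")
    case True
    have int': "integrable lborel (\<lambda>x. \<bar>u (x + z) - u x\<bar> powr p)"
    proof (rule Bochner_Integration.integrable_bound)
      show "integrable lborel (\<lambda>x. 2 powr p * (\<bar>u (x + z)\<bar> powr p + \<bar>u x\<bar> powr p))"
        using int(3)[of p] integrable_lborel_translation[OF int(3)[of p], of z] p by (intro integrable_mult_right integrable_add) auto
      show "AE x in lborel. norm (\<bar>u (x + z) - u x\<bar> powr p) \<le> norm (2 powr p * (\<bar>u (x + z)\<bar> powr p + \<bar>u x\<bar> powr p))"
        using norm_diff_powr_le[of p "u (x + z)" "u x" for x] p by (auto intro!: AE_I2)
    qed simp
    have "(\<integral>\<^sup>+x. ennreal (H x z) \<partial>lborel) = ennreal (\<integral>x. \<bar>u (x + z) - u x\<bar> powr p / h ^ n \<partial>lborel)"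
      using True int' h by (subst nn_integral_eq_integral[symmetric]) (auto simp: H_def)
    also have "\<dots> \<le> ennreal ((real n * h) powr p * G / h ^ n)"
    proof -
      have "(\<integral>x. \<bar>u (x + z) - u x\<bar> powr p \<partial>lborel) \<le> norm z powr p * G"
        unfolding G_def by (rule test_function_translation_estimate[OF u \<Omega> p])
      also have "\<dots> \<le> (real n * h) powr p * G"
        using norm_le_DIM[of z h] True C p G0 by (intro mult_right_mono powr_mono2) (auto simp: n_def)
      finally show ?thesis using h by (intro ennreal_leI) (simp add: divide_right_mono)
    qed
    finally show ?thesis using True by simp
  qed (simp add: H_def)
  have "(\<integral>\<^sup>+x. ennreal (\<bar>u x - grid_avg h u x\<bar> powr p) \<partial>lborel) \<le> (\<integral>\<^sup>+x. (\<integral>\<^sup>+z. ennreal (H x z) \<partial>lborel) \<partial>lborel)"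
    by (rule nn_integral_mono) (rule pw)
  also have "\<dots> = (\<integral>\<^sup>+z. (\<integral>\<^sup>+x. ennreal (H x z) \<partial>lborel) \<partial>lborel)"
    by (rule lborel_pair.Fubini'[symmetric]) (use Hm in measurable)
  also have "\<dots> \<le> (\<integral>\<^sup>+z. ennreal ((real n * h) powr p * G / h ^ n) * indicator C z \<partial>lborel)"
    by (rule nn_integral_mono) (rule inner)
  also have "\<dots> = ennreal ((real n * h) powr p * G / h ^ n) * ennreal ((2 * h) ^ n)"
    by (subst nn_integral_cmult_indicator) (simp_all add: mC)
  also have "\<dots> = ennreal ((real n * h) powr p * G / h ^ n * (2 * h) ^ n)"
    using h G0 by (subst ennreal_mult) auto
  also have "(real n * h) powr p * G / h ^ n * (2 * h) ^ n = 2 ^ n * real n powr p * h powr p * G"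
    using h by (simp add: powr_mult power_mult_distrib)
  finally have le: "(\<integral>\<^sup>+x. ennreal (\<bar>u x - grid_avg h u x\<bar> powr p) \<partial>lborel) \<le> ennreal (2 ^ n * real n powr p * h powr p * G)" .
  then show "integrable lborel (\<lambda>x. \<bar>u x - grid_avg h u x\<bar> powr p)"
    by (intro integrableI_nonneg) (auto intro: le_less_trans)
  show "(\<integral>x. \<bar>u x - grid_avg h u x\<bar> powr p \<partial>lborel) \<le> 2 ^ DIM('a) * real DIM('a) powr p * h powr p * (\<integral>x. norm (grad u x) powr p \<partial>lborel)"
    using integral_real_bounded[OF _ le] G0 unfolding n_def G_def by simp
qed

section \<open>Subcritical Sobolev inequality and Poincare inequality\<close>

lemma powr_dyadic_sum:
  fixes v s :: real
  assumes "0 \<le> v" "0 < s" "v \<le> 2 ^ n"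
  shows "v powr s \<le> 1 + (\<Sum>k<n. 2 powr (s * real (Suc k)) * of_bool (2 ^ k \<le> v))"
  using assms(3)
proof (induction n)
  case 0
  then show ?case using powr_mono2[of s v 1] assms by simp
next
  case (Suc n)
  show ?case
  proof (cases "2 ^ n \<le> v")
    case True
    \<comment> \<open>Only the highest dyadic level that is reached matters: its term alone bounds
      the whole power.\<close>
    have "v powr s \<le> (2 ^ Suc n) powr s" using Suc.prems assms by (intro powr_mono2) auto
    also have "\<dots> = 2 powr (s * real (Suc n))"
      by (simp only: powr_realpow[symmetric, of 2] powr_powr) (simp add: mult.commute)
    also have "\<dots> \<le> 1 + (\<Sum>k<Suc n. 2 powr (s * real (Suc k)) * of_bool (2 ^ k \<le> v))"
      using True by (simp add: add_increasing sum_nonneg)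
    finally show ?thesis .
  next
    case False
    then show ?thesis using Suc.IH by simp
  qed
qed

text \<open>Beyond 1 the constant \<open>V\<close> may be multiplied by
  \<open>K powr \<alpha>\<close> as well; division then leaves
  \<open>K powr (1 - \<alpha>) \<le> V + C\<close>.\<close>

lemma powr_sublinear_bound:
  fixes K V C \<alpha> :: real
  assumes "0 < \<alpha>" "\<alpha> < 1" "0 \<le> V" "0 \<le> C" "0 \<le> K" "K \<le> V + C * K powr \<alpha>"
  shows "K \<le> max 1 ((V + C) powr (1 / (1 - \<alpha>)))"
proof (cases "K \<le> 1")
  case False
  then have K: "1 < K" by simp
  have K1: "1 \<le> K powr \<alpha>" using K assms by (intro ge_one_powr_ge_zero) auto
  have "K \<le> V + C * K powr \<alpha>" by fact
  also have "\<dots> \<le> V * K powr \<alpha> + C * K powr \<alpha>"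
    using mult_left_mono[OF K1 assms(3)] by simp
  finally have "K \<le> (V + C) * K powr \<alpha>" by (simp add: algebra_simps)
  then have "K powr (1 - \<alpha>) \<le> V + C" using K by (simp add: powr_diff field_simps)
  then have "(K powr (1 - \<alpha>)) powr (1 / (1 - \<alpha>)) \<le> (V + C) powr (1 / (1 - \<alpha>))"
    using assms by (intro powr_mono2) auto
  then show ?thesis using K assms by (simp add: powr_powr)
qed simp

text \<open>Chebyshev's inequality for the error of the grid average. With a mesh so coarse that the
  average never exceeds \<open>t / 2\<close>, the error is at least \<open>t / 2\<close> wherever
  \<open>\<bar>u\<bar>\<close> reaches \<open>t\<close>.\<close>

lemma level_set_estimate:
  fixes u :: "'a::euclidean_space \<Rightarrow> real"
  assumes u: "u \<in> test_functions \<Omega>" and \<Omega>: "bounded \<Omega>" and p: "1 < p" and s: "1 < s"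
    and G: "(\<integral>x. norm (grad u x) powr p \<partial>lborel) \<le> 1" and t: "0 < t"
  defines "K \<equiv> (\<integral>x. \<bar>u x\<bar> powr s \<partial>lborel)"
  assumes K: "0 < K"
  shows "measure lborel {x. t \<le> \<bar>u x\<bar>} \<le> 2 ^ DIM('a) * real DIM('a) powr p *
    (2 powr (p + s * p / real DIM('a)) * K powr (p / real DIM('a)) * t powr - (p + s * p / real DIM('a)))"
proof -
  note [measurable] = test_functions_measurable[OF u]
  note int = test_functions_integrable[OF u \<Omega>]
  define n where "n = real DIM('a)"
  have n: "0 < n" by (simp add: n_def)
  \<comment> \<open>The cell volume is chosen so that \<open>K / h ^ DIM('a)\<close>, which bounds
    the average to the power \<open>s\<close>, equals \<open>(t / 2) powr s\<close>.\<close>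
  define h where "h = (K * (2 / t) powr s) powr (1 / n)"
  have h: "0 < h" using K t by (simp add: h_def)
  have "h powr n = K * (2 / t) powr s" unfolding h_def powr_powr using K t n by simp
  then have hn: "h ^ DIM('a) = K * (2 / t) powr s" using powr_realpow[OF h, of "DIM('a)"] by (simp add: n_def)
  have avg: "\<bar>grid_avg h u x\<bar> \<le> t / 2" for x
  proof -
    have "\<bar>grid_avg h u x\<bar> powr s \<le> K / h ^ DIM('a)"
      unfolding K_def using int s by (intro grid_avg_powr_le[OF h s]) auto
    also have "\<dots> = (t / 2) powr s" unfolding hn using K t by (simp add: powr_divide)
    finally show ?thesis using powr_less_mono2[of s "t / 2" "\<bar>grid_avg h u x\<bar>"] s t by linarith
  qed
  have lt: "t / 2 \<le> \<bar>u x - grid_avg h u x\<bar>" if "t \<le> \<bar>u x\<bar>" for x using avg[of x] that by linarith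
  define D where "D = 2 ^ DIM('a) * n powr p"
  have fin: "emeasure lborel {x. t \<le> \<bar>u x\<bar>} < \<infinity>"
  proof -
    have "{x. t \<le> \<bar>u x\<bar>} \<subseteq> \<Omega>" using test_functions_zero_outside(1)[OF u] t by fastforce
    then have "bounded {x. t \<le> \<bar>u x\<bar>}" using \<Omega> bounded_subset by blast
    then show ?thesis by (rule emeasure_bounded_finite)
  qed
  have "(t / 2) powr p * measure lborel {x. t \<le> \<bar>u x\<bar>} = (\<integral>x. (t / 2) powr p * indicator {x. t \<le> \<bar>u x\<bar>} x \<partial>lborel)"
    using fin by simp
  also have "\<dots> \<le> (\<integral>x. \<bar>u x - grid_avg h u x\<bar> powr p \<partial>lborel)"
  proof (rule integral_mono')
    show "(t / 2) powr p * indicator {x. t \<le> \<bar>u x\<bar>} x \<le> \<bar>u x - grid_avg h u x\<bar> powr p" for x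
      using lt[of x] t p by (auto simp: indicator_def intro!: powr_mono2)
  qed (use grid_avg_error[OF u \<Omega> h p] in auto)
  also have "\<dots> \<le> 2 ^ DIM('a) * n powr p * h powr p * (\<integral>x. norm (grad u x) powr p \<partial>lborel)"
    unfolding n_def by (rule grid_avg_error(2)[OF u \<Omega> h p])
  also have "\<dots> \<le> D * h powr p"
    using mult_left_mono[OF G, of "D * h powr p"] by (simp add: D_def)
  also have "h powr p = K powr (p / n) * (2 / t) powr (s * p / n)"
    unfolding h_def powr_powr using K t by (simp add: powr_mult powr_powr)
  finally have "measure lborel {x. t \<le> \<bar>u x\<bar>} \<le> D * (K powr (p / n) * (2 / t) powr (s * p / n)) / (t / 2) powr p"
    using t by (simp add: field_simps)
  also have "\<dots> = D * (2 powr (p + s * p / n) * K powr (p / n) * t powr - (p + s * p / n))"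
  proof -
    have "t powr - (p + s * p / n) = 1 / (t powr p * t powr (s * p / n))"
      unfolding powr_minus_divide powr_add by simp
    moreover have "2 powr (p + s * p / n) = 2 powr p * 2 powr (s * p / n)" unfolding powr_add by simp
    ultimately show ?thesis using t by (simp add: powr_divide mult_ac)
  qed
  finally show ?thesis unfolding D_def n_def .
qed

text \<open>
  With \<open>K\<close> the integral of \<open>|u|\<^sup>s\<close>, the level set estimate sums over dyadic levels to
  \<open>K \<le> V + C K\<^bsup>p/N\<^esup>\<close>, which bounds \<open>K\<close> because \<open>p < N\<close>.
\<close>
lemma sobolev_normalized:
  fixes \<Omega> :: "'a::euclidean_space set"
  assumes \<Omega>: "bounded \<Omega>" and p: "1 < p" "p < real DIM('a)" and s: "1 < s" "s < critical_exponent (real DIM('a)) p"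
  obtains C where "0 < C" "\<And>u. u \<in> test_functions \<Omega> \<Longrightarrow> (\<integral>x. norm (grad u x) powr p \<partial>lborel) \<le> 1 \<Longrightarrow>
    (\<integral>x. \<bar>u x\<bar> powr s \<partial>lborel) \<le> C"
proof -
  define n where "n = real DIM('a)"
  have n: "0 < n" "p < n" using p by (simp_all add: n_def)
  define \<tau> where "\<tau> = p + s * p / n"
  \<comment> \<open>The inequality \<open>s < p + s * p / n\<close> says exactly that
    \<open>s\<close> is below the critical exponent. It makes the dyadic series geometric with ratio
    \<open>2 powr (s - \<tau>) < 1\<close>.\<close>
  have \<tau>: "s < \<tau>" using s(2) n by (simp add: critical_exponent_def n_def[symmetric] \<tau>_def field_simps)
  obtain R where "\<forall>x\<in>\<Omega>. norm x \<le> R" using \<Omega> unfolding bounded_iff by blast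
  then have R: "\<Omega> \<subseteq> cball 0 R" by auto
  define V where "V = measure lborel (cball (0::'a) R)"
  define q where "q = 2 powr (s - \<tau>)"
  have q: "0 < q" "q < 1" using \<tau> powr_less_mono[of "s - \<tau>" 0 2] by (simp_all add: q_def)
  define D where "D = 2 ^ DIM('a) * n powr p * 2 powr \<tau>"
  have D: "0 \<le> D" by (simp add: D_def)
  define C where "C = D * 2 powr s / (1 - q)"
  have C: "0 \<le> C" using D q by (simp add: C_def)
  show thesis
  proof (rule that)
    show "0 < max 1 ((V + C) powr (1 / (1 - p / n)))" by simp
    fix u assume u: "u \<in> test_functions \<Omega>" and G: "(\<integral>x. norm (grad u x) powr p \<partial>lborel) \<le> 1"
    note [measurable] = test_functions_measurable[OF u]
    note int = test_functions_integrable[OF u \<Omega>]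
    define K where "K = (\<integral>x. \<bar>u x\<bar> powr s \<partial>lborel)"
    have K0: "0 \<le> K" by (simp add: K_def)
    have "K \<le> V + C * K powr (p / n)"
    proof (cases "K = 0")
      case False
      with K0 have K: "0 < K" by simp
      have lev: "measure lborel {x. t \<le> \<bar>u x\<bar>} \<le> D * K powr (p / n) * t powr - \<tau>" if "0 < t" for t
        using level_set_estimate[OF u \<Omega> p(1) s(1) G that, folded K_def, folded n_def, folded \<tau>_def, OF K]
        by (simp add: D_def mult_ac)
      obtain B where B: "\<And>x. \<bar>u x\<bar> \<le> B"
        by (rule test_functions_bounded[OF u]) blast
      obtain m where m: "B < 2 ^ m" using real_arch_pow[of 2 B] by auto
      have lint: "integrable lborel (\<lambda>x. indicator {x. 2 ^ k \<le> \<bar>u x\<bar>} x :: real)" for k :: nat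
      proof -
        have "{x. 2 ^ k \<le> \<bar>u x\<bar>} \<subseteq> \<Omega>" using test_functions_zero_outside(1)[OF u]
          by (smt (verit) mem_Collect_eq subsetI zero_less_power)
        then have "bounded {x. 2 ^ k \<le> \<bar>u x\<bar>}" using \<Omega> bounded_subset by blast
        then show ?thesis by (intro integrable_real_indicator emeasure_bounded_finite) auto
      qed
      have cint: "integrable lborel (\<lambda>x. indicator (cball 0 R) x :: real)"
        by (intro integrable_real_indicator emeasure_lborel_cball_finite) auto
      have pw: "\<bar>u x\<bar> powr s \<le> indicator (cball 0 R) x + (\<Sum>k<m. 2 powr (s * real (Suc k)) * indicator {x. 2 ^ k \<le> \<bar>u x\<bar>} x)" for x
      proof (cases "x \<in> cball 0 R")
        case True
        then show ?thesis using powr_dyadic_sum[of "\<bar>u x\<bar>" s m] s m B[of x] by (simp add: indicator_def of_bool_def)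
      next
        case False
        then have "u x = 0" using R test_functions_zero_outside(1)[OF u] by blast
        then show ?thesis by (simp add: sum_nonneg)
      qed
      have "K \<le> (\<integral>x. indicator (cball 0 R) x + (\<Sum>k<m. 2 powr (s * real (Suc k)) * indicator {x. 2 ^ k \<le> \<bar>u x\<bar>} x) \<partial>lborel)"
        unfolding K_def
        by (intro integral_mono pw Bochner_Integration.integrable_add Bochner_Integration.integrable_sum integrable_mult_right cint lint int) (use s in auto)
      also have "\<dots> = V + (\<Sum>k<m. 2 powr (s * real (Suc k)) * measure lborel {x. 2 ^ k \<le> \<bar>u x\<bar>})"
      proof -
        have i: "integrable lborel (\<lambda>x. 2 powr (s * real (Suc k)) * indicator {x. 2 ^ k \<le> \<bar>u x\<bar>} x :: real)" for k
          by (intro integrable_mult_right lint)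
        show ?thesis
          unfolding Bochner_Integration.integral_add[OF cint Bochner_Integration.integrable_sum[OF i]]
            Bochner_Integration.integral_sum[OF i]
          by (simp add: V_def)
      qed
      also have "\<dots> \<le> V + (\<Sum>k<m. D * 2 powr s * K powr (p / n) * q ^ k)"
      proof (intro add_left_mono sum_mono)
        fix k
        have "2 powr (s * real (Suc k)) * measure lborel {x. 2 ^ k \<le> \<bar>u x\<bar>}
            \<le> 2 powr (s * real (Suc k)) * (D * K powr (p / n) * (2 ^ k) powr - \<tau>)"
          by (intro mult_left_mono lev) auto
        also have "\<dots> = D * K powr (p / n) * (2 powr (s * real (Suc k)) * 2 powr (real k * - \<tau>))"
          by (simp add: powr_realpow[symmetric] powr_powr)
        also have "2 powr (s * real (Suc k)) * 2 powr (real k * - \<tau>) = 2 powr (s + (s - \<tau>) * real k)"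
          by (simp add: powr_add[symmetric] algebra_simps)
        also have "\<dots> = 2 powr s * q ^ k"
          using q by (simp add: powr_add powr_powr[symmetric] q_def powr_realpow)
        finally show "2 powr (s * real (Suc k)) * measure lborel {x. 2 ^ k \<le> \<bar>u x\<bar>} \<le> D * 2 powr s * K powr (p / n) * q ^ k"
          by (simp add: mult_ac)
      qed
      also have "\<dots> = V + D * 2 powr s * K powr (p / n) * (\<Sum>k<m. q ^ k)"
        by (simp add: sum_distrib_left)
      also have "\<dots> \<le> V + D * 2 powr s * K powr (p / n) * (1 / (1 - q))"
      proof (intro add_left_mono mult_left_mono)
        have "(\<Sum>k<m. q ^ k) = (1 - q ^ m) / (1 - q)" using q by (simp add: sum_gp_strict)
        also have "\<dots> \<le> 1 / (1 - q)" using q by (intro divide_right_mono) auto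
        finally show "(\<Sum>k<m. q ^ k) \<le> 1 / (1 - q)" .
      qed (use D in auto)
      also have "\<dots> = V + C * K powr (p / n)" by (simp add: C_def)
      finally show ?thesis .
    qed (simp add: V_def)
    then show "(\<integral>x. \<bar>u x\<bar> powr s \<partial>lborel) \<le> max 1 ((V + C) powr (1 / (1 - p / n)))"
      unfolding K_def[symmetric] using p n C K0 by (intro powr_sublinear_bound) (auto simp: V_def)
  qed
qed

text \<open>Scaling: a function with positive gradient integral is normalised. If that integral is
  0, every multiple obeys the normalised bound, which forces the left side to vanish.\<close>

lemma sobolev_test_functions:
  fixes \<Omega> :: "'a::euclidean_space set"
  assumes \<Omega>: "bounded \<Omega>" and p: "1 < p" "p < real DIM('a)" and s: "1 < s" "s < critical_exponent (real DIM('a)) p"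
  obtains C where "0 < C" "\<And>u. u \<in> test_functions \<Omega> \<Longrightarrow>
    (\<integral>x. \<bar>u x\<bar> powr s \<partial>lborel) \<le> C * (\<integral>x. norm (grad u x) powr p \<partial>lborel) powr (s / p)"
proof -
  obtain C where C: "0 < C" "\<And>u. u \<in> test_functions \<Omega> \<Longrightarrow> (\<integral>x. norm (grad u x) powr p \<partial>lborel) \<le> 1 \<Longrightarrow>
    (\<integral>x. \<bar>u x\<bar> powr s \<partial>lborel) \<le> C" by (rule sobolev_normalized[OF assms]) blast
  show thesis
  proof (rule that[OF C(1)])
    fix u assume u: "u \<in> test_functions \<Omega>"
    define G where "G = (\<integral>x. norm (grad u x) powr p \<partial>lborel)"
    define K where "K = (\<integral>x. \<bar>u x\<bar> powr s \<partial>lborel)"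
    have scale: "c powr s * K \<le> C" if c: "0 < c" "c powr p * G \<le> 1" for c
    proof -
      have "(\<integral>x. norm (grad (\<lambda>x. c * u x) x) powr p \<partial>lborel) = c powr p * G"
        using c by (simp add: test_functions_cmult(2)[OF u] powr_mult G_def)
      moreover have "(\<integral>x. \<bar>c * u x\<bar> powr s \<partial>lborel) = c powr s * K"
        using c by (simp add: abs_mult powr_mult K_def)
      ultimately show ?thesis using C(2)[OF test_functions_cmult(1)[OF u, of c]] c by simp
    qed
    have "K \<le> C * G powr (s / p)"
    proof (cases "G = 0")
      case True
      have "K \<le> 0"
      proof (rule ccontr)
        assume "\<not> K \<le> 0"
        then have K: "0 < K" by simp
        \<comment> \<open>Chosen so that the scaled integral would be \<open>C + 1\<close>, above
          the bound \<open>C\<close>.\<close>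
        define c where "c = ((C + 1) / K) powr (1 / s)"
        have "c powr s = (C + 1) / K" using K C s by (simp add: c_def powr_powr)
        moreover have "0 < c" using K C by (simp add: c_def)
        ultimately show False using scale[of c] True K by simp
      qed
      then show ?thesis using True by simp
    next
      case False
      then have G: "0 < G" by (simp add: G_def order_less_le)
      define c where "c = G powr (- 1 / p)"
      have "c powr p = G powr (- 1)" unfolding c_def powr_powr using p by simp
      then have "c powr p * G = 1" using G by (simp add: powr_minus_divide)
      moreover have c: "0 < c" using G by (simp add: c_def)
      ultimately have "c powr s * K \<le> C" using scale[of c] by simp
      then have "G powr (s / p) * (c powr s * K) \<le> G powr (s / p) * C" by (intro mult_left_mono) auto
      moreover have one: "c powr s * G powr (s / p) = 1"
        unfolding c_def powr_powr using G by (simp add: powr_add[symmetric])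
      have "G powr (s / p) * (c powr s * K) = (c powr s * G powr (s / p)) * K" by (simp only: mult_ac)
      ultimately have "K \<le> G powr (s / p) * C" unfolding one by simp
      then show ?thesis by (simp only: mult.commute)
    qed
    then show "(\<integral>x. \<bar>u x\<bar> powr s \<partial>lborel) \<le> C * (\<integral>x. norm (grad u x) powr p \<partial>lborel) powr (s / p)"
      by (simp add: K_def G_def)
  qed
qed

text \<open>A shift by more than the diameter moves \<open>\<Omega>\<close> off itself, so
  \<open>u (x + z)\<close> vanishes for \<open>x\<close> in \<open>\<Omega>\<close> and the
  translation estimate bounds \<open>u\<close> itself.\<close>

lemma poincare_test_functions:
  fixes \<Omega> :: "'a::euclidean_space set"
  assumes \<Omega>: "bounded \<Omega>" and p: "1 < p"
  obtains C where "0 < C" "\<And>u. u \<in> test_functions \<Omega> \<Longrightarrow>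
    (\<integral>x. \<bar>u x\<bar> powr p \<partial>lborel) \<le> C * (\<integral>x. norm (grad u x) powr p \<partial>lborel)"
proof -
  obtain R where R: "0 < R" "\<And>x. x \<in> \<Omega> \<Longrightarrow> norm x \<le> R" using \<Omega> unfolding bounded_pos by blast
  obtain i :: 'a where i: "i \<in> Basis" using nonempty_Basis by blast
  define z where "z = (2 * R + 1) *\<^sub>R i"
  have nz: "norm z = 2 * R + 1" using i R by (simp add: z_def)
  show thesis
  proof (rule that)
    show "0 < norm z powr p" using nz R by simp
    fix u assume u: "u \<in> test_functions \<Omega>"
    note [measurable] = test_functions_measurable[OF u]
    have "(\<integral>x. \<bar>u x\<bar> powr p \<partial>lborel) \<le> (\<integral>x. \<bar>u (x + z) - u x\<bar> powr p \<partial>lborel)"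
    proof (rule integral_mono')
      show "\<bar>u x\<bar> powr p \<le> \<bar>u (x + z) - u x\<bar> powr p" for x
      proof (cases "x \<in> \<Omega>")
        case True
        have "x + z \<notin> \<Omega>"
        proof
          assume "x + z \<in> \<Omega>"
          then have "norm z \<le> 2 * R" using R(2)[OF True] R(2)[of "x + z"] norm_triangle_ineq4[of "x + z" x] by simp
          then show False using nz by simp
        qed
        then show ?thesis using test_functions_zero_outside(1)[OF u] by simp
      qed (use test_functions_zero_outside(1)[OF u] in simp)
      show "integrable lborel (\<lambda>x. \<bar>u (x + z) - u x\<bar> powr p)"
      proof (rule Bochner_Integration.integrable_bound)
        have *: "integrable lborel (\<lambda>x. \<bar>u x\<bar> powr p)" using test_functions_integrable(3)[OF u \<Omega>, of p] p by simp
        show "integrable lborel (\<lambda>x. 2 powr p * (\<bar>u (x + z)\<bar> powr p + \<bar>u x\<bar> powr p))"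
          using * integrable_lborel_translation[OF *, of z] by (intro integrable_mult_right integrable_add) auto
        show "AE x in lborel. norm (\<bar>u (x + z) - u x\<bar> powr p) \<le> norm (2 powr p * (\<bar>u (x + z)\<bar> powr p + \<bar>u x\<bar> powr p))"
          using norm_diff_powr_le[of p "u (x + z)" "u x" for x] p by (auto intro!: AE_I2)
      qed simp
    qed simp
    also have "\<dots> \<le> norm z powr p * (\<integral>x. norm (grad u x) powr p \<partial>lborel)"
      by (rule test_function_translation_estimate[OF u \<Omega> p])
    finally show "(\<integral>x. \<bar>u x\<bar> powr p \<partial>lborel) \<le> norm z powr p * (\<integral>x. norm (grad u x) powr p \<partial>lborel)" .
  qed
qed

section \<open>Compactness of test functions in \<open>L^p\<close>\<close>

definition grid_point :: "real \<Rightarrow> ('a::euclidean_space \<Rightarrow> int) \<Rightarrow> 'a" where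
  "grid_point h k = (\<Sum>i\<in>Basis. (of_int (k i) * h) *\<^sub>R i)"

lemma countable_grid_points: "countable (grid_point h ` (Basis \<rightarrow>\<^sub>E (UNIV :: int set)) :: 'a::euclidean_space set)"
  by (intro countable_image countable_PiE) auto

lemma grid_cell_grid_point:
  fixes x :: "'a::euclidean_space"
  assumes h: "0 < h"
  obtains y where "y \<in> grid_point h ` (Basis \<rightarrow>\<^sub>E UNIV)" "grid_cell h x = grid_cell h y"
proof
  let ?k = "restrict (\<lambda>i. \<lfloor>(x \<bullet> i) / h\<rfloor>) Basis"
  show "grid_point h ?k \<in> grid_point h ` (Basis \<rightarrow>\<^sub>E UNIV)" by auto
  show "grid_cell h x = grid_cell h (grid_point h ?k)"
    using h by (auto simp: grid_cell_def grid_point_def inner_sum_left inner_Basis if_distrib cong: if_cong)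
qed

lemma diagonal_convergent_subsequence:
  fixes F :: "nat \<Rightarrow> nat \<Rightarrow> real"
  assumes "\<And>j. \<exists>b. \<forall>n. \<bar>F n j\<bar> \<le> b"
  obtains r :: "nat \<Rightarrow> nat" where "strict_mono r" "\<And>j. convergent (\<lambda>n. F (r n) j)"
proof -
  interpret subseqs "\<lambda>j s. convergent (\<lambda>n. F (s n) j)"
  proof
    fix j and s :: "nat \<Rightarrow> nat"
    obtain b where b: "\<And>n. \<bar>F n j\<bar> \<le> b" using assms by blast
    have "bounded (range (\<lambda>n. F (s n) j))" using b by (auto simp: bounded_iff)
    then obtain l r where "strict_mono r" "((\<lambda>n. F (s n) j) \<circ> r) \<longlonglongrightarrow> l"
      using bounded_imp_convergent_subsequence by blast
    then show "\<exists>r'. strict_mono r' \<and> convergent (\<lambda>n. F ((s \<circ> r') n) j)"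
      by (auto simp: o_def convergent_def)
  qed
  show thesis
  proof (rule that[OF subseq_diagseq])
    fix j
    have "convergent (\<lambda>n. F ((diagseq \<circ> ((+) (Suc j))) n) j)"
    proof (rule diagseq_holds)
      fix r s :: "nat \<Rightarrow> nat" and n assume "strict_mono r" "convergent (\<lambda>i. F (s i) n)"
      then show "convergent (\<lambda>i. F ((s \<circ> r) i) n)"
        unfolding convergent_def using LIMSEQ_subseq_LIMSEQ by (force simp: o_def)
    qed
    then have "convergent (\<lambda>n. F (diagseq (n + Suc j)) j)" by (simp add: o_def add.commute)
    then obtain l where "(\<lambda>n. F (diagseq (n + Suc j)) j) \<longlonglongrightarrow> l" unfolding convergent_def by blast
    then have "(\<lambda>n. F (diagseq n) j) \<longlonglongrightarrow> l" by (rule LIMSEQ_offset[where f = "\<lambda>n. F (diagseq n) j"])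
    then show "convergent (\<lambda>n. F (diagseq n) j)" unfolding convergent_def by blast
  qed
qed

lemma grid_avg_zero_outside:
  fixes u :: "'a::euclidean_space \<Rightarrow> real"
  assumes h: "0 < h" "h \<le> 1" and u: "\<And>x. x \<notin> cball 0 R \<Longrightarrow> u x = 0" and x: "x \<notin> cball 0 (R + real DIM('a))"
  shows "grid_avg h u x = 0"
proof -
  have "grid_kernel h x y * u y = 0" for y
  proof (cases "y \<in> grid_cell h x")
    case True
    then have "norm (y - x) \<le> real DIM('a) * 1"
      using grid_cell_diff[OF h(1) True] h(2) by (intro norm_le_DIM) force
    then have "y \<notin> cball 0 R" using x norm_triangle_ineq4[of y "y - x"] by simp
    then show ?thesis using u by simp
  qed (simp add: grid_kernel_def)
  then have "(\<lambda>y. grid_kernel h x y * u y) = (\<lambda>y. 0)" by (rule ext)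
  then show ?thesis unfolding grid_avg_def by simp
qed

text \<open>
  The grid averages of a bounded sequence converge along a diagonal subsequence, since there are
  only countably many cells; \<open>grid_avg_error\<close> controls the rest uniformly.
\<close>
lemma rellich_test_functions:
  fixes \<Omega> :: "'a::euclidean_space set" and u :: "nat \<Rightarrow> 'a \<Rightarrow> real"
  assumes \<Omega>: "bounded \<Omega>" and p: "1 < p"
    and u: "\<And>n. u n \<in> test_functions \<Omega>" and A: "\<And>n. (\<integral>x. norm (grad (u n) x) powr p \<partial>lborel) \<le> A"
  obtains r :: "nat \<Rightarrow> nat" where "strict_mono r"
    "\<And>\<epsilon>. 0 < \<epsilon> \<Longrightarrow> \<exists>n0. \<forall>m\<ge>n0. \<forall>n\<ge>n0. (\<integral>x. \<bar>u (r m) x - u (r n) x\<bar> powr p \<partial>lborel) \<le> \<epsilon>"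
proof -
  note [measurable] = test_functions_measurable[OF u]
  note int = test_functions_integrable[OF u \<Omega>]
  have intp: "integrable lborel (\<lambda>x. \<bar>u n x\<bar> powr p)" for n using int(3)[of p] p by simp
  obtain R where R: "\<forall>x\<in>\<Omega>. norm x \<le> R" using \<Omega> unfolding bounded_iff by blast
  have uR: "u n x = 0" if "x \<notin> cball 0 R" for n x
    using that R test_functions_zero_outside(1)[OF u] by (metis mem_cball_0)
  define S where "S = cball (0::'a) (R + real DIM('a))"
  have A0: "0 \<le> A" using A[of 0] by (smt (verit) integral_nonneg_AE AE_I2 powr_ge_zero)
  obtain C where C: "0 < C" "\<And>u. u \<in> test_functions \<Omega> \<Longrightarrow>
    (\<integral>x. \<bar>u x\<bar> powr p \<partial>lborel) \<le> C * (\<integral>x. norm (grad u x) powr p \<partial>lborel)"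
    by (rule poincare_test_functions[OF \<Omega> p]) blast
  have up: "(\<integral>x. \<bar>u n x\<bar> powr p \<partial>lborel) \<le> C * A" for n
    using order_trans[OF C(2)[OF u[of n]] mult_left_mono[OF A[of n], of C]] C(1) by simp
  have avg_bound: "\<bar>grid_avg h (u n) x\<bar> \<le> (C * A / h ^ DIM('a)) powr (1 / p)" if h: "0 < h" for h n x
  proof -
    have "\<bar>grid_avg h (u n) x\<bar> powr p \<le> (\<integral>x. \<bar>u n x\<bar> powr p \<partial>lborel) / h ^ DIM('a)"
      by (intro grid_avg_powr_le[OF h p] int intp)
    also have "\<dots> \<le> C * A / h ^ DIM('a)" using h up by (intro divide_right_mono) auto
    finally have "(\<bar>grid_avg h (u n) x\<bar> powr p) powr (1 / p) \<le> (C * A / h ^ DIM('a)) powr (1 / p)"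
      using p by (intro powr_mono2) auto
    then show ?thesis using p by (simp add: powr_powr)
  qed
  define H where "H k = 1 / real (Suc k)" for k
  have H: "0 < H k" "H k \<le> 1" for k by (simp_all add: H_def)
  define X where "X k = from_nat_into (grid_point (H k) ` (Basis \<rightarrow>\<^sub>E (UNIV :: int set)) :: 'a set)" for k
  \<comment> \<open>The single index \<open>j\<close> runs over all pairs of a mesh
    \<open>H k\<close> and a cell of that mesh, so one diagonal sequence makes all averages
    converge.\<close>
  define F where "F n j = grid_avg (H (fst (prod_decode j))) (u n) (X (fst (prod_decode j)) (snd (prod_decode j)))" for n j
  have "\<exists>b. \<forall>n. \<bar>F n j\<bar> \<le> b" for j unfolding F_def using avg_bound[OF H(1)] by blast
  then obtain r where r: "strict_mono r" and conv: "\<And>j. convergent (\<lambda>n. F (r n) j)"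
    using diagonal_convergent_subsequence by blast
  have conv': "convergent (\<lambda>n. grid_avg (H k) (u (r n)) x)" for k x
  proof -
    obtain y where y: "y \<in> grid_point (H k) ` (Basis \<rightarrow>\<^sub>E UNIV)" "grid_cell (H k) x = grid_cell (H k) y"
      using grid_cell_grid_point[OF H(1)] by blast
    then obtain l where "y = X k l" unfolding X_def using from_nat_into_surj[OF countable_grid_points] by metis
    then have "grid_avg (H k) (u (r n)) x = F (r n) (prod_encode (k, l))" for n
      using y(2) by (simp add: F_def grid_avg_def grid_kernel_def)
    then show ?thesis using conv by simp
  qed
  define L where "L k x = lim (\<lambda>n. grid_avg (H k) (u (r n)) x)" for k x
  have L: "(\<lambda>n. grid_avg (H k) (u (r n)) x) \<longlonglongrightarrow> L k x" for k x
    using conv' by (simp add: L_def convergent_LIMSEQ_iff)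
  have [measurable]: "L k \<in> borel_measurable borel" for k
    by (rule borel_measurable_LIMSEQ_real[OF L]) simp
  have avg0: "grid_avg (H k) (u n) x = 0" if "x \<notin> S" for k n x
    by (rule grid_avg_zero_outside[OF H uR]) (use that in \<open>simp_all add: S_def\<close>)
  have L0: "L k x = 0" if "x \<notin> S" for k x
    using L[of k x] avg0[OF that] by (simp add: LIMSEQ_const_iff)
  define b where "b k = (C * A / H k ^ DIM('a)) powr (1 / p)" for k
  have Lb: "\<bar>L k x\<bar> \<le> b k" for k x
    using L[of k x] avg_bound[OF H(1)] unfolding b_def by (intro LIMSEQ_le_const2[OF tendsto_rabs]) auto
  have diffb: "\<bar>grid_avg (H k) (u n) x - L k x\<bar> powr p \<le> (2 * b k) powr p * indicator S x" for k n x
  proof (cases "x \<in> S")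
    case True
    have "\<bar>grid_avg (H k) (u n) x - L k x\<bar> \<le> 2 * b k"
      using avg_bound[OF H(1)[of k], of n x] Lb[of k x] unfolding b_def by linarith
    then show ?thesis using True p by (auto intro: powr_mono2)
  next
    case False
    then show ?thesis using L0 avg0 by simp
  qed
  have dom: "integrable lborel (\<lambda>x. (2 * b k) powr p * indicator S x)" for k
    by (rule integrable_bounded_indicator) (auto simp: S_def)
  have dint: "integrable lborel (\<lambda>x. \<bar>grid_avg (H k) (u n) x - L k x\<bar> powr p)" for k n
  proof (rule Bochner_Integration.integrable_bound[OF dom])
    show "AE x in lborel. norm (\<bar>grid_avg (H k) (u n) x - L k x\<bar> powr p) \<le> norm ((2 * b k) powr p * indicator S x)"
      using diffb by (auto intro!: AE_I2 intro: order_trans[OF _ abs_ge_self])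
  qed simp
  have dlim: "(\<lambda>n. \<integral>x. \<bar>grid_avg (H k) (u (r n)) x - L k x\<bar> powr p \<partial>lborel) \<longlonglongrightarrow> 0" for k
  proof -
    have "(\<lambda>n. \<integral>x. \<bar>grid_avg (H k) (u (r n)) x - L k x\<bar> powr p \<partial>lborel) \<longlonglongrightarrow> (\<integral>x. 0 \<partial>(lborel :: 'a measure))"
    proof (rule integral_dominated_convergence[OF _ _ dom[of k]])
      have "(\<lambda>n. \<bar>grid_avg (H k) (u (r n)) x - L k x\<bar> powr p) \<longlonglongrightarrow> \<bar>L k x - L k x\<bar> powr p" for x
        using p by (intro tendsto_powr' tendsto_rabs tendsto_diff L tendsto_const) auto
      then show "AE x in lborel. (\<lambda>n. \<bar>grid_avg (H k) (u (r n)) x - L k x\<bar> powr p) \<longlonglongrightarrow> 0" by simp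
    qed (use diffb in auto)
    then show ?thesis by simp
  qed
  define E where "E k = 2 ^ DIM('a) * real DIM('a) powr p * H k powr p * A" for k
  have err: "(\<integral>x. \<bar>u n x - grid_avg (H k) (u n) x\<bar> powr p \<partial>lborel) \<le> E k" for n k
    unfolding E_def
    by (rule order_trans[OF grid_avg_error(2)[OF u \<Omega> H(1) p] mult_left_mono[OF A]]) simp
  note errint = grid_avg_error(1)[OF u \<Omega> H(1) p]
  have Elim: "E \<longlonglongrightarrow> 0"
  proof -
    have "(\<lambda>k. H k powr p) \<longlonglongrightarrow> 0 powr p" unfolding H_def using p LIMSEQ_inverse_real_of_nat
      by (intro tendsto_powr' tendsto_const) (auto simp: inverse_eq_divide)
    then have "(\<lambda>k. 2 ^ DIM('a) * real DIM('a) powr p * H k powr p * A) \<longlonglongrightarrow> 2 ^ DIM('a) * real DIM('a) powr p * 0 powr p * A"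
      by (intro tendsto_mult tendsto_const)
    then show ?thesis unfolding E_def by simp
  qed
  define c where "c = 2 powr p"
  have c: "0 < c" by (simp add: c_def)
  have split: "(\<integral>x. \<bar>u m x - u n x\<bar> powr p \<partial>lborel) \<le> c * (c * (E k + (\<integral>x. \<bar>grid_avg (H k) (u m) x - L k x\<bar> powr p \<partial>lborel))
      + c * (E k + (\<integral>x. \<bar>grid_avg (H k) (u n) x - L k x\<bar> powr p \<partial>lborel)))" for m n k
  proof -
    let ?d = "\<lambda>n x. \<bar>u n x - grid_avg (H k) (u n) x\<bar> powr p" and ?e = "\<lambda>n x. \<bar>grid_avg (H k) (u n) x - L k x\<bar> powr p"
    have tri: "\<bar>u n x - L k x\<bar> powr p \<le> c * (?d n x + ?e n x)" for n x
      using norm_add_powr_le[of p "u n x - grid_avg (H k) (u n) x" "grid_avg (H k) (u n) x - L k x"] p by (simp add: c_def)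
    have "(\<integral>x. \<bar>u m x - u n x\<bar> powr p \<partial>lborel) \<le> (\<integral>x. c * (c * (?d m x + ?e m x) + c * (?d n x + ?e n x)) \<partial>lborel)"
    proof (rule integral_mono')
      show "integrable lborel (\<lambda>x. c * (c * (?d m x + ?e m x) + c * (?d n x + ?e n x)))"
        by (intro integrable_mult_right Bochner_Integration.integrable_add dint errint)
      show "\<bar>u m x - u n x\<bar> powr p \<le> c * (c * (?d m x + ?e m x) + c * (?d n x + ?e n x))" for x
      proof -
        have "\<bar>u m x - u n x\<bar> powr p \<le> c * (\<bar>u m x - L k x\<bar> powr p + \<bar>u n x - L k x\<bar> powr p)"
          using norm_diff_powr_le[of p "u m x - L k x" "u n x - L k x"] p by (simp add: c_def)
        also have "\<dots> \<le> c * (c * (?d m x + ?e m x) + c * (?d n x + ?e n x))"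
          using c tri[of m x] tri[of n x] by (intro mult_left_mono add_mono) auto
        finally show ?thesis .
      qed
    qed (use c in simp)
    also have "\<dots> = c * (c * ((\<integral>x. ?d m x \<partial>lborel) + (\<integral>x. ?e m x \<partial>lborel)) + c * ((\<integral>x. ?d n x \<partial>lborel) + (\<integral>x. ?e n x \<partial>lborel)))"
      by (simp add: dint errint)
    also have "\<dots> \<le> c * (c * (E k + (\<integral>x. ?e m x \<partial>lborel)) + c * (E k + (\<integral>x. ?e n x \<partial>lborel)))"
      using c err by (intro mult_left_mono add_mono) auto
    finally show ?thesis .
  qed
  show thesis
  proof (rule that[OF r])
    fix \<epsilon> :: real assume \<epsilon>: "0 < \<epsilon>"
    \<comment> \<open>There are four error terms, and splitting powers of sums twice puts two
      factors \<open>c\<close> on each.\<close>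
    define \<delta> where "\<delta> = \<epsilon> / (4 * c * c)"
    have \<delta>: "0 < \<delta>" using \<epsilon> c by (simp add: \<delta>_def)
    obtain k where k: "E k \<le> \<delta>"
      using order_tendstoD(2)[OF Elim \<delta>] by (meson eventually_sequentially less_imp_le order_refl)
    obtain n0 where n0: "\<And>n. n \<ge> n0 \<Longrightarrow> (\<integral>x. \<bar>grid_avg (H k) (u (r n)) x - L k x\<bar> powr p \<partial>lborel) \<le> \<delta>"
      using order_tendstoD(2)[OF dlim \<delta>] by (meson eventually_sequentially less_imp_le)
    show "\<exists>n0. \<forall>m\<ge>n0. \<forall>n\<ge>n0. (\<integral>x. \<bar>u (r m) x - u (r n) x\<bar> powr p \<partial>lborel) \<le> \<epsilon>"
    proof (intro exI[of _ n0] allI impI)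
      fix m n assume "n0 \<le> m" "n0 \<le> n"
      then have "c * (c * (E k + (\<integral>x. \<bar>grid_avg (H k) (u (r m)) x - L k x\<bar> powr p \<partial>lborel))
        + c * (E k + (\<integral>x. \<bar>grid_avg (H k) (u (r n)) x - L k x\<bar> powr p \<partial>lborel))) \<le> c * (c * (\<delta> + \<delta>) + c * (\<delta> + \<delta>))"
        using c k n0 by (intro mult_left_mono add_mono) auto
      also have "\<dots> = \<epsilon>" using c by (simp add: \<delta>_def field_simps)
      finally show "(\<integral>x. \<bar>u (r m) x - u (r n) x\<bar> powr p \<partial>lborel) \<le> \<epsilon>"
        using split[of "r m" "r n" k] by linarith
    qed
  qed
qed

section \<open>Weak gradients and measure theory\<close>

text \<open>Test functions live on the whole space and are handled with \<open>lborel\<close>,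
  whereas the function spaces refer to \<open>lebesgue_on \<Omega>\<close>. This is the passage
  between the two.\<close>

lemma lebesgue_on_borel:
  fixes g :: "'a::euclidean_space \<Rightarrow> 'b::euclidean_space"
  assumes \<Omega>: "\<Omega> \<in> sets borel" and g: "g \<in> borel_measurable borel" and z: "\<And>x. x \<notin> \<Omega> \<Longrightarrow> g x = 0"
  shows "integral\<^sup>L (lebesgue_on \<Omega>) g = integral\<^sup>L lborel g" "integrable (lebesgue_on \<Omega>) g \<longleftrightarrow> integrable lborel g"
proof -
  have eq: "(\<lambda>x. indicator \<Omega> x *\<^sub>R g x) = g" using z by (auto simp: indicator_def fun_eq_iff)
  have m: "\<Omega> \<inter> space lebesgue \<in> sets lebesgue" using \<Omega> by simp
  have g': "g \<in> borel_measurable lborel" using g by simp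
  show "integral\<^sup>L (lebesgue_on \<Omega>) g = integral\<^sup>L lborel g"
    unfolding integral_restrict_space[OF m] eq by (rule integral_completion[OF g'])
  show "integrable (lebesgue_on \<Omega>) g \<longleftrightarrow> integrable lborel g"
    unfolding integrable_restrict_space[OF m] eq by (rule integrable_completion[OF g'])
qed

section \<open>Uniqueness of weak gradients\<close>

lemma AE_zero_if_box_integrals_zero:
  fixes g :: "'a::euclidean_space \<Rightarrow> real"
  assumes g: "integrable lebesgue g" and tot: "(\<integral>x. g x \<partial>lebesgue) = 0"
    and box: "\<And>a b. (\<integral>x. indicator (box a b) x * g x \<partial>lebesgue) = 0"
  shows "AE x in lebesgue. g x = 0"
proof -
  obtain f where f[measurable]: "f \<in> borel_measurable lborel" and ae: "AE x in lborel. g x = f x"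
    using completion_ex_borel_measurable_real[OF borel_measurable_integrable[OF g]] by blast
  have ae': "AE x in lebesgue. g x = f x" using AE_completion[OF ae] .
  have eq: "(\<integral>x. indicator A x * g x \<partial>lebesgue) = (\<integral>x. indicator A x * f x \<partial>lborel)" if [measurable]: "A \<in> sets borel" for A
  proof -
    have m: "(\<lambda>x. indicator A x * f x) \<in> borel_measurable lborel" by measurable
    have "(\<integral>x. indicator A x * g x \<partial>lebesgue) = (\<integral>x. indicator A x * f x \<partial>lebesgue)"
    proof (rule integral_cong_AE)
      have [measurable]: "A \<in> sets lebesgue" using that by simp
      have [measurable]: "g \<in> borel_measurable lebesgue" "f \<in> borel_measurable lebesgue"
        using g f by (auto intro: measurable_completion)
      show "(\<lambda>x. indicator A x * g x) \<in> borel_measurable lebesgue" "(\<lambda>x. indicator A x * f x) \<in> borel_measurable lebesgue"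
        by measurable
      show "AE x in lebesgue. indicator A x * g x = indicator A x * f x" using ae' by eventually_elim simp
    qed
    then show ?thesis using integral_completion[OF m] by simp
  qed
  have fint: "integrable lborel f"
  proof -
    have "integrable lebesgue f" by (rule integrable_cong_AE_imp[OF g measurable_completion[OF f] ae'])
    then show ?thesis using integrable_completion[OF f] by simp
  qed
  have Aint: "integrable lborel (\<lambda>x. indicator A x * f x)" if "A \<in> sets borel" for A
    using integrable_mult_indicator[of A lborel f] that fint by simp
  have ftot: "(\<integral>x. f x \<partial>lborel) = 0" using eq[of UNIV] tot by simp
  have "(\<integral>x. indicator A x * f x \<partial>lborel) = 0" if A: "A \<in> sets borel" for A
  proof -
    let ?G = "range (\<lambda>(a, b). box a b :: 'a set)"
    have sig: "sets (borel :: 'a measure) = sigma_sets UNIV ?G" by (subst borel_eq_box) simp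
    show ?thesis
    \<comment> \<open>The sets over which the integral vanishes form a Dynkin system, where
      complements use the vanishing total integral. Boxes are an intersection-stable generator of
      the Borel sets.\<close>
    proof (rule sigma_sets_induct_disjoint[where G = ?G and \<Omega> = UNIV and P = "\<lambda>A. (\<integral>x. indicator A x * f x \<partial>lborel) = 0"])
      show "Int_stable ?G" by (auto simp: Int_stable_def box_Int_box)
      show "A \<in> sigma_sets UNIV ?G" using A sig by simp
      show "(\<integral>x. indicator A x * f x \<partial>lborel) = 0" if "A \<in> ?G" for A using that eq box by auto
      show "(\<integral>x. indicator (UNIV - A) x * f x \<partial>lborel) = 0"
        if "A \<in> sigma_sets UNIV ?G" "(\<integral>x. indicator A x * f x \<partial>lborel) = 0" for A
      proof -
        have "(\<lambda>x. indicator (UNIV - A) x * f x) = (\<lambda>x. f x - indicator A x * f x)" by (auto simp: indicator_def)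
        then show ?thesis using that fint Aint[of A] ftot sig by simp
      qed
      show "(\<integral>x. indicator (\<Union>i. A i) x * f x \<partial>lborel) = 0"
        if A: "disjoint_family A" "range A \<subseteq> sigma_sets UNIV ?G" "\<And>i. (\<integral>x. indicator (A i) x * f x \<partial>lborel) = 0" for A :: "nat \<Rightarrow> 'a set"
      proof -
        have Am: "A i \<in> sets borel" for i using A(2) sig by auto
        have UA: "(\<Union>i. A i) \<in> sets borel" using Am by blast
        have "(LINT x:(\<Union>i. A i)|lborel. f x) = (\<Sum>i. LINT x:A i|lborel. f x)"
        proof (rule lebesgue_integral_countable_add)
          show "i \<noteq> j \<Longrightarrow> A i \<inter> A j = {}" for i j using A(1) by (auto simp: disjoint_family_on_def)
          show "set_integrable lborel (\<Union>i. A i) f" using Aint[OF UA] by (simp add: set_integrable_def)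
        qed (use Am in simp)
        then show ?thesis using A(3) by (simp add: set_lebesgue_integral_def)
      qed
    qed auto
  qed
  then have "AE x in lborel. f x = 0"
    by (intro density_unique_real[OF fint]) (auto simp: set_lebesgue_integral_def)
  then have "AE x in lebesgue. f x = 0" by (rule AE_completion)
  with ae' show ?thesis by eventually_elim simp
qed

text \<open>An open set is a countable union of closed boxes, and their boundaries are
  negligible.\<close>

lemma AE_on_open_if_AE_on_boxes:
  assumes "open (\<Omega> :: 'a::euclidean_space set)"
    and "\<And>a b. cbox a b \<subseteq> \<Omega> \<Longrightarrow> AE x in lebesgue. x \<in> box a b \<longrightarrow> P x"
  shows "AE x in lebesgue_on \<Omega>. P x"
proof -
  obtain \<D> where \<D>: "countable \<D>" "\<D> \<subseteq> Pow \<Omega>" "\<And>X. X \<in> \<D> \<Longrightarrow> \<exists>a b. X = cbox a b" "\<Union>\<D> = \<Omega>"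
    using open_countable_Union_open_cbox[OF assms(1)] by metis
  have "AE x in lebesgue. \<forall>X\<in>\<D>. x \<in> X \<longrightarrow> P x"
  proof (rule AE_ball_countable'[OF _ \<D>(1)])
    fix X assume X: "X \<in> \<D>"
    then obtain a b where ab: "X = cbox a b" using \<D>(3) by blast
    then have "AE x in lebesgue. x \<in> box a b \<longrightarrow> P x" using X \<D>(2) assms(2) by blast
    moreover have "AE x in lebesgue. x \<notin> cbox a b - box a b"
      using negligible_frontier_interval[of a b] by (intro AE_not_in) (simp add: negligible_iff_null_sets)
    ultimately show "AE x in lebesgue. x \<in> X \<longrightarrow> P x" unfolding ab by eventually_elim auto
  qed
  then have "AE x in lebesgue. x \<in> \<Omega> \<longrightarrow> P x" by (rule AE_mp) (use \<D>(4) in auto)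
  then show ?thesis using assms(1) by (simp add: AE_restrict_space_iff)
qed

text \<open>The fundamental lemma of the calculus of variations. Bump functions are admissible in
  the identities of both gradients and converge boundedly to the indicator of a box, so every
  component of \<open>G - G'\<close> has integral 0 over each box inside the chosen one.\<close>

lemma weak_gradient_unique:
  fixes \<Omega> :: "'a::euclidean_space set"
  assumes \<Omega>: "open \<Omega>" and G: "is_weak_gradient \<Omega> u G" and G': "is_weak_gradient \<Omega> u G'"
  shows "AE x in lebesgue_on \<Omega>. G x = G' x"
proof (rule AE_on_open_if_AE_on_boxes[OF \<Omega>])
  fix c d :: 'a assume cd: "cbox c d \<subseteq> \<Omega>"
  have *: "AE x in lebesgue. indicator (box c d) x * ((G x - G' x) \<bullet> i) = 0" if i: "i \<in> Basis" for i
  proof -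
    let ?g = "\<lambda>x. indicator (box c d) x * ((G x - G' x) \<bullet> i)"
    have "set_integrable lebesgue (cbox c d) G" "set_integrable lebesgue (cbox c d) G'"
      using G G' cd unfolding is_weak_gradient_def by (metis compact_cbox)+
    then have "set_integrable lebesgue (box c d) (\<lambda>x. G x - G' x)"
      by (intro set_integral_diff set_integrable_subset[of lebesgue "cbox c d" _ "box c d"]) (auto simp: box_subset_cbox)
    then have "integrable lebesgue (\<lambda>x. (indicator (box c d) x *\<^sub>R (G x - G' x)) \<bullet> i)"
      unfolding set_integrable_def by (rule integrable_inner_left)
    then have gint: "integrable lebesgue ?g" by simp
    have sub: "(\<integral>x. indicator (box a b) x * ?g x \<partial>lebesgue) = 0" if ab: "box a b \<subseteq> box c d" for a b
    proof (cases "box a b = {}")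
      case False
      have ab': "cbox a b \<subseteq> \<Omega>"
      proof -
        have "box c d \<noteq> {}" using False ab by auto
        then show ?thesis using closure_mono[OF ab] False cd by (simp add: closure_box)
      qed
      have "(\<integral>x. bump a b k x * ?g x \<partial>lebesgue) = 0" for k
      proof -
        have tf: "bump a b k \<in> test_functions \<Omega>" by (rule bump_test_function[OF ab'])
        have val: "(\<integral>x. bump a b k x * (H x \<bullet> i) \<partial>lebesgue) = - (LINT x|lebesgue_on \<Omega>. u x * frechet_derivative (bump a b k) (at x) i)"
          if H: "is_weak_gradient \<Omega> u H" for H
        proof -
          have "(LINT x|lebesgue_on \<Omega>. u x * frechet_derivative (bump a b k) (at x) i) = - (LINT x|lebesgue_on \<Omega>. (H x \<bullet> i) * bump a b k x)"
            using H tf i unfolding is_weak_gradient_def by blast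
          moreover have "(LINT x|lebesgue_on \<Omega>. (H x \<bullet> i) * bump a b k x) = (\<integral>x. bump a b k x * (H x \<bullet> i) \<partial>lebesgue)"
            using \<Omega> test_functions_zero_outside(1)[OF tf]
            by (subst integral_restrict_space) (auto intro!: Bochner_Integration.integral_cong simp: indicator_def)
          ultimately show ?thesis by simp
        qed
        have int: "integrable lebesgue (\<lambda>x. bump a b k x * (H x \<bullet> i))" if H: "is_weak_gradient \<Omega> u H" for H
        proof -
          have "set_integrable lebesgue (cbox c d) H" using H cd unfolding is_weak_gradient_def by (metis compact_cbox)
          then have "integrable lebesgue (\<lambda>x. (indicator (cbox c d) x *\<^sub>R H x) \<bullet> i)"
            unfolding set_integrable_def by (rule integrable_inner_left)
          then have 1: "integrable lebesgue (\<lambda>x. indicator (cbox c d) x * (H x \<bullet> i))" by simp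
          have m: "bump a b k \<in> borel_measurable lebesgue" using test_functions_measurable(1)[OF tf] by (intro measurable_completion) simp
          have 2: "bump a b k x * (H x \<bullet> i) = bump a b k x * (indicator (cbox c d) x * (H x \<bullet> i))" for x
            using bump_eq_0[of x a b k] ab box_subset_cbox[of c d] by (auto simp: indicator_def)
          show ?thesis unfolding 2
          proof (rule Bochner_Integration.integrable_bound[OF 1])
            show "(\<lambda>x. bump a b k x * (indicator (cbox c d) x * (H x \<bullet> i))) \<in> borel_measurable lebesgue"
              by (rule borel_measurable_times[OF m borel_measurable_integrable[OF 1]])
            show "AE x in lebesgue. norm (bump a b k x * (indicator (cbox c d) x * (H x \<bullet> i))) \<le> norm (indicator (cbox c d) x * (H x \<bullet> i))"
              using bump_bounds[of a b k] by (intro AE_I2) (simp add: abs_mult mult_left_le_one_le)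
          qed
        qed
        have "bump a b k x * ?g x = bump a b k x * (G x \<bullet> i) - bump a b k x * (G' x \<bullet> i)" for x
          using bump_eq_0[of x a b k] ab by (auto simp: indicator_def inner_diff_left right_diff_distrib)
        then show ?thesis using int[OF G] int[OF G'] val[OF G] val[OF G'] by simp
      qed
      moreover have "(\<lambda>k. \<integral>x. bump a b k x * ?g x \<partial>lebesgue) \<longlonglongrightarrow> (\<integral>x. indicator (box a b) x * ?g x \<partial>lebesgue)"
      proof (rule integral_dominated_convergence)
        show "integrable lebesgue (\<lambda>x. norm (?g x))" using gint by (rule integrable_norm)
        show "(\<lambda>x. indicator (box a b) x * ?g x) \<in> borel_measurable lebesgue"
          by (rule borel_measurable_times[OF borel_measurable_indicator borel_measurable_integrable[OF gint]]) simp
        show "(\<lambda>x. bump a b k x * ?g x) \<in> borel_measurable lebesgue" for k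
          by (rule borel_measurable_times[OF _ borel_measurable_integrable[OF gint]])
            (use test_functions_measurable(1)[OF bump_test_function[OF ab', of k]] in \<open>simp add: measurable_completion\<close>)
        show "AE x in lebesgue. (\<lambda>k. bump a b k x * ?g x) \<longlonglongrightarrow> indicator (box a b) x * ?g x"
          by (intro AE_I2 tendsto_mult tendsto_bump tendsto_const)
        show "AE x in lebesgue. norm (bump a b k x * ?g x) \<le> norm (?g x)" for k
          using bump_bounds[of a b k] by (intro AE_I2) (simp add: abs_mult mult_left_le_one_le)
      qed
      ultimately show ?thesis by (simp add: LIMSEQ_const_iff)
    qed simp
    show ?thesis
    proof (rule AE_zero_if_box_integrals_zero[OF gint])
      show "(\<integral>x. ?g x \<partial>lebesgue) = 0"
        using sub[of c d] by (simp add: mult.assoc[symmetric] flip: indicator_inter_arith)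
      show "(\<integral>x. indicator (box a b) x * ?g x \<partial>lebesgue) = 0" for a b
      proof -
        \<comment> \<open>An arbitrary box is cut down to its intersection with
          \<open>box c d\<close>, again a box, to which \<open>sub\<close> applies.\<close>
        obtain a' b' where ab': "box a b \<inter> box c d = box a' b'" by (simp add: box_Int_box)
        have "indicator (box a b) x * ?g x = indicator (box a' b') x * ?g x" for x
          using ab' by (auto simp: indicator_def)
        then have eq: "(\<lambda>x. indicator (box a b) x * ?g x) = (\<lambda>x. indicator (box a' b') x * ?g x)" by (rule ext)
        show ?thesis unfolding eq by (rule sub) (use ab' in blast)
      qed
    qed
  qed
  have "AE x in lebesgue. \<forall>i\<in>Basis. indicator (box c d) x * ((G x - G' x) \<bullet> i) = 0"
    using * by (intro AE_finite_allI) auto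
  then show "AE x in lebesgue. x \<in> box c d \<longrightarrow> G x = G' x"
  proof (rule AE_mp, intro AE_I2 impI)
    fix x assume "\<forall>i\<in>Basis. indicator (box c d) x * ((G x - G' x) \<bullet> i) = 0" "x \<in> box c d"
    then show "G x = G' x" by (auto intro!: euclidean_eqI[where 'a='a] simp: inner_diff_left)
  qed
qed

lemma wgrad_AE_eq:
  assumes "open \<Omega>" "is_weak_gradient \<Omega> u G"
  shows "is_weak_gradient \<Omega> u (wgrad \<Omega> u)" "AE x in lebesgue_on \<Omega>. wgrad \<Omega> u x = G x"
proof -
  show 1: "is_weak_gradient \<Omega> u (wgrad \<Omega> u)" unfolding wgrad_def by (rule someI[where P = "is_weak_gradient \<Omega> u", OF assms(2)])
  show "AE x in lebesgue_on \<Omega>. wgrad \<Omega> u x = G x" by (rule weak_gradient_unique[OF assms(1) 1 assms(2)])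
qed

text \<open>The product of two test functions is a test function, so the integral of its gradient is
  0.\<close>

lemma integration_by_parts_test_functions:
  fixes \<Omega> :: "'a::euclidean_space set"
  assumes \<Omega>: "open \<Omega>" "bounded \<Omega>" and u: "u \<in> test_functions \<Omega>" and \<phi>: "\<phi> \<in> test_functions \<Omega>"
  shows "(LINT x|lebesgue_on \<Omega>. u x * (grad \<phi> x \<bullet> i)) = - (LINT x|lebesgue_on \<Omega>. (grad u x \<bullet> i) * \<phi> x)"
proof -
  note [measurable] = test_functions_measurable[OF u] test_functions_measurable[OF \<phi>]
  have \<Omega>m: "\<Omega> \<in> sets borel" using \<Omega> by simp
  obtain B where B: "0 < B" "\<And>x. \<bar>u x\<bar> \<le> B" "\<And>x. norm (grad u x) \<le> B"
    by (rule test_functions_bounded[OF u]) blast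
  note zu = test_functions_zero_outside[OF u] and z = test_functions_zero_outside[OF \<phi>]
  have i1: "integrable lborel (\<lambda>x. u x * (grad \<phi> x \<bullet> i))"
    by (rule Bochner_Integration.integrable_bound[OF integrable_mult_right[OF integrable_inner_left[OF test_functions_integrable(2)[OF \<phi> \<Omega>(2)], of i], of B]])
      (use B in \<open>auto intro!: AE_I2 mult_right_mono simp: abs_mult\<close>)
  have i2: "integrable lborel (\<lambda>x. (grad u x \<bullet> i) * \<phi> x)"
  proof (rule Bochner_Integration.integrable_bound[OF integrable_mult_right[OF test_functions_integrable(1)[OF \<phi> \<Omega>(2)], of "B * norm i"]])
    have "\<bar>grad u x \<bullet> i\<bar> \<le> B * norm i" for x
      using Cauchy_Schwarz_ineq2[of "grad u x" i] mult_right_mono[OF B(3)[of x], of "norm i"] by simp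
    then show "AE x in lborel. norm ((grad u x \<bullet> i) * \<phi> x) \<le> norm (B * norm i * \<phi> x)"
      using B(1) by (intro AE_I2) (auto simp: abs_mult intro!: mult_right_mono)
  qed simp
  have "0 = (\<integral>x. grad (\<lambda>x. u x * \<phi> x) x \<bullet> i \<partial>lborel)"
    using integral_grad_eq_0[OF test_functions_mult(1)[OF u \<phi>] \<Omega>(2)] by simp
  also have "\<dots> = (\<integral>x. u x * (grad \<phi> x \<bullet> i) + (grad u x \<bullet> i) * \<phi> x \<partial>lborel)"
    by (rule Bochner_Integration.integral_cong)
      (simp_all add: test_functions_mult(2)[OF u \<phi>] inner_add_left mult.commute[of "\<phi> _"])
  also have "\<dots> = (\<integral>x. u x * (grad \<phi> x \<bullet> i) \<partial>lborel) + (\<integral>x. (grad u x \<bullet> i) * \<phi> x \<partial>lborel)"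
    using i1 i2 by simp
  finally show ?thesis
    using zu z by (simp add: lebesgue_on_borel(1)[OF \<Omega>m])
qed

section \<open>Limit theorems for integrals\<close>

lemma fatou_bound:
  fixes g :: "nat \<Rightarrow> 'b \<Rightarrow> real"
  assumes g: "\<And>n. integrable M (g n)" "\<And>n x. x \<in> space M \<Longrightarrow> 0 \<le> g n x" "\<And>n. (\<integral>x. g n x \<partial>M) \<le> c n" "c \<longlonglongrightarrow> C"
    and h: "h \<in> borel_measurable M" "AE x in M. (\<lambda>n. g n x) \<longlonglongrightarrow> h x"
  shows "integrable M h" "(\<integral>x. h x \<partial>M) \<le> C"
proof -
  have C0: "0 \<le> C"
  proof (rule LIMSEQ_le_const[OF g(4)])
    show "\<exists>N. \<forall>n\<ge>N. 0 \<le> c n"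
      using order_trans[OF Bochner_Integration.integral_nonneg[OF g(2)] g(3)] by blast
  qed
  have h0: "AE x in M. 0 \<le> h x"
    using h(2) AE_space by eventually_elim (use g(2) in \<open>auto intro: LIMSEQ_le_const\<close>)
  have "(\<integral>\<^sup>+x. ennreal (h x) \<partial>M) = (\<integral>\<^sup>+x. liminf (\<lambda>n. ennreal (g n x)) \<partial>M)"
  proof (rule nn_integral_cong_AE)
    show "AE x in M. ennreal (h x) = liminf (\<lambda>n. ennreal (g n x))"
      using h(2) by eventually_elim (auto intro!: lim_imp_Liminf[symmetric] tendsto_ennrealI)
  qed
  also have "\<dots> \<le> liminf (\<lambda>n. \<integral>\<^sup>+x. ennreal (g n x) \<partial>M)"
    by (rule nn_integral_liminf) (use g(1) in auto)
  also have "\<dots> \<le> liminf (\<lambda>n. ennreal (c n))"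
    using g by (intro Liminf_mono always_eventually allI)
      (simp add: nn_integral_eq_integral ennreal_leI)
  also have "\<dots> = ennreal C"
    using g(4) by (intro lim_imp_Liminf tendsto_ennrealI) auto
  finally have le: "(\<integral>\<^sup>+x. ennreal (h x) \<partial>M) \<le> ennreal C" .
  show "integrable M h"
    using le h0 h(1) by (intro integrableI_nonneg) (auto intro: le_less_trans)
  show "(\<integral>x. h x \<partial>M) \<le> C" by (rule integral_real_bounded[OF C0 le])
qed

text \<open>The completeness argument for \<open>L^1\<close>: along a subsequence with successive
  distances at most \<open>(1/2) ^ k\<close> the sum of the increments is integrable, hence finite
  almost everywhere. Only the pointwise limit is extracted; \<open>H_complete\<close> adds
  convergence in the modular.\<close>

lemma L1_Cauchy_AE_subseq:
  fixes w :: "nat \<Rightarrow> 'b \<Rightarrow> 'c::euclidean_space"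
  assumes w: "\<And>n. integrable M (w n)"
    and Cauchy: "\<And>\<epsilon>. 0 < \<epsilon> \<Longrightarrow> \<exists>n0. \<forall>m\<ge>n0. \<forall>n\<ge>n0. (\<integral>x. norm (w m x - w n x) \<partial>M) \<le> \<epsilon>"
  obtains r :: "nat \<Rightarrow> nat" and l where "strict_mono r" "l \<in> borel_measurable M" "AE x in M. (\<lambda>n. w (r n) x) \<longlonglongrightarrow> l x"
proof -
  have "\<exists>N. \<forall>m\<ge>N. \<forall>n\<ge>N. (\<integral>x. norm (w m x - w n x) \<partial>M) \<le> (1/2) ^ k" for k :: nat
    by (rule Cauchy) simp
  then obtain N where N: "\<And>k m n. N k \<le> m \<Longrightarrow> N k \<le> n \<Longrightarrow> (\<integral>x. norm (w m x - w n x) \<partial>M) \<le> (1/2) ^ k"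
    by metis
  \<comment> \<open>The maximum keeps the indices strictly increasing and at the same time
    \<open>r k\<close> beyond \<open>N k\<close>.\<close>
  define r where "r = rec_nat (N 0) (\<lambda>k m. max (Suc m) (N (Suc k)))"
  have r0: "r 0 = N 0" and rS: "r (Suc k) = max (Suc (r k)) (N (Suc k))" for k by (simp_all add: r_def)
  have mono: "strict_mono r" by (simp add: strict_mono_Suc_iff rS less_max_iff_disj)
  have rN: "N k \<le> r k" for k by (cases k) (simp_all add: r0 rS)
  define d where "d k x = norm (w (r (Suc k)) x - w (r k) x)" for k x
  have dint: "integrable M (d k)" for k unfolding d_def by (intro integrable_norm Bochner_Integration.integrable_diff w)
  have dle: "(\<integral>x. d k x \<partial>M) \<le> (1/2) ^ k" for k
    unfolding d_def using rN[of k] strict_monoD[OF mono, of k "Suc k"] by (intro N) auto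
  have [measurable]: "w n \<in> borel_measurable M" "d n \<in> borel_measurable M" for n using w dint by auto
  have "(\<integral>\<^sup>+x. (\<Sum>k. ennreal (d k x)) \<partial>M) = (\<Sum>k. \<integral>\<^sup>+x. ennreal (d k x) \<partial>M)"
    by (rule nn_integral_suminf) simp
  also have "\<dots> \<le> (\<Sum>k. ennreal ((1/2) ^ k))"
  proof (rule suminf_le)
    have d0: "0 \<le> d k x" for k x by (simp add: d_def)
    show "(\<integral>\<^sup>+x. ennreal (d k x) \<partial>M) \<le> ennreal ((1/2) ^ k)" for k
      unfolding nn_integral_eq_integral[OF dint AE_I2[OF d0]] by (rule ennreal_leI[OF dle])
  qed auto
  also have "\<dots> = ennreal (\<Sum>k. (1/2) ^ k)"
    by (rule suminf_ennreal2) (auto intro: summable_geometric)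
  also have "\<dots> < \<infinity>" by simp
  finally have "(\<integral>\<^sup>+x. (\<Sum>k. ennreal (d k x)) \<partial>M) \<noteq> \<infinity>" by simp
  then have "AE x in M. (\<Sum>k. ennreal (d k x)) \<noteq> \<infinity>"
    by (intro nn_integral_PInf_AE) auto
  then have conv: "AE x in M. convergent (\<lambda>n. w (r n) x)"
  proof eventually_elim
    case (elim x)
    have "summable (\<lambda>k. d k x)"
      using elim by (intro summable_suminf_not_top) (auto simp: d_def)
    then have "summable (\<lambda>k. w (r (Suc k)) x - w (r k) x)"
      unfolding d_def by (rule summable_norm_cancel)
    then obtain s where "(\<lambda>k. w (r (Suc k)) x - w (r k) x) sums s" by (auto simp: summable_def)
    then have "(\<lambda>n. \<Sum>k<n. w (r (Suc k)) x - w (r k) x) \<longlonglongrightarrow> s" by (simp add: sums_def)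
    then have "(\<lambda>n. w (r n) x - w (r 0) x) \<longlonglongrightarrow> s" using sum_lessThan_telescope[of "\<lambda>k. w (r k) x"] by simp
    then have "(\<lambda>n. (w (r n) x - w (r 0) x) + w (r 0) x) \<longlonglongrightarrow> s + w (r 0) x" by (intro tendsto_add tendsto_const)
    then show ?case by (auto simp: convergent_def)
  qed
  show thesis
  proof (rule that[OF mono])
    show "(\<lambda>x. lim (\<lambda>n. w (r n) x)) \<in> borel_measurable M" by measurable
    show "AE x in M. (\<lambda>n. w (r n) x) \<longlonglongrightarrow> lim (\<lambda>n. w (r n) x)"
      using conv by eventually_elim (simp add: convergent_LIMSEQ_iff)
  qed
qed

text \<open>Clipping to \<open>[-H, H]\<close> reduces this to the usual dominated convergence.\<close>
lemma dominated_convergence_perturbed: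
  fixes g :: "nat \<Rightarrow> 'b \<Rightarrow> real"
  assumes gm: "\<And>n. g n \<in> borel_measurable M" "h \<in> borel_measurable M"
    and H: "integrable M H" and k: "\<And>n. integrable M (k n)" "(\<lambda>n. \<integral>x. k n x \<partial>M) \<longlonglongrightarrow> 0"
    and k0: "\<And>n x. x \<in> space M \<Longrightarrow> 0 \<le> k n x" "AE x in M. (\<lambda>n. k n x) \<longlonglongrightarrow> 0"
    and dom: "\<And>n x. x \<in> space M \<Longrightarrow> \<bar>g n x\<bar> \<le> H x + k n x" and H0: "\<And>x. x \<in> space M \<Longrightarrow> 0 \<le> H x"
    and lim: "AE x in M. (\<lambda>n. g n x) \<longlonglongrightarrow> h x"
  shows "(\<lambda>n. \<integral>x. g n x \<partial>M) \<longlonglongrightarrow> (\<integral>x. h x \<partial>M)"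
proof -
  have [measurable]: "H \<in> borel_measurable M" using H by auto
  note [measurable] = gm
  have gint: "integrable M (g n)" for n
  proof (rule Bochner_Integration.integrable_bound)
    show "integrable M (\<lambda>x. H x + k n x)" using H k by simp
    show "AE x in M. norm (g n x) \<le> norm (H x + k n x)"
      using dom by (intro AE_I2) (auto intro: order_trans[OF _ abs_ge_self])
  qed simp
  have hH: "AE x in M. \<bar>h x\<bar> \<le> H x"
    using lim k0(2) AE_space
  proof eventually_elim
    case (elim x)
    have "(\<lambda>n. H x + k n x - \<bar>g n x\<bar>) \<longlonglongrightarrow> H x + 0 - \<bar>h x\<bar>"
      by (intro tendsto_intros elim)
    then have "0 \<le> H x + 0 - \<bar>h x\<bar>"
      by (rule LIMSEQ_le_const) (use dom[OF elim(3)] in \<open>auto simp: algebra_simps\<close>)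
    then show ?case by simp
  qed
  define c where "c n x = max (- H x) (min (H x) (g n x))" for n x
  have cm[measurable]: "c n \<in> borel_measurable M" for n unfolding c_def by measurable
  have cH: "norm (c n x) \<le> H x" if "x \<in> space M" for n x using H0[OF that] by (auto simp: c_def)
  \<comment> \<open>Clipping removes at most the excess of \<open>\<bar>g n x\<bar>\<close> over
    \<open>H x\<close>, which \<open>k n x\<close> bounds; so the clipped integrals have the same
    limit.\<close>
  have ck: "\<bar>g n x - c n x\<bar> \<le> k n x" if "x \<in> space M" for n x
    using dom[OF that, of n] H0[OF that] k0(1)[OF that, of n] by (auto simp: c_def max_def min_def)
  have cint: "integrable M (c n)" for n
    by (rule Bochner_Integration.integrable_bound[OF H cm]) (use cH in \<open>auto intro!: AE_I2 intro: order_trans[OF _ abs_ge_self]\<close>)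
  have clim: "(\<lambda>n. \<integral>x. c n x \<partial>M) \<longlonglongrightarrow> (\<integral>x. h x \<partial>M)"
  proof (rule integral_dominated_convergence[OF _ _ H])
    show "AE x in M. (\<lambda>n. c n x) \<longlonglongrightarrow> h x"
      using lim hH
    proof eventually_elim
      case (elim x)
      have "(\<lambda>n. c n x) \<longlonglongrightarrow> max (- H x) (min (H x) (h x))"
        unfolding c_def by (intro tendsto_max tendsto_min tendsto_const elim)
      moreover have "max (- H x) (min (H x) (h x)) = h x" using elim(2) by (auto simp: max_def min_def)
      ultimately show ?case by simp
    qed
    show "AE x in M. norm (c n x) \<le> H x" for n using cH by (intro AE_I2) auto
  qed auto
  have "(\<lambda>n. (\<integral>x. g n x \<partial>M) - (\<integral>x. c n x \<partial>M)) \<longlonglongrightarrow> 0"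
  proof (rule Lim_null_comparison[OF always_eventually k(2)], rule allI)
    fix n
    have "norm ((\<integral>x. g n x \<partial>M) - (\<integral>x. c n x \<partial>M)) = \<bar>\<integral>x. g n x - c n x \<partial>M\<bar>" using gint cint by simp
    also have "\<dots> \<le> (\<integral>x. \<bar>g n x - c n x\<bar> \<partial>M)" by (rule integral_abs_bound)
    also have "\<dots> \<le> (\<integral>x. k n x \<partial>M)"
      using gint cint k ck by (intro integral_mono) auto
    finally show "norm ((\<integral>x. g n x \<partial>M) - (\<integral>x. c n x \<partial>M)) \<le> (\<integral>x. k n x \<partial>M)" .
  qed
  from tendsto_add[OF this clim] show "(\<lambda>n. \<integral>x. g n x \<partial>M) \<longlonglongrightarrow> (\<integral>x. h x \<partial>M)" by simp
qed

text \<open>Lebesgue measure is complete, so measurability survives a change on a null set. It is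
  called for whenever a function is known only almost everywhere, as \<open>wgrad\<close>
  is.\<close>

lemma borel_measurable_lebesgue_on_AE:
  fixes f g :: "'a::euclidean_space \<Rightarrow> 'b::euclidean_space"
  assumes \<Omega>: "\<Omega> \<in> sets lebesgue" and f: "f \<in> borel_measurable (lebesgue_on \<Omega>)"
    and ae: "AE x in lebesgue_on \<Omega>. f x = g x"
  shows "g \<in> borel_measurable (lebesgue_on \<Omega>)"
proof -
  have m: "\<Omega> \<inter> space lebesgue \<in> sets lebesgue" using \<Omega> by simp
  have "(\<lambda>x. indicator \<Omega> x *\<^sub>R f x) \<in> borel_measurable lebesgue"
    using f borel_measurable_restrict_space_iff[OF m] by blast
  moreover have "AE x in lebesgue. indicator \<Omega> x *\<^sub>R f x = indicator \<Omega> x *\<^sub>R g x"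
    using ae unfolding AE_restrict_space_iff[OF m] by eventually_elim (auto simp: indicator_def)
  ultimately have "(\<lambda>x. indicator \<Omega> x *\<^sub>R g x) \<in> borel_measurable lebesgue" by (rule borel_measurable_AE)
  then show ?thesis using borel_measurable_restrict_space_iff[OF m] by blast
qed

lemma powr_ge_affine:
  fixes t p \<eta> :: real
  assumes "1 < p" "0 < \<eta>"
  obtains C where "0 < C" "\<And>t. 0 \<le> t \<Longrightarrow> t \<le> \<eta> + C * t powr p"
proof -
  obtain C where C: "0 < C" "\<And>x y. 0 \<le> x \<Longrightarrow> 0 \<le> y \<Longrightarrow> x powr (p - 1) * y \<le> \<eta> * x powr p + C * y powr p"
    by (rule young_small[OF assms]) blast
  show thesis by (rule that[OF C(1)]) (use C(2)[of 1] in simp)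
qed

text \<open>The test function and its gradient are bounded, so \<open>L^1\<close> convergence of
  functions and gradients passes to the limit on both sides of the integration by parts
  formula.\<close>

lemma is_weak_gradient_limit:
  fixes \<Omega> :: "'a::euclidean_space set"
  assumes \<Omega>: "open \<Omega>" "bounded \<Omega>" and v: "\<And>n. v n \<in> test_functions \<Omega>"
    and u: "integrable (lebesgue_on \<Omega>) u" and G: "integrable (lebesgue_on \<Omega>) G"
    and vu: "(\<lambda>n. LINT x|lebesgue_on \<Omega>. \<bar>v n x - u x\<bar>) \<longlonglongrightarrow> 0"
    and vG: "(\<lambda>n. LINT x|lebesgue_on \<Omega>. norm (grad (v n) x - G x)) \<longlonglongrightarrow> 0"
  shows "is_weak_gradient \<Omega> u G"
  unfolding is_weak_gradient_def
proof (intro conjI allI impI ballI)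
  let ?M = "lebesgue_on \<Omega>"
  have m: "\<Omega> \<inter> space lebesgue \<in> sets lebesgue" and \<Omega>m: "\<Omega> \<in> sets borel" using \<Omega> by auto
  fix K assume K: "compact K \<and> K \<subseteq> \<Omega>"
  have *: "set_integrable lebesgue K g" if "integrable ?M g" for g :: "'a \<Rightarrow> 'b::euclidean_space"
  proof -
    have "set_integrable lebesgue \<Omega> g" using that unfolding integrable_restrict_space[OF m] set_integrable_def .
    then show ?thesis by (rule set_integrable_subset) (use K in \<open>auto simp: compact_imp_closed borel_closed\<close>)
  qed
  show "u absolutely_integrable_on K" "G absolutely_integrable_on K" using *[OF u] *[OF G] by auto
next
  let ?M = "lebesgue_on \<Omega>"
  have \<Omega>m: "\<Omega> \<in> sets borel" using \<Omega> by auto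
  fix \<phi> i assume \<phi>: "\<phi> \<in> test_functions \<Omega>" and i: "i \<in> (Basis :: 'a set)"
  obtain B where B: "0 < B" "\<And>x. \<bar>\<phi> x\<bar> \<le> B" "\<And>x. norm (grad \<phi> x) \<le> B"
    by (rule test_functions_bounded[OF \<phi>]) blast
  have Bi: "\<bar>grad \<phi> x \<bullet> i\<bar> \<le> B" for x using Basis_le_norm[OF i, of "grad \<phi> x"] B(3)[of x] by simp
  have meas: "g \<in> borel_measurable ?M" if "g \<in> borel_measurable borel" for g :: "'a \<Rightarrow> 'b::euclidean_space"
    using that by (intro measurable_restrict_space1 measurable_completion) simp
  note [measurable] = test_functions_measurable[OF \<phi>] test_functions_measurable[OF v]
  have vint: "integrable ?M (v n)" "integrable ?M (grad (v n))" for n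
    using test_functions_integrable(1,2)[OF v \<Omega>(2)] test_functions_zero_outside[OF v]
    by (subst lebesgue_on_borel(2)[OF \<Omega>m]; simp)+
  have bnd: "integrable ?M (\<lambda>x. g x * h x)" "\<bar>LINT x|?M. g x * h x\<bar> \<le> B * (LINT x|?M. \<bar>g x\<bar>)"
    if g: "integrable ?M g" and h: "h \<in> borel_measurable ?M" "\<And>x. \<bar>h x\<bar> \<le> B" for g h :: "'a \<Rightarrow> real"
  proof -
    have le: "\<bar>g x * h x\<bar> \<le> B * \<bar>g x\<bar>" for x
      using mult_right_mono[OF h(2)[of x], of "\<bar>g x\<bar>"] by (simp add: abs_mult mult.commute)
    show int: "integrable ?M (\<lambda>x. g x * h x)"
    proof (rule Bochner_Integration.integrable_bound[OF integrable_mult_right[OF integrable_abs[OF g], of B]])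
      show "(\<lambda>x. g x * h x) \<in> borel_measurable ?M"
        by (rule borel_measurable_times[OF borel_measurable_integrable[OF g] h(1)])
      show "AE x in ?M. norm (g x * h x) \<le> norm (B * \<bar>g x\<bar>)"
        unfolding real_norm_def by (rule AE_I2) (rule order_trans[OF le abs_ge_self])
    qed
    have "\<bar>LINT x|?M. g x * h x\<bar> \<le> (LINT x|?M. \<bar>g x * h x\<bar>)" by (rule integral_abs_bound)
    also have "\<dots> \<le> (LINT x|?M. B * \<bar>g x\<bar>)" using le int g by (intro integral_mono) auto
    finally show "\<bar>LINT x|?M. g x * h x\<bar> \<le> B * (LINT x|?M. \<bar>g x\<bar>)" by simp
  qed
  have hm: "(\<lambda>x. grad \<phi> x \<bullet> i) \<in> borel_measurable ?M" "\<phi> \<in> borel_measurable ?M" by (rule meas, measurable)+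
  have l1: "(\<lambda>n. LINT x|?M. v n x * (grad \<phi> x \<bullet> i)) \<longlonglongrightarrow> (LINT x|?M. u x * (grad \<phi> x \<bullet> i))"
  proof (rule LIM_zero_cancel, rule Lim_null_comparison[OF always_eventually])
    show "(\<lambda>n. B * (LINT x|?M. \<bar>v n x - u x\<bar>)) \<longlonglongrightarrow> 0" using tendsto_mult_right_zero[OF vu] by simp
    show "\<forall>n. norm ((LINT x|?M. v n x * (grad \<phi> x \<bullet> i)) - (LINT x|?M. u x * (grad \<phi> x \<bullet> i))) \<le> B * (LINT x|?M. \<bar>v n x - u x\<bar>)"
    proof
      fix n
      have "(LINT x|?M. v n x * (grad \<phi> x \<bullet> i)) - (LINT x|?M. u x * (grad \<phi> x \<bullet> i)) = (LINT x|?M. (v n x - u x) * (grad \<phi> x \<bullet> i))"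
        using bnd(1)[OF vint(1) hm(1) Bi] bnd(1)[OF u hm(1) Bi] by (simp add: left_diff_distrib)
      then show "norm ((LINT x|?M. v n x * (grad \<phi> x \<bullet> i)) - (LINT x|?M. u x * (grad \<phi> x \<bullet> i))) \<le> B * (LINT x|?M. \<bar>v n x - u x\<bar>)"
        using bnd(2)[OF Bochner_Integration.integrable_diff[OF vint(1) u] hm(1) Bi] by simp
    qed
  qed
  have gi: "integrable ?M (\<lambda>x. G x \<bullet> i)" "integrable ?M (\<lambda>x. grad (v n) x \<bullet> i)" for n
    using G vint(2) by (intro integrable_inner_left; simp)+
  have l2: "(\<lambda>n. LINT x|?M. (grad (v n) x \<bullet> i) * \<phi> x) \<longlonglongrightarrow> (LINT x|?M. (G x \<bullet> i) * \<phi> x)"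
  proof (rule LIM_zero_cancel, rule Lim_null_comparison[OF always_eventually])
    show "(\<lambda>n. B * (LINT x|?M. norm (grad (v n) x - G x))) \<longlonglongrightarrow> 0" using tendsto_mult_right_zero[OF vG] by simp
    show "\<forall>n. norm ((LINT x|?M. (grad (v n) x \<bullet> i) * \<phi> x) - (LINT x|?M. (G x \<bullet> i) * \<phi> x)) \<le> B * (LINT x|?M. norm (grad (v n) x - G x))"
    proof
      fix n
      have "(LINT x|?M. (grad (v n) x \<bullet> i) * \<phi> x) - (LINT x|?M. (G x \<bullet> i) * \<phi> x) = (LINT x|?M. ((grad (v n) x \<bullet> i) - (G x \<bullet> i)) * \<phi> x)"
        using bnd(1)[OF gi(2) hm(2) B(2)] bnd(1)[OF gi(1) hm(2) B(2)] by (simp add: left_diff_distrib)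
      then have "norm ((LINT x|?M. (grad (v n) x \<bullet> i) * \<phi> x) - (LINT x|?M. (G x \<bullet> i) * \<phi> x)) \<le> B * (LINT x|?M. \<bar>(grad (v n) x \<bullet> i) - (G x \<bullet> i)\<bar>)"
        using bnd(2)[OF Bochner_Integration.integrable_diff[OF gi(2) gi(1)] hm(2) B(2)] by simp
      also have "\<dots> \<le> B * (LINT x|?M. norm (grad (v n) x - G x))"
        using B(1) gi vint(2) G Basis_le_norm[OF i]
        by (intro mult_left_mono integral_mono integrable_abs integrable_norm Bochner_Integration.integrable_diff)
          (auto simp: inner_diff_left[symmetric])
      finally show "norm ((LINT x|?M. (grad (v n) x \<bullet> i) * \<phi> x) - (LINT x|?M. (G x \<bullet> i) * \<phi> x)) \<le> B * (LINT x|?M. norm (grad (v n) x - G x))" .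
    qed
  qed
  have "(\<lambda>n. LINT x|?M. v n x * (grad \<phi> x \<bullet> i)) \<longlonglongrightarrow> - (LINT x|?M. (G x \<bullet> i) * \<phi> x)"
    using tendsto_minus[OF l2] integration_by_parts_test_functions[OF \<Omega> v \<phi>, of _ i] by simp
  with l1 have "(LINT x|?M. u x * (grad \<phi> x \<bullet> i)) = - (LINT x|?M. (G x \<bullet> i) * \<phi> x)" by (rule LIMSEQ_unique)
  then show "(LINT x|?M. u x * frechet_derivative \<phi> (at x) i) = - (LINT x|?M. (G x \<bullet> i) * \<phi> x)"
    using i by (simp add: grad_inner_Basis)
qed

text \<open>The set where \<open>u\<close> differs from 0 is open, and a nonempty open set is not
  negligible.\<close>

lemma continuous_AE_zero_imp_zero:
  fixes u :: "'a::euclidean_space \<Rightarrow> real"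
  assumes \<Omega>: "open \<Omega>" and u: "continuous_on UNIV u" "\<And>x. x \<notin> \<Omega> \<Longrightarrow> u x = 0" and ae: "AE x in lebesgue_on \<Omega>. u x = 0"
  shows "u x = 0"
proof -
  let ?S = "{x. u x \<noteq> 0}"
  have "open ?S" using u(1) by (intro open_Collect_neq continuous_on_const)
  have "AE x in lebesgue. x \<in> \<Omega> \<longrightarrow> u x = 0" using ae \<Omega> by (simp add: AE_restrict_space_iff)
  then have "AE x in lebesgue. x \<notin> ?S" by eventually_elim (use u(2) in auto)
  then have "negligible ?S"
    unfolding negligible_iff_null_sets completion.null_sets_iff_AE by simp
  then have "?S = {}" using open_not_negligible[OF \<open>open ?S\<close>] by blast
  then show ?thesis by blast
qed

lemma ex_nonzero_test_function:
  assumes "open \<Omega>" "\<Omega> \<noteq> {}"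
  obtains \<phi> x where "\<phi> \<in> test_functions \<Omega>" "\<phi> x \<noteq> 0"
proof -
  obtain z where z: "z \<in> \<Omega>" using assms by blast
  obtain a b where ab: "cbox a b \<subseteq> \<Omega>" "z \<in> box a b"
    by (rule open_contains_cbox[OF assms(1) z])
  have "bump a b 0 z \<noteq> 0"
    using ab(2) unfolding bump_def by (auto simp: flat_exp_def box_def inner_diff_left)
  then show thesis using that bump_test_function[OF ab(1)] by blast
qed

lemma AE_lebesgue_on_imp_ex:
  fixes \<Omega> :: "'a::euclidean_space set"
  assumes \<Omega>: "open \<Omega>" "\<Omega> \<noteq> {}" and P: "AE x in lebesgue_on \<Omega>. P x"
  shows "\<exists>x\<in>\<Omega>. P x"
proof (rule ccontr)
  assume no: "\<not> (\<exists>x\<in>\<Omega>. P x)"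
  have "AE x in lebesgue_on \<Omega>. False" using P AE_space by eventually_elim (use no in auto)
  then have "AE x in lebesgue. x \<notin> \<Omega>" using \<Omega>(1) by (simp add: AE_restrict_space_iff)
  then have "negligible \<Omega>" unfolding negligible_iff_null_sets completion.null_sets_iff_AE by simp
  then show False using open_not_negligible[OF \<Omega>] by blast
qed

section \<open>Musielak-Orlicz-Sobolev spaces\<close>

lemma borel_measurable_lebesgue_on_borel:
  fixes g :: "'a::euclidean_space \<Rightarrow> 'b::topological_space"
  shows "g \<in> borel_measurable borel \<Longrightarrow> g \<in> borel_measurable (lebesgue_on \<Omega>)"
  by (intro measurable_restrict_space1 measurable_completion) simp

lemma test_functions_measurable_on:
  assumes "\<phi> \<in> test_functions \<Omega>"
  shows "\<phi> \<in> borel_measurable (lebesgue_on \<Omega>)" "grad \<phi> \<in> borel_measurable (lebesgue_on \<Omega>)"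
  using test_functions_measurable[OF assms] by (auto intro: borel_measurable_lebesgue_on_borel)

lemma is_weak_gradient_test_function:
  assumes "open \<Omega>" "bounded \<Omega>" "u \<in> test_functions \<Omega>"
  shows "is_weak_gradient \<Omega> u (grad u)"
proof (rule is_weak_gradient_limit[OF assms(1,2), where v = "\<lambda>n. u"])
  have \<Omega>m: "\<Omega> \<in> sets borel" using assms by simp
  show "integrable (lebesgue_on \<Omega>) u" "integrable (lebesgue_on \<Omega>) (grad u)"
    using test_functions_integrable(1,2)[OF assms(3,2)] test_functions_measurable[OF assms(3)] test_functions_zero_outside[OF assms(3)]
    by (subst lebesgue_on_borel(2)[OF \<Omega>m]; simp)+
qed (use assms in auto)

text \<open>The integrals in \<open>is_weak_gradient\<close> can be subtracted only if they exist.
  They do, because \<open>u\<close> and \<open>G\<close> are integrable on the compact support of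
  the test function, which lies inside \<open>\<Omega>\<close>.\<close>

lemma is_weak_gradient_pairing_integrable:
  fixes \<Omega> :: "'a::euclidean_space set"
  assumes \<Omega>: "open \<Omega>" and G: "is_weak_gradient \<Omega> u G" and \<phi>: "\<phi> \<in> test_functions \<Omega>"
  shows "integrable (lebesgue_on \<Omega>) (\<lambda>x. u x * (grad \<phi> x \<bullet> i))" "integrable (lebesgue_on \<Omega>) (\<lambda>x. (G x \<bullet> i) * \<phi> x)"
proof -
  obtain K where K: "compact K" "K \<subseteq> \<Omega>" "\<And>x. x \<notin> K \<Longrightarrow> \<phi> x = 0" "\<And>x. x \<notin> K \<Longrightarrow> grad \<phi> x = 0"
    by (rule test_functions_support[OF \<phi>]) blast
  obtain B where B: "0 < B" "\<And>x. \<bar>\<phi> x\<bar> \<le> B" "\<And>x. norm (grad \<phi> x) \<le> B"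
    by (rule test_functions_bounded[OF \<phi>]) blast
  have Bi: "\<bar>grad \<phi> x \<bullet> i\<bar> \<le> B * norm i" for x
    using Cauchy_Schwarz_ineq2[of "grad \<phi> x" i] mult_right_mono[OF B(3)[of x], of "norm i"] by simp
  have m: "\<Omega> \<inter> space lebesgue \<in> sets lebesgue" using \<Omega> by simp
  have *: "integrable (lebesgue_on \<Omega>) (\<lambda>x. g x * h x)"
    if g: "set_integrable lebesgue K g" and h: "h \<in> borel_measurable borel" "\<And>x. \<bar>h x\<bar> \<le> C" "\<And>x. x \<notin> K \<Longrightarrow> h x = 0"
    for g h :: "'a \<Rightarrow> real" and C
  proof -
    have gi: "integrable lebesgue (\<lambda>x. indicator K x * g x)" using g by (simp add: set_integrable_def)
    have "integrable lebesgue (\<lambda>x. (indicator K x * g x) * h x)"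
    proof (rule Bochner_Integration.integrable_bound[OF integrable_mult_right[OF gi, of C]])
      show "(\<lambda>x. (indicator K x * g x) * h x) \<in> borel_measurable lebesgue"
        by (rule borel_measurable_times[OF borel_measurable_integrable[OF gi]])
          (use h(1) in \<open>simp add: measurable_completion\<close>)
      have C: "\<bar>h x\<bar> \<le> \<bar>C\<bar>" for x using h(2)[of x] by linarith
      show "AE x in lebesgue. norm ((indicator K x * g x) * h x) \<le> norm (C * (indicator K x * g x))"
        using C by (intro AE_I2) (simp add: abs_mult mult.commute mult_right_mono)
    qed
    also have "(\<lambda>x. (indicator K x * g x) * h x) = (\<lambda>x. indicator \<Omega> x *\<^sub>R (g x * h x))"
      using h(3) K(2) by (auto simp: indicator_def fun_eq_iff)
    finally show ?thesis unfolding integrable_restrict_space[OF m] .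
  qed
  have gK: "set_integrable lebesgue K u" "set_integrable lebesgue K G" using G K(1,2) unfolding is_weak_gradient_def by auto
  have "integrable lebesgue (\<lambda>x. (indicator K x *\<^sub>R G x) \<bullet> i)"
    using gK(2) unfolding set_integrable_def by (rule integrable_inner_left)
  then have gK': "set_integrable lebesgue K (\<lambda>x. G x \<bullet> i)" by (simp add: set_integrable_def)
  note [measurable] = test_functions_measurable[OF \<phi>]
  show "integrable (lebesgue_on \<Omega>) (\<lambda>x. u x * (grad \<phi> x \<bullet> i))"
    by (rule *[OF gK(1) _ Bi]) (use K(4) in auto)
  show "integrable (lebesgue_on \<Omega>) (\<lambda>x. (G x \<bullet> i) * \<phi> x)"
    by (rule *[OF gK' _ B(2)]) (use K(3) in auto)
qed

lemma is_weak_gradient_diff: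
  fixes \<Omega> :: "'a::euclidean_space set"
  assumes \<Omega>: "open \<Omega>" and G: "is_weak_gradient \<Omega> u G" and G': "is_weak_gradient \<Omega> v G'"
  shows "is_weak_gradient \<Omega> (\<lambda>x. u x - v x) (\<lambda>x. G x - G' x)"
  unfolding is_weak_gradient_def
proof (intro conjI allI impI ballI)
  fix K assume "compact K \<and> K \<subseteq> \<Omega>"
  then show "(\<lambda>x. u x - v x) absolutely_integrable_on K" "(\<lambda>x. G x - G' x) absolutely_integrable_on K"
    using G G' unfolding is_weak_gradient_def by (auto intro: set_integral_diff)
next
  fix \<phi> i assume \<phi>: "\<phi> \<in> test_functions \<Omega>" and i: "i \<in> (Basis :: 'a set)"
  note int = is_weak_gradient_pairing_integrable[OF \<Omega> G \<phi>, of i] is_weak_gradient_pairing_integrable[OF \<Omega> G' \<phi>, of i]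
  have e: "(LINT x|lebesgue_on \<Omega>. w x * (grad \<phi> x \<bullet> i)) = - (LINT x|lebesgue_on \<Omega>. (D x \<bullet> i) * \<phi> x)"
    if "is_weak_gradient \<Omega> w D" for w D
    using that \<phi> i unfolding is_weak_gradient_def by (simp add: grad_inner_Basis)
  have "(LINT x|lebesgue_on \<Omega>. (u x - v x) * (grad \<phi> x \<bullet> i)) = - (LINT x|lebesgue_on \<Omega>. ((G x - G' x) \<bullet> i) * \<phi> x)"
    using int e[OF G] e[OF G'] by (simp add: left_diff_distrib inner_diff_left)
  then show "(LINT x|lebesgue_on \<Omega>. (u x - v x) * frechet_derivative \<phi> (at x) i) = - (LINT x|lebesgue_on \<Omega>. ((G x - G' x) \<bullet> i) * \<phi> x)"
    using i by (simp add: grad_inner_Basis)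
qed

text \<open>The definition yields measurability on compact subsets only; countably many closed boxes
  exhaust \<open>\<Omega>\<close>.\<close>

lemma is_weak_gradient_measurable:
  fixes \<Omega> :: "'a::euclidean_space set"
  assumes \<Omega>: "open \<Omega>" and G: "is_weak_gradient \<Omega> u G"
  shows "G \<in> borel_measurable (lebesgue_on \<Omega>)"
proof -
  obtain \<D> where \<D>: "countable \<D>" "\<D> \<subseteq> Pow \<Omega>" "\<And>X. X \<in> \<D> \<Longrightarrow> \<exists>a b. X = cbox a b" "\<Union>\<D> = \<Omega>"
    using open_countable_Union_open_cbox[OF \<Omega>] by metis
  show ?thesis
  proof (rule measurable_piecewise_restrict[OF \<D>(1)])
    fix X assume X: "X \<in> \<D>"
    then have c: "compact X" "X \<subseteq> \<Omega>" using \<D>(2) \<D>(3)[OF X] compact_cbox by auto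
    then have m: "X \<inter> space lebesgue \<in> sets lebesgue" by (simp add: compact_imp_closed borel_closed)
    show "X \<inter> space (lebesgue_on \<Omega>) \<in> sets (lebesgue_on \<Omega>)"
      using c m \<Omega> by (auto simp: sets_restrict_space_iff)
    have "set_integrable lebesgue X G" using G c unfolding is_weak_gradient_def by auto
    then have "G \<in> borel_measurable (lebesgue_on X)"
      unfolding set_integrable_def borel_measurable_restrict_space_iff[OF m] by auto
    moreover have "restrict_space (lebesgue_on \<Omega>) X = lebesgue_on (\<Omega> \<inter> X)"
      by (rule restrict_restrict_space) (use m \<Omega> in auto)
    moreover have "\<Omega> \<inter> X = X" using c by blast
    ultimately show "G \<in> borel_measurable (restrict_space (lebesgue_on \<Omega>) X)" by simp
  qed (use \<D>(4) in auto)
qed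

text \<open>The bound of \<open>q\<close> by the critical exponent lets a Sobolev inequality in
  terms of the \<open>p\<close>-part of the gradient control the whole modular of a function; the
  constant \<open>A\<close> takes care of the weight there.\<close>

locale double_phase_domain =
  fixes \<Omega> :: "'a::euclidean_space set" and a :: "'a \<Rightarrow> real" and p q A :: real
  assumes open_\<Omega>: "open \<Omega>" and bounded_\<Omega>: "bounded \<Omega>"
    and p: "1 < p" "p < q" "p < real DIM('a)" "q < critical_exponent (real DIM('a)) p"
    and a_measurable [measurable]: "a \<in> borel_measurable (lebesgue_on \<Omega>)"
    and a_bounds: "\<And>x. x \<in> \<Omega> \<Longrightarrow> 0 \<le> a x" "\<And>x. x \<in> \<Omega> \<Longrightarrow> a x \<le> A" and A: "0 \<le> A"
begin

abbreviation \<mu> :: "'a measure" where "\<mu> \<equiv> lebesgue_on \<Omega>"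

abbreviation test :: "('a \<Rightarrow> real) set" where "test \<equiv> test_functions \<Omega>"

section \<open>Modular and Luxemburg norm\<close>

definition H :: "'a \<Rightarrow> real \<Rightarrow> real" where "H x t = t powr p + a x * t powr q"

lemma \<Omega>_borel: "\<Omega> \<in> sets borel" and \<Omega>_lebesgue: "\<Omega> \<in> sets lebesgue"
  using open_\<Omega> by auto

lemma space_\<mu> [simp]: "space \<mu> = \<Omega>" by simp

sublocale finite_measure \<mu>
proof
  have "emeasure lborel \<Omega> < \<infinity>" using bounded_\<Omega> by (rule emeasure_bounded_finite)
  then show "emeasure \<mu> (space \<mu>) \<noteq> \<infinity>" using \<Omega>_borel by (simp add: emeasure_restrict_space)
qed

lemma H_nonneg: "x \<in> \<Omega> \<Longrightarrow> 0 \<le> H x t"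
  using a_bounds by (simp add: H_def)

lemma H_zero [simp]: "H x 0 = 0" by (simp add: H_def)

lemma H_mono: "x \<in> \<Omega> \<Longrightarrow> 0 \<le> s \<Longrightarrow> s \<le> t \<Longrightarrow> H x s \<le> H x t"
  using a_bounds p unfolding H_def by (intro add_mono mult_left_mono powr_mono2) auto

lemma powr_le_H: "x \<in> \<Omega> \<Longrightarrow> t powr p \<le> H x t"
  using a_bounds by (simp add: H_def)

lemma H_le: "x \<in> \<Omega> \<Longrightarrow> H x t \<le> t powr p + A * t powr q"
  using a_bounds by (simp add: H_def mult_right_mono)

lemma H_diff:
  fixes v w :: "'b::real_normed_vector"
  assumes x: "x \<in> \<Omega>" shows "H x (norm (v - w)) \<le> 2 powr q * (H x (norm v) + H x (norm w))"
proof -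
  have "norm (v - w) powr p \<le> 2 powr p * (norm v powr p + norm w powr p)" using p by (intro norm_diff_powr_le) auto
  also have "\<dots> \<le> 2 powr q * (norm v powr p + norm w powr p)" using p by (intro mult_right_mono) auto
  finally have 1: "norm (v - w) powr p \<le> 2 powr q * (norm v powr p + norm w powr p)" .
  have "a x * norm (v - w) powr q \<le> a x * (2 powr q * (norm v powr q + norm w powr q))"
    using p a_bounds(1)[OF x] by (intro mult_left_mono norm_diff_powr_le) auto
  with 1 show ?thesis by (simp add: H_def algebra_simps)
qed

lemma H_add:
  fixes v w :: "'b::real_normed_vector"
  assumes x: "x \<in> \<Omega>" shows "H x (norm (v + w)) \<le> 2 powr q * (H x (norm v) + H x (norm w))"
  using H_diff[OF x, of v "- w"] by simp

text \<open>Division of the argument by \<open>c \<le> 1\<close> multiplies \<open>H\<close> by at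
  least \<open>1 / c\<close>, since both exponents exceed 1, and by at most
  \<open>1 / c powr q\<close>, since \<open>q\<close> is the larger exponent. The comparison between
  modular and norm rests on these two bounds.\<close>

lemma H_scale:
  assumes x: "x \<in> \<Omega>" and c: "0 < c" "c \<le> 1" and t: "0 \<le> t"
  shows "H x t \<le> c * H x (t / c)" "H x (t / c) \<le> H x t / c powr q"
proof -
  have cp: "t powr p = c powr p * (t / c) powr p" "t powr q = c powr q * (t / c) powr q"
    using c t by (simp_all add: powr_divide)
  have le: "c powr q \<le> c powr p" "c powr p \<le> c powr 1" "c powr q \<le> c powr 1" by (intro powr_mono'; use c p in simp)+
  have "t powr p \<le> c * (t / c) powr p" "t powr q \<le> c * (t / c) powr q"
    unfolding cp using le c by (simp_all add: mult_right_mono)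
  then show "H x t \<le> c * H x (t / c)" using a_bounds(1)[OF x] mult_left_mono[of "t powr q" "c * (t / c) powr q" "a x"]
    by (simp add: H_def algebra_simps)
  have "c powr q * (t / c) powr p \<le> t powr p"
    unfolding cp(1) using le by (intro mult_right_mono) auto
  then have "c powr q * H x (t / c) \<le> H x t" unfolding H_def using cp(2) by (simp add: algebra_simps)
  then show "H x (t / c) \<le> H x t / c powr q" using c by (simp add: pos_le_divide_eq mult.commute)
qed

lemma H_measurable [measurable (raw)]:
  fixes g :: "'a \<Rightarrow> real"
  assumes [measurable]: "g \<in> borel_measurable \<mu>"
  shows "(\<lambda>x. H x (g x)) \<in> borel_measurable \<mu>"
  unfolding H_def by measurable

lemma modular_eq: "modular \<Omega> a p q u = (\<integral>\<^sup>+x. ennreal (H x \<bar>u x\<bar>) \<partial>\<mu>)"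
  by (simp add: modular_def H_def)

lemma mem_LH_iff: "u \<in> LH \<Omega> a p q \<longleftrightarrow> u \<in> borel_measurable \<mu> \<and> integrable \<mu> (\<lambda>x. H x \<bar>u x\<bar>)"
proof (cases "u \<in> borel_measurable \<mu>")
  case [measurable]: True
  have "(\<integral>\<^sup>+x. ennreal (norm (H x \<bar>u x\<bar>)) \<partial>\<mu>) = (\<integral>\<^sup>+x. ennreal (H x \<bar>u x\<bar>) \<partial>\<mu>)"
    by (rule nn_integral_cong) (simp add: H_nonneg)
  then show ?thesis by (simp add: LH_def modular_eq integrable_iff_bounded)
qed (simp add: LH_def)

lemma modular_eq_integral:
  assumes "integrable \<mu> (\<lambda>x. H x \<bar>u x\<bar>)"
  shows "modular \<Omega> a p q u = ennreal (\<integral>x. H x \<bar>u x\<bar> \<partial>\<mu>)"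
  unfolding modular_eq using assms by (intro nn_integral_eq_integral AE_I2) (auto simp: H_nonneg)

lemma modular_scale:
  assumes u: "u \<in> borel_measurable \<mu>" and c: "0 < c" "c \<le> 1"
  shows "modular \<Omega> a p q u \<le> ennreal c * modular \<Omega> a p q (\<lambda>x. u x / c)"
    "modular \<Omega> a p q (\<lambda>x. u x / c) \<le> ennreal (1 / c powr q) * modular \<Omega> a p q u"
proof -
  note [measurable] = u
  have "modular \<Omega> a p q u \<le> (\<integral>\<^sup>+x. ennreal c * ennreal (H x \<bar>u x / c\<bar>) \<partial>\<mu>)"
    unfolding modular_eq using c H_scale(1)[OF _ c]
    by (intro nn_integral_mono) (auto simp: ennreal_mult'[symmetric] abs_divide intro!: ennreal_leI)
  then show "modular \<Omega> a p q u \<le> ennreal c * modular \<Omega> a p q (\<lambda>x. u x / c)"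
    unfolding modular_eq by (simp add: nn_integral_cmult)
  have "modular \<Omega> a p q (\<lambda>x. u x / c) \<le> (\<integral>\<^sup>+x. ennreal (1 / c powr q) * ennreal (H x \<bar>u x\<bar>) \<partial>\<mu>)"
    unfolding modular_eq using c H_scale(2)[OF _ c]
    by (intro nn_integral_mono) (auto simp: ennreal_mult'[symmetric] abs_divide intro!: ennreal_leI)
  then show "modular \<Omega> a p q (\<lambda>x. u x / c) \<le> ennreal (1 / c powr q) * modular \<Omega> a p q u"
    unfolding modular_eq by (simp add: nn_integral_cmult)
qed

lemma LH_norm_bdd: "bdd_below {l. 0 < l \<and> modular \<Omega> a p q (\<lambda>x. u x / l) \<le> 1}"
  by (rule bdd_belowI[of _ 0]) auto

text \<open>The infimum of an empty set of reals is an arbitrary value, so the set that defines the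
  norm has to be shown nonempty. Division by \<open>m + 1\<close>, where \<open>m\<close> is the
  modular, brings the modular below 1.\<close>

lemma LH_norm_nonneg:
  assumes "u \<in> LH \<Omega> a p q" shows "0 \<le> LH_norm \<Omega> a p q u" "{l. 0 < l \<and> modular \<Omega> a p q (\<lambda>x. u x / l) \<le> 1} \<noteq> {}"
proof -
  have u: "u \<in> borel_measurable \<mu>" "integrable \<mu> (\<lambda>x. H x \<bar>u x\<bar>)" using assms by (auto simp: mem_LH_iff)
  define m where "m = (\<integral>x. H x \<bar>u x\<bar> \<partial>\<mu>)"
  have m: "0 \<le> m" unfolding m_def by (intro Bochner_Integration.integral_nonneg) (auto simp: H_nonneg)
  have c: "0 < 1 / (m + 1)" "1 / (m + 1) \<le> 1" using m by auto
  have um: "(\<lambda>x. u x / (m + 1)) \<in> borel_measurable \<mu>" using u by simp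
  have "modular \<Omega> a p q (\<lambda>x. u x / (m + 1)) \<le> ennreal (1 / (m + 1)) * modular \<Omega> a p q u"
    using modular_scale(1)[OF um c] m by simp
  also have "\<dots> = ennreal (1 / (m + 1) * m)"
    unfolding modular_eq_integral[OF u(2)] m_def[symmetric] using m by (simp add: ennreal_mult'[symmetric])
  also have "\<dots> \<le> 1" using m by (simp add: divide_le_eq_1)
  finally show ne: "{l. 0 < l \<and> modular \<Omega> a p q (\<lambda>x. u x / l) \<le> 1} \<noteq> {}" using m by (auto intro!: exI[of _ "m + 1"])
  show "0 \<le> LH_norm \<Omega> a p q u" unfolding LH_norm_def using ne by (intro cInf_greatest) auto
qed

text \<open>Together with \<open>LH_norm_le\<close> this identifies small norm with small modular,
  so that from here on closeness can be measured by the modular, which is an integral.\<close>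

lemma LH_norm_less_imp:
  assumes u: "u \<in> LH \<Omega> a p q" and e: "LH_norm \<Omega> a p q u < \<epsilon>" "\<epsilon> \<le> 1"
  shows "(\<integral>x. H x \<bar>u x\<bar> \<partial>\<mu>) \<le> \<epsilon>"
proof -
  have um: "u \<in> borel_measurable \<mu>" and ui: "integrable \<mu> (\<lambda>x. H x \<bar>u x\<bar>)" using u by (auto simp: mem_LH_iff)
  obtain l where l: "0 < l" "modular \<Omega> a p q (\<lambda>x. u x / l) \<le> 1" "l < \<epsilon>"
    using cInf_lessD[OF LH_norm_nonneg(2)[OF u] e(1)[unfolded LH_norm_def]] by auto
  have "modular \<Omega> a p q u \<le> ennreal l * modular \<Omega> a p q (\<lambda>x. u x / l)"
    using l e by (intro modular_scale um) auto
  also have "\<dots> \<le> ennreal l * 1" using l(2) by (intro mult_left_mono) auto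
  finally have "ennreal (\<integral>x. H x \<bar>u x\<bar> \<partial>\<mu>) \<le> ennreal l" by (simp add: modular_eq_integral[OF ui])
  then have "(\<integral>x. H x \<bar>u x\<bar> \<partial>\<mu>) \<le> l" using l by (simp add: ennreal_le_iff)
  then show ?thesis using l by simp
qed

lemma LH_norm_le:
  assumes u: "u \<in> LH \<Omega> a p q" and e: "0 < \<epsilon>" "\<epsilon> \<le> 1" "(\<integral>x. H x \<bar>u x\<bar> \<partial>\<mu>) \<le> \<epsilon> powr q"
  shows "LH_norm \<Omega> a p q u \<le> \<epsilon>"
proof -
  have um: "u \<in> borel_measurable \<mu>" and ui: "integrable \<mu> (\<lambda>x. H x \<bar>u x\<bar>)" using u by (auto simp: mem_LH_iff)
  have "modular \<Omega> a p q (\<lambda>x. u x / \<epsilon>) \<le> ennreal (1 / \<epsilon> powr q) * modular \<Omega> a p q u"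
    using e by (intro modular_scale um)
  also have "\<dots> \<le> ennreal (1 / \<epsilon> powr q) * ennreal (\<epsilon> powr q)"
    unfolding modular_eq_integral[OF ui] using e by (intro mult_left_mono ennreal_leI) auto
  also have "\<dots> = 1" using e by (simp add: ennreal_mult'[symmetric])
  finally show ?thesis unfolding LH_norm_def using e by (intro cInf_lower LH_norm_bdd) auto
qed

lemma integrable_H_diff:
  fixes v w :: "'a \<Rightarrow> 'b::euclidean_space"
  assumes [measurable]: "v \<in> borel_measurable \<mu>" "w \<in> borel_measurable \<mu>"
    and i: "integrable \<mu> (\<lambda>x. H x (norm (v x)))" "integrable \<mu> (\<lambda>x. H x (norm (w x)))"
  shows "integrable \<mu> (\<lambda>x. H x (norm (v x - w x)))"
    "(\<integral>x. H x (norm (v x - w x)) \<partial>\<mu>) \<le> 2 powr q * ((\<integral>x. H x (norm (v x)) \<partial>\<mu>) + (\<integral>x. H x (norm (w x)) \<partial>\<mu>))"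
proof -
  have d: "integrable \<mu> (\<lambda>x. 2 powr q * (H x (norm (v x)) + H x (norm (w x))))" using i by simp
  show int: "integrable \<mu> (\<lambda>x. H x (norm (v x - w x)))"
  proof (rule Bochner_Integration.integrable_bound[OF d])
    show "AE x in \<mu>. norm (H x (norm (v x - w x))) \<le> norm (2 powr q * (H x (norm (v x)) + H x (norm (w x))))"
      using H_diff[of _ "v _" "w _"] by (intro AE_I2) (simp add: H_nonneg)
  qed measurable
  have "(\<integral>x. H x (norm (v x - w x)) \<partial>\<mu>) \<le> (\<integral>x. 2 powr q * (H x (norm (v x)) + H x (norm (w x))) \<partial>\<mu>)"
    using int d by (rule integral_mono) (simp add: H_diff)
  then show "(\<integral>x. H x (norm (v x - w x)) \<partial>\<mu>) \<le> 2 powr q * ((\<integral>x. H x (norm (v x)) \<partial>\<mu>) + (\<integral>x. H x (norm (w x)) \<partial>\<mu>))"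
    using i by simp
qed

lemma integrable_if_H_diff:
  fixes v w :: "'a \<Rightarrow> 'b::euclidean_space"
  assumes [measurable]: "v \<in> borel_measurable \<mu>" "w \<in> borel_measurable \<mu>"
    and i: "integrable \<mu> (\<lambda>x. H x (norm (v x - w x)))" "integrable \<mu> (\<lambda>x. H x (norm (w x)))"
  shows "integrable \<mu> (\<lambda>x. H x (norm (v x)))"
  using integrable_H_diff(1)[of "\<lambda>x. v x - w x" "\<lambda>x. - w x"] i by simp

lemma integrable_powr_of_H:
  fixes v :: "'a \<Rightarrow> 'b::euclidean_space"
  assumes [measurable]: "v \<in> borel_measurable \<mu>" and i: "integrable \<mu> (\<lambda>x. H x (norm (v x)))"
  shows "integrable \<mu> (\<lambda>x. norm (v x) powr p)" "(\<integral>x. norm (v x) powr p \<partial>\<mu>) \<le> (\<integral>x. H x (norm (v x)) \<partial>\<mu>)"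
    "integrable \<mu> v"
proof -
  show ip: "integrable \<mu> (\<lambda>x. norm (v x) powr p)"
    by (rule Bochner_Integration.integrable_bound[OF i]) (auto intro!: AE_I2 simp: powr_le_H H_nonneg)
  show "(\<integral>x. norm (v x) powr p \<partial>\<mu>) \<le> (\<integral>x. H x (norm (v x)) \<partial>\<mu>)"
    using ip i by (rule integral_mono) (simp add: powr_le_H)
  obtain C where C: "0 < C" "\<And>t::real. 0 \<le> t \<Longrightarrow> t \<le> 1 + C * t powr p"
    by (rule powr_ge_affine[OF p(1), of 1]) auto
  have "integrable \<mu> (\<lambda>x. 1 + C * norm (v x) powr p)" using ip by simp
  then show "integrable \<mu> v"
    by (rule Bochner_Integration.integrable_bound) (use C in \<open>auto intro!: AE_I2 intro: order_trans[OF _ abs_ge_self]\<close>)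
qed

text \<open>On a finite measure space the inequality \<open>t \<le> \<eta> + C * t powr p\<close>
  splits the \<open>L^1\<close> norm into a small constant part and a multiple of the
  modular.\<close>

lemma L1_small_of_H:
  assumes e: "0 < \<epsilon>"
  obtains \<delta> where "0 < \<delta>" "\<And>v :: 'a \<Rightarrow> 'b::euclidean_space. v \<in> borel_measurable \<mu> \<Longrightarrow> integrable \<mu> (\<lambda>x. H x (norm (v x))) \<Longrightarrow>
    (\<integral>x. H x (norm (v x)) \<partial>\<mu>) \<le> \<delta> \<Longrightarrow> (\<integral>x. norm (v x) \<partial>\<mu>) \<le> \<epsilon>"
proof -
  define V where "V = measure \<mu> \<Omega>"
  define \<eta> where "\<eta> = \<epsilon> / (2 * (V + 1))"
  have V: "0 \<le> V" by (simp add: V_def)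
  have eta: "0 < \<eta>" using e V by (simp add: \<eta>_def)
  obtain C where C: "0 < C" "\<And>t::real. 0 \<le> t \<Longrightarrow> t \<le> \<eta> + C * t powr p"
    by (rule powr_ge_affine[OF p(1) eta]) auto
  show thesis
  proof (rule that)
    show "0 < \<epsilon> / (2 * C)" using e C by simp
    fix v :: "'a \<Rightarrow> 'b" assume v: "v \<in> borel_measurable \<mu>" "integrable \<mu> (\<lambda>x. H x (norm (v x)))"
      "(\<integral>x. H x (norm (v x)) \<partial>\<mu>) \<le> \<epsilon> / (2 * C)"
    note ip = integrable_powr_of_H[OF v(1,2)]
    have "(\<integral>x. norm (v x) \<partial>\<mu>) \<le> (\<integral>x. \<eta> + C * norm (v x) powr p \<partial>\<mu>)"
      using ip C(2) by (intro integral_mono) auto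
    also have "\<dots> = \<eta> * V + C * (\<integral>x. norm (v x) powr p \<partial>\<mu>)"
      using ip by (simp add: V_def)
    also have "\<dots> \<le> \<eta> * V + C * (\<epsilon> / (2 * C))"
      using order_trans[OF ip(2) v(3)] C by (intro add_left_mono mult_left_mono) auto
    also have "\<dots> \<le> \<epsilon>"
    proof -
      have "\<eta> * V \<le> \<eta> * (V + 1)" using eta by (intro mult_left_mono) auto
      also have "\<dots> = \<epsilon> / 2" using V by (simp add: \<eta>_def field_simps)
      finally show ?thesis using C by simp
    qed
    finally show "(\<integral>x. norm (v x) \<partial>\<mu>) \<le> \<epsilon>" .
  qed
qed

lemma L1_tendsto_of_H:
  fixes v :: "'a \<Rightarrow> 'b::euclidean_space" and w :: "nat \<Rightarrow> 'a \<Rightarrow> 'b"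
  assumes m: "v \<in> borel_measurable \<mu>" "\<And>n. w n \<in> borel_measurable \<mu>"
    and i: "\<And>n. integrable \<mu> (\<lambda>x. H x (norm (w n x - v x)))" and lim: "(\<lambda>n. \<integral>x. H x (norm (w n x - v x)) \<partial>\<mu>) \<longlonglongrightarrow> 0"
  shows "(\<lambda>n. \<integral>x. norm (w n x - v x) \<partial>\<mu>) \<longlonglongrightarrow> 0"
proof (rule tendstoI)
  fix \<epsilon> :: real assume e: "0 < \<epsilon>"
  then have e2: "0 < \<epsilon> / 2" by simp
  obtain \<delta> where d: "0 < \<delta>" "\<And>v :: 'a \<Rightarrow> 'b. v \<in> borel_measurable \<mu> \<Longrightarrow> integrable \<mu> (\<lambda>x. H x (norm (v x))) \<Longrightarrow>
    (\<integral>x. H x (norm (v x)) \<partial>\<mu>) \<le> \<delta> \<Longrightarrow> (\<integral>x. norm (v x) \<partial>\<mu>) \<le> \<epsilon> / 2"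
    by (rule L1_small_of_H[OF e2, where 'b = 'b]) blast
  have "\<forall>\<^sub>F n in sequentially. (\<integral>x. H x (norm (w n x - v x)) \<partial>\<mu>) < \<delta>"
    by (rule order_tendstoD(2)[OF lim d(1)])
  then show "\<forall>\<^sub>F n in sequentially. dist (\<integral>x. norm (w n x - v x) \<partial>\<mu>) 0 < \<epsilon>"
  proof eventually_elim
    case (elim n)
    have "(\<integral>x. norm (w n x - v x) \<partial>\<mu>) \<le> \<epsilon> / 2"
      using elim m i by (intro d(2) borel_measurable_diff) auto
    then show ?case using e by (simp add: dist_real_def)
  qed
qed

section \<open>Sobolev inequalities in terms of the modular\<close>

lemma test_integrable:
  assumes \<phi>: "\<phi> \<in> test"
  shows "0 < s \<Longrightarrow> integrable \<mu> (\<lambda>x. \<bar>\<phi> x\<bar> powr s)" "0 < s \<Longrightarrow> integrable \<mu> (\<lambda>x. norm (grad \<phi> x) powr s)"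
    "integrable \<mu> (\<lambda>x. H x \<bar>\<phi> x\<bar>)" "integrable \<mu> (\<lambda>x. H x (norm (grad \<phi> x)))"
proof -
  note [measurable] = test_functions_measurable[OF \<phi>]
  note [measurable] = test_functions_measurable_on[OF \<phi>]
  show 1: "integrable \<mu> (\<lambda>x. \<bar>\<phi> x\<bar> powr s)" if "0 < s" for s
    using test_functions_integrable(3)[OF \<phi> bounded_\<Omega> that] test_functions_zero_outside[OF \<phi>]
    by (subst lebesgue_on_borel(2)[OF \<Omega>_borel]) auto
  show 2: "integrable \<mu> (\<lambda>x. norm (grad \<phi> x) powr s)" if "0 < s" for s
    using test_functions_integrable(4)[OF \<phi> bounded_\<Omega> that] test_functions_zero_outside[OF \<phi>]
    by (subst lebesgue_on_borel(2)[OF \<Omega>_borel]) auto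
  have *: "integrable \<mu> (\<lambda>x. H x (g x))" if g: "g \<in> borel_measurable \<mu>" "\<And>s. 0 < s \<Longrightarrow> integrable \<mu> (\<lambda>x. g x powr s)" for g
  proof (rule Bochner_Integration.integrable_bound)
    show "integrable \<mu> (\<lambda>x. g x powr p + A * g x powr q)" using g(2) p by simp
    show "AE x in \<mu>. norm (H x (g x)) \<le> norm (g x powr p + A * g x powr q)"
      using H_le A by (intro AE_I2) (simp add: H_nonneg)
  qed (use g(1) in measurable)
  show "integrable \<mu> (\<lambda>x. H x \<bar>\<phi> x\<bar>)" using * 1 by simp
  show "integrable \<mu> (\<lambda>x. H x (norm (grad \<phi> x)))" using * 2 by simp
qed

lemma sobolev:
  assumes s: "1 < s" "s < critical_exponent (real DIM('a)) p"
  obtains C where "0 < C" "\<And>\<phi>. \<phi> \<in> test \<Longrightarrow> (\<integral>x. \<bar>\<phi> x\<bar> powr s \<partial>\<mu>) \<le> C * (\<integral>x. norm (grad \<phi> x) powr p \<partial>\<mu>) powr (s / p)"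
proof -
  obtain C where C: "0 < C" "\<And>u. u \<in> test_functions \<Omega> \<Longrightarrow>
    (\<integral>x. \<bar>u x\<bar> powr s \<partial>lborel) \<le> C * (\<integral>x. norm (grad u x) powr p \<partial>lborel) powr (s / p)"
    by (rule sobolev_test_functions[OF bounded_\<Omega> p(1,3) s]) blast
  show thesis
  proof (rule that[OF C(1)])
    fix \<phi> assume \<phi>: "\<phi> \<in> test"
    note [measurable] = test_functions_measurable[OF \<phi>]
    show "(\<integral>x. \<bar>\<phi> x\<bar> powr s \<partial>\<mu>) \<le> C * (\<integral>x. norm (grad \<phi> x) powr p \<partial>\<mu>) powr (s / p)"
      using C(2)[OF \<phi>] test_functions_zero_outside[OF \<phi>]
      by (subst (1 2) lebesgue_on_borel(1)[OF \<Omega>_borel]) auto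
  qed
qed

lemma grad_powr_le_H:
  assumes "\<phi> \<in> test" shows "(\<integral>x. norm (grad \<phi> x) powr p \<partial>\<mu>) \<le> (\<integral>x. H x (norm (grad \<phi> x)) \<partial>\<mu>)"
  using integrable_powr_of_H(2)[OF test_functions_measurable_on(2)[OF assms] test_integrable(4)[OF assms]] .

lemma sobolev_tendsto:
  assumes s: "1 < s" "s < critical_exponent (real DIM('a)) p" and e: "0 < \<epsilon>"
  obtains \<delta> where "0 < \<delta>" "\<And>\<phi>. \<phi> \<in> test \<Longrightarrow> (\<integral>x. H x (norm (grad \<phi> x)) \<partial>\<mu>) \<le> \<delta> \<Longrightarrow> (\<integral>x. \<bar>\<phi> x\<bar> powr s \<partial>\<mu>) \<le> \<epsilon>"
proof -
  obtain C where C: "0 < C" "\<And>\<phi>. \<phi> \<in> test \<Longrightarrow> (\<integral>x. \<bar>\<phi> x\<bar> powr s \<partial>\<mu>) \<le> C * (\<integral>x. norm (grad \<phi> x) powr p \<partial>\<mu>) powr (s / p)"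
    by (rule sobolev[OF s]) blast
  define \<delta> where "\<delta> = (\<epsilon> / C) powr (p / s)"
  show thesis
  proof (rule that)
    show "0 < \<delta>" using e C by (simp add: \<delta>_def)
    fix \<phi> assume \<phi>: "\<phi> \<in> test" and le: "(\<integral>x. H x (norm (grad \<phi> x)) \<partial>\<mu>) \<le> \<delta>"
    have "(\<integral>x. norm (grad \<phi> x) powr p \<partial>\<mu>) powr (s / p) \<le> \<delta> powr (s / p)"
      using le grad_powr_le_H[OF \<phi>] p s by (intro powr_mono2) auto
    also have "\<dots> = \<epsilon> / C" using e C p s by (simp add: \<delta>_def powr_powr)
    finally show "(\<integral>x. \<bar>\<phi> x\<bar> powr s \<partial>\<mu>) \<le> \<epsilon>"
      using C(1) order_trans[OF C(2)[OF \<phi>] mult_left_mono[of _ "\<epsilon> / C" C]] by simp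
  qed
qed

lemma sobolev_H_tendsto:
  assumes e: "0 < \<epsilon>"
  obtains \<delta> where "0 < \<delta>" "\<And>\<phi>. \<phi> \<in> test \<Longrightarrow> (\<integral>x. H x (norm (grad \<phi> x)) \<partial>\<mu>) \<le> \<delta> \<Longrightarrow> (\<integral>x. H x \<bar>\<phi> x\<bar> \<partial>\<mu>) \<le> \<epsilon>"
proof -
  have e2: "0 < \<epsilon> / 2" "0 < \<epsilon> / (2 * (A + 1))" using e A by simp_all
  have q: "1 < q" "p < critical_exponent (real DIM('a)) p" using p by simp_all
  obtain d1 where d1: "0 < d1" "\<And>\<phi>. \<phi> \<in> test \<Longrightarrow> (\<integral>x. H x (norm (grad \<phi> x)) \<partial>\<mu>) \<le> d1 \<Longrightarrow> (\<integral>x. \<bar>\<phi> x\<bar> powr p \<partial>\<mu>) \<le> \<epsilon> / 2"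
    by (rule sobolev_tendsto[OF p(1) q(2) e2(1)]) blast
  obtain d2 where d2: "0 < d2" "\<And>\<phi>. \<phi> \<in> test \<Longrightarrow> (\<integral>x. H x (norm (grad \<phi> x)) \<partial>\<mu>) \<le> d2 \<Longrightarrow> (\<integral>x. \<bar>\<phi> x\<bar> powr q \<partial>\<mu>) \<le> \<epsilon> / (2 * (A + 1))"
    by (rule sobolev_tendsto[OF q(1) p(4) e2(2)]) blast
  show thesis
  proof (rule that)
    show "0 < min d1 d2" using d1 d2 by simp
    fix \<phi> assume \<phi>: "\<phi> \<in> test" and le: "(\<integral>x. H x (norm (grad \<phi> x)) \<partial>\<mu>) \<le> min d1 d2"
    have i: "integrable \<mu> (\<lambda>x. \<bar>\<phi> x\<bar> powr p)" "integrable \<mu> (\<lambda>x. \<bar>\<phi> x\<bar> powr q)"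
      using test_integrable(1)[OF \<phi>] p by auto
    have "(\<integral>x. H x \<bar>\<phi> x\<bar> \<partial>\<mu>) \<le> (\<integral>x. \<bar>\<phi> x\<bar> powr p + A * \<bar>\<phi> x\<bar> powr q \<partial>\<mu>)"
      using i by (intro integral_mono test_integrable \<phi>) (auto simp: H_le)
    also have "\<dots> = (\<integral>x. \<bar>\<phi> x\<bar> powr p \<partial>\<mu>) + A * (\<integral>x. \<bar>\<phi> x\<bar> powr q \<partial>\<mu>)" using i by simp
    also have "\<dots> \<le> \<epsilon> / 2 + A * (\<epsilon> / (2 * (A + 1)))"
      using d1(2)[OF \<phi>] d2(2)[OF \<phi>] le A by (intro add_mono mult_left_mono) auto
    also have "\<dots> \<le> \<epsilon>"
    proof -
      have "A * (\<epsilon> / (2 * (A + 1))) \<le> (A + 1) * (\<epsilon> / (2 * (A + 1)))" using e2 by (intro mult_right_mono) auto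
      also have "\<dots> = \<epsilon> / 2" using A by (simp add: divide_simps)
      finally show ?thesis by linarith
    qed
    finally show "(\<integral>x. H x \<bar>\<phi> x\<bar> \<partial>\<mu>) \<le> \<epsilon>" .
  qed
qed

lemma wgrad_diff_test:
  assumes G: "is_weak_gradient \<Omega> u G" and \<phi>: "\<phi> \<in> test"
  shows "AE x in \<mu>. wgrad \<Omega> (\<lambda>x. u x - \<phi> x) x = G x - grad \<phi> x"
  by (rule wgrad_AE_eq(2)[OF open_\<Omega> is_weak_gradient_diff[OF open_\<Omega> G is_weak_gradient_test_function[OF open_\<Omega> bounded_\<Omega> \<phi>]]])

lemma integral_H_cong:
  fixes v w :: "'a \<Rightarrow> 'b::euclidean_space"
  assumes v: "v \<in> borel_measurable \<mu>" and ae: "AE x in \<mu>. w x = v x"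
  shows "w \<in> borel_measurable \<mu>" "integrable \<mu> (\<lambda>x. H x (norm (w x))) \<longleftrightarrow> integrable \<mu> (\<lambda>x. H x (norm (v x)))"
    "(\<integral>x. H x (norm (w x)) \<partial>\<mu>) = (\<integral>x. H x (norm (v x)) \<partial>\<mu>)"
proof -
  note [measurable] = v
  show [measurable]: "w \<in> borel_measurable \<mu>"
    by (rule borel_measurable_lebesgue_on_AE[OF \<Omega>_lebesgue v]) (use ae in eventually_elim, simp)
  have ae': "AE x in \<mu>. H x (norm (w x)) = H x (norm (v x))" using ae by eventually_elim simp
  show "integrable \<mu> (\<lambda>x. H x (norm (w x))) \<longleftrightarrow> integrable \<mu> (\<lambda>x. H x (norm (v x)))"
    by (rule integrable_cong_AE[OF _ _ ae']) measurable
  show "(\<integral>x. H x (norm (w x)) \<partial>\<mu>) = (\<integral>x. H x (norm (v x)) \<partial>\<mu>)"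
    by (rule integral_cong_AE[OF _ _ ae']) measurable
qed

section \<open>Members of \<open>W1H0\<close> as limits of test functions\<close>

lemma W1H0_D:
  assumes u: "u \<in> W1H0 \<Omega> a p q"
  shows "u \<in> borel_measurable \<mu>" "integrable \<mu> (\<lambda>x. H x \<bar>u x\<bar>)"
    "is_weak_gradient \<Omega> u (wgrad \<Omega> u)" "wgrad \<Omega> u \<in> borel_measurable \<mu>" "integrable \<mu> (\<lambda>x. H x (norm (wgrad \<Omega> u x)))"
proof -
  have u': "u \<in> LH \<Omega> a p q" "\<exists>G. is_weak_gradient \<Omega> u G" "(\<lambda>x. norm (wgrad \<Omega> u x)) \<in> LH \<Omega> a p q"
    using u by (auto simp: W1H0_def W1H_def)
  show "u \<in> borel_measurable \<mu>" "integrable \<mu> (\<lambda>x. H x \<bar>u x\<bar>)" using u'(1) by (auto simp: mem_LH_iff)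
  show w: "is_weak_gradient \<Omega> u (wgrad \<Omega> u)" using u'(2) wgrad_AE_eq(1)[OF open_\<Omega>] by blast
  show "wgrad \<Omega> u \<in> borel_measurable \<mu>" by (rule is_weak_gradient_measurable[OF open_\<Omega> w])
  show "integrable \<mu> (\<lambda>x. H x (norm (wgrad \<Omega> u x)))" using u'(3) by (auto simp: mem_LH_iff)
qed

text \<open>This is the closure condition read in the modular. The norm in it involves
  \<open>wgrad\<close> of the difference \<open>u - \<phi>\<close>, a choice of its own, which
  equals \<open>wgrad \<Omega> u x - grad \<phi> x\<close> only almost everywhere.\<close>

lemma W1H0_approx:
  assumes u: "u \<in> W1H0 \<Omega> a p q" and e: "0 < \<epsilon>"
  obtains \<phi> where "\<phi> \<in> test" "(\<integral>x. H x \<bar>u x - \<phi> x\<bar> \<partial>\<mu>) \<le> \<epsilon>" "(\<integral>x. H x (norm (wgrad \<Omega> u x - grad \<phi> x)) \<partial>\<mu>) \<le> \<epsilon>"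
proof -
  note D = W1H0_D[OF u]
  define e' where "e' = min \<epsilon> 1"
  have e': "0 < e'" "e' \<le> \<epsilon>" "e' \<le> 1" using e by (auto simp: e'_def)
  obtain \<phi> where \<phi>: "\<phi> \<in> test" and nrm: "W1H_norm \<Omega> a p q (\<lambda>x. u x - \<phi> x) < e'"
    using u e' unfolding W1H0_def by blast
  let ?w = "\<lambda>x. u x - \<phi> x" and ?D = "\<lambda>x. wgrad \<Omega> u x - grad \<phi> x"
  note \<phi>m = test_functions_measurable_on[OF \<phi>]
  have wL: "?w \<in> LH \<Omega> a p q"
    using integrable_H_diff(1)[OF D(1) \<phi>m(1)] D(1,2) \<phi>m test_integrable(3)[OF \<phi>] by (auto simp: mem_LH_iff)
  have Dm: "?D \<in> borel_measurable \<mu>" using D(4) \<phi>m by (intro borel_measurable_diff)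
  have Di: "integrable \<mu> (\<lambda>x. H x (norm (?D x)))"
    by (rule integrable_H_diff(1)[OF D(4) \<phi>m(2) D(5) test_integrable(4)[OF \<phi>]])
  note cong = integral_H_cong[OF Dm wgrad_diff_test[OF D(3) \<phi>]]
  have gL: "(\<lambda>x. norm (wgrad \<Omega> ?w x)) \<in> LH \<Omega> a p q"
    using cong(1,2) Di by (auto simp: mem_LH_iff)
  have lt: "LH_norm \<Omega> a p q ?w < e'" "LH_norm \<Omega> a p q (\<lambda>x. norm (wgrad \<Omega> ?w x)) < e'"
    using nrm LH_norm_nonneg(1)[OF wL] LH_norm_nonneg(1)[OF gL] unfolding W1H_norm_def by linarith+
  show thesis
  proof (rule that[OF \<phi>])
    show "(\<integral>x. H x \<bar>u x - \<phi> x\<bar> \<partial>\<mu>) \<le> \<epsilon>" using LH_norm_less_imp[OF wL lt(1) e'(3)] e' by simp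
    show "(\<integral>x. H x (norm (?D x)) \<partial>\<mu>) \<le> \<epsilon>" using LH_norm_less_imp[OF gL lt(2) e'(3)] e' cong(3) by simp
  qed
qed

text \<open>The tool that recognises a limit of approximations as a member of the space: modular
  convergence implies \<open>L^1\<close> convergence, which identifies the weak gradient, and
  \<open>LH_norm_le\<close> leads back from the modular to the norm.\<close>

lemma W1H0_I:
  assumes v: "\<And>n. v n \<in> test" and u: "u \<in> borel_measurable \<mu>" and G: "G \<in> borel_measurable \<mu>"
    and iu: "\<And>n. integrable \<mu> (\<lambda>x. H x \<bar>v n x - u x\<bar>)" and iG: "\<And>n. integrable \<mu> (\<lambda>x. H x (norm (grad (v n) x - G x)))"
    and lu: "(\<lambda>n. \<integral>x. H x \<bar>v n x - u x\<bar> \<partial>\<mu>) \<longlonglongrightarrow> 0" and lG: "(\<lambda>n. \<integral>x. H x (norm (grad (v n) x - G x)) \<partial>\<mu>) \<longlonglongrightarrow> 0"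
  shows "u \<in> W1H0 \<Omega> a p q" "AE x in \<mu>. wgrad \<Omega> u x = G x"
proof -
  note vm = test_functions_measurable_on[OF v]
  note vi = test_integrable[OF v]
  have iu': "integrable \<mu> (\<lambda>x. H x \<bar>u x - v n x\<bar>)" for n using iu[of n] by (simp add: abs_minus_commute)
  have iG': "integrable \<mu> (\<lambda>x. H x (norm (G x - grad (v n) x)))" for n using iG[of n] by (simp add: norm_minus_commute)
  have Hu: "integrable \<mu> (\<lambda>x. H x \<bar>u x\<bar>)" using integrable_if_H_diff[OF u vm(1)] iu' vi(3) by simp
  have HG: "integrable \<mu> (\<lambda>x. H x (norm (G x)))" by (rule integrable_if_H_diff[OF G vm(2) iG' vi(4)])
  have uL: "u \<in> LH \<Omega> a p q" using u Hu by (simp add: mem_LH_iff)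
  have wG: "is_weak_gradient \<Omega> u G"
  proof (rule is_weak_gradient_limit[OF open_\<Omega> bounded_\<Omega> v])
    show "integrable \<mu> u" using integrable_powr_of_H(3)[OF u] Hu by simp
    show "integrable \<mu> G" by (rule integrable_powr_of_H(3)[OF G HG])
    show "(\<lambda>n. \<integral>x. \<bar>v n x - u x\<bar> \<partial>\<mu>) \<longlonglongrightarrow> 0" using L1_tendsto_of_H[OF u vm(1)] iu lu by simp
    show "(\<lambda>n. \<integral>x. norm (grad (v n) x - G x) \<partial>\<mu>) \<longlonglongrightarrow> 0" by (rule L1_tendsto_of_H[OF G vm(2) iG lG])
  qed
  show ae: "AE x in \<mu>. wgrad \<Omega> u x = G x" by (rule wgrad_AE_eq(2)[OF open_\<Omega> wG])
  have gL: "(\<lambda>x. norm (wgrad \<Omega> u x)) \<in> LH \<Omega> a p q"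
    using integral_H_cong(1,2)[OF G ae] HG by (auto simp: mem_LH_iff)
  have "\<exists>\<phi>\<in>test. W1H_norm \<Omega> a p q (\<lambda>x. u x - \<phi> x) < \<epsilon>" if e: "0 < \<epsilon>" for \<epsilon>
  proof -
    \<comment> \<open>Two norms of at most \<open>\<epsilon> / 3\<close> sum to less than
      \<open>\<epsilon>\<close>; the bound 1 is a premise of \<open>LH_norm_le\<close>.\<close>
    define e' where "e' = min (\<epsilon> / 3) 1"
    have e': "0 < e'" "e' \<le> \<epsilon> / 3" "e' \<le> 1" using e by (auto simp: e'_def)
    have "0 < e' powr q" using e' by simp
    then have "\<forall>\<^sub>F n in sequentially. (\<integral>x. H x \<bar>v n x - u x\<bar> \<partial>\<mu>) < e' powr q \<and> (\<integral>x. H x (norm (grad (v n) x - G x)) \<partial>\<mu>) < e' powr q"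
      using order_tendstoD(2)[OF lu] order_tendstoD(2)[OF lG] by (auto intro: eventually_conj)
    then obtain n where n: "(\<integral>x. H x \<bar>v n x - u x\<bar> \<partial>\<mu>) < e' powr q" "(\<integral>x. H x (norm (grad (v n) x - G x)) \<partial>\<mu>) < e' powr q"
      using eventually_happens'[OF sequentially_bot] by blast
    let ?w = "\<lambda>x. u x - v n x" and ?D = "\<lambda>x. G x - grad (v n) x"
    have wL: "?w \<in> LH \<Omega> a p q" using u vm iu' by (auto simp: mem_LH_iff)
    have Dm: "?D \<in> borel_measurable \<mu>" using G vm by (intro borel_measurable_diff)
    note cong = integral_H_cong[OF Dm wgrad_diff_test[OF wG v]]
    have gwL: "(\<lambda>x. norm (wgrad \<Omega> ?w x)) \<in> LH \<Omega> a p q" using cong(1,2) iG' by (auto simp: mem_LH_iff)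
    have "LH_norm \<Omega> a p q ?w \<le> e'" using n(1) by (intro LH_norm_le[OF wL e'(1,3)]) (simp add: abs_minus_commute)
    moreover have "LH_norm \<Omega> a p q (\<lambda>x. norm (wgrad \<Omega> ?w x)) \<le> e'"
      using n(2) cong(3) by (intro LH_norm_le[OF gwL e'(1,3)]) (simp add: norm_minus_commute)
    ultimately have "W1H_norm \<Omega> a p q ?w < \<epsilon>" using e' e unfolding W1H_norm_def by linarith
    then show ?thesis using v by blast
  qed
  then show "u \<in> W1H0 \<Omega> a p q" using uL gL wG unfolding W1H0_def W1H_def by blast
qed

lemma H_tendsto:
  assumes "f \<longlonglongrightarrow> l" "\<And>n. 0 \<le> f n"
  shows "(\<lambda>n. H x (f n)) \<longlonglongrightarrow> H x l"
  unfolding H_def using assms p by (intro tendsto_intros tendsto_powr') auto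

text \<open>The inequality passes from test functions to \<open>u\<close> along an almost everywhere
  convergent subsequence, by Fatou's lemma. It is stated for the difference to a test function, the
  form in which closeness is measured later; \<open>\<phi> = 0\<close> gives the inequality for
  \<open>u\<close> itself.\<close>

lemma sobolev_W1H0:
  assumes s: "1 < s" "s < critical_exponent (real DIM('a)) p"
  obtains C where "0 < C"
    "\<And>u \<phi>. u \<in> W1H0 \<Omega> a p q \<Longrightarrow> \<phi> \<in> test \<Longrightarrow> integrable \<mu> (\<lambda>x. \<bar>u x - \<phi> x\<bar> powr s)"
    "\<And>u \<phi>. u \<in> W1H0 \<Omega> a p q \<Longrightarrow> \<phi> \<in> test \<Longrightarrow>
      (\<integral>x. \<bar>u x - \<phi> x\<bar> powr s \<partial>\<mu>) \<le> C * (\<integral>x. H x (norm (wgrad \<Omega> u x - grad \<phi> x)) \<partial>\<mu>) powr (s / p)"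
proof -
  obtain C where C: "0 < C" "\<And>\<phi>. \<phi> \<in> test \<Longrightarrow> (\<integral>x. \<bar>\<phi> x\<bar> powr s \<partial>\<mu>) \<le> C * (\<integral>x. norm (grad \<phi> x) powr p \<partial>\<mu>) powr (s / p)"
    by (rule sobolev[OF s]) blast
  define D where "D = C * (2 powr q) powr (s / p)"
  have main: "integrable \<mu> (\<lambda>x. \<bar>u x - \<phi> x\<bar> powr s) \<and>
      (\<integral>x. \<bar>u x - \<phi> x\<bar> powr s \<partial>\<mu>) \<le> D * (\<integral>x. H x (norm (wgrad \<Omega> u x - grad \<phi> x)) \<partial>\<mu>) powr (s / p)"
    if u: "u \<in> W1H0 \<Omega> a p q" and \<phi>: "\<phi> \<in> test" for u \<phi>
  proof -
    note U = W1H0_D[OF u]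
    define G where "G = wgrad \<Omega> u"
    have Gm: "G \<in> borel_measurable \<mu>" using U(4) by (simp add: G_def)
    define X where "X = (\<integral>x. H x (norm (G x - grad \<phi> x)) \<partial>\<mu>)"
    have "\<exists>\<psi>. \<psi> \<in> test \<and> (\<integral>x. H x \<bar>u x - \<psi> x\<bar> \<partial>\<mu>) \<le> inverse (real (Suc k)) \<and> (\<integral>x. H x (norm (G x - grad \<psi> x)) \<partial>\<mu>) \<le> inverse (real (Suc k))" for k
    proof -
      have "0 < inverse (real (Suc k))" by simp
      from W1H0_approx[OF u this] show ?thesis unfolding G_def by blast
    qed
    then have "\<forall>k. \<exists>\<psi>. \<psi> \<in> test \<and> (\<integral>x. H x \<bar>u x - \<psi> x\<bar> \<partial>\<mu>) \<le> inverse (real (Suc k)) \<and> (\<integral>x. H x (norm (G x - grad \<psi> x)) \<partial>\<mu>) \<le> inverse (real (Suc k))" ..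
    from choice[OF this] obtain \<psi> where \<psi>: "\<And>k. \<psi> k \<in> test" "\<And>k. (\<integral>x. H x \<bar>u x - \<psi> k x\<bar> \<partial>\<mu>) \<le> inverse (real (Suc k))"
      "\<And>k. (\<integral>x. H x (norm (G x - grad (\<psi> k) x)) \<partial>\<mu>) \<le> inverse (real (Suc k))" by blast
    note \<psi>m = test_functions_measurable_on[OF \<psi>(1)] and \<phi>m = test_functions_measurable_on[OF \<phi>]
    note [measurable] = U(1) Gm \<psi>m \<phi>m
    have Hi: "integrable \<mu> (\<lambda>x. H x (norm (\<psi> k x - u x)))" for k
      using integrable_H_diff(1)[OF \<psi>m(1) U(1)] test_integrable(3)[OF \<psi>(1)] U(2) by simp
    have l: "(\<lambda>k. \<integral>x. H x (norm (\<psi> k x - u x)) \<partial>\<mu>) \<longlonglongrightarrow> 0"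
    proof (rule tendsto_sandwich[OF _ _ tendsto_const LIMSEQ_inverse_real_of_nat])
      show "\<forall>\<^sub>F k in sequentially. 0 \<le> (\<integral>x. H x (norm (\<psi> k x - u x)) \<partial>\<mu>)"
        by (intro always_eventually allI Bochner_Integration.integral_nonneg) (simp add: H_nonneg)
      show "\<forall>\<^sub>F k in sequentially. (\<integral>x. H x (norm (\<psi> k x - u x)) \<partial>\<mu>) \<le> inverse (real (Suc k))"
        using \<psi>(2) by (intro always_eventually allI) (simp add: abs_minus_commute)
    qed
    have wi: "integrable \<mu> (\<lambda>x. \<psi> k x - u x)" for k
      by (rule integrable_powr_of_H(3)[OF _ Hi]) measurable
    obtain r where r: "strict_mono r" "AE x in \<mu>. (\<lambda>k. \<psi> (r k) x - u x) \<longlonglongrightarrow> 0"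
      using tendsto_L1_AE_subseq[OF wi L1_tendsto_of_H[OF U(1) \<psi>m(1) Hi l]] by blast
    define c where "c k = C * (2 powr q * (inverse (real (Suc (r k))) + X)) powr (s / p)" for k
    have X0: "0 \<le> X" unfolding X_def by (intro Bochner_Integration.integral_nonneg) (simp add: H_nonneg)
    have dt: "(\<lambda>x. \<psi> k x - \<phi> x) \<in> test" "grad (\<lambda>x. \<psi> k x - \<phi> x) x = grad (\<psi> k) x - grad \<phi> x" for k x
      by (rule test_functions_diff[OF \<psi>(1) \<phi>])+
    have bound: "(\<integral>x. \<bar>\<psi> (r k) x - \<phi> x\<bar> powr s \<partial>\<mu>) \<le> c k" for k
    proof -
      have "(\<integral>x. norm (grad (\<lambda>x. \<psi> (r k) x - \<phi> x) x) powr p \<partial>\<mu>) \<le> (\<integral>x. H x (norm (grad (\<lambda>x. \<psi> (r k) x - \<phi> x) x)) \<partial>\<mu>)"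
        by (rule grad_powr_le_H[OF dt(1)])
      also have "\<dots> = (\<integral>x. H x (norm ((G x - grad \<phi> x) - (G x - grad (\<psi> (r k)) x))) \<partial>\<mu>)"
        by (simp add: dt(2))
      also have "\<dots> \<le> 2 powr q * ((\<integral>x. H x (norm (G x - grad \<phi> x)) \<partial>\<mu>) + (\<integral>x. H x (norm (G x - grad (\<psi> (r k)) x)) \<partial>\<mu>))"
        using U(4,5) \<phi>m \<psi>m unfolding G_def
        by (intro integrable_H_diff(2) integrable_H_diff(1) borel_measurable_diff test_integrable(4) \<phi> \<psi>) auto
      also have "\<dots> \<le> 2 powr q * (inverse (real (Suc (r k))) + X)"
        using \<psi>(3)[of "r k"] by (intro mult_left_mono) (auto simp: X_def)
      finally have "(\<integral>x. norm (grad (\<lambda>x. \<psi> (r k) x - \<phi> x) x) powr p \<partial>\<mu>) \<le> 2 powr q * (inverse (real (Suc (r k))) + X)" .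
      then have "(\<integral>x. norm (grad (\<lambda>x. \<psi> (r k) x - \<phi> x) x) powr p \<partial>\<mu>) powr (s / p) \<le> (2 powr q * (inverse (real (Suc (r k))) + X)) powr (s / p)"
        using s p by (intro powr_mono2) auto
      then have "C * (\<integral>x. norm (grad (\<lambda>x. \<psi> (r k) x - \<phi> x) x) powr p \<partial>\<mu>) powr (s / p) \<le> c k"
        unfolding c_def using C(1) by (intro mult_left_mono) auto
      then show ?thesis using C(2)[OF dt(1), of "r k"] by simp
    qed
    have cl: "c \<longlonglongrightarrow> C * (2 powr q * (0 + X)) powr (s / p)"
      unfolding c_def using s p X0 LIMSEQ_subseq_LIMSEQ[OF LIMSEQ_inverse_real_of_nat r(1)]
      by (intro tendsto_intros tendsto_powr') (auto simp: o_def)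
    have ae: "AE x in \<mu>. (\<lambda>k. \<bar>\<psi> (r k) x - \<phi> x\<bar> powr s) \<longlonglongrightarrow> \<bar>u x - \<phi> x\<bar> powr s"
      using r(2)
    proof eventually_elim
      case (elim x)
      have "(\<lambda>k. (\<psi> (r k) x - u x) + (u x - \<phi> x)) \<longlonglongrightarrow> 0 + (u x - \<phi> x)" by (intro tendsto_add elim tendsto_const)
      then have "(\<lambda>k. \<psi> (r k) x - \<phi> x) \<longlonglongrightarrow> u x - \<phi> x" by simp
      then show ?case using s by (intro tendsto_powr' tendsto_rabs tendsto_const) auto
    qed
    have ti: "integrable \<mu> (\<lambda>x. \<bar>\<psi> (r k) x - \<phi> x\<bar> powr s)" for k using test_integrable(1)[OF dt(1)] s by simp
    have "(2 powr q * (0 + X)) powr (s / p) = (2 powr q) powr (s / p) * X powr (s / p)"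
      using X0 by (simp add: powr_mult)
    then show ?thesis
      using fatou_bound[OF ti _ bound cl _ ae] unfolding D_def X_def G_def by (simp add: mult.assoc)
  qed
  show thesis by (rule that[of D]) (use main C in \<open>auto simp: D_def\<close>)
qed

text \<open>In the Cauchy condition one index is sent to infinity along \<open>r\<close>; Fatou's
  lemma then bounds the distance to the limit by the same \<open>\<epsilon>\<close>.\<close>

lemma H_complete:
  fixes w :: "nat \<Rightarrow> 'a \<Rightarrow> 'b::euclidean_space"
  assumes m: "\<And>n. w n \<in> borel_measurable \<mu>" "l \<in> borel_measurable \<mu>" and i: "\<And>n. integrable \<mu> (\<lambda>x. H x (norm (w n x)))"
    and Cauchy: "\<And>\<epsilon>. 0 < \<epsilon> \<Longrightarrow> \<exists>n0. \<forall>m\<ge>n0. \<forall>n\<ge>n0. (\<integral>x. H x (norm (w m x - w n x)) \<partial>\<mu>) \<le> \<epsilon>"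
    and r: "strict_mono r" "AE x in \<mu>. (\<lambda>n. w (r n) x) \<longlonglongrightarrow> l x"
  shows "integrable \<mu> (\<lambda>x. H x (norm (w n x - l x)))" "(\<lambda>n. \<integral>x. H x (norm (w n x - l x)) \<partial>\<mu>) \<longlonglongrightarrow> 0"
proof -
  note [measurable] = m
  have key: "\<exists>n0. \<forall>n\<ge>n0. integrable \<mu> (\<lambda>x. H x (norm (l x - w n x))) \<and> (\<integral>x. H x (norm (l x - w n x)) \<partial>\<mu>) \<le> \<epsilon>" if e: "0 < \<epsilon>" for \<epsilon>
  proof -
    obtain n0 where n0: "\<And>m n. n0 \<le> m \<Longrightarrow> n0 \<le> n \<Longrightarrow> (\<integral>x. H x (norm (w m x - w n x)) \<partial>\<mu>) \<le> \<epsilon>" using Cauchy[OF e] by blast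
    have "integrable \<mu> (\<lambda>x. H x (norm (l x - w n x))) \<and> (\<integral>x. H x (norm (l x - w n x)) \<partial>\<mu>) \<le> \<epsilon>" if n: "n0 \<le> n" for n
    proof -
      have gi: "integrable \<mu> (\<lambda>x. H x (norm (w (r (k + n0)) x - w n x)))" for k by (rule integrable_H_diff(1)[OF m(1) m(1) i i])
      have gb: "(\<integral>x. H x (norm (w (r (k + n0)) x - w n x)) \<partial>\<mu>) \<le> \<epsilon>" for k
        using n seq_suble[OF r(1), of "k + n0"] by (intro n0) auto
      have ae: "AE x in \<mu>. (\<lambda>k. H x (norm (w (r (k + n0)) x - w n x))) \<longlonglongrightarrow> H x (norm (l x - w n x))"
        using r(2) by eventually_elim (intro H_tendsto tendsto_norm tendsto_diff tendsto_const LIMSEQ_ignore_initial_segment; simp)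
      show ?thesis using fatou_bound[OF gi _ gb tendsto_const _ ae] by (simp add: H_nonneg)
    qed
    then show ?thesis by blast
  qed
  obtain n0 where n0: "\<forall>n\<ge>n0. integrable \<mu> (\<lambda>x. H x (norm (l x - w n x)))" using key[OF zero_less_one] by blast
  have li: "integrable \<mu> (\<lambda>x. H x (norm (l x)))" by (rule integrable_if_H_diff[OF m(2) m(1)[of n0] _ i]) (use n0 in simp)
  show "integrable \<mu> (\<lambda>x. H x (norm (w n x - l x)))" for n by (rule integrable_H_diff(1)[OF m(1,2) i li])
  show "(\<lambda>n. \<integral>x. H x (norm (w n x - l x)) \<partial>\<mu>) \<longlonglongrightarrow> 0"
  proof (rule LIMSEQ_I)
    fix \<epsilon> :: real assume e: "0 < \<epsilon>"
    then have "0 < \<epsilon> / 2" by simp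
    from key[OF this] obtain n1 where n1: "\<And>n. n1 \<le> n \<Longrightarrow> (\<integral>x. H x (norm (l x - w n x)) \<partial>\<mu>) \<le> \<epsilon> / 2" by blast
    have "0 \<le> (\<integral>x. H x (norm (w n x - l x)) \<partial>\<mu>)" for n
      by (intro Bochner_Integration.integral_nonneg) (simp add: H_nonneg)
    then show "\<exists>n0. \<forall>n\<ge>n0. norm ((\<integral>x. H x (norm (w n x - l x)) \<partial>\<mu>) - 0) < \<epsilon>"
      using n1 e by (intro exI[of _ n1]) (auto simp: norm_minus_commute intro: le_less_trans[of _ "\<epsilon> / 2"])
  qed
qed

lemma test_Cauchy_converges:
  assumes v: "\<And>n. v n \<in> test"
    and Cauchy: "\<And>\<epsilon>. 0 < \<epsilon> \<Longrightarrow> \<exists>n0. \<forall>m\<ge>n0. \<forall>n\<ge>n0. (\<integral>x. H x (norm (grad (v m) x - grad (v n) x)) \<partial>\<mu>) \<le> \<epsilon>"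
  obtains u r where "strict_mono r" "u \<in> W1H0 \<Omega> a p q" "AE x in \<mu>. (\<lambda>n. v (r n) x) \<longlonglongrightarrow> u x"
    "AE x in \<mu>. (\<lambda>n. grad (v (r n)) x) \<longlonglongrightarrow> wgrad \<Omega> u x"
    "(\<lambda>n. \<integral>x. H x (norm (grad (v n) x - wgrad \<Omega> u x)) \<partial>\<mu>) \<longlonglongrightarrow> 0"
proof -
  note vm = test_functions_measurable_on[OF v] and vi = test_integrable[OF v]
  have vi3: "integrable \<mu> (\<lambda>x. H x (norm (v n x)))" for n using vi(3) by simp
  note dt = test_functions_diff[OF v v]
  have Cauchy': "\<exists>n0. \<forall>m\<ge>n0. \<forall>n\<ge>n0. (\<integral>x. H x (norm (v m x - v n x)) \<partial>\<mu>) \<le> \<epsilon>" if e: "0 < \<epsilon>" for \<epsilon>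
  proof -
    obtain \<delta> where d: "0 < \<delta>" "\<And>\<phi>. \<phi> \<in> test \<Longrightarrow> (\<integral>x. H x (norm (grad \<phi> x)) \<partial>\<mu>) \<le> \<delta> \<Longrightarrow> (\<integral>x. H x \<bar>\<phi> x\<bar> \<partial>\<mu>) \<le> \<epsilon>"
      by (rule sobolev_H_tendsto[OF e]) blast
    obtain n0 where "\<forall>m\<ge>n0. \<forall>n\<ge>n0. (\<integral>x. H x (norm (grad (v m) x - grad (v n) x)) \<partial>\<mu>) \<le> \<delta>" using Cauchy[OF d(1)] by blast
    then show ?thesis using d(2)[OF dt(1)] by (intro exI[of _ n0]) (simp add: dt(2))
  qed
  \<comment> \<open>Pairing function and gradient yields one subsequence along which both converge
    almost everywhere.\<close>
  define w where "w n x = (v n x, grad (v n) x)" for n x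
  have wi: "integrable \<mu> (w n)" for n
  proof -
    have "integrable \<mu> (\<lambda>x. (v n x, 0 :: 'a) + (0 :: real, grad (v n) x))"
      by (intro Bochner_Integration.integrable_add
          integrable_bounded_linear[OF bounded_linear_Pair[OF bounded_linear_ident bounded_linear_zero] integrable_powr_of_H(3)[OF vm(1) vi3]]
          integrable_bounded_linear[OF bounded_linear_Pair[OF bounded_linear_zero bounded_linear_ident] integrable_powr_of_H(3)[OF vm(2) vi(4)]])
    then show ?thesis by (simp add: w_def[abs_def])
  qed
  have L1: "\<exists>n0. \<forall>m\<ge>n0. \<forall>n\<ge>n0. (\<integral>x. norm (w m x - w n x) \<partial>\<mu>) \<le> \<epsilon>" if e: "0 < \<epsilon>" for \<epsilon>
  proof -
    have e2: "0 < \<epsilon> / 2" using e by simp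
    obtain d1 where d1: "0 < d1" "\<And>v :: 'a \<Rightarrow> real. v \<in> borel_measurable \<mu> \<Longrightarrow> integrable \<mu> (\<lambda>x. H x (norm (v x))) \<Longrightarrow>
      (\<integral>x. H x (norm (v x)) \<partial>\<mu>) \<le> d1 \<Longrightarrow> (\<integral>x. norm (v x) \<partial>\<mu>) \<le> \<epsilon> / 2" by (rule L1_small_of_H[OF e2, where 'b = real]) blast
    obtain d2 where d2: "0 < d2" "\<And>v :: 'a \<Rightarrow> 'a. v \<in> borel_measurable \<mu> \<Longrightarrow> integrable \<mu> (\<lambda>x. H x (norm (v x))) \<Longrightarrow>
      (\<integral>x. H x (norm (v x)) \<partial>\<mu>) \<le> d2 \<Longrightarrow> (\<integral>x. norm (v x) \<partial>\<mu>) \<le> \<epsilon> / 2" by (rule L1_small_of_H[OF e2, where 'b = 'a]) blast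
    obtain n1 where n1: "\<forall>m\<ge>n1. \<forall>n\<ge>n1. (\<integral>x. H x (norm (v m x - v n x)) \<partial>\<mu>) \<le> d1" using Cauchy'[OF d1(1)] by blast
    obtain n2 where n2: "\<forall>m\<ge>n2. \<forall>n\<ge>n2. (\<integral>x. H x (norm (grad (v m) x - grad (v n) x)) \<partial>\<mu>) \<le> d2" using Cauchy[OF d2(1)] by blast
    show ?thesis
    proof (intro exI[of _ "max n1 n2"] allI impI)
      fix m n assume mn: "max n1 n2 \<le> m" "max n1 n2 \<le> n"
      have i1: "integrable \<mu> (\<lambda>x. v m x - v n x)" "integrable \<mu> (\<lambda>x. grad (v m) x - grad (v n) x)"
        using integrable_powr_of_H(3)[OF vm(1) vi3] integrable_powr_of_H(3)[OF vm(2) vi(4)] by auto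
      have "(\<integral>x. norm (w m x - w n x) \<partial>\<mu>) \<le> (\<integral>x. norm (v m x - v n x) + norm (grad (v m) x - grad (v n) x) \<partial>\<mu>)"
      proof (rule integral_mono)
        show "integrable \<mu> (\<lambda>x. norm (w m x - w n x))" by (intro integrable_norm Bochner_Integration.integrable_diff wi)
        show "integrable \<mu> (\<lambda>x. norm (v m x - v n x) + norm (grad (v m) x - grad (v n) x))"
          by (rule Bochner_Integration.integrable_add[OF integrable_norm[OF i1(1)] integrable_norm[OF i1(2)]])
        show "norm (w m x - w n x) \<le> norm (v m x - v n x) + norm (grad (v m) x - grad (v n) x)" for x
          unfolding w_def diff_Pair by (rule norm_Pair_le)
      qed
      also have "\<dots> = (\<integral>x. norm (v m x - v n x) \<partial>\<mu>) + (\<integral>x. norm (grad (v m) x - grad (v n) x) \<partial>\<mu>)"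
        using i1 by (intro Bochner_Integration.integral_add integrable_norm)
      also have "\<dots> \<le> \<epsilon> / 2 + \<epsilon> / 2"
        using mn n1 n2 vm vi vi3
        by (intro add_mono d1(2) d2(2) borel_measurable_diff integrable_H_diff(1)) auto
      finally show "(\<integral>x. norm (w m x - w n x) \<partial>\<mu>) \<le> \<epsilon>" by simp
    qed
  qed
  obtain r l where r: "strict_mono r" and lm: "l \<in> borel_measurable \<mu>" and ael: "AE x in \<mu>. (\<lambda>n. w (r n) x) \<longlonglongrightarrow> l x"
    by (rule L1_Cauchy_AE_subseq[OF wi L1]) blast
  define u where "u x = fst (l x)" for x
  define G where "G x = snd (l x)" for x
  have um: "u \<in> borel_measurable \<mu>" and Gm: "G \<in> borel_measurable \<mu>" unfolding u_def G_def
    by (rule borel_measurable_continuous_on[where f = fst, OF _ lm], intro continuous_intros)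
      (rule borel_measurable_continuous_on[where f = snd, OF _ lm], intro continuous_intros)
  have aeu: "AE x in \<mu>. (\<lambda>n. v (r n) x) \<longlonglongrightarrow> u x" and aeG: "AE x in \<mu>. (\<lambda>n. grad (v (r n)) x) \<longlonglongrightarrow> G x"
    using ael unfolding w_def u_def G_def by (eventually_elim, force dest: tendsto_fst tendsto_snd)+
  note cu = H_complete[OF vm(1) um vi3 Cauchy' r aeu] and cG = H_complete[OF vm(2) Gm vi(4) Cauchy r aeG]
  have W: "u \<in> W1H0 \<Omega> a p q" "AE x in \<mu>. wgrad \<Omega> u x = G x"
    using W1H0_I[OF v um Gm _ cG(1) _ cG(2)] cu by auto
  show thesis
  proof (rule that[OF r W(1) aeu])
    show "AE x in \<mu>. (\<lambda>n. grad (v (r n)) x) \<longlonglongrightarrow> wgrad \<Omega> u x"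
      using aeG W(2) by eventually_elim simp
    have "(\<integral>x. H x (norm (grad (v n) x - wgrad \<Omega> u x)) \<partial>\<mu>) = (\<integral>x. H x (norm (grad (v n) x - G x)) \<partial>\<mu>)" for n
    proof (rule integral_H_cong(3))
      show "(\<lambda>x. grad (v n) x - G x) \<in> borel_measurable \<mu>" using vm Gm by (intro borel_measurable_diff)
      show "AE x in \<mu>. grad (v n) x - wgrad \<Omega> u x = grad (v n) x - G x" using W(2) by eventually_elim simp
    qed
    then show "(\<lambda>n. \<integral>x. H x (norm (grad (v n) x - wgrad \<Omega> u x)) \<partial>\<mu>) \<longlonglongrightarrow> 0" using cG(2) by simp
  qed
qed

end

section \<open>Separability of the test functions\<close>

lemma test_functions_uniformly_continuous_grad:
  assumes \<Omega>: "bounded \<Omega>" and \<phi>: "\<phi> \<in> test_functions \<Omega>" and e: "0 < \<epsilon>"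
  obtains \<delta> where "0 < \<delta>" "\<And>x y. dist x y < \<delta> \<Longrightarrow> norm (grad \<phi> x - grad \<phi> y) \<le> \<epsilon>"
proof -
  obtain R where R: "\<forall>x\<in>\<Omega>. norm x \<le> R" using \<Omega> unfolding bounded_iff by blast
  have "uniformly_continuous_on (cball 0 (R + 1)) (grad \<phi>)"
    by (intro compact_uniformly_continuous test_functionsD(2)[OF \<phi>] compact_cball)
  then obtain d where d: "0 < d" "\<And>x y. x \<in> cball 0 (R + 1) \<Longrightarrow> y \<in> cball 0 (R + 1) \<Longrightarrow> dist y x < d \<Longrightarrow> dist (grad \<phi> y) (grad \<phi> x) < \<epsilon>"
    using e unfolding uniformly_continuous_on_def by meson
  show thesis
  proof (rule that[of "min d 1"])
    show "0 < min d 1" using d by simp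
    fix x y :: 'a assume xy: "dist x y < min d 1"
    show "norm (grad \<phi> x - grad \<phi> y) \<le> \<epsilon>"
    proof (cases "x \<in> \<Omega> \<or> y \<in> \<Omega>")
      case True
      have "norm x \<le> norm y + dist x y" "norm y \<le> norm x + dist x y"
        using norm_triangle_sub[of x y] norm_triangle_sub[of y x] by (simp_all add: dist_norm norm_minus_commute)
      then have "x \<in> cball 0 (R + 1)" "y \<in> cball 0 (R + 1)" using True R xy by force+
      then have "dist (grad \<phi> x) (grad \<phi> y) < \<epsilon>" using xy by (intro d(2)) auto
      then show ?thesis by (simp add: dist_norm)
    next
      case False
      then show ?thesis using test_functions_zero_outside(2)[OF \<phi>] e by simp
    qed
  qed
qed

text \<open>
  Gradients with a common modulus of continuity are determined up to a uniform error by finitely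
  many rounded values on a grid, so countably many representatives suffice.
\<close>
lemma countable_dense_test_functions:
  fixes \<Omega> :: "'a::euclidean_space set"
  assumes \<Omega>: "bounded \<Omega>"
  obtains S where "countable S" "S \<subseteq> test_functions \<Omega>"
    "\<And>\<phi> \<epsilon>. \<phi> \<in> test_functions \<Omega> \<Longrightarrow> 0 < \<epsilon> \<Longrightarrow> \<exists>\<psi>\<in>S. \<forall>x. norm (grad \<phi> x - grad \<psi> x) \<le> \<epsilon>"
proof -
  obtain R where R: "\<forall>x\<in>\<Omega>. norm x \<le> R" using \<Omega> unfolding bounded_iff by blast
  define N where "N = real DIM('a)"
  have N: "0 < N" by (simp add: N_def)
  define h where "h m = 1 / real (Suc m)" for m
  have h: "0 < h m" for m by (simp add: h_def)
  define T where "T n m = {\<phi> \<in> test_functions \<Omega>. \<forall>x y. norm (x - y) \<le> N * h m \<longrightarrow> norm (grad \<phi> x - grad \<phi> y) \<le> h n}" for n m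
  \<comment> \<open>The lattice indices of all cells that meet the bounded set
    \<open>\<Omega>\<close> are among these. There are finitely many, which keeps the set of codes
    countable.\<close>
  define F where "F m = (Basis :: 'a set) \<rightarrow>\<^sub>E {- (\<lceil>R / h m\<rceil> + 1)..\<lceil>R / h m\<rceil> + 1}" for m
  define code where "code n m \<phi> = (\<lambda>k\<in>F m. \<lambda>i\<in>Basis. \<lfloor>(grad \<phi> (grid_point (h m) k) \<bullet> i) / h n\<rfloor>)" for n m and \<phi> :: "'a \<Rightarrow> real"
  \<comment> \<open>One representative for every code that occurs in a class \<open>T n m\<close>.
    Members of the class with equal codes have gradients within \<open>(N + 2) * h n\<close>: the
    rounding at a common lattice point costs \<open>N * h n\<close>, the modulus of continuity
    \<open>h n\<close> for each of the two.\<close>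
  define S where "S = (\<Union>n. \<Union>m. inv_into (T n m) (code n m) ` (code n m ` T n m))"
  have cc: "countable (code n m ` T n m)" for n m
  proof (rule countable_subset)
    show "code n m ` T n m \<subseteq> F m \<rightarrow>\<^sub>E ((Basis :: 'a set) \<rightarrow>\<^sub>E (UNIV :: int set))" by (auto simp: code_def)
    show "countable (F m \<rightarrow>\<^sub>E ((Basis :: 'a set) \<rightarrow>\<^sub>E (UNIV :: int set)))"
      by (intro countable_PiE) (auto simp: F_def intro!: finite_PiE)
  qed
  have close: "norm (grad \<phi> x - grad \<psi> x) \<le> (N + 2) * h n"
    if \<phi>: "\<phi> \<in> T n m" and \<psi>: "\<psi> \<in> T n m" and c: "code n m \<phi> = code n m \<psi>" for \<phi> \<psi> n m x
  proof (cases "x \<in> \<Omega>")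
    case True
    define k where "k = restrict (\<lambda>i. \<lfloor>(x \<bullet> i) / h m\<rfloor>) Basis"
    have xi: "\<bar>x \<bullet> i\<bar> \<le> R" if "i \<in> Basis" for i using Basis_le_norm[OF that, of x] R True by force
    have kF: "k \<in> F m"
    proof -
      have "- (\<lceil>R / h m\<rceil> + 1) \<le> \<lfloor>(x \<bullet> i) / h m\<rfloor> \<and> \<lfloor>(x \<bullet> i) / h m\<rfloor> \<le> \<lceil>R / h m\<rceil> + 1" if i: "i \<in> Basis" for i
      proof -
        have "(x \<bullet> i) / h m \<le> R / h m" "- (R / h m) \<le> (x \<bullet> i) / h m"
          using xi[OF i] h[of m] by (auto simp: abs_le_iff field_simps)
        then show ?thesis by linarith
      qed
      then show ?thesis by (auto simp: F_def k_def)
    qed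
    define y where "y = grid_point (h m) k"
    have yx: "norm (x - y) \<le> N * h m" "norm (y - x) \<le> N * h m"
    proof -
      have "\<bar>(x - y) \<bullet> i\<bar> \<le> h m" if i: "i \<in> Basis" for i
      proof -
        have "y \<bullet> i = of_int \<lfloor>(x \<bullet> i) / h m\<rfloor> * h m"
          using i by (simp add: y_def grid_point_def k_def inner_sum_left inner_Basis if_distrib cong: if_cong)
        moreover have "of_int \<lfloor>(x \<bullet> i) / h m\<rfloor> * h m \<le> x \<bullet> i" "x \<bullet> i \<le> of_int \<lfloor>(x \<bullet> i) / h m\<rfloor> * h m + h m"
        proof -
          have "of_int \<lfloor>(x \<bullet> i) / h m\<rfloor> \<le> (x \<bullet> i) / h m" by (rule of_int_floor_le)
          then show "of_int \<lfloor>(x \<bullet> i) / h m\<rfloor> * h m \<le> x \<bullet> i" by (simp only: pos_le_divide_eq[OF h])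
          have "(x \<bullet> i) / h m \<le> of_int \<lfloor>(x \<bullet> i) / h m\<rfloor> + 1" by linarith
          then show "x \<bullet> i \<le> of_int \<lfloor>(x \<bullet> i) / h m\<rfloor> * h m + h m"
            by (simp only: pos_divide_le_eq[OF h] distrib_right mult_1)
        qed
        ultimately show ?thesis by (simp add: inner_diff_left)
      qed
      then show "norm (x - y) \<le> N * h m" unfolding N_def by (rule norm_le_DIM)
      then show "norm (y - x) \<le> N * h m" by (simp add: norm_minus_commute)
    qed
    have "norm (grad \<phi> y - grad \<psi> y) \<le> N * h n" unfolding N_def
    proof (rule norm_le_DIM)
      fix i :: 'a assume i: "i \<in> Basis"
      have "code n m \<phi> k i = code n m \<psi> k i" using c by simp
      then have "\<lfloor>(grad \<phi> y \<bullet> i) / h n\<rfloor> = \<lfloor>(grad \<psi> y \<bullet> i) / h n\<rfloor>"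
        using kF i by (simp add: code_def y_def)
      then have "\<bar>(grad \<phi> y \<bullet> i) / h n - (grad \<psi> y \<bullet> i) / h n\<bar> \<le> 1" by linarith
      then show "\<bar>(grad \<phi> y - grad \<psi> y) \<bullet> i\<bar> \<le> h n"
        using h[of n] by (simp add: inner_diff_left diff_divide_distrib[symmetric] abs_divide)
    qed
    moreover have "norm (grad \<phi> x - grad \<phi> y) \<le> h n" "norm (grad \<psi> y - grad \<psi> x) \<le> h n"
      using \<phi> \<psi> yx by (auto simp: T_def)
    moreover have "norm (grad \<phi> x - grad \<psi> x) \<le> norm (grad \<phi> x - grad \<phi> y) + norm (grad \<phi> y - grad \<psi> y) + norm (grad \<psi> y - grad \<psi> x)"
      using norm_triangle_ineq[of "grad \<phi> x - grad \<phi> y" "grad \<phi> y - grad \<psi> y"]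
        norm_triangle_ineq[of "grad \<phi> x - grad \<psi> y" "grad \<psi> y - grad \<psi> x"] by simp
    ultimately show ?thesis by (simp add: algebra_simps)
  next
    case False
    then have "grad \<phi> x = 0" "grad \<psi> x = 0"
      using \<phi> \<psi> test_functions_zero_outside(2)[of _ \<Omega> x] by (auto simp: T_def)
    then show ?thesis using N h[of n] by simp
  qed
  show thesis
  proof (rule that[of S])
    show "countable S" unfolding S_def by (intro countable_UN countable_image cc) auto
    have "inv_into (T n m) (code n m) c \<in> T n m" if "c \<in> code n m ` T n m" for n m c using that by (rule inv_into_into)
    then show "S \<subseteq> test_functions \<Omega>" by (auto simp: S_def T_def)
    fix \<phi> and \<epsilon> :: real assume \<phi>: "\<phi> \<in> test_functions \<Omega>" and e: "0 < \<epsilon>"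
    have "0 < \<epsilon> / (N + 2)" using e N by simp
    then obtain n where n: "inverse (real (Suc n)) < \<epsilon> / (N + 2)" using reals_Archimedean by blast
    then have n': "(N + 2) * h n \<le> \<epsilon>" using N by (simp add: h_def field_simps)
    obtain \<delta> where d: "0 < \<delta>" "\<And>x y. dist x y < \<delta> \<Longrightarrow> norm (grad \<phi> x - grad \<phi> y) \<le> h n"
      by (rule test_functions_uniformly_continuous_grad[OF \<Omega> \<phi> h[of n]]) blast
    have "0 < \<delta> / N" using d N by simp
    then obtain m where "inverse (real (Suc m)) < \<delta> / N" using reals_Archimedean by blast
    then have m: "N * h m < \<delta>" using N by (simp add: h_def field_simps)
    have T: "\<phi> \<in> T n m" using \<phi> d(2) m by (auto simp: T_def dist_norm intro: le_less_trans)
    define \<psi> where "\<psi> = inv_into (T n m) (code n m) (code n m \<phi>)"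
    have \<psi>: "\<psi> \<in> T n m" "code n m \<psi> = code n m \<phi>" unfolding \<psi>_def
      by (rule inv_into_into[OF imageI[OF T]], rule f_inv_into_f[OF imageI[OF T]])
    have "\<psi> \<in> S" unfolding S_def \<psi>_def using T by blast
    moreover have "norm (grad \<phi> x - grad \<psi> x) \<le> \<epsilon>" for x
      using close[OF T \<psi>(1) \<psi>(2)[symmetric], of x] n' by linarith
    ultimately show "\<exists>\<psi>\<in>S. \<forall>x. norm (grad \<phi> x - grad \<psi> x) \<le> \<epsilon>" by blast
  qed
qed

section \<open>A mountain pass theorem in finite dimensions\<close>

lemma bounded_coordinates_subsequence:
  fixes c :: "nat \<Rightarrow> nat \<Rightarrow> real"
  assumes "\<And>n i. i < k \<Longrightarrow> \<bar>c n i\<bar> \<le> R"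
  obtains r :: "nat \<Rightarrow> nat" and l where "strict_mono r" "\<And>i. i < k \<Longrightarrow> (\<lambda>n. c (r n) i) \<longlonglongrightarrow> l i"
proof -
  have "\<exists>b. \<forall>n. \<bar>if i < k then c n i else 0\<bar> \<le> b" for i
    using assms by (intro exI[of _ "max R 0"]) (auto simp: le_max_iff_disj)
  from diagonal_convergent_subsequence[of "\<lambda>n i. if i < k then c n i else 0", OF this]
  obtain r :: "nat \<Rightarrow> nat" where r: "strict_mono r" "\<And>i. convergent (\<lambda>n. if i < k then c (r n) i else 0)" by blast
  show thesis
  proof (rule that[OF r(1)])
    show "(\<lambda>n. c (r n) i) \<longlonglongrightarrow> lim (\<lambda>n. c (r n) i)" if "i < k" for i
      using r(2)[of i] that by (simp add: convergent_LIMSEQ_iff)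
  qed
qed

text \<open>
  Suppose there is no critical point at a level in \<open>[\<alpha>/4, B]\<close>. By compactness one explicit step
  \<open>c - s \<eta>(g c) D c\<close> along the gradient then lowers the level by a fixed amount above \<open>\<alpha>/2\<close>, so
  finitely many steps push the segment from 0 to \<open>e\<close> below \<open>\<alpha>\<close>; no gradient flow is needed.
\<close>
lemma mountain_pass_finite_dimensional:
  fixes g :: "(nat \<Rightarrow> real) \<Rightarrow> real" and D :: "nat \<Rightarrow> (nat \<Rightarrow> real) \<Rightarrow> real"
  assumes gc: "\<And>c l. (\<And>i. i < k \<Longrightarrow> (\<lambda>n. c n i) \<longlonglongrightarrow> l i) \<Longrightarrow> (\<lambda>n::nat. g (c n)) \<longlonglongrightarrow> g l"
    and Dc: "\<And>j c l. j < k \<Longrightarrow> (\<And>i. i < k \<Longrightarrow> (\<lambda>n. c n i) \<longlonglongrightarrow> l i) \<Longrightarrow> (\<lambda>n::nat. D j (c n)) \<longlonglongrightarrow> D j l"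
    and der: "\<And>c v t. ((\<lambda>t. g (\<lambda>i. c i + t * v i)) has_real_derivative (\<Sum>j<k. D j (\<lambda>i. c i + t * v i) * v j)) (at t)"
    and bdd: "\<And>c i. 0 \<le> g c \<Longrightarrow> i < k \<Longrightarrow> \<bar>c i\<bar> \<le> R"
    and \<alpha>: "0 < \<alpha>"
    and link: "\<And>\<gamma>. (\<And>i. continuous_on {0..1} (\<lambda>t. \<gamma> t i)) \<Longrightarrow> \<gamma> 0 = (\<lambda>i. 0) \<Longrightarrow> \<gamma> 1 = e \<Longrightarrow> \<exists>t\<in>{0..1::real}. \<alpha> \<le> g (\<gamma> t)"
    and ends: "g (\<lambda>i. 0) \<le> 0" "g e \<le> 0" and B: "\<And>t. t \<in> {0..1} \<Longrightarrow> g (\<lambda>i. t * e i) \<le> B"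
  obtains c where "\<alpha> / 4 \<le> g c" "g c \<le> B" "\<And>j. j < k \<Longrightarrow> D j c = 0"
proof (rule ccontr)
  assume no: "\<not> thesis"
  note found = that
  define K where "K = {c. \<alpha> / 4 \<le> g c \<and> g c \<le> B}"
  have nocrit: "\<exists>j<k. D j c \<noteq> 0" if "c \<in> K" for c using that no found[of c] unfolding K_def by blast
  define S where "S c = (\<Sum>j<k. (D j c)\<^sup>2)" for c
  have subseq: "\<exists>r l. strict_mono (r :: nat \<Rightarrow> nat) \<and> (\<forall>i<k. (\<lambda>n. c (r n) i) \<longlonglongrightarrow> l i) \<and> l \<in> K" if "\<And>n. c n \<in> K" for c :: "nat \<Rightarrow> nat \<Rightarrow> real"
  proof -
    have "\<bar>c n i\<bar> \<le> R" if "i < k" for n i using bdd[of "c n" i] \<open>\<And>n. c n \<in> K\<close>[of n] \<alpha> that by (auto simp: K_def)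
    then obtain r :: "nat \<Rightarrow> nat" and l where r: "strict_mono r" "\<And>i. i < k \<Longrightarrow> (\<lambda>n. c (r n) i) \<longlonglongrightarrow> l i"
      using bounded_coordinates_subsequence[of k c R] by blast
    have "(\<lambda>n. g (c (r n))) \<longlonglongrightarrow> g l" using r(2) by (rule gc)
    moreover have "\<alpha> / 4 \<le> g (c (r n))" "g (c (r n)) \<le> B" for n using that by (simp_all add: K_def)
    ultimately have "\<alpha> / 4 \<le> g l" "g l \<le> B" by (blast intro: LIMSEQ_le_const LIMSEQ_le_const2)+
    then show ?thesis using r unfolding K_def by blast
  qed
  \<comment> \<open>Otherwise a subsequence would converge to a critical point in \<open>K\<close>,
    since levels and derivatives are continuous in the coordinates.\<close>
  have "\<exists>\<delta>>0. \<forall>c\<in>K. \<delta> \<le> S c"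
  proof (rule ccontr)
    assume "\<not> ?thesis"
    then have "\<exists>c. c \<in> K \<and> S c < inverse (real (Suc n))" for n
      by (metis inverse_positive_iff_positive not_le of_nat_0_less_iff zero_less_Suc)
    then obtain c where c: "\<And>n. c n \<in> K" "\<And>n. S (c n) < inverse (real (Suc n))" by metis
    obtain r l where r: "strict_mono (r :: nat \<Rightarrow> nat)" "\<forall>i<k. (\<lambda>n. c (r n) i) \<longlonglongrightarrow> l i" "l \<in> K" using subseq[of c] c(1) by blast
    have "(\<lambda>n. S (c (r n))) \<longlonglongrightarrow> S l" unfolding S_def using r(2) by (intro tendsto_sum tendsto_power Dc) auto
    moreover have "(\<lambda>n. inverse (real (Suc (r n)))) \<longlonglongrightarrow> 0"
      using LIMSEQ_subseq_LIMSEQ[OF LIMSEQ_inverse_real_of_nat r(1)] by (simp add: o_def)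
    ultimately have "S l \<le> 0" by (rule LIMSEQ_le) (use c(2) in \<open>auto intro: less_imp_le\<close>)
    moreover obtain j where "j < k" "D j l \<noteq> 0" using nocrit[OF r(3)] by blast
    then have "0 < S l" unfolding S_def by (intro sum_pos2[of _ j]) auto
    ultimately show False by simp
  qed
  then obtain \<delta> where \<delta>: "0 < \<delta>" "\<And>c. c \<in> K \<Longrightarrow> \<delta> \<le> S c" by blast
  \<comment> \<open>A uniform step length: up to \<open>s\<close> the descent along the fixed
    direction \<open>- D c\<close> keeps at least half of the guaranteed rate
    \<open>\<delta>\<close>. For counterexamples with \<open>\<sigma>\<close> tending to 0 the sums
    would converge to \<open>S l\<close>, which is at least \<open>\<delta>\<close>.\<close>
  have "\<exists>s>0. \<forall>c\<in>K. \<forall>\<sigma>\<in>{0..s}. \<delta> / 2 \<le> (\<Sum>j<k. D j (\<lambda>i. c i + \<sigma> * (- D i c)) * D j c)"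
  proof (rule ccontr)
    assume neg: "\<not> ?thesis"
    have "\<exists>c \<sigma>. c \<in> K \<and> \<sigma> \<in> {0..inverse (real (Suc n))} \<and> (\<Sum>j<k. D j (\<lambda>i. c i + \<sigma> * (- D i c)) * D j c) < \<delta> / 2" for n
    proof -
      have "0 < inverse (real (Suc n))" by simp
      then have "\<not> (\<forall>c\<in>K. \<forall>\<sigma>\<in>{0..inverse (real (Suc n))}. \<delta> / 2 \<le> (\<Sum>j<k. D j (\<lambda>i. c i + \<sigma> * (- D i c)) * D j c))"
        using neg by blast
      then show ?thesis unfolding not_le[symmetric] by blast
    qed
    then have "\<forall>n. \<exists>c. c \<in> K \<and> (\<exists>\<sigma>\<in>{0..inverse (real (Suc n))}. (\<Sum>j<k. D j (\<lambda>i. c i + \<sigma> * (- D i c)) * D j c) < \<delta> / 2)" by blast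
    from choice[OF this] obtain c where c': "\<forall>n. c n \<in> K \<and> (\<exists>\<sigma>\<in>{0..inverse (real (Suc n))}. (\<Sum>j<k. D j (\<lambda>i. c n i + \<sigma> * (- D i (c n))) * D j (c n)) < \<delta> / 2)" ..
    then have "\<forall>n. \<exists>\<sigma>. \<sigma> \<in> {0..inverse (real (Suc n))} \<and> (\<Sum>j<k. D j (\<lambda>i. c n i + \<sigma> * (- D i (c n))) * D j (c n)) < \<delta> / 2" by blast
    from choice[OF this] c' obtain \<sigma> where c: "\<And>n. c n \<in> K" and \<sigma>: "\<And>n. \<sigma> n \<in> {0..inverse (real (Suc n))}"
      and lt: "\<And>n. (\<Sum>j<k. D j (\<lambda>i. c n i + \<sigma> n * (- D i (c n))) * D j (c n)) < \<delta> / 2" by blast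
    obtain r l where r: "strict_mono (r :: nat \<Rightarrow> nat)" "\<forall>i<k. (\<lambda>n. c (r n) i) \<longlonglongrightarrow> l i" "l \<in> K" using subseq[of c] c(1) by blast
    have "\<sigma> \<longlonglongrightarrow> 0"
      by (rule tendsto_sandwich[OF _ _ tendsto_const LIMSEQ_inverse_real_of_nat]) (use \<sigma> in auto)
    then have \<sigma>r: "(\<lambda>n. \<sigma> (r n)) \<longlonglongrightarrow> 0" using LIMSEQ_subseq_LIMSEQ[OF _ r(1)] by (auto simp: o_def)
    have Dr: "(\<lambda>n. D j (c (r n))) \<longlonglongrightarrow> D j l" if "j < k" for j using r(2) that by (intro Dc) auto
    have "(\<lambda>n. c (r n) i + \<sigma> (r n) * (- D i (c (r n)))) \<longlonglongrightarrow> l i + 0 * (- D i l)" if "i < k" for i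
      using r(2) that by (intro tendsto_intros \<sigma>r Dr) auto
    then have "(\<lambda>n. D j (\<lambda>i. c (r n) i + \<sigma> (r n) * (- D i (c (r n))))) \<longlonglongrightarrow> D j l" if "j < k" for j
      using that by (intro Dc) auto
    then have "(\<lambda>n. \<Sum>j<k. D j (\<lambda>i. c (r n) i + \<sigma> (r n) * (- D i (c (r n)))) * D j (c (r n))) \<longlonglongrightarrow> (\<Sum>j<k. D j l * D j l)"
      using Dr by (intro tendsto_sum tendsto_mult) auto
    then have "(\<Sum>j<k. D j l * D j l) \<le> \<delta> / 2"
      by (rule LIMSEQ_le_const2) (use lt in \<open>auto intro: less_imp_le\<close>)
    then show False using \<delta> \<delta>(2)[OF r(3)] by (simp add: S_def power2_eq_square)
  qed
  then obtain s where s: "0 < s" "\<And>c \<sigma>. c \<in> K \<Longrightarrow> 0 \<le> \<sigma> \<Longrightarrow> \<sigma> \<le> s \<Longrightarrow> \<delta> / 2 \<le> (\<Sum>j<k. D j (\<lambda>i. c i + \<sigma> * (- D i c)) * D j c)"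
    by force
  \<comment> \<open>The cut-off is 0 up to the level \<open>\<alpha> / 4\<close>, so that the
    endpoints 0 and \<open>e\<close> stay fixed, and 1 from \<open>\<alpha> / 2\<close> on, so that
    each step there lowers the level by the full amount.\<close>
  define \<eta> where "\<eta> y = max 0 (min 1 (4 * y / \<alpha> - 1))" for y :: real
  have \<eta>: "0 \<le> \<eta> y" "\<eta> y \<le> 1" for y by (auto simp: \<eta>_def)
  have \<eta>0: "\<eta> y = 0" if "y \<le> \<alpha> / 4" for y using that \<alpha> by (auto simp: \<eta>_def field_simps)
  have \<eta>1: "\<eta> y = 1" if "\<alpha> / 2 \<le> y" for y using that \<alpha> by (auto simp: \<eta>_def field_simps)
  define \<Phi> where "\<Phi> c = (\<lambda>i. c i + s * \<eta> (g c) * (if i < k then - D i c else 0))" for c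
  \<comment> \<open>By \<open>gc\<close>, applied to a constant sequence, \<open>g\<close> depends
    on the first \<open>k\<close> coordinates only; hence the direction may be set to 0 beyond them
    in \<open>\<Phi>\<close>.\<close>
  have gcoord: "g c = g c'" if "\<And>i. i < k \<Longrightarrow> c i = c' i" for c c'
  proof -
    have "(\<lambda>n::nat. g c) \<longlonglongrightarrow> g c'" by (rule gc) (simp add: that)
    then show ?thesis by (simp add: LIMSEQ_const_iff)
  qed
  have step: "g (\<Phi> c) \<le> g c - s * \<eta> (g c) * \<delta> / 2" if "g c \<le> B" for c
  proof (cases "\<eta> (g c) = 0")
    case True
    then have "\<Phi> c = c" by (simp add: \<Phi>_def)
    then show ?thesis using True by simp
  next
    case False
    then have cK: "c \<in> K" using \<eta>0[of "g c"] that by (force simp: K_def)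
    define m where "m = s * \<eta> (g c)"
    have m: "0 < m" "m \<le> s" using False \<eta>[of "g c"] s(1) by (auto simp: m_def mult_left_le order_less_le)
    let ?h = "\<lambda>t. g (\<lambda>i. c i + t * (- D i c))" and ?h' = "\<lambda>t. \<Sum>j<k. D j (\<lambda>i. c i + t * (- D i c)) * (- D j c)"
    obtain z where z: "0 < z" "z < m" "?h m - ?h 0 = (m - 0) * ?h' z"
      using MVT2[OF m(1), of ?h ?h'] der[of c "\<lambda>i. - D i c"] by blast
    have "?h' z \<le> - (\<delta> / 2)" using s(2)[OF cK, of z] z m by (simp add: sum_negf)
    then have "m * ?h' z \<le> m * (- (\<delta> / 2))" using m by (intro mult_left_mono) auto
    then have "?h m \<le> g c - m * \<delta> / 2" using z(3) by simp
    moreover have "?h m = g (\<Phi> c)" by (rule gcoord) (simp add: \<Phi>_def m_def)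
    ultimately show ?thesis by (simp add: m_def)
  qed
  have step0: "g (\<Phi> c) \<le> g c" if "g c \<le> B" for c
  proof -
    have "0 \<le> s * \<eta> (g c) * \<delta> / 2" using s(1) \<eta>(1)[of "g c"] \<delta>(1) by (intro divide_nonneg_pos mult_nonneg_nonneg) auto
    then show ?thesis using step[OF that] by linarith
  qed
  define \<gamma> where "\<gamma> m t = (\<Phi> ^^ m) (\<lambda>i. t * e i)" for m and t :: real
  have \<gamma>0: "\<gamma> 0 t = (\<lambda>i. t * e i)" and \<gamma>S: "\<gamma> (Suc m) t = \<Phi> (\<gamma> m t)" for m t by (simp_all add: \<gamma>_def)
  have cont: "continuous_on {0..1} (\<lambda>t. \<gamma> m t i)" for m i
  proof (induction m arbitrary: i)
    case 0 show ?case unfolding \<gamma>0 by (intro continuous_intros)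
  next
    case (Suc m)
    have lim: "(\<lambda>n. \<gamma> m (x n) i) \<longlonglongrightarrow> \<gamma> m t i" if "\<And>n. x n \<in> {0..1}" "x \<longlonglongrightarrow> t" "t \<in> {0..1}" for x t i
      using Suc.IH[of i] that unfolding continuous_on_sequentially by (auto simp: o_def)
    have gl: "continuous_on {0..1} (\<lambda>t. g (\<gamma> m t))"
      unfolding continuous_on_sequentially by (auto simp: o_def intro!: gc lim)
    have Dl: "continuous_on {0..1} (\<lambda>t. D j (\<gamma> m t))" if "j < k" for j
      unfolding continuous_on_sequentially using that by (auto simp: o_def intro!: Dc lim)
    show ?case unfolding \<gamma>S \<Phi>_def \<eta>_def using \<alpha>
      by (cases "i < k") (auto intro!: continuous_intros Suc.IH gl Dl)
  qed
  have start: "\<gamma> m 0 = (\<lambda>i. 0)" for m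
  proof (induction m)
    case (Suc m)
    have "\<eta> (g (\<lambda>i. 0)) = 0" using ends \<alpha> by (intro \<eta>0) auto
    then show ?case unfolding \<gamma>S Suc \<Phi>_def by simp
  qed (simp add: \<gamma>0)
  have stop: "\<gamma> m 1 = e" for m
  proof (induction m)
    case (Suc m)
    have "\<eta> (g e) = 0" using ends \<alpha> by (intro \<eta>0) auto
    then show ?case unfolding \<gamma>S Suc \<Phi>_def by simp
  qed (simp add: \<gamma>0)
  have level: "g (\<gamma> m t) \<le> B \<and> g (\<gamma> m t) \<le> max (\<alpha> / 2) (B - real m * (s * \<delta> / 2))" if t: "t \<in> {0..1}" for m t
  proof (induction m)
    case 0 then show ?case using B[OF t] by (simp add: \<gamma>0)
  next
    case (Suc m)
    have b: "g (\<gamma> (Suc m) t) \<le> g (\<gamma> m t)" unfolding \<gamma>S using Suc by (intro step0) auto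
    show ?case
    proof (cases "\<alpha> / 2 \<le> g (\<gamma> m t)")
      case True
      have "g (\<gamma> (Suc m) t) \<le> g (\<gamma> m t) - s * \<delta> / 2" unfolding \<gamma>S using step[of "\<gamma> m t"] Suc \<eta>1[OF True] by simp
      moreover have "0 < s * \<delta> / 2" using s(1) \<delta>(1) by simp
      moreover have "real (Suc m) * (s * \<delta> / 2) = real m * (s * \<delta> / 2) + s * \<delta> / 2" by (simp add: algebra_simps)
      ultimately show ?thesis using Suc b unfolding le_max_iff_disj by linarith
    qed (use b Suc in auto)
  qed
  \<comment> \<open>After so many steps the second entry of the maximum in \<open>level\<close> is
    negative, which leaves the whole path at levels of at most \<open>\<alpha> / 2\<close>.\<close>
  obtain m :: nat where m: "B < real m * (s * \<delta> / 2)"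
    using reals_Archimedean3[of "s * \<delta> / 2"] s(1) \<delta>(1) by auto
  obtain t where t: "t \<in> {0..1}" "\<alpha> \<le> g (\<gamma> m t)"
    using link[of "\<gamma> m", OF cont start stop] by blast
  show False using level[OF t(1), of m] t(2) m \<alpha> by auto
qed

section \<open>Primitives and derivatives of integrals\<close>

lemma primitive_0 [simp]: "primitive g 0 = 0"
  by (simp add: primitive_def zero_ereal_def[symmetric])

lemma DERIV_primitive:
  assumes g: "continuous_on UNIV g"
  shows "(primitive g has_real_derivative g t) (at t)"
proof -
  define b where "b = \<bar>t\<bar> + 1"
  have b: "- b < t" "t < b" "- b \<le> 0" "0 \<le> b" by (auto simp: b_def)
  have "((\<lambda>u. LBINT y=ereal 0..ereal u. g y) has_vector_derivative g t) (at t within {- b..b})"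
    using b by (intro interval_integral_FTC2 continuous_on_subset[OF g]) auto
  moreover have "at t within {- b..b} = at t" by (rule at_within_interior) (use b in simp)
  ultimately have "((\<lambda>u. LBINT y=ereal 0..ereal u. g y) has_vector_derivative g t) (at t)" by simp
  then show ?thesis unfolding primitive_def[abs_def] has_real_derivative_iff_has_vector_derivative .
qed

lemma primitive_cong:
  assumes "0 \<le> t" "\<And>s. 0 \<le> s \<Longrightarrow> g s = h s"
  shows "primitive g t = primitive h t"
  unfolding primitive_def
  by (rule interval_lebesgue_integral_cong) (use assms in \<open>auto simp: einterval_iff\<close>)

lemma continuous_on_primitive: "continuous_on UNIV g \<Longrightarrow> continuous_on S (primitive g)"
  by (rule continuous_at_imp_continuous_on) (auto intro: DERIV_isCont DERIV_primitive)

lemma abs_primitive_le: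
  assumes g: "continuous_on UNIV g" and b: "\<And>s. \<bar>s\<bar> \<le> \<bar>t\<bar> \<Longrightarrow> \<bar>g s\<bar> \<le> b"
  shows "\<bar>primitive g t\<bar> \<le> b * \<bar>t\<bar>"
proof -
  have "norm (primitive g t - primitive g 0) \<le> b * norm (t - 0)"
  proof (rule field_differentiable_bound[where S = "{-\<bar>t\<bar>..\<bar>t\<bar>}" and f' = g])
    show "(primitive g has_field_derivative g z) (at z within {-\<bar>t\<bar>..\<bar>t\<bar>})" for z
      by (rule DERIV_subset[OF DERIV_primitive[OF g]]) simp
  qed (use b in \<open>auto simp: abs_le_iff\<close>)
  then show ?thesis by simp
qed

text \<open>The differential inequality says that \<open>G t * t powr - \<sigma>\<close> is
  nondecreasing.\<close>

lemma powr_quotient_mono: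
  fixes G G' :: "real \<Rightarrow> real"
  assumes der: "\<And>t. 0 < t \<Longrightarrow> (G has_real_derivative G' t) (at t)"
    and ge: "\<And>t. t1 \<le> t \<Longrightarrow> \<sigma> * G t \<le> t * G' t" and t: "0 < t1" "t1 \<le> t"
  shows "G t1 * (t / t1) powr \<sigma> \<le> G t"
proof -
  let ?h = "\<lambda>t. G t * t powr - \<sigma>"
  have "?h t1 \<le> ?h t"
  proof (rule DERIV_nonneg_imp_nondecreasing[OF t(2)])
    fix x assume x: "t1 \<le> x" "x \<le> t"
    then have x0: "0 < x" using t by simp
    have "(?h has_real_derivative (G' x * x powr - \<sigma> + G x * (- \<sigma> * x powr (- \<sigma> - 1)))) (at x)"
      using x0 by (auto intro!: derivative_eq_intros der)
    moreover have "G' x * x powr - \<sigma> + G x * (- \<sigma> * x powr (- \<sigma> - 1)) = x powr (- \<sigma> - 1) * (x * G' x - \<sigma> * G x)"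
      using powr_mult_base[of x "- \<sigma> - 1"] x0 by (simp add: algebra_simps)
    moreover have "0 \<le> x powr (- \<sigma> - 1) * (x * G' x - \<sigma> * G x)"
      using ge[OF x(1)] by (intro mult_nonneg_nonneg) auto
    ultimately show "\<exists>y. (?h has_real_derivative y) (at x) \<and> 0 \<le> y" by auto
  qed
  then show ?thesis using t by (simp add: powr_minus powr_divide field_simps)
qed

lemma powr_quotient_antimono:
  fixes G G' :: "real \<Rightarrow> real"
  assumes der: "\<And>t. 0 < t \<Longrightarrow> (G has_real_derivative G' t) (at t)"
    and le: "\<And>t. 0 < t \<Longrightarrow> t * G' t \<le> \<sigma> * G t" and t: "0 < t1" "t1 \<le> t"
  shows "G t \<le> G t1 * (t / t1) powr \<sigma>"
  using powr_quotient_mono[of "\<lambda>t. - G t" "\<lambda>t. - G' t" t1 \<sigma> t] der le t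
  by (auto intro!: DERIV_minus)

text \<open>Rounding \<open>u\<close> down to multiples of \<open>1 / Suc k\<close> leaves countably
  many values, each of which is harmless; continuity in the second argument gives the limit.\<close>

lemma caratheodory_measurable:
  fixes g :: "'b \<Rightarrow> real \<Rightarrow> real"
  assumes g: "\<And>t. (\<lambda>x. g x t) \<in> borel_measurable M" "\<And>x. x \<in> space M \<Longrightarrow> continuous_on UNIV (g x)"
    and [measurable]: "u \<in> borel_measurable M"
  shows "(\<lambda>x. g x (u x)) \<in> borel_measurable M"
proof (rule borel_measurable_LIMSEQ_metric)
  define d where "d k x = real_of_int \<lfloor>real (Suc k) * u x\<rfloor> / real (Suc k)" for k x
  show "(\<lambda>x. g x (d k x)) \<in> borel_measurable M" for k
  proof -
    have "(\<lambda>x. (\<lambda>i x. g x (real_of_int i / real (Suc k))) (\<lfloor>real (Suc k) * u x\<rfloor>) x) \<in> borel_measurable M"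
      by (rule measurable_compose_countable) (use g(1) in \<open>auto intro!: measurable_compose[OF _ measurable_real_floor]\<close>)
    then show ?thesis by (simp add: d_def)
  qed
  fix x assume x: "x \<in> space M"
  have "(\<lambda>k. d k x) \<longlonglongrightarrow> u x"
  proof (rule LIM_zero_cancel, rule Lim_null_comparison[OF always_eventually LIMSEQ_inverse_real_of_nat], rule allI)
    fix k
    have "d k x - u x = (real_of_int \<lfloor>real (Suc k) * u x\<rfloor> - real (Suc k) * u x) / real (Suc k)"
      by (simp add: d_def field_simps)
    moreover have "\<bar>real_of_int \<lfloor>real (Suc k) * u x\<rfloor> - real (Suc k) * u x\<bar> \<le> 1" by linarith
    ultimately show "norm (d k x - u x) \<le> inverse (real (Suc k))"
      by (simp add: abs_divide inverse_eq_divide divide_right_mono)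
  qed
  then show "(\<lambda>k. g x (d k x)) \<longlonglongrightarrow> g x (u x)"
    using g(2)[OF x] by (intro continuous_on_tendsto_compose[where s = UNIV and f = "g x"]) auto
qed

text \<open>On the product space \<open>caratheodory_measurable\<close>, applied to the second
  projection, gives joint measurability, which integration over the second variable
  respects.\<close>

lemma primitive_measurable:
  fixes g :: "'b \<Rightarrow> real \<Rightarrow> real"
  assumes g: "\<And>t. (\<lambda>x. g x t) \<in> borel_measurable M" "\<And>x. x \<in> space M \<Longrightarrow> continuous_on UNIV (g x)"
  shows "(\<lambda>x. primitive (g x) t) \<in> borel_measurable M"
proof -
  have [measurable]: "(\<lambda>z. g (fst z) (snd z)) \<in> borel_measurable (M \<Otimes>\<^sub>M lborel)"
  proof (rule caratheodory_measurable[where g = "\<lambda>z. g (fst z)"])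
    show "(\<lambda>z. g (fst z) s) \<in> borel_measurable (M \<Otimes>\<^sub>M lborel)" for s
      by (rule measurable_compose[OF measurable_fst g(1)])
  qed (use g(2) in \<open>auto simp: space_pair_measure\<close>)
  have "(\<lambda>x. \<integral>s. indicator A s * g x s \<partial>lborel) \<in> borel_measurable M" if [measurable]: "A \<in> sets borel" for A
    by (intro lborel.borel_measurable_lebesgue_integral) (simp add: case_prod_beta')
  then show ?thesis
    unfolding primitive_def interval_lebesgue_integral_def set_lebesgue_integral_def by simp
qed

lemma DERIV_integral_bounded:
  fixes h h' :: "real \<Rightarrow> 'b \<Rightarrow> real"
  assumes M: "finite_measure M" and i: "\<And>t. integrable M (h t)" and m: "h' t0 \<in> borel_measurable M"
    and der: "\<And>t x. x \<in> space M \<Longrightarrow> ((\<lambda>t. h t x) has_real_derivative h' t x) (at t)"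
    and b: "\<And>t x. \<bar>t - t0\<bar> \<le> 1 \<Longrightarrow> x \<in> space M \<Longrightarrow> \<bar>h' t x\<bar> \<le> K"
  shows "((\<lambda>t. \<integral>x. h t x \<partial>M) has_real_derivative (\<integral>x. h' t0 x \<partial>M)) (at t0)"
proof -
  interpret finite_measure M by (rule M)
  have "((\<lambda>s. ((\<integral>x. h (t0 + s) x \<partial>M) - (\<integral>x. h t0 x \<partial>M)) / s) \<longlongrightarrow> (\<integral>x. h' t0 x \<partial>M)) (at 0)"
    unfolding tendsto_at_iff_sequentially
  proof (intro allI impI)
    fix s :: "nat \<Rightarrow> real" assume s0: "\<forall>n. s n \<in> UNIV - {0}" and s: "s \<longlonglongrightarrow> 0"
    obtain n0 where n0: "\<And>n. n0 \<le> n \<Longrightarrow> \<bar>s n\<bar> < 1" using LIMSEQ_D[OF s zero_less_one] by auto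
    \<comment> \<open>Dropping an initial segment keeps the increments below 1, where the bound
      \<open>K\<close> on the derivative is available.\<close>
    define s' where "s' n = s (n + n0)" for n
    have s': "s' n \<noteq> 0" "\<bar>s' n\<bar> < 1" for n using s0 n0 by (auto simp: s'_def)
    have s'l: "s' \<longlonglongrightarrow> 0" unfolding s'_def using s by (rule LIMSEQ_ignore_initial_segment)
    have s'at: "filterlim s' (at 0) sequentially" using s'l s' by (auto simp: filterlim_at)
    have [measurable]: "h t \<in> borel_measurable M" for t using i[of t] by auto
    note [measurable] = m
    have "(\<lambda>n. \<integral>x. (h (t0 + s' n) x - h t0 x) / s' n \<partial>M) \<longlonglongrightarrow> (\<integral>x. h' t0 x \<partial>M)"
    proof (rule integral_dominated_convergence[where w = "\<lambda>x. K"])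
      show "AE x in M. (\<lambda>n. (h (t0 + s' n) x - h t0 x) / s' n) \<longlonglongrightarrow> h' t0 x"
      proof (rule AE_I2)
        fix x assume "x \<in> space M"
        from der[OF this, of t0] have "((\<lambda>s. (h (t0 + s) x - h t0 x) / s) \<longlongrightarrow> h' t0 x) (at 0)" by (simp add: DERIV_def)
        from filterlim_compose[OF this s'at] show "(\<lambda>n. (h (t0 + s' n) x - h t0 x) / s' n) \<longlonglongrightarrow> h' t0 x" .
      qed
      show "AE x in M. norm ((h (t0 + s' n) x - h t0 x) / s' n) \<le> K" for n
      proof (rule AE_I2)
        fix x assume x: "x \<in> space M"
        have "norm (h (t0 + s' n) x - h t0 x) \<le> K * norm (t0 + s' n - t0)"
        proof (rule field_differentiable_bound[where S = "{t0 - 1..t0 + 1}" and f' = "\<lambda>t. h' t x"])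
          show "((\<lambda>t. h t x) has_field_derivative h' z x) (at z within {t0 - 1..t0 + 1})" for z
            by (rule DERIV_subset[OF der[OF x]]) simp
          show "norm (h' z x) \<le> K" if "z \<in> {t0 - 1..t0 + 1}" for z using b[OF _ x, of z] that by (auto simp: abs_le_iff)
        qed (use s'(2)[of n] in \<open>auto simp: abs_less_iff\<close>)
        then show "norm ((h (t0 + s' n) x - h t0 x) / s' n) \<le> K"
          using s'(1)[of n] by (simp add: abs_divide divide_le_eq)
      qed
    qed auto
    moreover have "(\<integral>x. (h (t0 + s' n) x - h t0 x) / s' n \<partial>M) = ((\<integral>x. h (t0 + s' n) x \<partial>M) - (\<integral>x. h t0 x \<partial>M)) / s' n" for n
      using i by simp
    ultimately have "(\<lambda>n. ((\<integral>x. h (t0 + s' n) x \<partial>M) - (\<integral>x. h t0 x \<partial>M)) / s' n) \<longlonglongrightarrow> (\<integral>x. h' t0 x \<partial>M)"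
      by (simp only:)
    then have "(\<lambda>n. ((\<integral>x. h (t0 + s (n + n0)) x \<partial>M) - (\<integral>x. h t0 x \<partial>M)) / s (n + n0)) \<longlonglongrightarrow> (\<integral>x. h' t0 x \<partial>M)"
      unfolding s'_def .
    then have "(\<lambda>n. ((\<integral>x. h (t0 + s n) x \<partial>M) - (\<integral>x. h t0 x \<partial>M)) / s n) \<longlonglongrightarrow> (\<integral>x. h' t0 x \<partial>M)"
      by (rule LIMSEQ_offset)
    then show "((\<lambda>s. ((\<integral>x. h (t0 + s) x \<partial>M) - (\<integral>x. h t0 x \<partial>M)) / s) \<circ> s) \<longlonglongrightarrow> (\<integral>x. h' t0 x \<partial>M)"
      by (simp add: o_def)
  qed
  then show ?thesis by (simp add: DERIV_def)
qed

lemma dot_self_powr: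
  fixes y :: "'a::real_inner"
  shows "(y \<bullet> y) powr s = norm y powr (2 * s)"
proof -
  have "y \<bullet> y = norm y powr 2" by (simp add: dot_square_norm)
  then show ?thesis by (simp only: powr_powr)
qed

text \<open>Away from the zero vector this is the chain rule for a power of the inner product. At
  the zero vector the difference quotient has the size of a constant times
  \<open>\<bar>s\<bar> powr (p - 1)\<close> and tends to 0 because \<open>p > 1\<close>.\<close>

lemma norm_powr_DERIV:
  fixes v w :: "'a::euclidean_space"
  assumes p: "1 < p"
  shows "((\<lambda>t. norm (v + t *\<^sub>R w) powr p / p) has_real_derivative (norm (v + t *\<^sub>R w) powr (p - 2) * ((v + t *\<^sub>R w) \<bullet> w))) (at t)"
proof (cases "v + t *\<^sub>R w = 0")
  case False
  let ?y = "\<lambda>t. v + t *\<^sub>R w"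
  have pos: "0 < ?y t \<bullet> ?y t" using False by simp
  have eq: "norm (?y s) powr p / p = (?y s \<bullet> ?y s) powr (p / 2) / p" for s
    by (simp only: dot_self_powr) simp
  have "((\<lambda>t. ?y t \<bullet> ?y t) has_real_derivative 2 * (?y t \<bullet> w)) (at t)"
    by (auto intro!: derivative_eq_intros simp: has_field_derivative_def algebra_simps inner_add_left inner_add_right inner_commute fun_eq_iff)
  then have "((\<lambda>t. (?y t \<bullet> ?y t) powr (p / 2) / p) has_real_derivative ((p / 2) * (?y t \<bullet> ?y t) powr (p / 2 - 1) * (2 * (?y t \<bullet> w))) / p) (at t)"
    using pos by (intro DERIV_cdivide) (auto intro!: derivative_eq_intros simp: mult_ac)
  moreover have "(?y t \<bullet> ?y t) powr (p / 2 - 1) = norm (?y t) powr (p - 2)"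
    by (simp only: dot_self_powr) (simp add: algebra_simps)
  ultimately show ?thesis unfolding eq using p by (simp add: mult_ac)
next
  case True
  have "((\<lambda>s. \<bar>s\<bar> powr (p - 1) * (norm w powr p / p)) \<longlongrightarrow> 0 powr (p - 1) * (norm w powr p / p)) (at 0)"
    using p by (intro tendsto_mult tendsto_powr' tendsto_const tendsto_rabs_zero) auto
  then have z: "((\<lambda>s. \<bar>s\<bar> powr (p - 1) * (norm w powr p / p)) \<longlongrightarrow> 0) (at 0)" by simp
  have "((\<lambda>s. (norm (v + (t + s) *\<^sub>R w) powr p / p - norm (v + t *\<^sub>R w) powr p / p) / s) \<longlongrightarrow> 0) (at 0)"
  proof (rule Lim_null_comparison[OF _ z])
    show "\<forall>\<^sub>F s in at 0. norm ((norm (v + (t + s) *\<^sub>R w) powr p / p - norm (v + t *\<^sub>R w) powr p / p) / s) \<le> \<bar>s\<bar> powr (p - 1) * (norm w powr p / p)"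
    proof (unfold eventually_at_filter, intro always_eventually allI impI)
      fix s :: real assume s: "s \<noteq> 0"
      have "v + (t + s) *\<^sub>R w = s *\<^sub>R w" using True by (simp add: algebra_simps)
      then have "norm (v + (t + s) *\<^sub>R w) powr p = \<bar>s\<bar> powr p * norm w powr p" by (simp add: powr_mult)
      moreover have "\<bar>s\<bar> powr p = \<bar>s\<bar> * \<bar>s\<bar> powr (p - 1)" using powr_mult_base[of "\<bar>s\<bar>" "p - 1"] by simp
      ultimately show "norm ((norm (v + (t + s) *\<^sub>R w) powr p / p - norm (v + t *\<^sub>R w) powr p / p) / s) \<le> \<bar>s\<bar> powr (p - 1) * (norm w powr p / p)"
        using True s p by (simp add: abs_mult abs_divide)
    qed
  qed
  then show ?thesis using True by (simp add: DERIV_def)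
qed

lemma powr_minus_2_mult: "0 \<le> y \<Longrightarrow> y powr (s - 2) * y = y powr (s - 1)" for y s :: real
  using powr_mult_base[of y "s - 2"] by (simp add: mult.commute)

text \<open>For \<open>s < 2\<close> the scalar factor is unbounded near 0, but the product has norm
  \<open>norm (v n) powr (s - 1)\<close>, which tends to 0 with \<open>v n\<close>.\<close>

lemma tendsto_powr_scaleR:
  fixes v :: "nat \<Rightarrow> 'a::real_normed_vector"
  assumes s: "1 < s" and v: "v \<longlonglongrightarrow> l"
  shows "(\<lambda>n. norm (v n) powr (s - 2) *\<^sub>R v n) \<longlonglongrightarrow> norm l powr (s - 2) *\<^sub>R l"
proof (cases "l = 0")
  case True
  have "(\<lambda>n. norm (v n) powr (s - 1)) \<longlonglongrightarrow> norm l powr (s - 1)"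
    using s by (intro tendsto_powr' tendsto_norm v tendsto_const) auto
  then have z: "(\<lambda>n. norm (v n) powr (s - 1)) \<longlonglongrightarrow> 0" using True by simp
  have "(\<lambda>n. norm (v n) powr (s - 2) *\<^sub>R v n) \<longlonglongrightarrow> 0"
    by (rule Lim_null_comparison[OF always_eventually z]) (simp add: powr_minus_2_mult)
  then show ?thesis using True by simp
next
  case False
  then show ?thesis by (intro tendsto_intros v) auto
qed

section \<open>The Kirchhoff functional\<close>

text \<open>
  The almost everywhere conditions on \<open>f\<close> are required at every point of \<open>\<Omega>\<close>, and \<open>M\<close> is defined and
  continuous on the whole line: in the application \<open>f\<close> is changed on a null set and \<open>M t\<close> is replaced
  by \<open>M (max 0 t)\<close>.
\<close>
locale kirchhoff_problem = double_phase_domain \<Omega> a p q A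
  for \<Omega> :: "'a::euclidean_space set" and a p q A +
  fixes \<theta> r \<sigma> C0 c0 t0 :: real and M :: "real \<Rightarrow> real" and f :: "'a \<Rightarrow> real \<Rightarrow> real"
  assumes \<Omega>_nonempty: "\<Omega> \<noteq> {}"
    and M_cont: "continuous_on UNIV M" and M_nonneg: "\<And>t. 0 \<le> M t"
    and M_growth: "\<And>t. 0 \<le> t \<Longrightarrow> t * M t \<le> \<theta> * primitive M t"
    and M_pos: "\<And>\<tau>. 0 < \<tau> \<Longrightarrow> \<exists>\<kappa>>0. \<forall>t\<ge>\<tau>. \<kappa> \<le> M t"
    and \<theta>: "1 \<le> \<theta>" and r: "q * \<theta> < r" "r < critical_exponent (real DIM('a)) p" and \<sigma>: "q * \<theta> < \<sigma>"
    and f_measurable: "\<And>t. (\<lambda>x. f x t) \<in> borel_measurable (lebesgue_on \<Omega>)"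
    and f_cont: "\<And>x. x \<in> \<Omega> \<Longrightarrow> continuous_on UNIV (f x)"
    and C0: "0 < C0" and f_growth: "\<And>x t. x \<in> \<Omega> \<Longrightarrow> \<bar>f x t\<bar> \<le> C0 * (\<bar>t\<bar> powr (q * \<theta> - 1) + \<bar>t\<bar> powr (r - 1))"
    and c0: "0 < c0" and t0: "0 < t0"
    and f_AR: "\<And>x t. x \<in> \<Omega> \<Longrightarrow> t0 \<le> \<bar>t\<bar> \<Longrightarrow> c0 \<le> \<sigma> * primitive (f x) t"
      "\<And>x t. x \<in> \<Omega> \<Longrightarrow> t0 \<le> \<bar>t\<bar> \<Longrightarrow> \<sigma> * primitive (f x) t \<le> t * f x t"
begin

definition F :: "'a \<Rightarrow> real \<Rightarrow> real" where "F x t = primitive (f x) t"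

definition e :: "'a \<Rightarrow> 'a \<Rightarrow> real" where "e x v = norm v powr p / p + a x * (norm v powr q / q)"

text \<open>The gauge of the source term: up to constants it bounds \<open>F\<close>, and by Young's
  inequality it bounds \<open>f x t * w\<close> through \<open>L t\<close> and \<open>L w\<close>.
  Both exponents are subcritical.\<close>

definition L :: "real \<Rightarrow> real" where "L t = \<bar>t\<bar> powr (q * \<theta>) + \<bar>t\<bar> powr r"

abbreviation \<Phi> :: "'a \<Rightarrow> 'a \<Rightarrow> 'a" where "\<Phi> \<equiv> flux a p q"

text \<open>Vector fields, rather than functions, are the arguments here and in \<open>AP\<close>,
  so that the same functionals serve the classical gradients of test functions and the weak gradient
  of their limit.\<close>

definition EN :: "('a \<Rightarrow> 'a) \<Rightarrow> real" where "EN G = (\<integral>x. e x (G x) \<partial>\<mu>)"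
definition FN :: "('a \<Rightarrow> real) \<Rightarrow> real" where "FN u = (\<integral>x. F x (u x) \<partial>\<mu>)"
definition AP :: "('a \<Rightarrow> 'a) \<Rightarrow> ('a \<Rightarrow> 'a) \<Rightarrow> real" where "AP G W = (\<integral>x. \<Phi> x (G x) \<bullet> W x \<partial>\<mu>)"
definition BP :: "('a \<Rightarrow> real) \<Rightarrow> ('a \<Rightarrow> real) \<Rightarrow> real" where "BP u \<phi> = (\<integral>x. f x (u x) * \<phi> x \<partial>\<mu>)"

section \<open>Pointwise bounds for flux, energy density and source\<close>

lemma exponents: "1 < q" "1 < q * \<theta>" "1 < r" "q * \<theta> < critical_exponent (real DIM('a)) p" "1 < \<sigma>" "q \<le> q * \<theta>"
proof -
  show q: "1 < q" using p by simp
  show "q \<le> q * \<theta>" using mult_left_mono[OF \<theta>, of q] q by simp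
  then show "1 < q * \<theta>" using q by linarith
  then show "1 < r" "q * \<theta> < critical_exponent (real DIM('a)) p" "1 < \<sigma>" using r \<sigma> by linarith+
qed

lemma norm_flux: "x \<in> \<Omega> \<Longrightarrow> norm (\<Phi> x v) = norm v powr (p - 1) + a x * norm v powr (q - 1)"
  using a_bounds(1)[of x] powr_minus_2_mult[of "norm v" p] powr_minus_2_mult[of "norm v" q]
  by (simp add: flux_def distrib_right)

lemma flux_self: "\<Phi> x v \<bullet> v = H x (norm v)"
proof -
  have "norm v powr (s - 2) * (norm v * norm v) = norm v powr s" for s
  proof -
    have "norm v powr (s - 2) * (norm v * norm v) = (norm v powr (s - 2) * norm v) * norm v" by simp
    also have "\<dots> = norm v powr (s - 1) * norm v" by (simp add: powr_minus_2_mult)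
    also have "\<dots> = norm v powr s" using powr_mult_base[of "norm v" "s - 1"] by (simp add: mult.commute)
    finally show ?thesis .
  qed
  then show ?thesis by (simp add: flux_def H_def dot_square_norm power2_eq_square distrib_right mult.assoc)
qed

text \<open>Young's inequality with the small factor on the field inside the flux: a pairing of a
  fixed field with a perturbation of small modular is then small.\<close>

lemma flux_inner_small:
  assumes "0 < \<eta>"
  obtains C where "0 < C" "\<And>x v w. x \<in> \<Omega> \<Longrightarrow> \<bar>\<Phi> x v \<bullet> w\<bar> \<le> \<eta> * H x (norm v) + C * H x (norm w)"
proof -
  obtain C1 where C1: "0 < C1" "\<And>x y. 0 \<le> x \<Longrightarrow> 0 \<le> y \<Longrightarrow> x powr (p - 1) * y \<le> \<eta> * x powr p + C1 * y powr p"
    by (rule young_small[OF p(1) assms]) blast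
  obtain C2 where C2: "0 < C2" "\<And>x y. 0 \<le> x \<Longrightarrow> 0 \<le> y \<Longrightarrow> x powr (q - 1) * y \<le> \<eta> * x powr q + C2 * y powr q"
    by (rule young_small[OF exponents(1) assms]) blast
  show thesis
  proof (rule that)
    show "0 < max C1 C2" using C1 by simp
    fix x v w assume x: "x \<in> \<Omega>"
    have "\<bar>\<Phi> x v \<bullet> w\<bar> \<le> norm (\<Phi> x v) * norm w" by (rule Cauchy_Schwarz_ineq2)
    also have "\<dots> = norm v powr (p - 1) * norm w + a x * (norm v powr (q - 1) * norm w)"
      using norm_flux[OF x] by (simp add: distrib_right)
    also have "\<dots> \<le> (\<eta> * norm v powr p + max C1 C2 * norm w powr p) + a x * (\<eta> * norm v powr q + max C1 C2 * norm w powr q)"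
    proof (intro add_mono mult_left_mono)
      show "norm v powr (p - 1) * norm w \<le> \<eta> * norm v powr p + max C1 C2 * norm w powr p"
        by (rule order_trans[OF C1(2)]) (auto intro: mult_right_mono)
      show "norm v powr (q - 1) * norm w \<le> \<eta> * norm v powr q + max C1 C2 * norm w powr q"
        by (rule order_trans[OF C2(2)]) (auto intro: mult_right_mono)
    qed (use a_bounds x in auto)
    finally show "\<bar>\<Phi> x v \<bullet> w\<bar> \<le> \<eta> * H x (norm v) + max C1 C2 * H x (norm w)"
      by (simp add: H_def algebra_simps)
  qed
qed

lemma flux_tendsto:
  assumes "v \<longlonglongrightarrow> l" shows "(\<lambda>n. \<Phi> x (v n)) \<longlonglongrightarrow> \<Phi> x l"
  unfolding flux_def scaleR_add_left scaleR_scaleR[symmetric]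
  using exponents(1) p(1) by (intro tendsto_add tendsto_scaleR tendsto_const tendsto_powr_scaleR assms)

lemma e_tendsto:
  assumes "v \<longlonglongrightarrow> l" shows "(\<lambda>n. e x (v n)) \<longlonglongrightarrow> e x l"
  unfolding e_def using exponents(1) p(1) assms by (intro tendsto_intros tendsto_powr') auto

lemma e_bounds:
  assumes x: "x \<in> \<Omega>" shows "0 \<le> e x v" "H x (norm v) \<le> q * e x v" "e x v \<le> H x (norm v)"
proof -
  show "0 \<le> e x v" using p a_bounds(1)[OF x] by (simp add: e_def)
  have "norm v powr p \<le> q * (norm v powr p / p)" "q * (a x * (norm v powr q / q)) = a x * norm v powr q"
    using p mult_right_mono[of p q "norm v powr p"] by (simp_all add: field_simps)
  then show "H x (norm v) \<le> q * e x v" by (simp add: H_def e_def distrib_left)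
  have "norm v powr p / p \<le> norm v powr p" "norm v powr q / q \<le> norm v powr q"
    using p divide_left_mono[of 1 p "norm v powr p"] divide_left_mono[of 1 q "norm v powr q"] by simp_all
  then show "e x v \<le> H x (norm v)" using a_bounds(1)[OF x] unfolding e_def H_def by (intro add_mono mult_left_mono)
qed

lemma e_DERIV: "((\<lambda>t. e x (v + t *\<^sub>R w)) has_real_derivative (\<Phi> x (v + t *\<^sub>R w) \<bullet> w)) (at t)"
proof -
  have "((\<lambda>t. e x (v + t *\<^sub>R w)) has_real_derivative
      (norm (v + t *\<^sub>R w) powr (p - 2) * ((v + t *\<^sub>R w) \<bullet> w) + a x * (norm (v + t *\<^sub>R w) powr (q - 2) * ((v + t *\<^sub>R w) \<bullet> w)))) (at t)"
    unfolding e_def using p by (intro DERIV_add DERIV_cmult norm_powr_DERIV) auto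
  then show ?thesis by (simp add: flux_def distrib_right mult.assoc)
qed

lemma e_tangent:
  assumes x: "x \<in> \<Omega>" shows "e x v + \<Phi> x v \<bullet> (w - v) \<le> e x w"
proof -
  have "norm v powr p / p + norm v powr (p - 2) * (v \<bullet> (w - v)) \<le> norm w powr p / p" by (rule norm_powr_tangent(1)[OF p(1)])
  moreover have "a x * (norm v powr q / q + norm v powr (q - 2) * (v \<bullet> (w - v))) \<le> a x * (norm w powr q / q)"
    using a_bounds(1)[OF x] by (intro mult_left_mono norm_powr_tangent(1) exponents)
  ultimately show ?thesis by (simp add: e_def flux_def algebra_simps)
qed

lemma L_nonneg: "0 \<le> L t" and L_zero [simp]: "L 0 = 0" and L_minus [simp]: "L (- t) = L t"
  by (simp_all add: L_def)

lemma L_diff: "L (s - t) \<le> 2 powr r * (L s + L t)"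
proof -
  have "\<bar>s - t\<bar> powr (q * \<theta>) \<le> 2 powr (q * \<theta>) * (\<bar>s\<bar> powr (q * \<theta>) + \<bar>t\<bar> powr (q * \<theta>))"
    using norm_diff_powr_le[of "q * \<theta>" s t] exponents by simp
  also have "\<dots> \<le> 2 powr r * (\<bar>s\<bar> powr (q * \<theta>) + \<bar>t\<bar> powr (q * \<theta>))"
    using r by (intro mult_right_mono) auto
  finally show ?thesis using norm_diff_powr_le[of r s t] exponents by (simp add: L_def algebra_simps)
qed

lemma L_add: "L (s + t) \<le> 2 powr r * (L s + L t)"
  using L_diff[of s "- t"] by simp

lemma L_tendsto: "u \<longlonglongrightarrow> l \<Longrightarrow> (\<lambda>n. L (u n)) \<longlonglongrightarrow> L l"
  unfolding L_def using exponents by (intro tendsto_intros tendsto_powr') auto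

lemma f_small:
  assumes "0 < \<eta>"
  obtains C where "0 < C" "\<And>x t w. x \<in> \<Omega> \<Longrightarrow> \<bar>f x t * w\<bar> \<le> \<eta> * L t + C * L w"
proof -
  have eta: "0 < \<eta> / C0" using assms C0 by simp
  obtain C1 where C1: "0 < C1" "\<And>x y. 0 \<le> x \<Longrightarrow> 0 \<le> y \<Longrightarrow> x powr (q * \<theta> - 1) * y \<le> \<eta> / C0 * x powr (q * \<theta>) + C1 * y powr (q * \<theta>)"
    by (rule young_small[OF exponents(2) eta]) blast
  obtain C2 where C2: "0 < C2" "\<And>x y. 0 \<le> x \<Longrightarrow> 0 \<le> y \<Longrightarrow> x powr (r - 1) * y \<le> \<eta> / C0 * x powr r + C2 * y powr r"
    by (rule young_small[OF exponents(3) eta]) blast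
  show thesis
  proof (rule that)
    show "0 < C0 * max C1 C2" using C1 C0 by simp
    fix x t w assume x: "x \<in> \<Omega>"
    have 1: "\<bar>t\<bar> powr (q * \<theta> - 1) * \<bar>w\<bar> \<le> \<eta> / C0 * \<bar>t\<bar> powr (q * \<theta>) + max C1 C2 * \<bar>w\<bar> powr (q * \<theta>)"
      by (rule order_trans[OF C1(2)]) (auto intro: mult_right_mono)
    have 2: "\<bar>t\<bar> powr (r - 1) * \<bar>w\<bar> \<le> \<eta> / C0 * \<bar>t\<bar> powr r + max C1 C2 * \<bar>w\<bar> powr r"
      by (rule order_trans[OF C2(2)]) (auto intro: mult_right_mono)
    have "\<bar>f x t * w\<bar> \<le> C0 * (\<bar>t\<bar> powr (q * \<theta> - 1) + \<bar>t\<bar> powr (r - 1)) * \<bar>w\<bar>"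
      unfolding abs_mult by (intro mult_right_mono f_growth x) simp
    also have "\<dots> = C0 * (\<bar>t\<bar> powr (q * \<theta> - 1) * \<bar>w\<bar> + \<bar>t\<bar> powr (r - 1) * \<bar>w\<bar>)" by (simp add: algebra_simps)
    also have "\<dots> \<le> C0 * ((\<eta> / C0 * \<bar>t\<bar> powr (q * \<theta>) + max C1 C2 * \<bar>w\<bar> powr (q * \<theta>)) + (\<eta> / C0 * \<bar>t\<bar> powr r + max C1 C2 * \<bar>w\<bar> powr r))"
      using C0 1 2 by (intro mult_left_mono add_mono) auto
    also have "\<dots> = \<eta> * L t + C0 * max C1 C2 * L w"
      using C0 by (simp add: L_def field_simps)
    finally show "\<bar>f x t * w\<bar> \<le> \<eta> * L t + C0 * max C1 C2 * L w" .
  qed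
qed

lemma F_DERIV: "x \<in> \<Omega> \<Longrightarrow> (F x has_real_derivative f x t) (at t)"
  unfolding F_def by (rule DERIV_primitive[OF f_cont])

lemma F_zero [simp]: "F x 0 = 0" by (simp add: F_def)

lemma F_cont: "x \<in> \<Omega> \<Longrightarrow> continuous_on S (F x)"
  using continuous_on_primitive[OF f_cont] by (simp add: F_def[abs_def])

lemma F_bound:
  assumes x: "x \<in> \<Omega>" shows "\<bar>F x t\<bar> \<le> C0 * L t"
proof -
  have "\<bar>F x t\<bar> \<le> C0 * (\<bar>t\<bar> powr (q * \<theta> - 1) + \<bar>t\<bar> powr (r - 1)) * \<bar>t\<bar>" unfolding F_def
  proof (rule abs_primitive_le[OF f_cont[OF x]])
    fix s assume s: "\<bar>s\<bar> \<le> \<bar>t\<bar>"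
    have "\<bar>s\<bar> powr (q * \<theta> - 1) + \<bar>s\<bar> powr (r - 1) \<le> \<bar>t\<bar> powr (q * \<theta> - 1) + \<bar>t\<bar> powr (r - 1)"
      using s exponents(2,3) by (intro add_mono powr_mono2) auto
    then show "\<bar>f x s\<bar> \<le> C0 * (\<bar>t\<bar> powr (q * \<theta> - 1) + \<bar>t\<bar> powr (r - 1))"
      using order_trans[OF f_growth[OF x] mult_left_mono] C0 by simp
  qed
  also have "\<dots> = C0 * L t"
    using powr_mult_base[of "\<bar>t\<bar>" "q * \<theta> - 1"] powr_mult_base[of "\<bar>t\<bar>" "r - 1"] by (simp add: L_def algebra_simps)
  finally show ?thesis .
qed

text \<open>The superlinearity condition is a differential inequality for \<open>F x\<close>;
  integrated outward from \<open>t0\<close> and from \<open>- t0\<close> it gives growth of order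
  \<open>\<sigma>\<close>. The constant \<open>C2\<close> covers the interval in between, where
  \<open>F\<close> is bounded.\<close>

lemma F_superlinear:
  obtains c2 C2 where "0 < c2" "0 < C2" "\<And>x t. x \<in> \<Omega> \<Longrightarrow> c2 * \<bar>t\<bar> powr \<sigma> - C2 \<le> F x t"
proof -
  define c2 where "c2 = c0 / \<sigma> * (1 / t0) powr \<sigma>"
  define C2 where "C2 = c2 * t0 powr \<sigma> + C0 * L t0"
  have s: "0 < \<sigma>" using exponents by simp
  have c2: "0 < c2" using c0 s t0 by (simp add: c2_def)
  have L0: "0 \<le> L t" for t by (rule L_nonneg)
  show thesis
  proof (rule that[OF c2])
    show "0 < C2" unfolding C2_def using c2 t0 C0 L0[of t0] by (intro add_pos_nonneg mult_pos_pos mult_nonneg_nonneg) auto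
    fix x t assume x: "x \<in> \<Omega>"
    have main: "c2 * \<bar>t\<bar> powr \<sigma> \<le> F x t" if t: "t0 \<le> \<bar>t\<bar>"
    proof -
      define k where "k = sgn t"
      have k: "k * \<bar>t\<bar> = t" "\<bar>k\<bar> = 1" using t t0 by (auto simp: k_def sgn_if)
      have "F x (k * t0) * (\<bar>t\<bar> / t0) powr \<sigma> \<le> F x (k * \<bar>t\<bar>)"
      proof (rule powr_quotient_mono[where G = "\<lambda>t. F x (k * t)" and G' = "\<lambda>t. f x (k * t) * k"])
        show "((\<lambda>t. F x (k * t)) has_real_derivative f x (k * s) * k) (at s)" for s
          by (rule DERIV_chain2[OF F_DERIV[OF x]]) (auto intro!: derivative_eq_intros)
        show "\<sigma> * F x (k * s) \<le> s * (f x (k * s) * k)" if "t0 \<le> s" for s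
          using f_AR(2)[OF x, of "k * s"] that k t0 by (simp add: F_def abs_mult mult_ac)
      qed (use t0 t in auto)
      moreover have "c0 / \<sigma> \<le> F x (k * t0)"
        using f_AR(1)[OF x, of "k * t0"] k t0 s by (simp add: F_def abs_mult field_simps)
      then have "c0 / \<sigma> * (\<bar>t\<bar> / t0) powr \<sigma> \<le> F x (k * t0) * (\<bar>t\<bar> / t0) powr \<sigma>" by (intro mult_right_mono) auto
      moreover have "c0 / \<sigma> * (\<bar>t\<bar> / t0) powr \<sigma> = c2 * \<bar>t\<bar> powr \<sigma>" using t0 by (simp add: c2_def powr_divide)
      ultimately show ?thesis using k by simp
    qed
    show "c2 * \<bar>t\<bar> powr \<sigma> - C2 \<le> F x t"
    proof (cases "t0 \<le> \<bar>t\<bar>")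
      case True
      then show ?thesis using main \<open>0 < C2\<close> by simp
    next
      case False
      then have le: "\<bar>t\<bar> powr \<sigma> \<le> t0 powr \<sigma>" "L t \<le> L t0"
        unfolding L_def using s exponents(2,3) t0 by (auto intro!: powr_mono2 add_mono)
      have "\<bar>F x t\<bar> \<le> C0 * L t0" using order_trans[OF F_bound[OF x] mult_left_mono[OF le(2)]] C0 by simp
      moreover have "c2 * \<bar>t\<bar> powr \<sigma> \<le> c2 * t0 powr \<sigma>" using le(1) c2 by (intro mult_left_mono) auto
      ultimately show ?thesis unfolding C2_def by linarith
    qed
  qed
qed

text \<open>Where \<open>\<bar>t\<bar>\<close> is at least \<open>t0\<close> the difference is not
  positive; for smaller \<open>t\<close> the growth condition bounds both terms.\<close>

lemma f_AR_remainder: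
  obtains C3 where "0 < C3" "\<And>x t. x \<in> \<Omega> \<Longrightarrow> F x t - t * f x t / \<sigma> \<le> C3"
proof -
  have s: "0 < \<sigma>" using exponents by simp
  define b where "b = C0 * (t0 powr (q * \<theta> - 1) + t0 powr (r - 1))"
  have b: "0 \<le> b" using C0 by (simp add: b_def)
  show thesis
  proof (rule that)
    show "0 < C0 * L t0 + t0 * b / \<sigma> + 1" using C0 L_nonneg[of t0] t0 b s by (intro add_nonneg_pos add_nonneg_nonneg) auto
    fix x t assume x: "x \<in> \<Omega>"
    show "F x t - t * f x t / \<sigma> \<le> C0 * L t0 + t0 * b / \<sigma> + 1"
    proof (cases "t0 \<le> \<bar>t\<bar>")
      case True
      then have "F x t \<le> t * f x t / \<sigma>" using f_AR(2)[OF x True] s by (simp add: F_def field_simps)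
      moreover have "0 \<le> C0 * L t0 + t0 * b / \<sigma>" using C0 L_nonneg[of t0] t0 b s by (intro add_nonneg_nonneg) auto
      ultimately show ?thesis by simp
    next
      case False
      then have le: "L t \<le> L t0" "\<bar>t\<bar> powr (q * \<theta> - 1) + \<bar>t\<bar> powr (r - 1) \<le> t0 powr (q * \<theta> - 1) + t0 powr (r - 1)"
        unfolding L_def using exponents(2,3) t0 by (auto intro!: powr_mono2 add_mono)
      have 1: "F x t \<le> C0 * L t0" using order_trans[OF F_bound[OF x, of t] mult_left_mono[OF le(1)]] C0 by (simp add: abs_le_iff)
      have fb: "\<bar>f x t\<bar> \<le> b" unfolding b_def using order_trans[OF f_growth[OF x, of t] mult_left_mono[OF le(2)]] C0 by simp
      have "\<bar>t * f x t\<bar> \<le> t0 * b" unfolding abs_mult using False fb by (intro mult_mono) auto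
      then have "- (t * f x t) / \<sigma> \<le> t0 * b / \<sigma>" using s by (intro divide_right_mono) auto
      with 1 show ?thesis by simp
    qed
  qed
qed

lemma f_comp_measurable [measurable (raw)]: "u \<in> borel_measurable \<mu> \<Longrightarrow> (\<lambda>x. f x (u x)) \<in> borel_measurable \<mu>"
  by (rule caratheodory_measurable[OF f_measurable]) (use f_cont in auto)

lemma F_comp_measurable [measurable (raw)]: "u \<in> borel_measurable \<mu> \<Longrightarrow> (\<lambda>x. F x (u x)) \<in> borel_measurable \<mu>"
  by (rule caratheodory_measurable) (use F_cont primitive_measurable[OF f_measurable] f_cont in \<open>auto simp: F_def\<close>)

lemma e_comp_measurable [measurable (raw)]:
  assumes [measurable]: "G \<in> borel_measurable \<mu>" shows "(\<lambda>x. e x (G x)) \<in> borel_measurable \<mu>"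
  unfolding e_def by measurable

lemma flux_comp_measurable [measurable (raw)]:
  assumes [measurable]: "G \<in> borel_measurable \<mu>" shows "(\<lambda>x. \<Phi> x (G x)) \<in> borel_measurable \<mu>"
  unfolding flux_def by measurable

section \<open>The primitive of \<open>M\<close>\<close>

lemma P_DERIV: "(primitive M has_real_derivative M t) (at t)"
  by (rule DERIV_primitive[OF M_cont])

lemma P_mono: "s \<le> t \<Longrightarrow> primitive M s \<le> primitive M t"
  by (rule DERIV_nonneg_imp_nondecreasing[where f = "primitive M"]) (auto intro!: exI[of _ "M _"] P_DERIV M_nonneg)

lemma P_nonneg: "0 \<le> t \<Longrightarrow> 0 \<le> primitive M t"
  using P_mono[of 0 t] by simp

text \<open>\<open>M\<close> may vanish at 0, but it has a positive lower bound from
  \<open>1/2\<close> on.\<close>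

lemma P_1_pos: "0 < primitive M 1"
proof -
  obtain \<kappa> where k: "0 < \<kappa>" "\<forall>t\<ge>1/2. \<kappa> \<le> M t" using M_pos[of "1/2"] by auto
  obtain z :: real where z: "1/2 < z" "z < 1" "primitive M 1 - primitive M (1/2) = (1 - 1/2) * M z"
    using MVT2[of "1/2" 1 "primitive M" M] P_DERIV by auto
  then have "0 < primitive M 1 - primitive M (1/2)" using k by (smt (verit) mult_pos_pos)
  then show ?thesis using P_nonneg[of "1/2"] by simp
qed

text \<open>\<open>M_growth\<close> makes \<open>primitive M t / t powr \<theta>\<close>
  nonincreasing for positive \<open>t\<close>. Comparison with the value at 1 bounds the primitive
  from below to the left of 1 and, in \<open>P_upper\<close>, from above to the right of it.\<close>

lemma P_lower: "0 < t \<Longrightarrow> t \<le> 1 \<Longrightarrow> primitive M 1 * t powr \<theta> \<le> primitive M t"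
proof -
  assume t: "0 < t" "t \<le> 1"
  have "primitive M 1 \<le> primitive M t * (1 / t) powr \<theta>"
    by (rule powr_quotient_antimono[OF P_DERIV]) (use M_growth t in auto)
  then show ?thesis using t by (simp add: powr_divide field_simps)
qed

lemma P_upper: "0 \<le> t \<Longrightarrow> primitive M t \<le> primitive M 1 * (1 + t powr \<theta>)"
proof -
  assume t: "0 \<le> t"
  show ?thesis
  proof (cases "t \<le> 1")
    case True
    then show ?thesis using P_mono[of t 1] P_1_pos by (simp add: add_increasing2 distrib_left)
  next
    case False
    have "primitive M t \<le> primitive M 1 * (t / 1) powr \<theta>"
      by (rule powr_quotient_antimono[OF P_DERIV]) (use M_growth False in auto)
    then show ?thesis using P_1_pos by (simp add: distrib_left)
  qed
qed

section \<open>Integrability and continuity of the functionals\<close>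

lemma EN_integrable:
  assumes [measurable]: "G \<in> borel_measurable \<mu>" and i: "integrable \<mu> (\<lambda>x. H x (norm (G x)))"
  shows "integrable \<mu> (\<lambda>x. e x (G x))" "0 \<le> EN G" "(\<integral>x. H x (norm (G x)) \<partial>\<mu>) \<le> q * EN G" "EN G \<le> (\<integral>x. H x (norm (G x)) \<partial>\<mu>)"
proof -
  show ei: "integrable \<mu> (\<lambda>x. e x (G x))"
    by (rule Bochner_Integration.integrable_bound[OF i]) (auto intro!: AE_I2 simp: e_bounds H_nonneg)
  show "0 \<le> EN G" unfolding EN_def by (intro Bochner_Integration.integral_nonneg) (simp add: e_bounds)
  have "(\<integral>x. H x (norm (G x)) \<partial>\<mu>) \<le> (\<integral>x. q * e x (G x) \<partial>\<mu>)" using i ei by (intro integral_mono) (auto simp: e_bounds)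
  then show "(\<integral>x. H x (norm (G x)) \<partial>\<mu>) \<le> q * EN G" by (simp add: EN_def)
  show "EN G \<le> (\<integral>x. H x (norm (G x)) \<partial>\<mu>)" unfolding EN_def using i ei by (intro integral_mono) (auto simp: e_bounds)
qed

lemma FN_integrable:
  assumes [measurable]: "u \<in> borel_measurable \<mu>" and i: "integrable \<mu> (\<lambda>x. L (u x))"
  shows "integrable \<mu> (\<lambda>x. F x (u x))" "\<bar>FN u\<bar> \<le> C0 * (\<integral>x. L (u x) \<partial>\<mu>)"
proof -
  show fi: "integrable \<mu> (\<lambda>x. F x (u x))"
    by (rule Bochner_Integration.integrable_bound[OF integrable_mult_right[OF i, of C0]])
      (use F_bound C0 L_nonneg in \<open>auto intro!: AE_I2 simp: abs_mult\<close>)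
  have "\<bar>FN u\<bar> \<le> (\<integral>x. \<bar>F x (u x)\<bar> \<partial>\<mu>)" unfolding FN_def by (rule integral_abs_bound)
  also have "\<dots> \<le> (\<integral>x. C0 * L (u x) \<partial>\<mu>)" using fi i F_bound by (intro integral_mono) auto
  finally show "\<bar>FN u\<bar> \<le> C0 * (\<integral>x. L (u x) \<partial>\<mu>)" by simp
qed

lemma AP_integrable:
  assumes [measurable]: "G \<in> borel_measurable \<mu>" "W \<in> borel_measurable \<mu>"
    and i: "integrable \<mu> (\<lambda>x. H x (norm (G x)))" "integrable \<mu> (\<lambda>x. H x (norm (W x)))"
  shows "integrable \<mu> (\<lambda>x. \<Phi> x (G x) \<bullet> W x)"
proof -
  obtain C where C: "0 < C" "\<And>x v w. x \<in> \<Omega> \<Longrightarrow> \<bar>\<Phi> x v \<bullet> w\<bar> \<le> 1 * H x (norm v) + C * H x (norm w)"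
    by (rule flux_inner_small[of 1]) auto
  show ?thesis
  proof (rule Bochner_Integration.integrable_bound)
    show "integrable \<mu> (\<lambda>x. 1 * H x (norm (G x)) + C * H x (norm (W x)))" using i by simp
    show "AE x in \<mu>. norm (\<Phi> x (G x) \<bullet> W x) \<le> norm (1 * H x (norm (G x)) + C * H x (norm (W x)))"
      unfolding real_norm_def by (intro AE_I2 order_trans[OF C(2) abs_ge_self]) simp
  qed measurable
qed

lemma BP_integrable:
  assumes [measurable]: "u \<in> borel_measurable \<mu>" "w \<in> borel_measurable \<mu>"
    and i: "integrable \<mu> (\<lambda>x. L (u x))" "integrable \<mu> (\<lambda>x. L (w x))"
  shows "integrable \<mu> (\<lambda>x. f x (u x) * w x)"
proof -
  obtain C where C: "0 < C" "\<And>x t w. x \<in> \<Omega> \<Longrightarrow> \<bar>f x t * w\<bar> \<le> 1 * L t + C * L w"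
    by (rule f_small[of 1]) auto
  show ?thesis
  proof (rule Bochner_Integration.integrable_bound)
    show "integrable \<mu> (\<lambda>x. 1 * L (u x) + C * L (w x))" using i by simp
    show "AE x in \<mu>. norm (f x (u x) * w x) \<le> norm (1 * L (u x) + C * L (w x))"
      unfolding real_norm_def by (intro AE_I2 order_trans[OF C(2) abs_ge_self]) simp
  qed measurable
qed

text \<open>A fixed integrable majorant is not at hand, but \<open>H x (norm (Gn n x))\<close> is at
  most a fixed integrable function plus \<open>k n x\<close>, whose integral tends to 0. This is the
  situation of \<open>dominated_convergence_perturbed\<close>.\<close>

lemma gradient_functionals_tendsto:
  assumes m: "\<And>n. Gn n \<in> borel_measurable \<mu>" "G \<in> borel_measurable \<mu>" and i: "integrable \<mu> (\<lambda>x. H x (norm (G x)))"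
    and d: "\<And>n. integrable \<mu> (\<lambda>x. H x (norm (Gn n x - G x)))" "(\<lambda>n. \<integral>x. H x (norm (Gn n x - G x)) \<partial>\<mu>) \<longlonglongrightarrow> 0"
    and ae: "AE x in \<mu>. (\<lambda>n. Gn n x) \<longlonglongrightarrow> G x"
  shows "(\<lambda>n. EN (Gn n)) \<longlonglongrightarrow> EN G"
    "\<And>W. W \<in> borel_measurable \<mu> \<Longrightarrow> integrable \<mu> (\<lambda>x. H x (norm (W x))) \<Longrightarrow> (\<lambda>n. AP (Gn n) W) \<longlonglongrightarrow> AP G W"
proof -
  note [measurable] = m
  define k where "k n x = 2 powr q * H x (norm (Gn n x - G x))" for n x
  have ki: "integrable \<mu> (k n)" for n unfolding k_def using d(1) by simp
  have kl: "(\<lambda>n. \<integral>x. k n x \<partial>\<mu>) \<longlonglongrightarrow> 0" unfolding k_def using tendsto_mult_right_zero[OF d(2)] by simp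
  have k0: "0 \<le> k n x" if "x \<in> space \<mu>" for n x using that by (simp add: k_def H_nonneg)
  have kae: "AE x in \<mu>. (\<lambda>n. k n x) \<longlonglongrightarrow> 0"
    using ae
  proof eventually_elim
    case (elim x)
    have "(\<lambda>n. norm (Gn n x - G x)) \<longlonglongrightarrow> 0" using elim by (simp add: LIM_zero tendsto_norm_zero)
    from tendsto_mult[OF tendsto_const[of "2 powr q"] H_tendsto[OF this, of x]] show ?case by (simp add: k_def)
  qed
  have HG: "H x (norm (Gn n x)) \<le> 2 powr q * H x (norm (G x)) + k n x" if "x \<in> space \<mu>" for n x
    using H_add[of x "G x" "Gn n x - G x"] that by (simp add: k_def algebra_simps)
  show "(\<lambda>n. EN (Gn n)) \<longlonglongrightarrow> EN G" unfolding EN_def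
  proof (rule dominated_convergence_perturbed[where H = "\<lambda>x. 2 powr q * H x (norm (G x))" and k = k, OF _ _ _ ki kl k0 kae])
    show "\<bar>e x (Gn n x)\<bar> \<le> 2 powr q * H x (norm (G x)) + k n x" if "x \<in> space \<mu>" for n x
      using order_trans[OF e_bounds(3) HG] e_bounds(1) that by simp
    show "AE x in \<mu>. (\<lambda>n. e x (Gn n x)) \<longlonglongrightarrow> e x (G x)" using ae by eventually_elim (rule e_tendsto)
  qed (use i in \<open>auto simp: H_nonneg\<close>)
  fix W :: "'a \<Rightarrow> 'a" assume W[measurable]: "W \<in> borel_measurable \<mu>" and Wi: "integrable \<mu> (\<lambda>x. H x (norm (W x)))"
  obtain C where C: "0 < C" "\<And>x v w. x \<in> \<Omega> \<Longrightarrow> \<bar>\<Phi> x v \<bullet> w\<bar> \<le> 1 * H x (norm v) + C * H x (norm w)"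
    by (rule flux_inner_small[of 1]) auto
  show "(\<lambda>n. AP (Gn n) W) \<longlonglongrightarrow> AP G W" unfolding AP_def
  proof (rule dominated_convergence_perturbed[where H = "\<lambda>x. 2 powr q * H x (norm (G x)) + C * H x (norm (W x))" and k = k, OF _ _ _ ki kl k0 kae])
    show "\<bar>\<Phi> x (Gn n x) \<bullet> W x\<bar> \<le> 2 powr q * H x (norm (G x)) + C * H x (norm (W x)) + k n x" if "x \<in> space \<mu>" for n x
      using C(2)[of x "Gn n x" "W x"] HG[OF that, of n] that by simp
    show "AE x in \<mu>. (\<lambda>n. \<Phi> x (Gn n x) \<bullet> W x) \<longlonglongrightarrow> \<Phi> x (G x) \<bullet> W x"
      using ae by eventually_elim (intro tendsto_inner flux_tendsto tendsto_const)
  qed (use i Wi C(1) in \<open>auto simp: H_nonneg\<close>)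
qed

lemma source_functionals_tendsto:
  assumes m: "\<And>n. un n \<in> borel_measurable \<mu>" "u \<in> borel_measurable \<mu>" and i: "integrable \<mu> (\<lambda>x. L (u x))"
    and d: "\<And>n. integrable \<mu> (\<lambda>x. L (un n x - u x))" "(\<lambda>n. \<integral>x. L (un n x - u x) \<partial>\<mu>) \<longlonglongrightarrow> 0"
    and ae: "AE x in \<mu>. (\<lambda>n. un n x) \<longlonglongrightarrow> u x"
  shows "(\<lambda>n. FN (un n)) \<longlonglongrightarrow> FN u"
    "\<And>w. w \<in> borel_measurable \<mu> \<Longrightarrow> integrable \<mu> (\<lambda>x. L (w x)) \<Longrightarrow> (\<lambda>n. BP (un n) w) \<longlonglongrightarrow> BP u w"
proof -
  note [measurable] = m
  define D where "D = max 1 C0 * 2 powr r"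
  have D: "0 \<le> D" by (simp add: D_def)
  define k where "k n x = D * L (un n x - u x)" for n x
  have ki: "integrable \<mu> (k n)" for n unfolding k_def using d(1) by simp
  have kl: "(\<lambda>n. \<integral>x. k n x \<partial>\<mu>) \<longlonglongrightarrow> 0" unfolding k_def using tendsto_mult_right_zero[OF d(2)] by simp
  have k0: "0 \<le> k n x" if "x \<in> space \<mu>" for n x using D by (simp add: k_def L_nonneg)
  have kae: "AE x in \<mu>. (\<lambda>n. k n x) \<longlonglongrightarrow> 0"
    using ae
  proof eventually_elim
    case (elim x)
    have "(\<lambda>n. un n x - u x) \<longlonglongrightarrow> 0" using elim by (rule LIM_zero)
    from tendsto_mult[OF tendsto_const[of D] L_tendsto[OF this]] show ?case by (simp add: k_def)
  qed
  have Lu: "max 1 C0 * L (un n x) \<le> D * L (u x) + k n x" for n x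
  proof -
    have "max 1 C0 * L (un n x) \<le> max 1 C0 * (2 powr r * (L (u x) + L (un n x - u x)))"
      using L_add[of "u x" "un n x - u x"] by (intro mult_left_mono) auto
    then show ?thesis by (simp add: k_def D_def algebra_simps)
  qed
  show "(\<lambda>n. FN (un n)) \<longlonglongrightarrow> FN u" unfolding FN_def
  proof (rule dominated_convergence_perturbed[where H = "\<lambda>x. D * L (u x)" and k = k, OF _ _ _ ki kl k0 kae])
    show "\<bar>F x (un n x)\<bar> \<le> D * L (u x) + k n x" if "x \<in> space \<mu>" for n x
    proof -
      have "\<bar>F x (un n x)\<bar> \<le> C0 * L (un n x)" using that by (simp add: F_bound)
      also have "\<dots> \<le> max 1 C0 * L (un n x)" by (intro mult_right_mono L_nonneg) simp
      finally show ?thesis using Lu[of n x] by simp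
    qed
    show "AE x in \<mu>. (\<lambda>n. F x (un n x)) \<longlonglongrightarrow> F x (u x)" using ae AE_space
      by eventually_elim (auto intro: continuous_on_tendsto_compose[OF F_cont[where S = UNIV]])
  qed (use i D in \<open>auto simp: L_nonneg\<close>)
  fix w assume w[measurable]: "w \<in> borel_measurable \<mu>" and wi: "integrable \<mu> (\<lambda>x. L (w x))"
  obtain C where C: "0 < C" "\<And>x t w. x \<in> \<Omega> \<Longrightarrow> \<bar>f x t * w\<bar> \<le> 1 * L t + C * L w"
    by (rule f_small[of 1]) auto
  show "(\<lambda>n. BP (un n) w) \<longlonglongrightarrow> BP u w" unfolding BP_def
  proof (rule dominated_convergence_perturbed[where H = "\<lambda>x. D * L (u x) + C * L (w x)" and k = k, OF _ _ _ ki kl k0 kae])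
    show "\<bar>f x (un n x) * w x\<bar> \<le> D * L (u x) + C * L (w x) + k n x" if "x \<in> space \<mu>" for n x
    proof -
      have "\<bar>f x (un n x) * w x\<bar> \<le> 1 * L (un n x) + C * L (w x)" using that by (intro C(2)) simp
      also have "1 * L (un n x) \<le> max 1 C0 * L (un n x)" by (intro mult_right_mono L_nonneg) simp
      finally show ?thesis using Lu[of n x] by simp
    qed
    show "AE x in \<mu>. (\<lambda>n. f x (un n x) * w x) \<longlonglongrightarrow> f x (u x) * w x" using ae AE_space
      by eventually_elim (auto intro!: tendsto_mult_right continuous_on_tendsto_compose[OF f_cont])
  qed (use i D wi C(1) in \<open>auto simp: L_nonneg\<close>)
qed

definition J :: "('a \<Rightarrow> real) \<Rightarrow> real" where "J u = primitive M (EN (grad u)) - FN u"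

text \<open>Vanishing of \<open>DJ u \<phi>\<close> is the weak equation for \<open>u\<close> tested
  with \<open>\<phi>\<close>; \<open>J_DERIV\<close> shows that it is the directional derivative of
  \<open>J\<close>.\<close>

definition DJ :: "('a \<Rightarrow> real) \<Rightarrow> ('a \<Rightarrow> real) \<Rightarrow> real" where
  "DJ u \<phi> = M (EN (grad u)) * AP (grad u) (grad \<phi>) - BP u \<phi>"

lemma test_L_integrable: "\<phi> \<in> test \<Longrightarrow> integrable \<mu> (\<lambda>x. L (\<phi> x))"
  unfolding L_def using test_integrable(1) exponents(2,3) by (intro Bochner_Integration.integrable_add) auto

lemma L_mono: "\<bar>s\<bar> \<le> \<bar>t\<bar> \<Longrightarrow> L s \<le> L t"
  unfolding L_def using exponents(2,3) by (intro add_mono powr_mono2) auto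

lemma test_integrals_le:
  assumes \<phi>: "\<phi> \<in> test" and b: "\<And>x. \<bar>\<phi> x\<bar> \<le> b" "\<And>x. norm (grad \<phi> x) \<le> b"
  shows "(\<integral>x. L (\<phi> x) \<partial>\<mu>) \<le> L b * measure \<mu> \<Omega>"
    "(\<integral>x. H x (norm (grad \<phi> x)) \<partial>\<mu>) \<le> (b powr p + A * b powr q) * measure \<mu> \<Omega>"
proof -
  have b0: "0 \<le> b" using b(1)[of undefined] by simp
  have "(\<integral>x. L (\<phi> x) \<partial>\<mu>) \<le> (\<integral>x. L b \<partial>\<mu>)"
    by (rule integral_mono[OF test_L_integrable[OF \<phi>]]) (use b b0 in \<open>auto intro: L_mono\<close>)
  then show "(\<integral>x. L (\<phi> x) \<partial>\<mu>) \<le> L b * measure \<mu> \<Omega>" by (simp add: mult.commute)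
  have "(\<integral>x. H x (norm (grad \<phi> x)) \<partial>\<mu>) \<le> (\<integral>x. b powr p + A * b powr q \<partial>\<mu>)"
  proof (rule integral_mono[OF test_integrable(4)[OF \<phi>]])
    show "H x (norm (grad \<phi> x)) \<le> b powr p + A * b powr q" if "x \<in> space \<mu>" for x
      using H_mono[of x "norm (grad \<phi> x)" b] H_le[of x b] b(2)[of x] that by simp
  qed simp
  then show "(\<integral>x. H x (norm (grad \<phi> x)) \<partial>\<mu>) \<le> (b powr p + A * b powr q) * measure \<mu> \<Omega>" by (simp add: mult.commute)
qed

section \<open>Finite linear combinations of test functions\<close>

definition comb :: "nat \<Rightarrow> (nat \<Rightarrow> 'a \<Rightarrow> real) \<Rightarrow> (nat \<Rightarrow> real) \<Rightarrow> 'a \<Rightarrow> real" where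
  "comb k \<psi> c x = (\<Sum>i<k. c i * \<psi> i x)"

context
  fixes k :: nat and \<psi> :: "nat \<Rightarrow> 'a \<Rightarrow> real"
  assumes \<psi>: "\<And>i. i < k \<Longrightarrow> \<psi> i \<in> test"
begin

lemma comb_test: "comb k \<psi> c \<in> test" "grad (comb k \<psi> c) x = (\<Sum>i<k. c i *\<^sub>R grad (\<psi> i) x)"
  using test_functions_lincomb[of "{..<k}" \<psi> \<Omega> c] \<psi> by (simp_all add: comb_def[abs_def])

lemma comb_bound:
  obtains B where "0 < B" "\<And>c x. \<bar>comb k \<psi> c x\<bar> \<le> B * (\<Sum>i<k. \<bar>c i\<bar>)" "\<And>c x. norm (grad (comb k \<psi> c) x) \<le> B * (\<Sum>i<k. \<bar>c i\<bar>)"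
proof -
  have "\<forall>i\<in>{..<k}. \<exists>b. 0 < b \<and> (\<forall>x. \<bar>\<psi> i x\<bar> \<le> b \<and> norm (grad (\<psi> i) x) \<le> b)"
    using test_functions_bounded[OF \<psi>] by (metis lessThan_iff)
  from bchoice[OF this] obtain b where b: "\<forall>i\<in>{..<k}. 0 < b i \<and> (\<forall>x. \<bar>\<psi> i x\<bar> \<le> b i \<and> norm (grad (\<psi> i) x) \<le> b i)" ..
  define B where "B = 1 + (\<Sum>i<k. b i)"
  have bB: "b i \<le> B" if "i < k" for i
    using member_le_sum[of i "{..<k}" b] b that by (auto simp: B_def less_imp_le)
  have B0: "0 < B" unfolding B_def using b by (intro add_pos_nonneg sum_nonneg) (auto simp: less_imp_le)
  show thesis
  proof (rule that[OF B0])
    fix c x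
    have "\<bar>comb k \<psi> c x\<bar> \<le> (\<Sum>i<k. \<bar>c i * \<psi> i x\<bar>)" unfolding comb_def by (rule sum_abs)
    also have "\<dots> \<le> (\<Sum>i<k. B * \<bar>c i\<bar>)"
    proof (rule sum_mono)
      fix i assume "i \<in> {..<k}"
      then have "\<bar>\<psi> i x\<bar> \<le> B" using b bB[of i] by (auto intro: order_trans)
      then show "\<bar>c i * \<psi> i x\<bar> \<le> B * \<bar>c i\<bar>" unfolding abs_mult by (subst mult.commute) (intro mult_right_mono; simp)
    qed
    finally show "\<bar>comb k \<psi> c x\<bar> \<le> B * (\<Sum>i<k. \<bar>c i\<bar>)" by (simp add: sum_distrib_left)
    have "norm (grad (comb k \<psi> c) x) \<le> (\<Sum>i<k. norm (c i *\<^sub>R grad (\<psi> i) x))" unfolding comb_test(2) by (rule norm_sum)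
    also have "\<dots> \<le> (\<Sum>i<k. B * \<bar>c i\<bar>)"
    proof (rule sum_mono)
      fix i assume "i \<in> {..<k}"
      then have "norm (grad (\<psi> i) x) \<le> B" using b bB[of i] by (auto intro: order_trans)
      then show "norm (c i *\<^sub>R grad (\<psi> i) x) \<le> B * \<bar>c i\<bar>" unfolding norm_scaleR by (subst mult.commute) (intro mult_right_mono; simp)
    qed
    finally show "norm (grad (comb k \<psi> c) x) \<le> B * (\<Sum>i<k. \<bar>c i\<bar>)" by (simp add: sum_distrib_left)
  qed
qed

lemma comb_diff: "comb k \<psi> c x - comb k \<psi> d x = comb k \<psi> (\<lambda>i. c i - d i) x"
  "grad (comb k \<psi> c) x - grad (comb k \<psi> d) x = grad (comb k \<psi> (\<lambda>i. c i - d i)) x"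
  by (simp_all add: comb_test(2)) (simp_all add: comb_def sum_subtractf left_diff_distrib scaleR_diff_left)

lemma comb_add: "comb k \<psi> (\<lambda>i. c i + t * d i) x = comb k \<psi> c x + t * comb k \<psi> d x"
  by (simp add: comb_def sum.distrib distrib_right sum_distrib_left mult.assoc)

text \<open>Convergence of the \<open>k\<close> coordinates entails uniform convergence of the
  functions and of their gradients, both at the rate \<open>b n\<close>.\<close>

lemma comb_tendsto:
  assumes "\<And>i. i < k \<Longrightarrow> (\<lambda>n. c n i) \<longlonglongrightarrow> l i"
  shows "(\<lambda>n. EN (grad (comb k \<psi> (c n)))) \<longlonglongrightarrow> EN (grad (comb k \<psi> l))"
    "(\<lambda>n. FN (comb k \<psi> (c n))) \<longlonglongrightarrow> FN (comb k \<psi> l)"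
    "\<phi> \<in> test \<Longrightarrow> (\<lambda>n. AP (grad (comb k \<psi> (c n))) (grad \<phi>)) \<longlonglongrightarrow> AP (grad (comb k \<psi> l)) (grad \<phi>)"
    "\<phi> \<in> test \<Longrightarrow> (\<lambda>n. BP (comb k \<psi> (c n)) \<phi>) \<longlonglongrightarrow> BP (comb k \<psi> l) \<phi>"
proof -
  obtain B where B: "0 < B" "\<And>c x. \<bar>comb k \<psi> c x\<bar> \<le> B * (\<Sum>i<k. \<bar>c i\<bar>)" "\<And>c x. norm (grad (comb k \<psi> c) x) \<le> B * (\<Sum>i<k. \<bar>c i\<bar>)"
    by (rule comb_bound) blast
  define b where "b n = B * (\<Sum>i<k. \<bar>c n i - l i\<bar>)" for n
  have b0: "0 \<le> b n" for n unfolding b_def using B by (intro mult_nonneg_nonneg sum_nonneg) auto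
  have bl: "b \<longlonglongrightarrow> 0"
  proof -
    have "b \<longlonglongrightarrow> B * (\<Sum>i<k. 0)" unfolding b_def
      by (intro tendsto_mult tendsto_const tendsto_sum tendsto_rabs_zero[OF LIM_zero[OF assms]]) simp
    then show ?thesis by simp
  qed
  define d where "d n = comb k \<psi> (\<lambda>i. c n i - l i)" for n
  have dt: "d n \<in> test" for n unfolding d_def by (rule comb_test)
  have db: "\<bar>d n x\<bar> \<le> b n" "norm (grad (d n) x) \<le> b n" for n x
    using B(2,3)[of "\<lambda>i. c n i - l i" x] by (simp_all add: d_def b_def)
  have gd: "grad (comb k \<psi> (c n)) x - grad (comb k \<psi> l) x = grad (d n) x" and ud: "comb k \<psi> (c n) x - comb k \<psi> l x = d n x" for n x
    by (simp_all add: d_def comb_diff)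
  have lim1: "(\<lambda>n. comb k \<psi> (c n) x) \<longlonglongrightarrow> comb k \<psi> l x" for x
    by (rule LIM_zero_cancel, rule Lim_null_comparison[OF _ bl]) (use db in \<open>simp add: ud\<close>)
  have lim2: "(\<lambda>n. grad (comb k \<psi> (c n)) x) \<longlonglongrightarrow> grad (comb k \<psi> l) x" for x
    by (rule LIM_zero_cancel, rule Lim_null_comparison[OF _ bl]) (use db in \<open>simp add: gd\<close>)
  have "(\<lambda>n. (b n powr p + A * b n powr q) * measure \<mu> \<Omega>) \<longlonglongrightarrow> (0 powr p + A * 0 powr q) * measure \<mu> \<Omega>"
    using p b0 bl by (intro tendsto_intros tendsto_powr') auto
  then have z1: "(\<lambda>n. (b n powr p + A * b n powr q) * measure \<mu> \<Omega>) \<longlonglongrightarrow> 0" by simp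
  have Hl: "(\<lambda>n. \<integral>x. H x (norm (grad (comb k \<psi> (c n)) x - grad (comb k \<psi> l) x)) \<partial>\<mu>) \<longlonglongrightarrow> 0"
  proof (rule Lim_null_comparison[OF always_eventually z1], rule allI)
    show "norm (\<integral>x. H x (norm (grad (comb k \<psi> (c n)) x - grad (comb k \<psi> l) x)) \<partial>\<mu>) \<le> (b n powr p + A * b n powr q) * measure \<mu> \<Omega>" for n
    proof -
      have "0 \<le> (\<integral>x. H x (norm (grad (d n) x)) \<partial>\<mu>)" by (intro Bochner_Integration.integral_nonneg) (simp add: H_nonneg)
      then show ?thesis using test_integrals_le(2)[OF dt db] by (simp add: gd)
    qed
  qed
  have "(\<lambda>n. L (b n) * measure \<mu> \<Omega>) \<longlonglongrightarrow> L 0 * measure \<mu> \<Omega>" by (intro tendsto_intros L_tendsto bl)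
  then have z2: "(\<lambda>n. L (b n) * measure \<mu> \<Omega>) \<longlonglongrightarrow> 0" by simp
  have Ll: "(\<lambda>n. \<integral>x. L (comb k \<psi> (c n) x - comb k \<psi> l x) \<partial>\<mu>) \<longlonglongrightarrow> 0"
  proof (rule Lim_null_comparison[OF always_eventually z2], rule allI)
    show "norm (\<integral>x. L (comb k \<psi> (c n) x - comb k \<psi> l x) \<partial>\<mu>) \<le> L (b n) * measure \<mu> \<Omega>" for n
    proof -
      have "0 \<le> (\<integral>x. L (d n x) \<partial>\<mu>)" by (intro Bochner_Integration.integral_nonneg) (simp add: L_nonneg)
      then show ?thesis using test_integrals_le(1)[OF dt db] by (simp add: ud)
    qed
  qed
  note cm = test_functions_measurable_on[OF comb_test(1)]
  have Hi: "integrable \<mu> (\<lambda>x. H x (norm (grad (comb k \<psi> (c n)) x - grad (comb k \<psi> l) x)))" for n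
    using test_integrable(4)[OF dt] by (simp add: gd)
  have Li: "integrable \<mu> (\<lambda>x. L (comb k \<psi> (c n) x - comb k \<psi> l x))" for n
    using test_L_integrable[OF dt] by (simp add: ud)
  note G = gradient_functionals_tendsto[OF cm(2) cm(2) test_integrable(4)[OF comb_test(1)] Hi Hl AE_I2[OF lim2]]
  note S = source_functionals_tendsto[OF cm(1) cm(1) test_L_integrable[OF comb_test(1)] Li Ll AE_I2[OF lim1]]
  show "(\<lambda>n. EN (grad (comb k \<psi> (c n)))) \<longlonglongrightarrow> EN (grad (comb k \<psi> l))" by (rule G(1))
  show "(\<lambda>n. FN (comb k \<psi> (c n))) \<longlonglongrightarrow> FN (comb k \<psi> l)" by (rule S(1))
  assume \<phi>: "\<phi> \<in> test"
  show "(\<lambda>n. AP (grad (comb k \<psi> (c n))) (grad \<phi>)) \<longlonglongrightarrow> AP (grad (comb k \<psi> l)) (grad \<phi>)"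
    by (rule G(2)[OF test_functions_measurable_on(2)[OF \<phi>] test_integrable(4)[OF \<phi>]])
  show "(\<lambda>n. BP (comb k \<psi> (c n)) \<phi>) \<longlonglongrightarrow> BP (comb k \<psi> l) \<phi>"
    by (rule S(2)[OF test_functions_measurable_on(1)[OF \<phi>] test_L_integrable[OF \<phi>]])
qed

lemma J_comb_tendsto:
  assumes "\<And>i. i < k \<Longrightarrow> (\<lambda>n. c n i) \<longlonglongrightarrow> l i"
  shows "(\<lambda>n. J (comb k \<psi> (c n))) \<longlonglongrightarrow> J (comb k \<psi> l)"
    "\<phi> \<in> test \<Longrightarrow> (\<lambda>n. DJ (comb k \<psi> (c n)) \<phi>) \<longlonglongrightarrow> DJ (comb k \<psi> l) \<phi>"
  unfolding J_def DJ_def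
  by (intro tendsto_intros comb_tendsto[OF assms] isCont_tendsto_compose[OF DERIV_isCont[OF P_DERIV]]
      continuous_on_tendsto_compose[OF M_cont]; simp)+

lemma DJ_comb:
  assumes u: "u \<in> test"
  shows "DJ u (comb k \<psi> v) = (\<Sum>j<k. DJ u (\<psi> j) * v j)"
proof -
  note um = test_functions_measurable_on[OF u]
  have i1: "integrable \<mu> (\<lambda>x. \<Phi> x (grad u x) \<bullet> grad (\<psi> j) x)" if "j < k" for j
    using that by (intro AP_integrable um test_functions_measurable_on test_integrable u \<psi>)
  have i2: "integrable \<mu> (\<lambda>x. f x (u x) * \<psi> j x)" if "j < k" for j
    using that by (intro BP_integrable um test_functions_measurable_on test_L_integrable u \<psi>)
  have "AP (grad u) (grad (comb k \<psi> v)) = (\<integral>x. (\<Sum>j<k. v j * (\<Phi> x (grad u x) \<bullet> grad (\<psi> j) x)) \<partial>\<mu>)"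
    by (simp add: AP_def comb_test(2) inner_sum_right)
  also have "\<dots> = (\<Sum>j<k. v j * AP (grad u) (grad (\<psi> j)))"
    using i1 by (subst Bochner_Integration.integral_sum) (auto simp: AP_def)
  finally have 1: "AP (grad u) (grad (comb k \<psi> v)) = (\<Sum>j<k. v j * AP (grad u) (grad (\<psi> j)))" .
  have "BP u (comb k \<psi> v) = (\<integral>x. (\<Sum>j<k. v j * (f x (u x) * \<psi> j x)) \<partial>\<mu>)"
    by (simp add: BP_def comb_def sum_distrib_left mult_ac)
  also have "\<dots> = (\<Sum>j<k. v j * BP u (\<psi> j))"
    using i2 by (subst Bochner_Integration.integral_sum) (auto simp: BP_def)
  finally have 2: "BP u (comb k \<psi> v) = (\<Sum>j<k. v j * BP u (\<psi> j))" .
  show ?thesis unfolding DJ_def 1 2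
    by (simp add: sum_distrib_left sum_subtractf left_diff_distrib right_diff_distrib mult_ac)
qed

end

lemma J_DERIV:
  assumes u: "u \<in> test" and v: "v \<in> test"
  shows "((\<lambda>t. J (\<lambda>x. u x + t * v x)) has_real_derivative DJ (\<lambda>x. u x + t * v x) v) (at t)"
proof -
  obtain B where B: "0 < B" "\<And>x. \<bar>u x\<bar> \<le> B" "\<And>x. norm (grad u x) \<le> B"
    by (rule test_functions_bounded[OF u]) blast
  obtain B' where B': "0 < B'" "\<And>x. \<bar>v x\<bar> \<le> B'" "\<And>x. norm (grad v x) \<le> B'"
    by (rule test_functions_bounded[OF v]) blast
  have w: "(\<lambda>x. u x + s * v x) \<in> test" "grad (\<lambda>x. u x + s * v x) x = grad u x + s *\<^sub>R grad v x" for s x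
    using test_functions_add[OF u test_functions_cmult(1)[OF v, of s]] test_functions_cmult(2)[OF v, of s] by simp_all
  note wm = test_functions_measurable_on[OF w(1)] and vm = test_functions_measurable_on[OF v]
  \<comment> \<open>Bounds functions and gradients along the line for all parameters within distance
    1 of \<open>t\<close>, the range that \<open>DERIV_integral_bounded\<close> asks for.\<close>
  define b where "b = B + (\<bar>t\<bar> + 1) * B'"
  have b: "\<bar>u x + s * v x\<bar> \<le> b" "norm (grad u x + s *\<^sub>R grad v x) \<le> b" if "\<bar>s - t\<bar> \<le> 1" for s x
  proof -
    have s: "\<bar>s\<bar> \<le> \<bar>t\<bar> + 1" using that by linarith
    have "\<bar>s * v x\<bar> \<le> (\<bar>t\<bar> + 1) * B'" unfolding abs_mult using s B' by (intro mult_mono) auto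
    then show "\<bar>u x + s * v x\<bar> \<le> b" unfolding b_def using B(2)[of x] by linarith
    have "norm (s *\<^sub>R grad v x) \<le> (\<bar>t\<bar> + 1) * B'" unfolding norm_scaleR using s B' by (intro mult_mono) auto
    then show "norm (grad u x + s *\<^sub>R grad v x) \<le> b" unfolding b_def using B(3)[of x] norm_triangle_ineq[of "grad u x" "s *\<^sub>R grad v x"] by linarith
  qed
  obtain C where C: "0 < C" "\<And>x v w. x \<in> \<Omega> \<Longrightarrow> \<bar>\<Phi> x v \<bullet> w\<bar> \<le> 1 * H x (norm v) + C * H x (norm w)"
    by (rule flux_inner_small[of 1]) auto
  have E: "((\<lambda>t. \<integral>x. e x (grad u x + t *\<^sub>R grad v x) \<partial>\<mu>) has_real_derivative (\<integral>x. \<Phi> x (grad u x + t *\<^sub>R grad v x) \<bullet> grad v x \<partial>\<mu>)) (at t)"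
  proof (rule DERIV_integral_bounded[where h' = "\<lambda>t x. \<Phi> x (grad u x + t *\<^sub>R grad v x) \<bullet> grad v x"])
    show "integrable \<mu> (\<lambda>x. e x (grad u x + s *\<^sub>R grad v x))" for s
      using EN_integrable(1)[OF wm(2) test_integrable(4)[OF w(1)]] by (simp add: w(2))
    show "(\<lambda>x. \<Phi> x (grad u x + t *\<^sub>R grad v x) \<bullet> grad v x) \<in> borel_measurable \<mu>"
      using flux_comp_measurable[OF wm(2)[of t]] vm(2) by (simp add: w(2))
    show "\<bar>\<Phi> x (grad u x + s *\<^sub>R grad v x) \<bullet> grad v x\<bar> \<le> (b powr p + A * b powr q) + C * (B' powr p + A * B' powr q)"
      if "\<bar>s - t\<bar> \<le> 1" "x \<in> space \<mu>" for s x
    proof -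
      have x: "x \<in> \<Omega>" using that by simp
      have "\<bar>\<Phi> x (grad u x + s *\<^sub>R grad v x) \<bullet> grad v x\<bar> \<le> 1 * H x (norm (grad u x + s *\<^sub>R grad v x)) + C * H x (norm (grad v x))"
        by (rule C(2)[OF x])
      also have "\<dots> \<le> 1 * (b powr p + A * b powr q) + C * (B' powr p + A * B' powr q)"
        using C(1) by (intro add_mono mult_left_mono order_trans[OF H_mono[OF x _ b(2)[OF that(1)]] H_le[OF x]] order_trans[OF H_mono[OF x _ B'(3)] H_le[OF x]]) auto
      finally show ?thesis by simp
    qed
  qed (auto intro: e_DERIV finite_measure_axioms)
  have Fd: "((\<lambda>t. \<integral>x. F x (u x + t * v x) \<partial>\<mu>) has_real_derivative (\<integral>x. f x (u x + t * v x) * v x \<partial>\<mu>)) (at t)"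
  proof (rule DERIV_integral_bounded[where h' = "\<lambda>t x. f x (u x + t * v x) * v x"])
    show "integrable \<mu> (\<lambda>x. F x (u x + s * v x))" for s
      by (rule FN_integrable(1)[OF wm(1) test_L_integrable[OF w(1)]])
    show "(\<lambda>x. f x (u x + t * v x) * v x) \<in> borel_measurable \<mu>"
      using f_comp_measurable[OF wm(1)[of t]] vm(1) by simp
    show "((\<lambda>t. F x (u x + t * v x)) has_real_derivative f x (u x + s * v x) * v x) (at s)" if "x \<in> space \<mu>" for s x
      by (rule DERIV_chain2[OF F_DERIV]) (use that in \<open>auto intro!: derivative_eq_intros\<close>)
    show "\<bar>f x (u x + s * v x) * v x\<bar> \<le> C0 * (b powr (q * \<theta> - 1) + b powr (r - 1)) * B'"
      if "\<bar>s - t\<bar> \<le> 1" "x \<in> space \<mu>" for s x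
    proof -
      have x: "x \<in> \<Omega>" using that by simp
      have "\<bar>u x + s * v x\<bar> powr (q * \<theta> - 1) + \<bar>u x + s * v x\<bar> powr (r - 1) \<le> b powr (q * \<theta> - 1) + b powr (r - 1)"
        using b(1)[OF that(1), of x] exponents(2,3) by (intro add_mono powr_mono2) auto
      then have "\<bar>f x (u x + s * v x)\<bar> \<le> C0 * (b powr (q * \<theta> - 1) + b powr (r - 1))"
        using order_trans[OF f_growth[OF x] mult_left_mono] C0 by simp
      then show ?thesis unfolding abs_mult using B' by (intro mult_mono) auto
    qed
  qed (auto intro: finite_measure_axioms)
  have E': "((\<lambda>t. EN (grad (\<lambda>x. u x + t * v x))) has_real_derivative AP (grad (\<lambda>x. u x + t * v x)) (grad v)) (at t)"
    using E by (simp add: EN_def AP_def w(2))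
  have "((\<lambda>t. primitive M (EN (grad (\<lambda>x. u x + t * v x))) - FN (\<lambda>x. u x + t * v x)) has_real_derivative
      M (EN (grad (\<lambda>x. u x + t * v x))) * AP (grad (\<lambda>x. u x + t * v x)) (grad v) - BP (\<lambda>x. u x + t * v x) v) (at t)"
    using Fd unfolding FN_def BP_def by (intro DERIV_diff DERIV_chain2[OF P_DERIV E'])
  then show ?thesis by (simp add: J_def DJ_def)
qed

text \<open>
  Near 0 the primitive of \<open>M\<close> is at least of the order \<open>E\<^bsup>\<theta>\<^esup>\<close> in the energy \<open>E\<close>, whereas the source term is
  at most of the order \<open>E\<^bsup>q\<theta>/p\<^esup>\<close>, and \<open>q > p\<close>.
\<close>
lemma J_near_zero:
  obtains E0 \<alpha> where "0 < E0" "0 < \<alpha>" "\<And>u. u \<in> test \<Longrightarrow> EN (grad u) \<le> E0 \<Longrightarrow> 0 \<le> J u"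
    "\<And>u. u \<in> test \<Longrightarrow> EN (grad u) = E0 \<Longrightarrow> \<alpha> \<le> J u"
proof -
  obtain C1 where C1: "0 < C1" "\<And>\<phi>. \<phi> \<in> test \<Longrightarrow> (\<integral>x. \<bar>\<phi> x\<bar> powr (q * \<theta>) \<partial>\<mu>) \<le> C1 * (\<integral>x. norm (grad \<phi> x) powr p \<partial>\<mu>) powr (q * \<theta> / p)"
    by (rule sobolev[OF exponents(2,4)]) blast
  obtain C2 where C2: "0 < C2" "\<And>\<phi>. \<phi> \<in> test \<Longrightarrow> (\<integral>x. \<bar>\<phi> x\<bar> powr r \<partial>\<mu>) \<le> C2 * (\<integral>x. norm (grad \<phi> x) powr p \<partial>\<mu>) powr (r / p)"
    by (rule sobolev[OF exponents(3) r(2)]) blast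
  define \<beta> where "\<beta> = q * \<theta> / p"
  have \<beta>: "\<theta> < \<beta>" "\<beta> \<le> r / p" "0 < \<beta>"
    using p \<theta> r(1) mult_strict_right_mono[of p q \<theta>] by (simp_all add: \<beta>_def less_divide_eq divide_right_mono mult.commute)
  define D where "D = C0 * (C1 * q powr \<beta> + C2 * q powr (r / p))"
  have D: "0 < D" unfolding D_def using C0 C1 C2 p by (intro mult_pos_pos add_pos_pos) auto
  define P1 where "P1 = primitive M 1"
  have P1: "0 < P1" using P_1_pos by (simp add: P1_def)
  have lower: "P1 * E powr \<theta> - D * E powr \<beta> \<le> J u" if u: "u \<in> test" and E: "E = EN (grad u)" "E \<le> 1" for u E
  proof -
    note um = test_functions_measurable_on[OF u]
    note en = EN_integrable[OF um(2) test_integrable(4)[OF u]]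
    have E0: "0 \<le> E" using en E by simp
    define Y where "Y = (\<integral>x. norm (grad u x) powr p \<partial>\<mu>)"
    have Y: "0 \<le> Y" "Y \<le> q * E" using grad_powr_le_H[OF u] en(3) E by (auto simp: Y_def)
    have i: "integrable \<mu> (\<lambda>x. \<bar>u x\<bar> powr (q * \<theta>))" "integrable \<mu> (\<lambda>x. \<bar>u x\<bar> powr r)"
      using test_integrable(1)[OF u] exponents(2,3) by auto
    have "(\<integral>x. L (u x) \<partial>\<mu>) = (\<integral>x. \<bar>u x\<bar> powr (q * \<theta>) \<partial>\<mu>) + (\<integral>x. \<bar>u x\<bar> powr r \<partial>\<mu>)"
      unfolding L_def using i by simp
    also have "\<dots> \<le> C1 * Y powr \<beta> + C2 * Y powr (r / p)"
      using C1(2)[OF u] C2(2)[OF u] by (auto simp: Y_def \<beta>_def intro: add_mono)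
    also have "\<dots> \<le> C1 * (q * E) powr \<beta> + C2 * (q * E) powr (r / p)"
      using Y \<beta> C1 C2 by (intro add_mono mult_left_mono powr_mono2) auto
    also have "\<dots> = C1 * q powr \<beta> * E powr \<beta> + C2 * q powr (r / p) * E powr (r / p)"
      using p E0 by (simp add: powr_mult)
    also have "\<dots> \<le> C1 * q powr \<beta> * E powr \<beta> + C2 * q powr (r / p) * E powr \<beta>"
      using \<beta> E0 E(2) C2 by (intro add_left_mono mult_left_mono powr_mono') auto
    also have "\<dots> = (C1 * q powr \<beta> + C2 * q powr (r / p)) * E powr \<beta>" by (simp add: distrib_right)
    finally have "C0 * (\<integral>x. L (u x) \<partial>\<mu>) \<le> D * E powr \<beta>" unfolding D_def mult.assoc using C0 by (intro mult_left_mono) auto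
    then have "FN u \<le> D * E powr \<beta>" using FN_integrable(2)[OF um(1) test_L_integrable[OF u]] by linarith
    moreover have "P1 * E powr \<theta> \<le> primitive M E"
    proof (cases "E = 0")
      case False
      then show ?thesis using P_lower[of E] E0 E(2) by (simp add: P1_def)
    qed simp
    ultimately show ?thesis by (simp add: J_def E)
  qed
  \<comment> \<open>Up to this threshold \<open>D * E powr \<beta>\<close> is at most half of
    \<open>P1 * E powr \<theta>\<close>; the minimum with 1 keeps \<open>lower\<close>
    applicable.\<close>
  define E0 where "E0 = min 1 ((P1 / (2 * D)) powr (1 / (\<beta> - \<theta>)))"
  have E0: "0 < E0" "E0 \<le> 1" using P1 D by (auto simp: E0_def)
  have small: "P1 / 2 * E powr \<theta> \<le> P1 * E powr \<theta> - D * E powr \<beta>" if E: "0 \<le> E" "E \<le> E0" for E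
  proof (cases "E = 0")
    case False
    with E have E: "0 < E" "E \<le> E0" by simp_all
    have "E powr (\<beta> - \<theta>) \<le> ((P1 / (2 * D)) powr (1 / (\<beta> - \<theta>))) powr (\<beta> - \<theta>)"
      using E \<beta> by (intro powr_mono2) (auto simp: E0_def)
    also have "\<dots> = P1 / (2 * D)" using \<beta> P1 D by (simp add: powr_powr)
    finally have "D * E powr (\<beta> - \<theta>) \<le> P1 / 2" using D by (simp add: field_simps)
    then have "D * E powr (\<beta> - \<theta>) * E powr \<theta> \<le> P1 / 2 * E powr \<theta>" by (intro mult_right_mono) auto
    moreover have "E powr (\<beta> - \<theta>) * E powr \<theta> = E powr \<beta>" by (simp add: powr_add[symmetric])
    ultimately show ?thesis by (simp add: mult.assoc)
  qed (use \<beta> \<theta> in simp)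
  show thesis
  proof (rule that[OF E0(1)])
    show "0 < P1 / 2 * E0 powr \<theta>" using P1 E0 by simp
    have en0: "0 \<le> EN (grad u)" if "u \<in> test" for u
      using EN_integrable(2)[OF test_functions_measurable_on(2)[OF that] test_integrable(4)[OF that]] .
    show "0 \<le> J u" if u: "u \<in> test" "EN (grad u) \<le> E0" for u
    proof -
      have "0 \<le> P1 / 2 * EN (grad u) powr \<theta>" using P1 by simp
      then show ?thesis using small[OF en0[OF u(1)] u(2)] lower[OF u(1) refl] u(2) E0 by linarith
    qed
    show "P1 / 2 * E0 powr \<theta> \<le> J u" if u: "u \<in> test" "EN (grad u) = E0" for u
      using small[of E0] lower[OF u(1) u(2)[symmetric] E0(2)] E0(1) by linarith
  qed
qed

section \<open>Galerkin critical points\<close>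

definition comb_independent :: "nat \<Rightarrow> (nat \<Rightarrow> 'a \<Rightarrow> real) \<Rightarrow> bool" where
  "comb_independent k \<psi> \<longleftrightarrow> (\<forall>c. (\<forall>x. comb k \<psi> c x = 0) \<longrightarrow> (\<forall>i<k. c i = 0))"

text \<open>Independence is what allows coordinates to be bounded in terms of the function. A member
  of \<open>S\<close> is appended only if it is not yet a combination of the earlier ones.\<close>

lemma ex_independent_spanning:
  assumes "finite S"
  shows "\<exists>k \<psi>. (\<forall>i<k. \<psi> i \<in> S) \<and> comb_independent k \<psi> \<and> (\<forall>\<phi>\<in>S. \<exists>c. \<phi> = comb k \<psi> c)"
  using assms
proof (induction S rule: finite_induct)
  case empty
  show ?case by (rule exI[of _ 0]) (simp add: comb_independent_def)
next
  case (insert \<phi> S)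
  then obtain k \<psi> where IH: "\<forall>i<k. \<psi> i \<in> S" "comb_independent k \<psi>" "\<forall>\<phi>\<in>S. \<exists>c. \<phi> = comb k \<psi> c" by blast
  show ?case
  proof (cases "\<exists>c. \<phi> = comb k \<psi> c")
    case True
    then show ?thesis using IH by (intro exI[of _ k] exI[of _ \<psi>]) auto
  next
    case False
    define \<psi>' where "\<psi>' = \<psi>(k := \<phi>)"
    have S: "comb (Suc k) \<psi>' c x = comb k \<psi> c x + c k * \<phi> x" for c x
      by (simp add: comb_def \<psi>'_def)
    have ind: "comb_independent (Suc k) \<psi>'" unfolding comb_independent_def
    proof (intro allI impI)
      fix c i assume z: "\<forall>x. comb (Suc k) \<psi>' c x = 0" and i: "i < Suc k"
      have ck: "c k = 0"
      proof (rule ccontr)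
        assume ck: "c k \<noteq> 0"
        have "\<phi> x = comb k \<psi> (\<lambda>i. - c i / c k) x" for x
        proof -
          have "comb k \<psi> (\<lambda>i. - c i / c k) x = - comb k \<psi> c x / c k"
            by (simp add: comb_def sum_negf sum_divide_distrib)
          moreover have "comb k \<psi> c x = - c k * \<phi> x" using z S[of c x] by (simp add: eq_neg_iff_add_eq_0)
          ultimately show ?thesis using ck by simp
        qed
        then show False using False by blast
      qed
      then have "\<forall>x. comb k \<psi> c x = 0" using z S by simp
      then show "c i = 0" using IH(2) ck i unfolding comb_independent_def less_Suc_eq by blast
    qed
    have "\<exists>c. \<phi>' = comb (Suc k) \<psi>' c" if "\<phi>' \<in> insert \<phi> S" for \<phi>'
    proof (cases "\<phi>' = \<phi>")
      case True
      have "\<phi> = comb (Suc k) \<psi>' (\<lambda>i. if i = k then 1 else 0)" by (simp add: fun_eq_iff S) (simp add: comb_def)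
      then show ?thesis using True by blast
    next
      case False
      then obtain c where c: "\<phi>' = comb k \<psi> c" using IH(3) \<open>\<phi>' \<in> insert \<phi> S\<close> by blast
      have "\<phi>' = comb (Suc k) \<psi>' (\<lambda>i. if i = k then 0 else c i)"
        unfolding c fun_eq_iff S by (simp add: comb_def)
      then show ?thesis by blast
    qed
    moreover have "\<forall>i<Suc k. \<psi>' i \<in> insert \<phi> S" using IH(1) by (simp add: \<psi>'_def less_Suc_eq)
    ultimately show ?thesis using ind by blast
  qed
qed

context
  fixes k :: nat and \<psi> :: "nat \<Rightarrow> 'a \<Rightarrow> real"
  assumes \<psi>: "\<And>i. i < k \<Longrightarrow> \<psi> i \<in> test" and ind: "comb_independent k \<psi>"
begin

text \<open>Equivalence of norms in finite dimensions, by compactness: coordinates along which the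
  integral tends to 0 would converge to those of a combination that vanishes almost everywhere, by
  continuity everywhere, against independence.\<close>

lemma comb_powr_integral_lower:
  obtains \<kappa> where "0 < \<kappa>" "\<And>c. (\<Sum>i<k. \<bar>c i\<bar>) = 1 \<Longrightarrow> \<kappa> \<le> (\<integral>x. \<bar>comb k \<psi> c x\<bar> powr \<sigma> \<partial>\<mu>)"
proof (rule ccontr)
  assume no: "\<not> thesis"
  note found = that
  obtain B where B: "0 < B" "\<And>c x. \<bar>comb k \<psi> c x\<bar> \<le> B * (\<Sum>i<k. \<bar>c i\<bar>)" by (rule comb_bound[OF \<psi>]) blast+
  have s: "0 < \<sigma>" using exponents(5) by simp
  have "\<exists>c. (\<Sum>i<k. \<bar>c i\<bar>) = 1 \<and> (\<integral>x. \<bar>comb k \<psi> c x\<bar> powr \<sigma> \<partial>\<mu>) < inverse (real (Suc n))" for n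
  proof (rule ccontr)
    assume "\<not> ?thesis"
    then have "inverse (real (Suc n)) \<le> (\<integral>x. \<bar>comb k \<psi> c x\<bar> powr \<sigma> \<partial>\<mu>)" if "(\<Sum>i<k. \<bar>c i\<bar>) = 1" for c using that by force
    then show False using found[of "inverse (real (Suc n))"] no by simp
  qed
  then have "\<forall>n. \<exists>c. (\<Sum>i<k. \<bar>c i\<bar>) = 1 \<and> (\<integral>x. \<bar>comb k \<psi> c x\<bar> powr \<sigma> \<partial>\<mu>) < inverse (real (Suc n))" ..
  from choice[OF this] obtain c where c: "\<And>n. (\<Sum>i<k. \<bar>c n i\<bar>) = 1"
    "\<And>n. (\<integral>x. \<bar>comb k \<psi> (c n) x\<bar> powr \<sigma> \<partial>\<mu>) < inverse (real (Suc n))" by blast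
  have c1: "\<bar>c n i\<bar> \<le> 1" if "i < k" for n i
    using member_le_sum[of i "{..<k}" "\<lambda>i. \<bar>c n i\<bar>"] that c(1)[of n] by simp
  obtain r l where r: "strict_mono (r :: nat \<Rightarrow> nat)" "\<And>i. i < k \<Longrightarrow> (\<lambda>n. c (r n) i) \<longlonglongrightarrow> l i"
    using bounded_coordinates_subsequence[of k c 1] c1 by blast
  have "(\<lambda>n. \<Sum>i<k. \<bar>c (r n) i\<bar>) \<longlonglongrightarrow> (\<Sum>i<k. \<bar>l i\<bar>)" using r(2) by (intro tendsto_sum tendsto_rabs) auto
  then have l1: "(\<Sum>i<k. \<bar>l i\<bar>) = 1" using c(1) by (simp add: LIMSEQ_const_iff)
  note ct = comb_test[OF \<psi>]
  have "(\<lambda>n. \<integral>x. \<bar>comb k \<psi> (c (r n)) x\<bar> powr \<sigma> \<partial>\<mu>) \<longlonglongrightarrow> (\<integral>x. \<bar>comb k \<psi> l x\<bar> powr \<sigma> \<partial>\<mu>)"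
  proof (rule integral_dominated_convergence[where w = "\<lambda>x. B powr \<sigma>"])
    show "(\<lambda>x. \<bar>comb k \<psi> l x\<bar> powr \<sigma>) \<in> borel_measurable \<mu>" "(\<lambda>x. \<bar>comb k \<psi> (c (r n)) x\<bar> powr \<sigma>) \<in> borel_measurable \<mu>" for n
      using borel_measurable_integrable[OF test_integrable(1)[OF ct(1) s]] by simp_all
    have "(\<lambda>n. comb k \<psi> (c (r n)) x) \<longlonglongrightarrow> comb k \<psi> l x" for x
      unfolding comb_def using r(2) by (intro tendsto_sum tendsto_mult tendsto_const) auto
    then show "AE x in \<mu>. (\<lambda>n. \<bar>comb k \<psi> (c (r n)) x\<bar> powr \<sigma>) \<longlonglongrightarrow> \<bar>comb k \<psi> l x\<bar> powr \<sigma>"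
      using s by (intro AE_I2 tendsto_powr' tendsto_rabs tendsto_const) auto
    show "AE x in \<mu>. norm (\<bar>comb k \<psi> (c (r n)) x\<bar> powr \<sigma>) \<le> B powr \<sigma>" for n
      using B(2)[of "c (r n)"] s by (intro AE_I2) (auto simp: c(1) intro!: powr_mono2)
  qed simp
  moreover have "(\<lambda>n. inverse (real (Suc (r n)))) \<longlonglongrightarrow> 0"
    using LIMSEQ_subseq_LIMSEQ[OF LIMSEQ_inverse_real_of_nat r(1)] by (simp add: o_def)
  ultimately have "(\<integral>x. \<bar>comb k \<psi> l x\<bar> powr \<sigma> \<partial>\<mu>) \<le> 0"
    by (rule LIMSEQ_le) (use c(2) in \<open>auto intro: less_imp_le\<close>)
  then have "(\<integral>x. \<bar>comb k \<psi> l x\<bar> powr \<sigma> \<partial>\<mu>) = 0" by (simp add: order_antisym)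
  then have "AE x in \<mu>. comb k \<psi> l x = 0"
    using integral_nonneg_eq_0_iff_AE[OF test_integrable(1)[OF ct(1) s]] by simp
  note ae = this
  have "comb k \<psi> l x = 0" for x
    by (rule continuous_AE_zero_imp_zero[OF open_\<Omega> test_functionsD(1)[OF ct(1)] test_functions_zero_outside(1)[OF ct(1)] ae])
  then have "\<forall>i<k. l i = 0" using ind unfolding comb_independent_def by blast
  then show False using l1 by simp
qed

text \<open>With \<open>N\<close> the sum of the absolute coordinates, the energy part is at most of
  the order \<open>N powr (q * \<theta>)\<close> and the source term at least of the order
  \<open>N powr \<sigma>\<close>, where \<open>\<sigma>\<close> exceeds
  \<open>q * \<theta>\<close>.\<close>

lemma J_anticoercive:
  obtains R where "\<And>c i. 0 \<le> J (comb k \<psi> c) \<Longrightarrow> i < k \<Longrightarrow> \<bar>c i\<bar> \<le> R"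
proof -
  obtain B where B: "0 < B" "\<And>c x. \<bar>comb k \<psi> c x\<bar> \<le> B * (\<Sum>i<k. \<bar>c i\<bar>)" "\<And>c x. norm (grad (comb k \<psi> c) x) \<le> B * (\<Sum>i<k. \<bar>c i\<bar>)"
    by (rule comb_bound[OF \<psi>]) blast+
  obtain \<kappa> where \<kappa>: "0 < \<kappa>" "\<And>c. (\<Sum>i<k. \<bar>c i\<bar>) = 1 \<Longrightarrow> \<kappa> \<le> (\<integral>x. \<bar>comb k \<psi> c x\<bar> powr \<sigma> \<partial>\<mu>)"
    by (rule comb_powr_integral_lower) blast
  obtain c2 C2 where F: "0 < c2" "0 < C2" "\<And>x t. x \<in> \<Omega> \<Longrightarrow> c2 * \<bar>t\<bar> powr \<sigma> - C2 \<le> F x t"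
    by (rule F_superlinear) blast
  note ct = comb_test[OF \<psi>]
  have s: "0 < \<sigma>" "1 < \<sigma>" using exponents(5) by simp_all
  define V where "V = measure \<mu> \<Omega>"
  have V: "0 \<le> V" by (simp add: V_def)
  define K1 where "K1 = (B powr p + A * B powr q) * V"
  have K1: "0 \<le> K1" using V A by (simp add: K1_def)
  define P1 where "P1 = primitive M 1"
  have P1: "0 < P1" using P_1_pos by (simp add: P1_def)
  define Q where "Q = P1 * K1 powr \<theta>"
  have Q: "0 \<le> Q" using P1 by (simp add: Q_def)
  \<comment> \<open>Chosen so that the energy part costs at most half of the available
    \<open>c2 * \<kappa> * N powr \<sigma>\<close>.\<close>
  define \<eta> where "\<eta> = c2 * \<kappa> / (2 * (Q + 1))"
  have \<eta>: "0 < \<eta>" using F \<kappa> Q by (simp add: \<eta>_def)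
  have Q\<eta>: "Q * \<eta> \<le> c2 * \<kappa> / 2"
  proof -
    have "Q * \<eta> \<le> (Q + 1) * \<eta>" using \<eta> by (intro mult_right_mono) auto
    also have "\<dots> = c2 * \<kappa> / 2" using Q by (simp add: \<eta>_def field_simps)
    finally show ?thesis .
  qed
  have "0 < q * \<theta>" using exponents(2) by simp
  \<comment> \<open>Interpolation down to the exponent 0 leaves a plain constant, as
    \<open>w powr 0\<close> is 1 for positive \<open>w\<close>.\<close>
  then obtain C where C: "0 < C" "\<And>w::real. 0 \<le> w \<Longrightarrow> w powr (q * \<theta>) \<le> \<eta> * w powr \<sigma> + C * w powr 0"
    using powr_interpolation[of 0 "q * \<theta>" \<sigma> \<eta>] \<sigma> \<eta> by blast
  define X where "X = P1 + C2 * V + Q * C"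
  show thesis
  proof (rule that)
    fix c i assume J: "0 \<le> J (comb k \<psi> c)" and i: "i < k"
    define N where "N = (\<Sum>i<k. \<bar>c i\<bar>)"
    have ci: "\<bar>c i\<bar> \<le> N" using member_le_sum[of i "{..<k}" "\<lambda>i. \<bar>c i\<bar>"] i by (simp add: N_def)
    have "N \<le> max 1 (2 * X / (c2 * \<kappa>))"
    proof (cases "N \<le> 1")
      case False
      then have N: "1 < N" by simp
      let ?u = "comb k \<psi> c"
      have "EN (grad ?u) \<le> (\<integral>x. H x (norm (grad ?u x)) \<partial>\<mu>)"
        by (rule EN_integrable(4)[OF test_functions_measurable_on(2)[OF ct(1)] test_integrable(4)[OF ct(1)]])
      also have "\<dots> \<le> ((B * N) powr p + A * (B * N) powr q) * V"
        unfolding V_def N_def by (rule test_integrals_le(2)[OF ct(1) B(2,3)])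
      also have "\<dots> \<le> (B powr p * N powr q + A * (B powr q * N powr q)) * V"
      proof -
        have "N powr p \<le> N powr q" using N p by (intro powr_mono) auto
        then show ?thesis using N B V by (intro mult_right_mono) (auto simp: powr_mult intro!: mult_left_mono)
      qed
      also have "\<dots> = K1 * N powr q" by (simp add: K1_def algebra_simps)
      finally have "EN (grad ?u) \<le> K1 * N powr q" .
      moreover have en: "0 \<le> EN (grad ?u)"
        by (rule EN_integrable(2)[OF test_functions_measurable_on(2)[OF ct(1)] test_integrable(4)[OF ct(1)]])
      ultimately have "EN (grad ?u) powr \<theta> \<le> (K1 * N powr q) powr \<theta>" using \<theta> by (intro powr_mono2) auto
      also have "\<dots> = K1 powr \<theta> * N powr (q * \<theta>)" using K1 by (simp add: powr_mult powr_powr)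
      finally have "P1 * (1 + EN (grad ?u) powr \<theta>) \<le> P1 * (1 + K1 powr \<theta> * N powr (q * \<theta>))"
        using P1 by (intro mult_left_mono) auto
      then have PE: "primitive M (EN (grad ?u)) \<le> P1 + Q * N powr (q * \<theta>)"
        using P_upper[OF en] by (simp add: P1_def Q_def distrib_left mult.assoc)
      define d where "d i = c i / N" for i
      have d1: "(\<Sum>i<k. \<bar>d i\<bar>) = 1" using N by (simp add: d_def abs_divide N_def flip: sum_divide_distrib)
      have ud: "comb k \<psi> c x = N * comb k \<psi> d x" for x using N by (simp add: comb_def d_def sum_distrib_left)
      have "\<kappa> * N powr \<sigma> \<le> (\<integral>x. \<bar>comb k \<psi> d x\<bar> powr \<sigma> \<partial>\<mu>) * N powr \<sigma>"
        using \<kappa>(2)[OF d1] by (intro mult_right_mono) auto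
      also have "\<dots> = (\<integral>x. \<bar>?u x\<bar> powr \<sigma> \<partial>\<mu>)" using N by (simp add: ud abs_mult powr_mult mult.commute)
      finally have "c2 * (\<kappa> * N powr \<sigma>) - C2 * V \<le> c2 * (\<integral>x. \<bar>?u x\<bar> powr \<sigma> \<partial>\<mu>) - C2 * V"
        using F(1) by simp
      also have "\<dots> = (\<integral>x. c2 * \<bar>?u x\<bar> powr \<sigma> - C2 \<partial>\<mu>)"
        using test_integrable(1)[OF ct(1) s(1)] by (simp add: V_def)
      also have "\<dots> \<le> FN ?u" unfolding FN_def
      proof (rule integral_mono)
        show "integrable \<mu> (\<lambda>x. c2 * \<bar>?u x\<bar> powr \<sigma> - C2)" using test_integrable(1)[OF ct(1) s(1)] by simp
        show "integrable \<mu> (\<lambda>x. F x (?u x))"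
          by (rule FN_integrable(1)[OF test_functions_measurable_on(1)[OF ct(1)] test_L_integrable[OF ct(1)]])
      qed (simp add: F(3))
      finally have "c2 * (\<kappa> * N powr \<sigma>) \<le> P1 + C2 * V + Q * N powr (q * \<theta>)"
        using PE J unfolding J_def by linarith
      also have "\<dots> \<le> P1 + C2 * V + Q * (\<eta> * N powr \<sigma> + C)"
        using C(2)[of N] N Q by (intro add_left_mono mult_left_mono) auto
      also have "\<dots> = X + Q * \<eta> * N powr \<sigma>" by (simp add: X_def algebra_simps)
      also have "\<dots> \<le> X + c2 * \<kappa> / 2 * N powr \<sigma>" using Q\<eta> by (intro add_left_mono mult_right_mono) auto
      finally have "c2 * \<kappa> * N powr \<sigma> \<le> 2 * X" by simp
      then have "N powr \<sigma> \<le> 2 * X / (c2 * \<kappa>)" using F(1) \<kappa>(1) by (simp add: field_simps)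
      moreover have "N powr 1 \<le> N powr \<sigma>" using N s by (intro powr_mono) auto
      ultimately show ?thesis using N by simp
    qed simp
    with ci show "\<bar>c i\<bar> \<le> max 1 (2 * X / (c2 * \<kappa>))" by linarith
  qed
qed

end

lemma EN_J_zero [simp]: "EN (grad (\<lambda>x. 0)) = 0" "J (\<lambda>x. 0) = 0"
proof -
  have "grad (\<lambda>x. 0::real) = (\<lambda>x. 0 :: 'a)" using test_functions_zero(2) by blast
  then show "EN (grad (\<lambda>x. 0)) = 0" "J (\<lambda>x. 0) = 0" by (simp_all add: J_def EN_def e_def FN_def)
qed

text \<open>The direction is fixed before any finite-dimensional space is chosen, so the bound
  \<open>B\<close> along its segment limits the mountain pass levels in all dimensions alike. On the
  line through a nonzero test function, \<open>J_anticoercive\<close> makes \<open>J\<close>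
  negative far out.\<close>

lemma mountain_pass_direction:
  obtains \<phi> B where "\<phi> \<in> test" "J \<phi> < 0" "\<And>t. t \<in> {0..1} \<Longrightarrow> J (\<lambda>x. t * \<phi> x) \<le> B"
proof -
  obtain \<phi> x where \<phi>: "\<phi> \<in> test" "\<phi> x \<noteq> 0" by (rule ex_nonzero_test_function[OF open_\<Omega> \<Omega>_nonempty])
  have "comb_independent 1 (\<lambda>i. \<phi>)" unfolding comb_independent_def comb_def using \<phi>(2) by auto
  then obtain R where R: "\<And>c i. 0 \<le> J (comb 1 (\<lambda>i. \<phi>) c) \<Longrightarrow> i < 1 \<Longrightarrow> \<bar>c i\<bar> \<le> R"
    using J_anticoercive[of 1 "\<lambda>i. \<phi>"] \<phi>(1) by blast
  define w where "w = (\<lambda>x. (\<bar>R\<bar> + 1) * \<phi> x)"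
  have w: "w \<in> test" unfolding w_def by (rule test_functions_cmult[OF \<phi>(1)])
  have eq: "comb 1 (\<lambda>i. \<phi>) (\<lambda>i. \<bar>R\<bar> + 1) = w" by (simp add: w_def comb_def fun_eq_iff)
  have neg: "J w < 0"
  proof (rule ccontr)
    assume "\<not> J w < 0"
    then have "\<bar>\<bar>R\<bar> + 1\<bar> \<le> R" using R[of "\<lambda>i. \<bar>R\<bar> + 1" 0] eq by simp
    then show False by linarith
  qed
  have "continuous_on {0..1} (\<lambda>t. J (\<lambda>x. t * w x))"
    using J_DERIV[OF test_functions_zero(1) w] by (intro continuous_at_imp_continuous_on ballI DERIV_isCont) auto
  then have "compact ((\<lambda>t. J (\<lambda>x. t * w x)) ` {0..1})" by (intro compact_continuous_image) auto
  then have "bounded ((\<lambda>t. J (\<lambda>x. t * w x)) ` {0..1})" by (rule compact_imp_bounded)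
  then obtain B where B: "\<forall>y\<in>(\<lambda>t. J (\<lambda>x. t * w x)) ` {0..1}. norm y \<le> B" unfolding bounded_iff by blast
  have "J (\<lambda>x. t * w x) \<le> B" if "t \<in> {0..1}" for t
    using bspec[OF B imageI[OF that]] by simp
  then show thesis using that[OF w neg] by blast
qed

lemma galerkin_critical_point:
  assumes S: "finite S" "S \<subseteq> test" and \<phi>: "\<phi> \<in> S" "J \<phi> < 0" and B: "\<And>t. t \<in> {0..1} \<Longrightarrow> J (\<lambda>x. t * \<phi> x) \<le> B"
    and E0: "0 < E0" "\<And>u. u \<in> test \<Longrightarrow> EN (grad u) \<le> E0 \<Longrightarrow> 0 \<le> J u"
    and \<alpha>: "0 < \<alpha>" "\<And>u. u \<in> test \<Longrightarrow> EN (grad u) = E0 \<Longrightarrow> \<alpha> \<le> J u"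
  shows "\<exists>k \<psi> c. (\<forall>i<k. \<psi> i \<in> S) \<and> \<alpha> / 4 \<le> J (comb k \<psi> c) \<and> J (comb k \<psi> c) \<le> B \<and> (\<forall>w\<in>S. DJ (comb k \<psi> c) w = 0)"
proof -
  obtain k \<psi> where ind: "\<forall>i<k. \<psi> i \<in> S" "comb_independent k \<psi>" "\<forall>\<phi>\<in>S. \<exists>c. \<phi> = comb k \<psi> c"
    using ex_independent_spanning[OF S(1)] by blast
  have \<psi>: "\<psi> i \<in> test" if "i < k" for i using ind(1) S(2) that by blast
  obtain R where R: "\<And>c i. 0 \<le> J (comb k \<psi> c) \<Longrightarrow> i < k \<Longrightarrow> \<bar>c i\<bar> \<le> R"
    using J_anticoercive[OF \<psi> ind(2)] by blast
  obtain d where d: "\<phi> = comb k \<psi> d" using ind(3) \<phi>(1) by blast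
  have \<phi>t: "\<phi> \<in> test" using \<phi>(1) S(2) by blast
  have ct: "comb k \<psi> c \<in> test" for c by (rule comb_test(1)[OF \<psi>])
  have DJc: "DJ (comb k \<psi> c) (comb k \<psi> v) = (\<Sum>j<k. DJ (comb k \<psi> c) (\<psi> j) * v j)" for c v
    by (rule DJ_comb[OF \<psi> ct])
  have zero: "comb k \<psi> (\<lambda>i. 0) = (\<lambda>x. 0)" by (simp add: comb_def fun_eq_iff)
  obtain c where c: "\<alpha> / 4 \<le> J (comb k \<psi> c)" "J (comb k \<psi> c) \<le> B" "\<And>j. j < k \<Longrightarrow> DJ (comb k \<psi> c) (\<psi> j) = 0"
  proof (rule mountain_pass_finite_dimensional[where g = "\<lambda>c. J (comb k \<psi> c)" and D = "\<lambda>j c. DJ (comb k \<psi> c) (\<psi> j)" and k = k and R = R and \<alpha> = \<alpha> and e = d and B = B])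
    show "(\<lambda>n. J (comb k \<psi> (c n))) \<longlonglongrightarrow> J (comb k \<psi> l)" if "\<And>i. i < k \<Longrightarrow> (\<lambda>n. c n i) \<longlonglongrightarrow> l i" for c l
      by (rule J_comb_tendsto(1)[OF \<psi> that])
    show "(\<lambda>n. DJ (comb k \<psi> (c n)) (\<psi> j)) \<longlonglongrightarrow> DJ (comb k \<psi> l) (\<psi> j)" if "j < k" "\<And>i. i < k \<Longrightarrow> (\<lambda>n. c n i) \<longlonglongrightarrow> l i" for j c l
      by (rule J_comb_tendsto(2)[OF \<psi> that(2) \<psi>[OF that(1)]])
    show "((\<lambda>t. J (comb k \<psi> (\<lambda>i. c i + t * v i))) has_real_derivative (\<Sum>j<k. DJ (comb k \<psi> (\<lambda>i. c i + t * v i)) (\<psi> j) * v j)) (at t)" for c v t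
    proof -
      have eq: "comb k \<psi> (\<lambda>i. c i + t * v i) = (\<lambda>x. comb k \<psi> c x + t * comb k \<psi> v x)" for t by (rule ext) (rule comb_add[OF \<psi>])
      show ?thesis using J_DERIV[OF ct[of c] ct[of v], of t] DJc[of "\<lambda>i. c i + t * v i" v] by (simp add: eq)
    qed
    \<comment> \<open>\<open>J \<phi> < 0\<close> puts the energy of the endpoint above
      \<open>E0\<close>; by the intermediate value theorem the path meets the set of energy
      \<open>E0\<close>, where \<open>J\<close> is at least \<open>\<alpha>\<close>.\<close>
    show "\<exists>t\<in>{0..1}. \<alpha> \<le> J (comb k \<psi> (\<gamma> t))"
      if \<gamma>: "\<And>i. continuous_on {0..1} (\<lambda>t. \<gamma> t i)" "\<gamma> 0 = (\<lambda>i. 0)" "\<gamma> 1 = d" for \<gamma> :: "real \<Rightarrow> nat \<Rightarrow> real"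
    proof -
      have "continuous_on {0..1} (\<lambda>t. EN (grad (comb k \<psi> (\<gamma> t))))"
        unfolding continuous_on_sequentially
      proof (intro allI impI ballI)
        fix x and t :: real assume x: "t \<in> {0..1}" "(\<forall>n. x n \<in> {0..1}) \<and> x \<longlonglongrightarrow> t"
        have "(\<lambda>n. \<gamma> (x n) i) \<longlonglongrightarrow> \<gamma> t i" for i
          using \<gamma>(1)[of i] x unfolding continuous_on_sequentially by (auto simp: o_def)
        then show "((\<lambda>t. EN (grad (comb k \<psi> (\<gamma> t)))) \<circ> x) \<longlonglongrightarrow> EN (grad (comb k \<psi> (\<gamma> t)))"
          unfolding o_def by (intro comb_tendsto(1)[OF \<psi>])
      qed
      moreover have "EN (grad (comb k \<psi> (\<gamma> 0))) \<le> E0" using E0(1) by (simp add: \<gamma>(2) zero)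
      moreover have "E0 \<le> EN (grad (comb k \<psi> (\<gamma> 1)))"
        using E0(2)[OF \<phi>t] \<phi>(2) by (force simp: \<gamma>(3) d[symmetric])
      ultimately obtain t where t: "0 \<le> t" "t \<le> 1" "EN (grad (comb k \<psi> (\<gamma> t))) = E0"
        using IVT'[of "\<lambda>t. EN (grad (comb k \<psi> (\<gamma> t)))" 0 E0 1] by auto
      then show ?thesis using \<alpha>(2)[OF ct t(3)] by (intro bexI[of _ t]) auto
    qed
    show "J (comb k \<psi> (\<lambda>i. t * d i)) \<le> B" if "t \<in> {0..1}" for t
    proof -
      have "comb k \<psi> (\<lambda>i. t * d i) = (\<lambda>x. t * \<phi> x)" by (simp add: d comb_def fun_eq_iff sum_distrib_left mult.assoc)
      then show ?thesis using B[OF that] by simp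
    qed
    show "J (comb k \<psi> d) \<le> 0" using \<phi>(2) by (simp add: d[symmetric])
  qed (use R \<alpha>(1) zero in auto)
  have "DJ (comb k \<psi> c) w = 0" if w: "w \<in> S" for w
  proof -
    obtain v where v: "w = comb k \<psi> v" using bspec[OF ind(3) w] ..
    show ?thesis unfolding v DJc by (rule sum.neutral) (simp add: c(3))
  qed
  then show ?thesis using ind(1) c(1,2) by blast
qed

section \<open>Passage to the limit\<close>

lemma H_uniformly_convex:
  assumes \<eta>: "0 < \<eta>"
  obtains C where "0 < C" "\<And>x (v :: 'a) w. x \<in> \<Omega> \<Longrightarrow> H x (norm (v - w)) \<le>
    \<eta> * (H x (norm v) + H x (norm w)) + C * ((e x v + e x w) / 2 - e x ((1/2) *\<^sub>R (v + w)))"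
proof -
  obtain C1 where C1: "0 < C1" "\<And>v w :: 'a. norm (v - w) powr p \<le> \<eta> * (norm v powr p + norm w powr p) + C1 * powr_gap p v w"
    by (rule powr_uniformly_convex[OF p(1) \<eta>]) blast
  obtain C2 where C2: "0 < C2" "\<And>v w :: 'a. norm (v - w) powr q \<le> \<eta> * (norm v powr q + norm w powr q) + C2 * powr_gap q v w"
    by (rule powr_uniformly_convex[OF exponents(1) \<eta>]) blast
  \<comment> \<open>The factors \<open>p\<close> and \<open>q\<close> undo the divisions in the
    energy density \<open>e\<close>.\<close>
  define C where "C = max (C1 * p) (C2 * q)"
  show thesis
  proof (rule that[of C])
    show "0 < C" using C1 p by (simp add: C_def less_max_iff_disj)
    fix x and v w :: 'a assume x: "x \<in> \<Omega>"
    let ?gp = "powr_gap p v w" and ?gq = "powr_gap q v w"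
    have g: "0 \<le> ?gp" "0 \<le> ?gq" using powr_gap_nonneg p(1) exponents(1) by blast+
    have gap: "(e x v + e x w) / 2 - e x ((1/2) *\<^sub>R (v + w)) = ?gp / p + a x * (?gq / q)"
      using p by (simp add: e_def powr_gap_def field_simps)
    have "C1 * ?gp \<le> C * (?gp / p)" "C2 * ?gq \<le> C * (?gq / q)"
      using p g mult_right_mono[of "C1 * p" C "?gp / p"] mult_right_mono[of "C2 * q" C "?gq / q"] by (auto simp: C_def)
    then have 1: "norm (v - w) powr p \<le> \<eta> * (norm v powr p + norm w powr p) + C * (?gp / p)"
      and 2: "norm (v - w) powr q \<le> \<eta> * (norm v powr q + norm w powr q) + C * (?gq / q)"
      using C1(2)[of v w] C2(2)[of v w] by linarith+
    have "a x * norm (v - w) powr q \<le> a x * (\<eta> * (norm v powr q + norm w powr q) + C * (?gq / q))"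
      using 2 a_bounds(1)[OF x] by (intro mult_left_mono)
    then show "H x (norm (v - w)) \<le> \<eta> * (H x (norm v) + H x (norm w)) + C * ((e x v + e x w) / 2 - e x ((1/2) *\<^sub>R (v + w)))"
      using 1 unfolding gap by (simp add: H_def algebra_simps)
  qed
qed

lemma sobolev_L_tendsto:
  assumes e: "0 < \<epsilon>"
  obtains \<delta> where "0 < \<delta>" "\<And>\<phi>. \<phi> \<in> test \<Longrightarrow> (\<integral>x. H x (norm (grad \<phi> x)) \<partial>\<mu>) \<le> \<delta> \<Longrightarrow> (\<integral>x. L (\<phi> x) \<partial>\<mu>) \<le> \<epsilon>"
proof -
  have e2: "0 < \<epsilon> / 2" using e by simp
  obtain d1 where d1: "0 < d1" "\<And>\<phi>. \<phi> \<in> test \<Longrightarrow> (\<integral>x. H x (norm (grad \<phi> x)) \<partial>\<mu>) \<le> d1 \<Longrightarrow> (\<integral>x. \<bar>\<phi> x\<bar> powr (q * \<theta>) \<partial>\<mu>) \<le> \<epsilon> / 2"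
    by (rule sobolev_tendsto[OF exponents(2,4) e2]) blast
  obtain d2 where d2: "0 < d2" "\<And>\<phi>. \<phi> \<in> test \<Longrightarrow> (\<integral>x. H x (norm (grad \<phi> x)) \<partial>\<mu>) \<le> d2 \<Longrightarrow> (\<integral>x. \<bar>\<phi> x\<bar> powr r \<partial>\<mu>) \<le> \<epsilon> / 2"
    by (rule sobolev_tendsto[OF exponents(3) r(2) e2]) blast
  show thesis
  proof (rule that)
    show "0 < min d1 d2" using d1 d2 by simp
    fix \<phi> assume \<phi>: "\<phi> \<in> test" and le: "(\<integral>x. H x (norm (grad \<phi> x)) \<partial>\<mu>) \<le> min d1 d2"
    have "(\<integral>x. L (\<phi> x) \<partial>\<mu>) = (\<integral>x. \<bar>\<phi> x\<bar> powr (q * \<theta>) \<partial>\<mu>) + (\<integral>x. \<bar>\<phi> x\<bar> powr r \<partial>\<mu>)"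
      unfolding L_def using test_integrable(1)[OF \<phi>] exponents(2,3) by (intro Bochner_Integration.integral_add) auto
    then show "(\<integral>x. L (\<phi> x) \<partial>\<mu>) \<le> \<epsilon>" using d1(2)[OF \<phi>] d2(2)[OF \<phi>] le by simp
  qed
qed

lemma sobolev_L_bounded:
  obtains C where "\<And>\<phi>. \<phi> \<in> test \<Longrightarrow> (\<integral>x. H x (norm (grad \<phi> x)) \<partial>\<mu>) \<le> D \<Longrightarrow> (\<integral>x. L (\<phi> x) \<partial>\<mu>) \<le> C"
proof -
  obtain C1 where C1: "0 < C1" "\<And>\<phi>. \<phi> \<in> test \<Longrightarrow> (\<integral>x. \<bar>\<phi> x\<bar> powr (q * \<theta>) \<partial>\<mu>) \<le> C1 * (\<integral>x. norm (grad \<phi> x) powr p \<partial>\<mu>) powr (q * \<theta> / p)"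
    by (rule sobolev[OF exponents(2,4)]) blast
  obtain C2 where C2: "0 < C2" "\<And>\<phi>. \<phi> \<in> test \<Longrightarrow> (\<integral>x. \<bar>\<phi> x\<bar> powr r \<partial>\<mu>) \<le> C2 * (\<integral>x. norm (grad \<phi> x) powr p \<partial>\<mu>) powr (r / p)"
    by (rule sobolev[OF exponents(3) r(2)]) blast
  show thesis
  proof (rule that)
    fix \<phi> assume \<phi>: "\<phi> \<in> test" and le: "(\<integral>x. H x (norm (grad \<phi> x)) \<partial>\<mu>) \<le> D"
    let ?Y = "\<integral>x. norm (grad \<phi> x) powr p \<partial>\<mu>"
    have Y: "0 \<le> ?Y" "?Y \<le> D" using order_trans[OF grad_powr_le_H[OF \<phi>] le] by auto
    have "(\<integral>x. L (\<phi> x) \<partial>\<mu>) = (\<integral>x. \<bar>\<phi> x\<bar> powr (q * \<theta>) \<partial>\<mu>) + (\<integral>x. \<bar>\<phi> x\<bar> powr r \<partial>\<mu>)"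
      unfolding L_def using test_integrable(1)[OF \<phi>] exponents(2,3) by (intro Bochner_Integration.integral_add) auto
    also have "\<dots> \<le> C1 * ?Y powr (q * \<theta> / p) + C2 * ?Y powr (r / p)" by (intro add_mono C1(2) C2(2) \<phi>)
    also have "\<dots> \<le> C1 * D powr (q * \<theta> / p) + C2 * D powr (r / p)"
      using Y C1(1) C2(1) exponents(2,3) p by (intro add_mono mult_left_mono powr_mono2) auto
    finally show "(\<integral>x. L (\<phi> x) \<partial>\<mu>) \<le> C1 * D powr (q * \<theta> / p) + C2 * D powr (r / p)" .
  qed
qed

lemma L_Cauchy_of_Lp:
  assumes e: "0 < \<epsilon>"
  obtains \<delta> where "0 < \<delta>" "\<And>\<phi>. \<phi> \<in> test \<Longrightarrow> (\<integral>x. H x (norm (grad \<phi> x)) \<partial>\<mu>) \<le> D \<Longrightarrow>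
    (\<integral>x. \<bar>\<phi> x\<bar> powr p \<partial>\<mu>) \<le> \<delta> \<Longrightarrow> (\<integral>x. L (\<phi> x) \<partial>\<mu>) \<le> \<epsilon>"
proof -
  \<comment> \<open>An auxiliary exponent between \<open>r\<close> and the critical one: its power
    stays bounded by the Sobolev inequality, and interpolation with a small integral of the power
    \<open>p\<close> makes both powers in \<open>L\<close> small.\<close>
  define s where "s = (r + critical_exponent (real DIM('a)) p) / 2"
  have s: "1 < s" "s < critical_exponent (real DIM('a)) p" "q * \<theta> < s" "r < s" using r exponents(3) by (simp_all add: s_def)
  obtain C1 where C1: "0 < C1" "\<And>\<phi>. \<phi> \<in> test \<Longrightarrow> (\<integral>x. \<bar>\<phi> x\<bar> powr s \<partial>\<mu>) \<le> C1 * (\<integral>x. norm (grad \<phi> x) powr p \<partial>\<mu>) powr (s / p)"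
    by (rule sobolev[OF s(1,2)]) blast
  define K where "K = C1 * D powr (s / p) + 1"
  have K: "0 < K" unfolding K_def using C1 by (intro add_nonneg_pos mult_nonneg_nonneg) auto
  define \<eta> where "\<eta> = \<epsilon> / (4 * K)"
  have \<eta>: "0 < \<eta>" using e K by (simp add: \<eta>_def)
  have ps: "p < q * \<theta>" "p < r" using exponents(6) p r(1) by linarith+
  obtain A1 where A1: "0 < A1" "\<And>w. 0 \<le> w \<Longrightarrow> w powr (q * \<theta>) \<le> \<eta> * w powr s + A1 * w powr p"
    by (rule powr_interpolation[OF ps(1) s(3) \<eta>]) blast
  obtain A2 where A2: "0 < A2" "\<And>w. 0 \<le> w \<Longrightarrow> w powr r \<le> \<eta> * w powr s + A2 * w powr p"
    by (rule powr_interpolation[OF ps(2) s(4) \<eta>]) blast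
  show thesis
  proof (rule that)
    show "0 < \<epsilon> / (2 * (A1 + A2))" using e A1 A2 by simp
    fix \<phi> assume \<phi>: "\<phi> \<in> test" and D: "(\<integral>x. H x (norm (grad \<phi> x)) \<partial>\<mu>) \<le> D" and le: "(\<integral>x. \<bar>\<phi> x\<bar> powr p \<partial>\<mu>) \<le> \<epsilon> / (2 * (A1 + A2))"
    have i: "integrable \<mu> (\<lambda>x. \<bar>\<phi> x\<bar> powr s)" "integrable \<mu> (\<lambda>x. \<bar>\<phi> x\<bar> powr p)"
      using test_integrable(1)[OF \<phi>] s(1) p by auto
    have "(\<integral>x. norm (grad \<phi> x) powr p \<partial>\<mu>) powr (s / p) \<le> D powr (s / p)"
      using order_trans[OF grad_powr_le_H[OF \<phi>] D] s(1) p by (intro powr_mono2) auto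
    then have sK: "(\<integral>x. \<bar>\<phi> x\<bar> powr s \<partial>\<mu>) \<le> K"
      using order_trans[OF C1(2)[OF \<phi>] mult_left_mono[OF _ less_imp_le[OF C1(1)]]] unfolding K_def by fastforce
    have "(\<integral>x. L (\<phi> x) \<partial>\<mu>) \<le> (\<integral>x. 2 * \<eta> * \<bar>\<phi> x\<bar> powr s + (A1 + A2) * \<bar>\<phi> x\<bar> powr p \<partial>\<mu>)"
    proof (rule integral_mono[OF test_L_integrable[OF \<phi>]])
      show "integrable \<mu> (\<lambda>x. 2 * \<eta> * \<bar>\<phi> x\<bar> powr s + (A1 + A2) * \<bar>\<phi> x\<bar> powr p)" using i by simp
      show "L (\<phi> x) \<le> 2 * \<eta> * \<bar>\<phi> x\<bar> powr s + (A1 + A2) * \<bar>\<phi> x\<bar> powr p" for x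
        using A1(2)[of "\<bar>\<phi> x\<bar>"] A2(2)[of "\<bar>\<phi> x\<bar>"] by (simp add: L_def algebra_simps)
    qed
    also have "\<dots> = 2 * \<eta> * (\<integral>x. \<bar>\<phi> x\<bar> powr s \<partial>\<mu>) + (A1 + A2) * (\<integral>x. \<bar>\<phi> x\<bar> powr p \<partial>\<mu>)" using i by simp
    also have "\<dots> \<le> 2 * \<eta> * K + (A1 + A2) * (\<epsilon> / (2 * (A1 + A2)))"
      using sK le \<eta> A1 A2 by (intro add_mono mult_left_mono) auto
    also have "\<dots> = \<epsilon>" using K A1 A2 by (simp add: \<eta>_def field_simps)
    finally show "(\<integral>x. L (\<phi> x) \<partial>\<mu>) \<le> \<epsilon>" .
  qed
qed

text \<open>The Ambrosetti--Rabinowitz argument: \<open>J u - DJ u u / \<sigma>\<close> controls \<open>M E * E\<close> because \<open>\<sigma> > q \<theta>\<close>.\<close>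
lemma energy_bound:
  obtains D where "0 < D" "\<And>u. u \<in> test \<Longrightarrow> J u \<le> B \<Longrightarrow> DJ u u = 0 \<Longrightarrow> EN (grad u) \<le> D"
proof -
  obtain C3 where C3: "0 < C3" "\<And>x t. x \<in> \<Omega> \<Longrightarrow> F x t - t * f x t / \<sigma> \<le> C3" by (rule f_AR_remainder) blast
  define V where "V = measure \<mu> \<Omega>"
  \<comment> \<open>Positive because \<open>\<sigma>\<close> exceeds \<open>q * \<theta>\<close>.
    The growth of \<open>M\<close> contributes \<open>1 / \<theta>\<close>; the pairing of the flux
    with its own gradient takes away at most \<open>q / \<sigma>\<close>.\<close>
  define g where "g = 1 / \<theta> - q / \<sigma>"
  have s: "0 < \<sigma>" using exponents(5) by simp
  have g: "0 < g" using \<sigma> s \<theta> by (simp add: g_def field_simps)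
  obtain \<kappa> where \<kappa>: "0 < \<kappa>" "\<And>t. 1 \<le> t \<Longrightarrow> \<kappa> \<le> M t" using M_pos[of 1] by auto
  show thesis
  proof (rule that)
    show "0 < max 1 ((B + C3 * V) / (g * \<kappa>))" by simp
    fix u assume u: "u \<in> test" and JB: "J u \<le> B" and D0: "DJ u u = 0"
    define E where "E = EN (grad u)"
    note um = test_functions_measurable_on[OF u]
    note en = EN_integrable[OF um(2) test_integrable(4)[OF u]]
    have E0: "0 \<le> E" using en by (simp add: E_def)
    have AP: "AP (grad u) (grad u) \<le> q * E"
      using en(3) by (simp add: AP_def flux_self E_def)
    have fi: "integrable \<mu> (\<lambda>x. F x (u x))" "integrable \<mu> (\<lambda>x. f x (u x) * u x)"
      using FN_integrable(1)[OF um(1) test_L_integrable[OF u]] BP_integrable[OF um(1) um(1) test_L_integrable[OF u] test_L_integrable[OF u]] by simp_all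
    have "FN u - BP u u / \<sigma> = (\<integral>x. F x (u x) - f x (u x) * u x / \<sigma> \<partial>\<mu>)"
      unfolding FN_def BP_def using fi by simp
    also have "\<dots> \<le> (\<integral>x. C3 \<partial>\<mu>)"
      using fi C3(2) by (intro integral_mono) (auto simp: mult.commute)
    also have "\<dots> = C3 * V" by (simp add: V_def)
    finally have 1: "FN u - BP u u / \<sigma> \<le> C3 * V" .
    have 2: "BP u u = M E * AP (grad u) (grad u)" using D0 by (simp add: DJ_def E_def)
    have "M E * AP (grad u) (grad u) \<le> M E * (q * E)" using AP M_nonneg by (intro mult_left_mono)
    then have "BP u u / \<sigma> \<le> M E * (q * E) / \<sigma>" unfolding 2 using s by (intro divide_right_mono) auto
    moreover have "E * M E / \<theta> \<le> primitive M E" using M_growth[OF E0] \<theta> by (simp add: field_simps)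
    moreover have "primitive M E - FN u \<le> B" using JB by (simp add: J_def E_def)
    ultimately have "E * M E / \<theta> - M E * (q * E) / \<sigma> \<le> B + C3 * V" using 1 by linarith
    then have 3: "g * (M E * E) \<le> B + C3 * V" by (simp add: g_def algebra_simps)
    have "E \<le> max 1 ((B + C3 * V) / (g * \<kappa>))"
    proof (cases "E \<le> 1")
      case False
      have "g * (\<kappa> * E) \<le> g * (M E * E)" using g \<kappa> False by (intro mult_left_mono mult_right_mono) auto
      with 3 have "g * \<kappa> * E \<le> B + C3 * V" by simp
      then have "E \<le> (B + C3 * V) / (g * \<kappa>)" using g \<kappa> by (simp add: pos_le_divide_eq mult.commute)
      then show ?thesis by simp
    qed simp
    then show "EN (grad u) \<le> max 1 ((B + C3 * V) / (g * \<kappa>))" by (simp add: E_def)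
  qed
qed

text \<open>Used in the contrapositive: a level of at least \<open>\<alpha>\<close> keeps the energy
  away from 0, and so from a possible zero of \<open>M\<close>.\<close>

lemma J_small:
  assumes "0 < \<epsilon>"
  obtains \<delta> where "0 < \<delta>" "\<And>u. u \<in> test \<Longrightarrow> EN (grad u) \<le> \<delta> \<Longrightarrow> J u \<le> \<epsilon>"
proof -
  have e2: "0 < \<epsilon> / 2" "0 < \<epsilon> / (2 * C0)" using assms C0 by simp_all
  obtain d1 where d1: "0 < d1" "\<And>\<phi>. \<phi> \<in> test \<Longrightarrow> (\<integral>x. H x (norm (grad \<phi> x)) \<partial>\<mu>) \<le> d1 \<Longrightarrow> (\<integral>x. L (\<phi> x) \<partial>\<mu>) \<le> \<epsilon> / (2 * C0)"
    by (rule sobolev_L_tendsto[OF e2(2)]) blast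
  have "(primitive M \<longlongrightarrow> primitive M 0) (at 0)" using DERIV_isCont[OF P_DERIV] isCont_def by blast
  then have "\<forall>\<^sub>F t in at 0. primitive M t < \<epsilon> / 2" using order_tendstoD(2)[of _ "primitive M 0" _ "\<epsilon> / 2"] e2(1) by simp
  then obtain d2 where d2: "0 < d2" "\<And>t. t \<noteq> 0 \<Longrightarrow> dist t 0 < d2 \<Longrightarrow> primitive M t < \<epsilon> / 2"
    unfolding eventually_at by auto
  show thesis
  proof (rule that)
    show "0 < min (d1 / q) (d2 / 2)" using d1 d2 exponents(1) by simp
    fix u assume u: "u \<in> test" and le: "EN (grad u) \<le> min (d1 / q) (d2 / 2)"
    note um = test_functions_measurable_on[OF u]
    note en = EN_integrable[OF um(2) test_integrable(4)[OF u]]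
    have "q * EN (grad u) \<le> d1" using le exponents(1) by (simp add: field_simps)
    then have "(\<integral>x. L (u x) \<partial>\<mu>) \<le> \<epsilon> / (2 * C0)" using en(3) by (intro d1(2) u) simp
    then have "C0 * (\<integral>x. L (u x) \<partial>\<mu>) \<le> \<epsilon> / 2" using C0 by (simp add: field_simps)
    then have "- FN u \<le> \<epsilon> / 2" using FN_integrable(2)[OF um(1) test_L_integrable[OF u]] by linarith
    moreover have "primitive M (EN (grad u)) \<le> \<epsilon> / 2"
    proof (cases "EN (grad u) = 0")
      case False
      then show ?thesis using d2(2)[of "EN (grad u)"] le d2(1) en(2) by (simp add: dist_real_def)
    qed (use e2(1) in simp)
    ultimately show "J u \<le> \<epsilon>" by (simp add: J_def)
  qed
qed

text \<open>
  Testing the later equation with both functions makes the duality term small, and the tangent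
  inequality turns this into smallness of the convexity gap of the energy.
\<close>
lemma gradients_close:
  assumes \<epsilon>: "0 < \<epsilon>" and D: "0 < D" and E1: "0 < E1"
  obtains \<delta> where "0 < \<delta>" "\<And>u v. u \<in> test \<Longrightarrow> v \<in> test \<Longrightarrow> E1 \<le> EN (grad u) \<Longrightarrow> EN (grad u) \<le> D \<Longrightarrow> EN (grad v) \<le> D \<Longrightarrow>
    \<bar>EN (grad u) - EN (grad v)\<bar> \<le> \<delta> \<Longrightarrow> (\<integral>x. L (u x - v x) \<partial>\<mu>) \<le> \<delta> \<Longrightarrow> DJ u u = 0 \<Longrightarrow> DJ u v = 0 \<Longrightarrow>
    (\<integral>x. H x (norm (grad u x - grad v x)) \<partial>\<mu>) \<le> \<epsilon>"
proof -
  \<comment> \<open>The modulars of the two gradients are at most \<open>q * D\<close> each, so the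
    first part of the convexity estimate costs \<open>\<epsilon> / 2\<close>.\<close>
  define \<eta> where "\<eta> = \<epsilon> / (4 * q * D)"
  have \<eta>: "0 < \<eta>" using \<epsilon> D exponents(1) by (simp add: \<eta>_def)
  obtain C where C: "0 < C" "\<And>x v w. x \<in> \<Omega> \<Longrightarrow> H x (norm (v - w)) \<le>
    \<eta> * (H x (norm v) + H x (norm w)) + C * ((e x v + e x w) / 2 - e x ((1/2) *\<^sub>R (v + w)))"
    by (rule H_uniformly_convex[OF \<eta>]) blast
  obtain \<kappa> where \<kappa>: "0 < \<kappa>" "\<And>t. E1 \<le> t \<Longrightarrow> \<kappa> \<le> M t" using M_pos[OF E1] by auto
  obtain KL where KL: "\<And>\<phi>. \<phi> \<in> test \<Longrightarrow> (\<integral>x. H x (norm (grad \<phi> x)) \<partial>\<mu>) \<le> q * D \<Longrightarrow> (\<integral>x. L (\<phi> x) \<partial>\<mu>) \<le> KL"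
    using sobolev_L_bounded[of "q * D"] by blast
  define \<epsilon>1 where "\<epsilon>1 = \<epsilon> / (4 * C)"
  have \<epsilon>1: "0 < \<epsilon>1" using \<epsilon> C by (simp add: \<epsilon>1_def)
  define \<eta>2 where "\<eta>2 = \<epsilon>1 * \<kappa> / (\<bar>KL\<bar> + 1)"
  have \<eta>2: "0 < \<eta>2" using \<epsilon>1 \<kappa> by (simp add: \<eta>2_def)
  obtain C2 where C2: "0 < C2" "\<And>x t w. x \<in> \<Omega> \<Longrightarrow> \<bar>f x t * w\<bar> \<le> \<eta>2 * L t + C2 * L w"
    by (rule f_small[OF \<eta>2]) blast
  define \<delta> where "\<delta> = min (2 * \<epsilon>1) (\<epsilon>1 * \<kappa> / C2)"
  show thesis
  proof (rule that)
    show "0 < \<delta>" using \<epsilon>1 \<kappa> C2 by (simp add: \<delta>_def)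
    fix u v assume u: "u \<in> test" and v: "v \<in> test" and Eu: "E1 \<le> EN (grad u)" "EN (grad u) \<le> D" and Ev: "EN (grad v) \<le> D"
      and Euv: "\<bar>EN (grad u) - EN (grad v)\<bar> \<le> \<delta>" and Luv: "(\<integral>x. L (u x - v x) \<partial>\<mu>) \<le> \<delta>" and DJ: "DJ u u = 0" "DJ u v = 0"
    note um = test_functions_measurable_on[OF u] and vm = test_functions_measurable_on[OF v]
    note ui = test_integrable(4)[OF u] and vi = test_integrable(4)[OF v]
    note enu = EN_integrable[OF um(2) ui] and env = EN_integrable[OF vm(2) vi]
    have HD: "(\<integral>x. H x (norm (grad u x)) \<partial>\<mu>) \<le> q * D" "(\<integral>x. H x (norm (grad v x)) \<partial>\<mu>) \<le> q * D"
      using order_trans[OF enu(3) mult_left_mono[OF Eu(2)]] order_trans[OF env(3) mult_left_mono[OF Ev]] exponents(1) by simp_all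
    have \<kappa>E: "\<kappa> \<le> M (EN (grad u))" by (rule \<kappa>(2)[OF Eu(1)])
    define Z where "Z = AP (grad u) (grad u) - AP (grad u) (grad v)"
    have APi: "integrable \<mu> (\<lambda>x. \<Phi> x (grad u x) \<bullet> grad u x)" "integrable \<mu> (\<lambda>x. \<Phi> x (grad u x) \<bullet> grad v x)"
      by (rule AP_integrable[OF um(2) um(2) ui ui], rule AP_integrable[OF um(2) vm(2) ui vi])
    have BPi: "integrable \<mu> (\<lambda>x. f x (u x) * u x)" "integrable \<mu> (\<lambda>x. f x (u x) * v x)"
      by (rule BP_integrable[OF um(1) um(1) test_L_integrable[OF u] test_L_integrable[OF u]],
          rule BP_integrable[OF um(1) vm(1) test_L_integrable[OF u] test_L_integrable[OF v]])
    have Ld: "integrable \<mu> (\<lambda>x. L (u x - v x))" using test_L_integrable[OF test_functions_diff(1)[OF u v]] .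
    \<comment> \<open>The two equations at \<open>u\<close> express \<open>M\<close> times the
      duality term through the source paired with \<open>u - v\<close>, which is small as soon as
      \<open>u - v\<close> is small in the gauge \<open>L\<close>.\<close>
    have "M (EN (grad u)) * Z = BP u u - BP u v" using DJ by (simp add: Z_def DJ_def right_diff_distrib)
    also have "\<dots> = (\<integral>x. f x (u x) * (u x - v x) \<partial>\<mu>)" unfolding BP_def using BPi by (simp add: right_diff_distrib)
    also have "\<bar>\<dots>\<bar> \<le> (\<integral>x. \<bar>f x (u x) * (u x - v x)\<bar> \<partial>\<mu>)" by (rule integral_abs_bound)
    also have "\<dots> \<le> (\<integral>x. \<eta>2 * L (u x) + C2 * L (u x - v x) \<partial>\<mu>)"
    proof (rule integral_mono)
      show "integrable \<mu> (\<lambda>x. \<bar>f x (u x) * (u x - v x)\<bar>)" using BPi by (simp add: right_diff_distrib)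
      show "integrable \<mu> (\<lambda>x. \<eta>2 * L (u x) + C2 * L (u x - v x))" using Ld test_L_integrable[OF u] by simp
      show "\<bar>f x (u x) * (u x - v x)\<bar> \<le> \<eta>2 * L (u x) + C2 * L (u x - v x)" if "x \<in> space \<mu>" for x
        using C2(2) that by simp
    qed
    also have "\<dots> = \<eta>2 * (\<integral>x. L (u x) \<partial>\<mu>) + C2 * (\<integral>x. L (u x - v x) \<partial>\<mu>)" using Ld test_L_integrable[OF u] by simp
    also have "\<dots> \<le> \<epsilon>1 * \<kappa> + \<epsilon>1 * \<kappa>"
    proof (rule add_mono)
      have "\<eta>2 * (\<integral>x. L (u x) \<partial>\<mu>) \<le> \<eta>2 * (\<bar>KL\<bar> + 1)" using KL[OF u HD(1)] \<eta>2 by (intro mult_left_mono) auto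
      then show "\<eta>2 * (\<integral>x. L (u x) \<partial>\<mu>) \<le> \<epsilon>1 * \<kappa>" by (simp add: \<eta>2_def)
      have "C2 * (\<integral>x. L (u x - v x) \<partial>\<mu>) \<le> C2 * (\<epsilon>1 * \<kappa> / C2)" using Luv C2(1) by (intro mult_left_mono) (auto simp: \<delta>_def)
      then show "C2 * (\<integral>x. L (u x - v x) \<partial>\<mu>) \<le> \<epsilon>1 * \<kappa>" using C2(1) by simp
    qed
    finally have MZ: "M (EN (grad u)) * \<bar>Z\<bar> \<le> 2 * \<epsilon>1 * \<kappa>" using M_nonneg by (simp add: abs_mult)
    have "\<kappa> * \<bar>Z\<bar> \<le> M (EN (grad u)) * \<bar>Z\<bar>" using \<kappa>E by (intro mult_right_mono) auto
    with MZ have "\<kappa> * \<bar>Z\<bar> \<le> \<kappa> * (2 * \<epsilon>1)" by (simp add: mult_ac)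
    then have Z: "\<bar>Z\<bar> \<le> 2 * \<epsilon>1" using \<kappa>(1) by simp
    let ?w = "\<lambda>x. (1/2) *\<^sub>R (grad u x + grad v x)"
    have wt: "(\<lambda>x. (1/2) * (u x + v x)) \<in> test" "grad (\<lambda>x. (1/2) * (u x + v x)) x = ?w x" for x
      using test_functions_cmult[OF test_functions_add(1)[OF u v], of "1/2"] test_functions_add(2)[OF u v] by simp_all
    have wi: "integrable \<mu> (\<lambda>x. e x (?w x))"
      using EN_integrable(1)[OF test_functions_measurable_on(2)[OF wt(1)] test_integrable(4)[OF wt(1)]] by (simp only: wt(2))
    \<comment> \<open>The tangent to the energy at \<open>grad u\<close>, evaluated at the midpoint
      of the two gradients. It bounds the midpoint energy from below, so the convexity gap is at
      most half the difference of the energies plus \<open>Z / 2\<close>.\<close>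
    have "EN (grad u) - Z / 2 = (\<integral>x. e x (grad u x) + (\<Phi> x (grad u x) \<bullet> grad v x - \<Phi> x (grad u x) \<bullet> grad u x) / 2 \<partial>\<mu>)"
      using enu(1) APi by (simp add: EN_def AP_def Z_def) argo
    also have "\<dots> \<le> (\<integral>x. e x (?w x) \<partial>\<mu>)"
    proof (rule integral_mono[OF _ wi])
      show "e x (grad u x) + (\<Phi> x (grad u x) \<bullet> grad v x - \<Phi> x (grad u x) \<bullet> grad u x) / 2 \<le> e x (?w x)" if "x \<in> space \<mu>" for x
      proof -
        have "?w x - grad u x = (1/2) *\<^sub>R (grad v x - grad u x)" by (simp add: algebra_simps flip: scaleR_2)
        then have "\<Phi> x (grad u x) \<bullet> (?w x - grad u x) = (\<Phi> x (grad u x) \<bullet> grad v x - \<Phi> x (grad u x) \<bullet> grad u x) / 2"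
          by (simp add: inner_diff_right)
        then show ?thesis using e_tangent[of x "grad u x" "?w x"] that unfolding space_\<mu> by argo
      qed
    qed (use enu(1) APi in simp)
    finally have tang: "EN (grad u) - Z / 2 \<le> (\<integral>x. e x (?w x) \<partial>\<mu>)" .
    have "(\<integral>x. H x (norm (grad u x - grad v x)) \<partial>\<mu>)
      \<le> (\<integral>x. \<eta> * (H x (norm (grad u x)) + H x (norm (grad v x))) + C * ((e x (grad u x) + e x (grad v x)) / 2 - e x (?w x)) \<partial>\<mu>)"
      using ui vi enu(1) env(1) wi C(2) integrable_H_diff(1)[OF um(2) vm(2) ui vi] by (intro integral_mono) auto
    also have "\<dots> = \<eta> * ((\<integral>x. H x (norm (grad u x)) \<partial>\<mu>) + (\<integral>x. H x (norm (grad v x)) \<partial>\<mu>))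
      + C * ((EN (grad u) + EN (grad v)) / 2 - (\<integral>x. e x (?w x) \<partial>\<mu>))"
      using ui vi enu(1) env(1) wi by (simp add: EN_def)
    also have "\<dots> \<le> \<eta> * (q * D + q * D) + C * (2 * \<epsilon>1)"
    proof (intro add_mono mult_left_mono)
      show "(EN (grad u) + EN (grad v)) / 2 - (\<integral>x. e x (?w x) \<partial>\<mu>) \<le> 2 * \<epsilon>1"
        using tang Z Euv by (simp add: \<delta>_def abs_le_iff) argo
    qed (use HD \<eta> C in auto)
    also have "\<dots> = \<epsilon>" using D C exponents(1) by (simp add: \<eta>_def \<epsilon>1_def field_simps)
    finally show "(\<integral>x. H x (norm (grad u x - grad v x)) \<partial>\<mu>) \<le> \<epsilon>" .
  qed
qed

section \<open>The Galerkin sequence and its strong convergence\<close>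

lemma galerkin_sequence:
  obtains s U :: "nat \<Rightarrow> 'a \<Rightarrow> real" and \<alpha> D :: real where "\<And>n. s n \<in> test"
    "\<And>\<phi> \<epsilon>. \<phi> \<in> test \<Longrightarrow> 0 < \<epsilon> \<Longrightarrow> \<exists>n. \<forall>x. norm (grad \<phi> x - grad (s n) x) \<le> \<epsilon>"
    "0 < \<alpha>" "0 < D" "\<And>n. U n \<in> test" "\<And>n. \<alpha> \<le> J (U n)" "\<And>n. EN (grad (U n)) \<le> D"
    "\<And>m n. m \<le> n \<Longrightarrow> DJ (U n) (s m) = 0" "\<And>m n. m \<le> n \<Longrightarrow> DJ (U n) (U m) = 0"
proof -
  obtain E0 \<alpha> where E0: "0 < E0" "\<And>u. u \<in> test \<Longrightarrow> EN (grad u) \<le> E0 \<Longrightarrow> 0 \<le> J u"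
    and \<alpha>: "0 < \<alpha>" "\<And>u. u \<in> test \<Longrightarrow> EN (grad u) = E0 \<Longrightarrow> \<alpha> \<le> J u"
    by (rule J_near_zero) blast
  obtain \<phi>0 B where \<phi>0: "\<phi>0 \<in> test" "J \<phi>0 < 0" and B: "\<And>t. t \<in> {0..1} \<Longrightarrow> J (\<lambda>x. t * \<phi>0 x) \<le> B"
    by (rule mountain_pass_direction) blast
  obtain S0 where S0: "countable S0" "S0 \<subseteq> test"
    "\<And>\<phi> \<epsilon>. \<phi> \<in> test \<Longrightarrow> 0 < \<epsilon> \<Longrightarrow> \<exists>\<psi>\<in>S0. \<forall>x. norm (grad \<phi> x - grad \<psi> x) \<le> \<epsilon>"
    by (rule countable_dense_test_functions[OF bounded_\<Omega>]) blast
  obtain D where D: "0 < D" "\<And>u. u \<in> test \<Longrightarrow> J u \<le> B \<Longrightarrow> DJ u u = 0 \<Longrightarrow> EN (grad u) \<le> D"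
    by (rule energy_bound) blast
  define T where "T = insert \<phi>0 S0"
  define s where "s = from_nat_into T"
  have rs: "range s = T" unfolding s_def using S0(1) by (intro range_from_nat_into) (auto simp: T_def)
  have st: "s n \<in> test" for n using rangeI[of s n] S0(2) \<phi>0(1) unfolding rs T_def by auto
  \<comment> \<open>Keeping \<open>\<phi>0\<close> in every set lets the same endpoint and the same
    \<open>B\<close> serve all dimensions.\<close>
  define Sn where "Sn n = insert \<phi>0 (s ` {..n})" for n
  \<comment> \<open>The last clause expresses without coordinates what is needed of \<open>u\<close>
    being in the span of \<open>Sn n\<close>; it makes \<open>U m\<close> admissible in the equation
    of every later \<open>U n\<close>.\<close>
  define Q where "Q n u \<longleftrightarrow> u \<in> test \<and> \<alpha> / 4 \<le> J u \<and> J u \<le> B \<and> (\<forall>w\<in>Sn n. DJ u w = 0) \<and>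
    (\<forall>v\<in>test. (\<forall>w\<in>Sn n. DJ v w = 0) \<longrightarrow> DJ v u = 0)" for n u
  have ex: "\<exists>u. Q n u" for n
  proof -
    have Sn: "finite (Sn n)" "Sn n \<subseteq> test" "\<phi>0 \<in> Sn n" using st \<phi>0(1) by (auto simp: Sn_def)
    obtain k \<psi> c where k: "\<forall>i<k. \<psi> i \<in> Sn n" "\<alpha> / 4 \<le> J (comb k \<psi> c)" "J (comb k \<psi> c) \<le> B" "\<forall>w\<in>Sn n. DJ (comb k \<psi> c) w = 0"
      using galerkin_critical_point[OF Sn(1,2,3) \<phi>0(2) B E0 \<alpha>] by blast
    have \<psi>: "\<psi> i \<in> test" if "i < k" for i using k(1) Sn(2) that by blast
    have "comb k \<psi> c \<in> test" by (rule comb_test(1)[OF \<psi>])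
    moreover have "DJ v (comb k \<psi> c) = 0" if v: "v \<in> test" "\<forall>w\<in>Sn n. DJ v w = 0" for v
    proof -
      have "DJ v (comb k \<psi> c) = (\<Sum>j<k. DJ v (\<psi> j) * c j)" by (rule DJ_comb[OF \<psi> v(1)])
      also have "\<dots> = 0" using v(2) k(1) by (intro sum.neutral) simp
      finally show ?thesis .
    qed
    ultimately show ?thesis using k(2-4) unfolding Q_def by (intro exI[of _ "comb k \<psi> c"]) simp
  qed
  have "\<exists>U. \<forall>n. Q n (U n)" using ex by (intro choice allI)
  then obtain U where "\<And>n. Q n (U n)" by blast
  then have U: "\<And>n. U n \<in> test" "\<And>n. \<alpha> / 4 \<le> J (U n)" "\<And>n. J (U n) \<le> B"
    "\<And>n w. w \<in> Sn n \<Longrightarrow> DJ (U n) w = 0" "\<And>n v. v \<in> test \<Longrightarrow> (\<And>w. w \<in> Sn n \<Longrightarrow> DJ v w = 0) \<Longrightarrow> DJ v (U n) = 0"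
    unfolding Q_def by blast+
  have sub: "Sn m \<subseteq> Sn n" if "m \<le> n" for m n using that by (auto simp: Sn_def)
  have UU: "DJ (U n) (U m) = 0" if "m \<le> n" for m n
    using U(4) sub[OF that] by (intro U(5) U(1)) blast
  show thesis
  proof (rule that[of s "\<alpha> / 4" D U])
    show "\<exists>n. \<forall>x. norm (grad \<phi> x - grad (s n) x) \<le> \<epsilon>" if \<phi>: "\<phi> \<in> test" "0 < \<epsilon>" for \<phi> \<epsilon>
    proof -
      obtain \<psi> where \<psi>: "\<psi> \<in> S0" "\<forall>x. norm (grad \<phi> x - grad \<psi> x) \<le> \<epsilon>" using S0(3)[OF \<phi>] by blast
      then have "\<psi> \<in> range s" unfolding rs T_def by simp
      with \<psi>(2) show ?thesis by blast
    qed
    show "DJ (U n) (s m) = 0" if "m \<le> n" for m n using that by (intro U(4)) (simp add: Sn_def)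
    show "EN (grad (U n)) \<le> D" for n by (intro D(2) U UU order_refl)
  qed (use st \<alpha> D U UU in auto)
qed

lemma galerkin_gradients_Cauchy:
  assumes U: "\<And>n. U n \<in> test" and \<alpha>: "0 < \<alpha>" "\<And>n. \<alpha> \<le> J (U n)" and D: "0 < D" "\<And>n. EN (grad (U n)) \<le> D"
    and crit: "\<And>m n. m \<le> n \<Longrightarrow> DJ (U n) (U m) = 0"
  obtains \<rho> :: "nat \<Rightarrow> nat" where "strict_mono \<rho>"
    "\<And>\<epsilon>. 0 < \<epsilon> \<Longrightarrow> \<exists>n0. \<forall>m\<ge>n0. \<forall>n\<ge>n0. (\<integral>x. H x (norm (grad (U (\<rho> m)) x - grad (U (\<rho> n)) x)) \<partial>\<mu>) \<le> \<epsilon>"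
proof -
  note um = test_functions_measurable_on[OF U] and ui = test_integrable(4)[OF U]
  note en = EN_integrable[OF um(2) ui]
  have "bounded (range (\<lambda>n. EN (grad (U n))))"
    unfolding bounded_iff using D(2) en(2) by (intro exI[of _ D]) (auto simp: abs_of_nonneg)
  then obtain l and r1 :: "nat \<Rightarrow> nat" where r1: "strict_mono r1" "((\<lambda>n. EN (grad (U n))) \<circ> r1) \<longlonglongrightarrow> l"
    using bounded_imp_convergent_subsequence by blast
  have HD: "(\<integral>x. H x (norm (grad (U n) x)) \<partial>\<mu>) \<le> q * D" for n
    using order_trans[OF en(3) mult_left_mono[OF D(2)]] exponents(1) by simp
  have lb: "(\<integral>x. norm (grad (U (r1 n)) x) powr p \<partial>lborel) \<le> q * D" for n
  proof -
    note [measurable] = test_functions_measurable[OF U]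
    have "(\<integral>x. norm (grad (U (r1 n)) x) powr p \<partial>lborel) = (\<integral>x. norm (grad (U (r1 n)) x) powr p \<partial>\<mu>)"
      using test_functions_zero_outside[OF U] by (subst lebesgue_on_borel(1)[OF \<Omega>_borel]) auto
    also have "\<dots> \<le> q * D" using grad_powr_le_H[OF U] HD order_trans by blast
    finally show ?thesis .
  qed
  obtain r2 :: "nat \<Rightarrow> nat" where r2: "strict_mono r2"
    "\<And>\<epsilon>. 0 < \<epsilon> \<Longrightarrow> \<exists>n0. \<forall>m\<ge>n0. \<forall>n\<ge>n0. (\<integral>x. \<bar>U (r1 (r2 m)) x - U (r1 (r2 n)) x\<bar> powr p \<partial>lborel) \<le> \<epsilon>"
    by (rule rellich_test_functions[OF bounded_\<Omega> p(1), where u = "\<lambda>n. U (r1 n)", OF U lb]) blast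
  define \<rho> where "\<rho> = (\<lambda>n. r1 (r2 n))"
  have \<rho>: "strict_mono \<rho>" using strict_mono_o[OF r1(1) r2(1)] by (simp add: \<rho>_def o_def)
  have Elim: "(\<lambda>n. EN (grad (U (\<rho> n)))) \<longlonglongrightarrow> l" using LIMSEQ_subseq_LIMSEQ[OF r1(2) r2(1)] by (simp add: \<rho>_def o_def)
  obtain E1 where E1: "0 < E1" "\<And>u. u \<in> test \<Longrightarrow> EN (grad u) \<le> E1 \<Longrightarrow> J u \<le> \<alpha> / 2"
    by (rule J_small[of "\<alpha> / 2"]) (use \<alpha>(1) in auto)
  have El: "E1 \<le> EN (grad (U n))" for n
  proof (rule ccontr)
    assume "\<not> E1 \<le> EN (grad (U n))"
    then have "J (U n) \<le> \<alpha> / 2" by (intro E1(2) U) simp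
    then show False using \<alpha>(1) \<alpha>(2)[of n] by simp
  qed
  show thesis
  proof (rule that[OF \<rho>])
    fix \<epsilon> :: real assume \<epsilon>: "0 < \<epsilon>"
    obtain \<delta> where \<delta>: "0 < \<delta>" "\<And>u v. u \<in> test \<Longrightarrow> v \<in> test \<Longrightarrow> E1 \<le> EN (grad u) \<Longrightarrow> EN (grad u) \<le> D \<Longrightarrow> EN (grad v) \<le> D \<Longrightarrow>
      \<bar>EN (grad u) - EN (grad v)\<bar> \<le> \<delta> \<Longrightarrow> (\<integral>x. L (u x - v x) \<partial>\<mu>) \<le> \<delta> \<Longrightarrow> DJ u u = 0 \<Longrightarrow> DJ u v = 0 \<Longrightarrow>
      (\<integral>x. H x (norm (grad u x - grad v x)) \<partial>\<mu>) \<le> \<epsilon>"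
      by (rule gradients_close[OF \<epsilon> D(1) E1(1)]) blast
    \<comment> \<open>The constant \<open>2 powr q * (q * D + q * D)\<close> bounds the modulars of
      the gradients of all differences, as interpolation requires.\<close>
    obtain \<delta>2 where \<delta>2: "0 < \<delta>2" "\<And>\<phi>. \<phi> \<in> test \<Longrightarrow> (\<integral>x. H x (norm (grad \<phi> x)) \<partial>\<mu>) \<le> 2 powr q * (q * D + q * D) \<Longrightarrow>
      (\<integral>x. \<bar>\<phi> x\<bar> powr p \<partial>\<mu>) \<le> \<delta>2 \<Longrightarrow> (\<integral>x. L (\<phi> x) \<partial>\<mu>) \<le> \<delta>"
      by (rule L_Cauchy_of_Lp[OF \<delta>(1)]) blast
    have "\<exists>n0. \<forall>m\<ge>n0. \<forall>n\<ge>n0. \<bar>EN (grad (U (\<rho> m))) - EN (grad (U (\<rho> n)))\<bar> < \<delta>"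
      using LIMSEQ_imp_Cauchy[OF Elim] \<delta>(1) by (auto simp: Cauchy_def dist_real_def)
    then obtain n1 where n1: "\<And>m n. n1 \<le> m \<Longrightarrow> n1 \<le> n \<Longrightarrow> \<bar>EN (grad (U (\<rho> m))) - EN (grad (U (\<rho> n)))\<bar> < \<delta>" by blast
    obtain n2 where n2: "\<And>m n. n2 \<le> m \<Longrightarrow> n2 \<le> n \<Longrightarrow> (\<integral>x. \<bar>U (\<rho> m) x - U (\<rho> n) x\<bar> powr p \<partial>lborel) \<le> \<delta>2"
      using r2(2)[OF \<delta>2(1)] unfolding \<rho>_def by blast
    have Lsmall: "(\<integral>x. L (U (\<rho> m) x - U (\<rho> n) x) \<partial>\<mu>) \<le> \<delta>" if "n2 \<le> m" "n2 \<le> n" for m n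
    proof (rule \<delta>2(2))
      note t = test_functions_diff[OF U[of "\<rho> m"] U[of "\<rho> n"]]
      show "(\<lambda>x. U (\<rho> m) x - U (\<rho> n) x) \<in> test" by (rule t)
      have "(\<integral>x. H x (norm (grad (U (\<rho> m)) x - grad (U (\<rho> n)) x)) \<partial>\<mu>) \<le> 2 powr q * (q * D + q * D)"
        by (rule order_trans[OF integrable_H_diff(2)[OF um(2) um(2) ui ui]]) (intro mult_left_mono add_mono HD, simp)
      then show "(\<integral>x. H x (norm (grad (\<lambda>x. U (\<rho> m) x - U (\<rho> n) x) x)) \<partial>\<mu>) \<le> 2 powr q * (q * D + q * D)"
        unfolding t(2) .
      note [measurable] = test_functions_measurable[OF U]
      have "(\<integral>x. \<bar>U (\<rho> m) x - U (\<rho> n) x\<bar> powr p \<partial>\<mu>) = (\<integral>x. \<bar>U (\<rho> m) x - U (\<rho> n) x\<bar> powr p \<partial>lborel)"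
        using test_functions_zero_outside[OF U] by (subst lebesgue_on_borel(1)[OF \<Omega>_borel]) auto
      then show "(\<integral>x. \<bar>U (\<rho> m) x - U (\<rho> n) x\<bar> powr p \<partial>\<mu>) \<le> \<delta>2" using n2[OF that] by simp
    qed
    \<comment> \<open>The equation of the later function is the one in which both are admissible,
      hence the premise \<open>n \<le> m\<close>; the other order follows because the modular of a
      difference is symmetric.\<close>
    have le: "(\<integral>x. H x (norm (grad (U (\<rho> m)) x - grad (U (\<rho> n)) x)) \<partial>\<mu>) \<le> \<epsilon>"
      if "max n1 n2 \<le> m" "max n1 n2 \<le> n" "n \<le> m" for m n
    proof (rule \<delta>(2))
      show "DJ (U (\<rho> m)) (U (\<rho> n)) = 0" using crit strict_mono_less_eq[OF \<rho>] that(3) by blast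
      show "(\<integral>x. L (U (\<rho> m) x - U (\<rho> n) x) \<partial>\<mu>) \<le> \<delta>" using Lsmall that by simp
      show "\<bar>EN (grad (U (\<rho> m))) - EN (grad (U (\<rho> n)))\<bar> \<le> \<delta>" using n1 that by (intro less_imp_le) simp
    qed (intro U El D(2) crit order_refl)+
    show "\<exists>n0. \<forall>m\<ge>n0. \<forall>n\<ge>n0. (\<integral>x. H x (norm (grad (U (\<rho> m)) x - grad (U (\<rho> n)) x)) \<partial>\<mu>) \<le> \<epsilon>"
    proof (intro exI allI impI)
      fix m n assume mn: "max n1 n2 \<le> m" "max n1 n2 \<le> n"
      show "(\<integral>x. H x (norm (grad (U (\<rho> m)) x - grad (U (\<rho> n)) x)) \<partial>\<mu>) \<le> \<epsilon>"
      proof (cases "n \<le> m")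
        case True
        then show ?thesis by (rule le[OF mn])
      next
        case False
        then have "(\<integral>x. H x (norm (grad (U (\<rho> n)) x - grad (U (\<rho> m)) x)) \<partial>\<mu>) \<le> \<epsilon>" by (intro le mn) simp
        then show ?thesis by (simp add: norm_minus_commute)
      qed
    qed
  qed
qed

section \<open>The limit equation\<close>

lemma sobolev_W1H0_L:
  assumes e: "0 < \<epsilon>"
  obtains \<delta> where "0 < \<delta>" "\<And>u \<phi>. u \<in> W1H0 \<Omega> a p q \<Longrightarrow> \<phi> \<in> test \<Longrightarrow> integrable \<mu> (\<lambda>x. L (u x - \<phi> x))"
    "\<And>u \<phi>. u \<in> W1H0 \<Omega> a p q \<Longrightarrow> \<phi> \<in> test \<Longrightarrow> (\<integral>x. H x (norm (wgrad \<Omega> u x - grad \<phi> x)) \<partial>\<mu>) \<le> \<delta> \<Longrightarrow>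
      (\<integral>x. L (u x - \<phi> x) \<partial>\<mu>) \<le> \<epsilon>"
proof -
  have small: "\<exists>\<delta>>0. \<forall>u\<in>W1H0 \<Omega> a p q. \<forall>\<phi>\<in>test. integrable \<mu> (\<lambda>x. \<bar>u x - \<phi> x\<bar> powr s) \<and>
    ((\<integral>x. H x (norm (wgrad \<Omega> u x - grad \<phi> x)) \<partial>\<mu>) \<le> \<delta> \<longrightarrow> (\<integral>x. \<bar>u x - \<phi> x\<bar> powr s \<partial>\<mu>) \<le> \<epsilon> / 2)"
    if s: "1 < s" "s < critical_exponent (real DIM('a)) p" for s
  proof -
    obtain C where C: "0 < C" "\<And>u \<phi>. u \<in> W1H0 \<Omega> a p q \<Longrightarrow> \<phi> \<in> test \<Longrightarrow> integrable \<mu> (\<lambda>x. \<bar>u x - \<phi> x\<bar> powr s)"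
      "\<And>u \<phi>. u \<in> W1H0 \<Omega> a p q \<Longrightarrow> \<phi> \<in> test \<Longrightarrow>
      (\<integral>x. \<bar>u x - \<phi> x\<bar> powr s \<partial>\<mu>) \<le> C * (\<integral>x. H x (norm (wgrad \<Omega> u x - grad \<phi> x)) \<partial>\<mu>) powr (s / p)"
      by (rule sobolev_W1H0[OF s]) blast
    define \<delta> where "\<delta> = (\<epsilon> / (2 * C)) powr (p / s)"
    have "0 < \<delta>" using e C by (simp add: \<delta>_def)
    moreover have "(\<integral>x. \<bar>u x - \<phi> x\<bar> powr s \<partial>\<mu>) \<le> \<epsilon> / 2"
      if u: "u \<in> W1H0 \<Omega> a p q" "\<phi> \<in> test" and le: "(\<integral>x. H x (norm (wgrad \<Omega> u x - grad \<phi> x)) \<partial>\<mu>) \<le> \<delta>" for u \<phi>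
    proof -
      have "0 \<le> (\<integral>x. H x (norm (wgrad \<Omega> u x - grad \<phi> x)) \<partial>\<mu>)"
        by (intro Bochner_Integration.integral_nonneg) (simp add: H_nonneg)
      then have "(\<integral>x. H x (norm (wgrad \<Omega> u x - grad \<phi> x)) \<partial>\<mu>) powr (s / p) \<le> \<delta> powr (s / p)"
        using le p s by (intro powr_mono2) auto
      also have "\<dots> = \<epsilon> / (2 * C)" using e C p s by (simp add: \<delta>_def powr_powr)
      finally have "C * (\<integral>x. H x (norm (wgrad \<Omega> u x - grad \<phi> x)) \<partial>\<mu>) powr (s / p) \<le> C * (\<epsilon> / (2 * C))"
        using C(1) by (intro mult_left_mono) auto
      also have "C * (\<epsilon> / (2 * C)) = \<epsilon> / 2" using C(1) by simp
      finally show ?thesis using order_trans[OF C(3)[OF u]] by blast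
    qed
    ultimately show ?thesis using C(2) by blast
  qed
  obtain d1 where d1: "0 < d1" "\<And>u \<phi>. u \<in> W1H0 \<Omega> a p q \<Longrightarrow> \<phi> \<in> test \<Longrightarrow> integrable \<mu> (\<lambda>x. \<bar>u x - \<phi> x\<bar> powr (q * \<theta>))"
    "\<And>u \<phi>. u \<in> W1H0 \<Omega> a p q \<Longrightarrow> \<phi> \<in> test \<Longrightarrow> (\<integral>x. H x (norm (wgrad \<Omega> u x - grad \<phi> x)) \<partial>\<mu>) \<le> d1 \<Longrightarrow>
      (\<integral>x. \<bar>u x - \<phi> x\<bar> powr (q * \<theta>) \<partial>\<mu>) \<le> \<epsilon> / 2"
    using small[OF exponents(2,4)] by blast
  obtain d2 where d2: "0 < d2" "\<And>u \<phi>. u \<in> W1H0 \<Omega> a p q \<Longrightarrow> \<phi> \<in> test \<Longrightarrow> integrable \<mu> (\<lambda>x. \<bar>u x - \<phi> x\<bar> powr r)"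
    "\<And>u \<phi>. u \<in> W1H0 \<Omega> a p q \<Longrightarrow> \<phi> \<in> test \<Longrightarrow> (\<integral>x. H x (norm (wgrad \<Omega> u x - grad \<phi> x)) \<partial>\<mu>) \<le> d2 \<Longrightarrow>
      (\<integral>x. \<bar>u x - \<phi> x\<bar> powr r \<partial>\<mu>) \<le> \<epsilon> / 2"
    using small[OF exponents(3) r(2)] by blast
  show thesis
  proof (rule that[of "min d1 d2"])
    show "0 < min d1 d2" using d1(1) d2(1) by simp
    fix u \<phi> assume u: "u \<in> W1H0 \<Omega> a p q" "\<phi> \<in> test"
    show "integrable \<mu> (\<lambda>x. L (u x - \<phi> x))"
      unfolding L_def by (intro Bochner_Integration.integrable_add d1(2)[OF u] d2(2)[OF u])
    assume le: "(\<integral>x. H x (norm (wgrad \<Omega> u x - grad \<phi> x)) \<partial>\<mu>) \<le> min d1 d2"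
    have "(\<integral>x. L (u x - \<phi> x) \<partial>\<mu>) = (\<integral>x. \<bar>u x - \<phi> x\<bar> powr (q * \<theta>) \<partial>\<mu>) + (\<integral>x. \<bar>u x - \<phi> x\<bar> powr r \<partial>\<mu>)"
      unfolding L_def by (rule Bochner_Integration.integral_add[OF d1(2)[OF u] d2(2)[OF u]])
    then show "(\<integral>x. L (u x - \<phi> x) \<partial>\<mu>) \<le> \<epsilon>" using d1(3)[OF u] d2(3)[OF u] le by simp
  qed
qed

lemma W1H0_L_integrable:
  assumes u: "u \<in> W1H0 \<Omega> a p q" shows "integrable \<mu> (\<lambda>x. L (u x))"
proof -
  obtain \<delta> where "\<And>\<phi>. \<phi> \<in> test \<Longrightarrow> integrable \<mu> (\<lambda>x. L (u x - \<phi> x))"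
    by (rule sobolev_W1H0_L[of 1]) (use u in auto)
  from this[OF test_functions_zero(1)] show ?thesis by simp
qed

text \<open>The small factor of \<open>flux_inner_small\<close> goes to the fixed field
  \<open>G\<close>, whose modular is \<open>K\<close>, the large one to \<open>W\<close>.\<close>

lemma AP_small:
  assumes [measurable]: "G \<in> borel_measurable \<mu>" and i: "integrable \<mu> (\<lambda>x. H x (norm (G x)))" and \<epsilon>: "0 < \<epsilon>"
  obtains \<delta> where "0 < \<delta>" "\<And>W. W \<in> borel_measurable \<mu> \<Longrightarrow> integrable \<mu> (\<lambda>x. H x (norm (W x))) \<Longrightarrow>
    (\<integral>x. H x (norm (W x)) \<partial>\<mu>) \<le> \<delta> \<Longrightarrow> \<bar>AP G W\<bar> \<le> \<epsilon>"
proof -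
  define K where "K = (\<integral>x. H x (norm (G x)) \<partial>\<mu>)"
  have K: "0 \<le> K" unfolding K_def by (intro Bochner_Integration.integral_nonneg) (simp add: H_nonneg)
  define \<eta> where "\<eta> = \<epsilon> / (2 * (K + 1))"
  have \<eta>: "0 < \<eta>" "\<eta> * K \<le> \<epsilon> / 2" using \<epsilon> K by (simp_all add: \<eta>_def field_simps)
  obtain C where C: "0 < C" "\<And>x v w. x \<in> \<Omega> \<Longrightarrow> \<bar>\<Phi> x v \<bullet> w\<bar> \<le> \<eta> * H x (norm v) + C * H x (norm w)"
    by (rule flux_inner_small[OF \<eta>(1)]) blast
  show thesis
  proof (rule that)
    show "0 < \<epsilon> / (2 * C)" using \<epsilon> C by simp
    fix W :: "'a \<Rightarrow> 'a" assume W[measurable]: "W \<in> borel_measurable \<mu>" and Wi: "integrable \<mu> (\<lambda>x. H x (norm (W x)))"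
      and le: "(\<integral>x. H x (norm (W x)) \<partial>\<mu>) \<le> \<epsilon> / (2 * C)"
    have "\<bar>AP G W\<bar> \<le> (\<integral>x. \<bar>\<Phi> x (G x) \<bullet> W x\<bar> \<partial>\<mu>)" unfolding AP_def by (rule integral_abs_bound)
    also have "\<dots> \<le> (\<integral>x. \<eta> * H x (norm (G x)) + C * H x (norm (W x)) \<partial>\<mu>)"
      using AP_integrable[OF assms(1) W i Wi] i Wi C(2) by (intro integral_mono) auto
    also have "\<dots> = \<eta> * K + C * (\<integral>x. H x (norm (W x)) \<partial>\<mu>)" using i Wi by (simp add: K_def)
    also have "\<dots> \<le> \<epsilon> / 2 + C * (\<epsilon> / (2 * C))" using \<eta>(2) le C(1) by (intro add_mono mult_left_mono) auto
    also have "\<dots> = \<epsilon>" using C(1) by simp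
    finally show "\<bar>AP G W\<bar> \<le> \<epsilon>" .
  qed
qed

lemma BP_small:
  assumes [measurable]: "u \<in> borel_measurable \<mu>" and i: "integrable \<mu> (\<lambda>x. L (u x))" and \<epsilon>: "0 < \<epsilon>"
  obtains \<delta> where "0 < \<delta>" "\<And>w. w \<in> borel_measurable \<mu> \<Longrightarrow> integrable \<mu> (\<lambda>x. L (w x)) \<Longrightarrow>
    (\<integral>x. L (w x) \<partial>\<mu>) \<le> \<delta> \<Longrightarrow> \<bar>BP u w\<bar> \<le> \<epsilon>"
proof -
  define K where "K = (\<integral>x. L (u x) \<partial>\<mu>)"
  have K: "0 \<le> K" unfolding K_def by (intro Bochner_Integration.integral_nonneg) (simp add: L_nonneg)
  define \<eta> where "\<eta> = \<epsilon> / (2 * (K + 1))"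
  have \<eta>: "0 < \<eta>" "\<eta> * K \<le> \<epsilon> / 2" using \<epsilon> K by (simp_all add: \<eta>_def field_simps)
  obtain C where C: "0 < C" "\<And>x t w. x \<in> \<Omega> \<Longrightarrow> \<bar>f x t * w\<bar> \<le> \<eta> * L t + C * L w"
    by (rule f_small[OF \<eta>(1)]) blast
  show thesis
  proof (rule that)
    show "0 < \<epsilon> / (2 * C)" using \<epsilon> C by simp
    fix w assume w[measurable]: "w \<in> borel_measurable \<mu>" and wi: "integrable \<mu> (\<lambda>x. L (w x))"
      and le: "(\<integral>x. L (w x) \<partial>\<mu>) \<le> \<epsilon> / (2 * C)"
    have "\<bar>BP u w\<bar> \<le> (\<integral>x. \<bar>f x (u x) * w x\<bar> \<partial>\<mu>)" unfolding BP_def by (rule integral_abs_bound)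
    also have "\<dots> \<le> (\<integral>x. \<eta> * L (u x) + C * L (w x) \<partial>\<mu>)"
      using BP_integrable[OF assms(1) w i wi] i wi C(2) by (intro integral_mono) auto
    also have "\<dots> = \<eta> * K + C * (\<integral>x. L (w x) \<partial>\<mu>)" using i wi by (simp add: K_def)
    also have "\<dots> \<le> \<epsilon> / 2 + C * (\<epsilon> / (2 * C))" using \<eta>(2) le C(1) by (intro add_mono mult_left_mono) auto
    also have "\<dots> = \<epsilon>" using C(1) by simp
    finally show "\<bar>BP u w\<bar> \<le> \<epsilon>" .
  qed
qed

lemma dense_sequence_W1H0:
  assumes s: "\<And>n. s n \<in> test" "\<And>\<phi> \<epsilon>. \<phi> \<in> test \<Longrightarrow> 0 < \<epsilon> \<Longrightarrow> \<exists>n. \<forall>x. norm (grad \<phi> x - grad (s n) x) \<le> \<epsilon>"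
    and \<phi>: "\<phi> \<in> W1H0 \<Omega> a p q" and \<epsilon>: "0 < \<epsilon>"
  shows "\<exists>n. (\<integral>x. H x (norm (wgrad \<Omega> \<phi> x - grad (s n) x)) \<partial>\<mu>) \<le> \<epsilon>"
proof -
  define \<delta> where "\<delta> = \<epsilon> / (2 * 2 powr q)"
  have \<delta>: "0 < \<delta>" using \<epsilon> by (simp add: \<delta>_def)
  note w = W1H0_D[OF \<phi>]
  obtain \<psi> where \<psi>: "\<psi> \<in> test" "(\<integral>x. H x (norm (wgrad \<Omega> \<phi> x - grad \<psi> x)) \<partial>\<mu>) \<le> \<delta>"
    by (rule W1H0_approx[OF \<phi> \<delta>]) blast
  define V where "V = measure \<mu> \<Omega>"
  have V: "0 \<le> V" by (simp add: V_def)
  \<comment> \<open>The bound 1 makes both powers of \<open>b\<close> at most \<open>b\<close>; the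
    other entry keeps the integral over \<open>\<Omega>\<close> below
    \<open>\<delta>\<close>.\<close>
  define b where "b = min 1 (\<delta> / ((1 + A) * (V + 1)))"
  have b: "0 < b" "b \<le> 1" using \<delta> A V by (simp_all add: b_def)
  have "b * ((1 + A) * (V + 1)) \<le> \<delta> / ((1 + A) * (V + 1)) * ((1 + A) * (V + 1))"
    using A V by (intro mult_right_mono) (simp_all add: b_def)
  then have "b * ((1 + A) * (V + 1)) \<le> \<delta>" using A V by simp
  moreover have "b * ((1 + A) * V) \<le> b * ((1 + A) * (V + 1))" using b A V by (intro mult_left_mono) auto
  ultimately have bV: "b * ((1 + A) * V) \<le> \<delta>" by linarith
  obtain n where n: "\<And>x. norm (grad \<psi> x - grad (s n) x) \<le> b" using s(2)[OF \<psi>(1) b(1)] by blast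
  note pm = test_functions_measurable_on[OF \<psi>(1)] and sm = test_functions_measurable_on[OF s(1)[of n]]
  note pi = test_integrable(4)[OF \<psi>(1)] and si = test_integrable(4)[OF s(1)[of n]]
  have "(\<integral>x. H x (norm (grad \<psi> x - grad (s n) x)) \<partial>\<mu>) \<le> (\<integral>x. (1 + A) * b \<partial>\<mu>)"
  proof (rule integral_mono[OF integrable_H_diff(1)[OF pm(2) sm(2) pi si]])
    fix x assume x: "x \<in> space \<mu>"
    have "H x (norm (grad \<psi> x - grad (s n) x)) \<le> H x b" using x n by (intro H_mono) auto
    also have "\<dots> \<le> b powr p + A * b powr q" using x by (intro H_le) simp
    also have "\<dots> \<le> b powr 1 + A * b powr 1" using b p A by (intro add_mono mult_left_mono powr_mono') auto
    finally show "H x (norm (grad \<psi> x - grad (s n) x)) \<le> (1 + A) * b" using b by (simp add: algebra_simps)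
  qed simp
  also have "\<dots> = b * ((1 + A) * V)" by (simp add: V_def)
  finally have 1: "(\<integral>x. H x (norm (grad (s n) x - grad \<psi> x)) \<partial>\<mu>) \<le> \<delta>" using bV by (simp add: norm_minus_commute)
  have "(\<integral>x. H x (norm (wgrad \<Omega> \<phi> x - grad (s n) x)) \<partial>\<mu>)
    = (\<integral>x. H x (norm ((wgrad \<Omega> \<phi> x - grad \<psi> x) - (grad (s n) x - grad \<psi> x))) \<partial>\<mu>)" by simp
  also have "\<dots> \<le> 2 powr q * ((\<integral>x. H x (norm (wgrad \<Omega> \<phi> x - grad \<psi> x)) \<partial>\<mu>) + (\<integral>x. H x (norm (grad (s n) x - grad \<psi> x)) \<partial>\<mu>))"
    by (intro integrable_H_diff(2) integrable_H_diff(1) borel_measurable_diff w(4,5) pm sm pi si)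
  also have "\<dots> \<le> 2 powr q * (\<delta> + \<delta>)" using \<psi>(2) 1 by (intro mult_left_mono add_mono) auto
  also have "\<dots> = \<epsilon>" by (simp add: \<delta>_def)
  finally show ?thesis by blast
qed

lemma critical_point_on_test_sequence:
  obtains s :: "nat \<Rightarrow> 'a \<Rightarrow> real" and u where "\<And>n. s n \<in> test"
    "\<And>\<phi> \<epsilon>. \<phi> \<in> test \<Longrightarrow> 0 < \<epsilon> \<Longrightarrow> \<exists>n. \<forall>x. norm (grad \<phi> x - grad (s n) x) \<le> \<epsilon>"
    "u \<in> W1H0 \<Omega> a p q" "0 < EN (wgrad \<Omega> u)" "\<And>n. M (EN (wgrad \<Omega> u)) * AP (wgrad \<Omega> u) (grad (s n)) = BP u (s n)"
proof -
  obtain s U :: "nat \<Rightarrow> 'a \<Rightarrow> real" and \<alpha> D :: real where s: "\<And>n. s n \<in> test"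
    "\<And>\<phi> \<epsilon>. \<phi> \<in> test \<Longrightarrow> 0 < \<epsilon> \<Longrightarrow> \<exists>n. \<forall>x. norm (grad \<phi> x - grad (s n) x) \<le> \<epsilon>"
    and \<alpha>: "0 < \<alpha>" and D: "0 < D" and U: "\<And>n. U n \<in> test" and JU: "\<And>n. \<alpha> \<le> J (U n)" and ED: "\<And>n. EN (grad (U n)) \<le> D"
    and crit: "\<And>m n. m \<le> n \<Longrightarrow> DJ (U n) (s m) = 0" "\<And>m n. m \<le> n \<Longrightarrow> DJ (U n) (U m) = 0"
    by (rule galerkin_sequence) blast
  obtain \<rho> :: "nat \<Rightarrow> nat" where \<rho>: "strict_mono \<rho>"
    "\<And>\<epsilon>. 0 < \<epsilon> \<Longrightarrow> \<exists>n0. \<forall>m\<ge>n0. \<forall>n\<ge>n0. (\<integral>x. H x (norm (grad (U (\<rho> m)) x - grad (U (\<rho> n)) x)) \<partial>\<mu>) \<le> \<epsilon>"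
    by (rule galerkin_gradients_Cauchy[where U = U, OF U \<alpha> JU D ED crit(2)]) blast+
  obtain u and \<rho>' :: "nat \<Rightarrow> nat" where \<rho>': "strict_mono \<rho>'" and u: "u \<in> W1H0 \<Omega> a p q"
    and ae: "AE x in \<mu>. (\<lambda>n. U (\<rho> (\<rho>' n)) x) \<longlonglongrightarrow> u x"
    "AE x in \<mu>. (\<lambda>n. grad (U (\<rho> (\<rho>' n))) x) \<longlonglongrightarrow> wgrad \<Omega> u x"
    and lim: "(\<lambda>n. \<integral>x. H x (norm (grad (U (\<rho> n)) x - wgrad \<Omega> u x)) \<partial>\<mu>) \<longlonglongrightarrow> 0"
    by (rule test_Cauchy_converges[of "\<lambda>n. U (\<rho> n)", OF U \<rho>(2)]) blast
  define k where "k = (\<lambda>n. \<rho> (\<rho>' n))"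
  define V where "V = (\<lambda>n. U (k n))"
  have k: "strict_mono k" using strict_mono_o[OF \<rho>(1) \<rho>'] by (simp add: k_def o_def)
  have V: "V n \<in> test" for n by (simp add: V_def U)
  note Vm = test_functions_measurable_on[OF V] and Vi = test_integrable(4)[OF V] and w = W1H0_D[OF u]
  have aeV: "AE x in \<mu>. (\<lambda>n. V n x) \<longlonglongrightarrow> u x" "AE x in \<mu>. (\<lambda>n. grad (V n) x) \<longlonglongrightarrow> wgrad \<Omega> u x"
    using ae by (simp_all add: V_def k_def)
  have limV: "(\<lambda>n. \<integral>x. H x (norm (grad (V n) x - wgrad \<Omega> u x)) \<partial>\<mu>) \<longlonglongrightarrow> 0"
    using LIMSEQ_subseq_LIMSEQ[OF lim \<rho>'] by (simp add: V_def k_def o_def)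
  have Li: "integrable \<mu> (\<lambda>x. L (V n x - u x))" for n
  proof -
    obtain \<delta> where "\<And>\<phi>. \<phi> \<in> test \<Longrightarrow> integrable \<mu> (\<lambda>x. L (u x - \<phi> x))"
      by (rule sobolev_W1H0_L[of 1]) (use u in auto)
    from this[OF V, of n] show ?thesis using L_minus[of "u x - V n x" for x] by simp
  qed
  have Llim: "(\<lambda>n. \<integral>x. L (V n x - u x) \<partial>\<mu>) \<longlonglongrightarrow> 0"
  proof (rule LIMSEQ_I)
    fix \<epsilon> :: real assume \<epsilon>: "0 < \<epsilon>"
    then have \<epsilon>2: "0 < \<epsilon> / 2" by simp
    obtain \<delta> where \<delta>: "0 < \<delta>" "\<And>\<phi>. \<phi> \<in> test \<Longrightarrow> (\<integral>x. H x (norm (wgrad \<Omega> u x - grad \<phi> x)) \<partial>\<mu>) \<le> \<delta> \<Longrightarrow>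
      (\<integral>x. L (u x - \<phi> x) \<partial>\<mu>) \<le> \<epsilon> / 2"
      by (rule sobolev_W1H0_L[OF \<epsilon>2]) (use u in blast)
    obtain n0 where n0: "\<And>n. n0 \<le> n \<Longrightarrow> norm ((\<integral>x. H x (norm (grad (V n) x - wgrad \<Omega> u x)) \<partial>\<mu>) - 0) < \<delta>"
      using LIMSEQ_D[OF limV \<delta>(1)] by blast
    have "norm ((\<integral>x. L (V n x - u x) \<partial>\<mu>) - 0) < \<epsilon>" if "n0 \<le> n" for n
    proof -
      have "(\<integral>x. H x (norm (wgrad \<Omega> u x - grad (V n) x)) \<partial>\<mu>) \<le> \<delta>"
        using n0[OF that] by (simp add: norm_minus_commute abs_less_iff less_imp_le)
      then have 1: "(\<integral>x. L (u x - V n x) \<partial>\<mu>) \<le> \<epsilon> / 2" by (rule \<delta>(2)[OF V])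
      have "L (u x - V n x) = L (V n x - u x)" for x using L_minus[of "u x - V n x"] by simp
      then have "(\<integral>x. L (V n x - u x) \<partial>\<mu>) \<le> \<epsilon> / 2" using 1 by simp
      moreover have "0 \<le> (\<integral>x. L (V n x - u x) \<partial>\<mu>)" by (simp add: L_nonneg)
      ultimately show ?thesis using \<epsilon> by simp
    qed
    then show "\<exists>n0. \<forall>n\<ge>n0. norm ((\<integral>x. L (V n x - u x) \<partial>\<mu>) - 0) < \<epsilon>" by blast
  qed
  note Gt = gradient_functionals_tendsto[OF Vm(2) w(4,5) integrable_H_diff(1)[OF Vm(2) w(4) Vi w(5)] limV aeV(2)]
  note St = source_functionals_tendsto[OF Vm(1) w(1) W1H0_L_integrable[OF u] Li Llim aeV(1)]
  obtain E1 where E1: "0 < E1" "\<And>v. v \<in> test \<Longrightarrow> EN (grad v) \<le> E1 \<Longrightarrow> J v \<le> \<alpha> / 2"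
    by (rule J_small[of "\<alpha> / 2"]) (use \<alpha> in auto)
  have El: "E1 \<le> EN (grad (V n))" for n
  proof (rule ccontr)
    assume "\<not> E1 \<le> EN (grad (V n))"
    then have "J (V n) \<le> \<alpha> / 2" by (intro E1(2) V) simp
    then show False using \<alpha> JU[of "k n"] by (simp add: V_def)
  qed
  \<comment> \<open>The lower bound \<open>E1\<close> on the energies survives in the limit, and
    this excludes the zero solution.\<close>
  have Epos: "0 < EN (wgrad \<Omega> u)"
    using LIMSEQ_le_const[OF Gt(1), of E1] El E1(1) by fastforce
  show thesis
  proof (rule that[of s u, OF s u Epos])
    fix m
    \<comment> \<open>The equation of \<open>U (k n)\<close> admits \<open>s m\<close> as soon as
      \<open>m \<le> k n\<close>, and \<open>n \<le> k n\<close> because \<open>k\<close> is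
      strictly increasing.\<close>
    have eq: "M (EN (grad (V n))) * AP (grad (V n)) (grad (s m)) = BP (V n) (s m)" if "m \<le> n" for n
      using crit(1)[of m "k n"] that strict_mono_imp_increasing[OF k, of n] by (simp add: DJ_def V_def)
    have "isCont M (EN (wgrad \<Omega> u))" using M_cont by (simp add: continuous_on_eq_continuous_at)
    from isCont_tendsto_compose[OF this Gt(1)]
    have "(\<lambda>n. M (EN (grad (V n))) * AP (grad (V n)) (grad (s m))) \<longlonglongrightarrow> M (EN (wgrad \<Omega> u)) * AP (wgrad \<Omega> u) (grad (s m))"
      by (intro tendsto_mult Gt(2) test_functions_measurable_on test_integrable s(1))
    moreover have "(\<lambda>n. M (EN (grad (V n))) * AP (grad (V n)) (grad (s m))) \<longlonglongrightarrow> BP u (s m)"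
    proof (rule Lim_transform_eventually)
      show "(\<lambda>n. BP (V n) (s m)) \<longlonglongrightarrow> BP u (s m)" by (intro St(2) test_functions_measurable_on test_L_integrable s(1))
      show "\<forall>\<^sub>F n in sequentially. BP (V n) (s m) = M (EN (grad (V n))) * AP (grad (V n)) (grad (s m))"
        using eventually_ge_at_top[of m] by eventually_elim (simp add: eq)
    qed
    ultimately show "M (EN (wgrad \<Omega> u)) * AP (wgrad \<Omega> u) (grad (s m)) = BP u (s m)" by (rule LIMSEQ_unique)
  qed
qed

theorem ex_nontrivial_weak_solution:
  "\<exists>u. weak_solution \<Omega> a p q M f u \<and> \<not> (AE x in \<mu>. u x = 0)"
proof -
  obtain s :: "nat \<Rightarrow> 'a \<Rightarrow> real" and u where s: "\<And>n. s n \<in> test"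
    "\<And>\<phi> \<epsilon>. \<phi> \<in> test \<Longrightarrow> 0 < \<epsilon> \<Longrightarrow> \<exists>n. \<forall>x. norm (grad \<phi> x - grad (s n) x) \<le> \<epsilon>"
    and u: "u \<in> W1H0 \<Omega> a p q" and E: "0 < EN (wgrad \<Omega> u)"
    and eq: "\<And>n. M (EN (wgrad \<Omega> u)) * AP (wgrad \<Omega> u) (grad (s n)) = BP u (s n)"
    by (rule critical_point_on_test_sequence) blast
  note w = W1H0_D[OF u] and Lu = W1H0_L_integrable[OF u]
  define m where "m = M (EN (wgrad \<Omega> u))"
  have m0: "0 \<le> m" by (simp add: m_def M_nonneg)
  have eq': "m * AP (wgrad \<Omega> u) (wgrad \<Omega> \<phi>) = BP u \<phi>" if \<phi>: "\<phi> \<in> W1H0 \<Omega> a p q" for \<phi>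
  proof -
    note v = W1H0_D[OF \<phi>] and Lv = W1H0_L_integrable[OF \<phi>]
    have "\<bar>m * AP (wgrad \<Omega> u) (wgrad \<Omega> \<phi>) - BP u \<phi>\<bar> \<le> \<epsilon>" if \<epsilon>: "0 < \<epsilon>" for \<epsilon>
    proof -
      \<comment> \<open>The gradient error enters with the factor \<open>m\<close> and the source
        error with the factor 1.\<close>
      define \<epsilon>1 where "\<epsilon>1 = \<epsilon> / (m + 1)"
      have \<epsilon>1: "0 < \<epsilon>1" using \<epsilon> m0 by (simp add: \<epsilon>1_def)
      obtain d1 where d1: "0 < d1" "\<And>W. W \<in> borel_measurable \<mu> \<Longrightarrow> integrable \<mu> (\<lambda>x. H x (norm (W x))) \<Longrightarrow>
        (\<integral>x. H x (norm (W x)) \<partial>\<mu>) \<le> d1 \<Longrightarrow> \<bar>AP (wgrad \<Omega> u) W\<bar> \<le> \<epsilon>1"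
        by (rule AP_small[OF w(4,5) \<epsilon>1]) blast
      obtain d2 where d2: "0 < d2" "\<And>w. w \<in> borel_measurable \<mu> \<Longrightarrow> integrable \<mu> (\<lambda>x. L (w x)) \<Longrightarrow>
        (\<integral>x. L (w x) \<partial>\<mu>) \<le> d2 \<Longrightarrow> \<bar>BP u w\<bar> \<le> \<epsilon>1"
        by (rule BP_small[OF w(1) Lu \<epsilon>1]) blast
      obtain d3 where d3: "0 < d3" "\<And>\<psi>. \<psi> \<in> test \<Longrightarrow> integrable \<mu> (\<lambda>x. L (\<phi> x - \<psi> x))"
        "\<And>\<psi>. \<psi> \<in> test \<Longrightarrow> (\<integral>x. H x (norm (wgrad \<Omega> \<phi> x - grad \<psi> x)) \<partial>\<mu>) \<le> d3 \<Longrightarrow> (\<integral>x. L (\<phi> x - \<psi> x) \<partial>\<mu>) \<le> d2"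
        by (rule sobolev_W1H0_L[OF d2(1)]) (use \<phi> in blast)
      have "0 < min d1 d3" using d1(1) d3(1) by simp
      then obtain n where n: "(\<integral>x. H x (norm (wgrad \<Omega> \<phi> x - grad (s n) x)) \<partial>\<mu>) \<le> min d1 d3"
        using dense_sequence_W1H0[OF s \<phi>] by blast
      note sm = test_functions_measurable_on[OF s(1)[of n]] and si = test_integrable(4)[OF s(1)[of n]] and Ls = test_L_integrable[OF s(1)[of n]]
      have 1: "\<bar>AP (wgrad \<Omega> u) (\<lambda>x. wgrad \<Omega> \<phi> x - grad (s n) x)\<bar> \<le> \<epsilon>1"
        using n by (intro d1(2) borel_measurable_diff integrable_H_diff(1) v sm si) simp
      have 2: "\<bar>BP u (\<lambda>x. \<phi> x - s n x)\<bar> \<le> \<epsilon>1"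
        using n by (intro d2(2) d3(2,3) borel_measurable_diff v sm s(1)) simp
      have "AP (wgrad \<Omega> u) (\<lambda>x. wgrad \<Omega> \<phi> x - grad (s n) x) = AP (wgrad \<Omega> u) (wgrad \<Omega> \<phi>) - AP (wgrad \<Omega> u) (grad (s n))"
        unfolding AP_def using AP_integrable[OF w(4) v(4) w(5) v(5)] AP_integrable[OF w(4) sm(2) w(5) si] by (simp add: inner_diff_right)
      moreover have "BP u (\<lambda>x. \<phi> x - s n x) = BP u \<phi> - BP u (s n)"
        unfolding BP_def using BP_integrable[OF w(1) v(1) Lu Lv] BP_integrable[OF w(1) sm(1) Lu Ls] by (simp add: right_diff_distrib)
      ultimately have "m * AP (wgrad \<Omega> u) (wgrad \<Omega> \<phi>) - BP u \<phi>
        = m * AP (wgrad \<Omega> u) (\<lambda>x. wgrad \<Omega> \<phi> x - grad (s n) x) - BP u (\<lambda>x. \<phi> x - s n x)"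
        using eq[of n] by (simp add: m_def right_diff_distrib)
      also have "\<bar>\<dots>\<bar> \<le> \<bar>m * AP (wgrad \<Omega> u) (\<lambda>x. wgrad \<Omega> \<phi> x - grad (s n) x)\<bar> + \<bar>BP u (\<lambda>x. \<phi> x - s n x)\<bar>" by (rule abs_triangle_ineq4)
      also have "\<dots> \<le> m * \<epsilon>1 + \<epsilon>1" unfolding abs_mult using 1 2 m0 by (intro add_mono mult_mono) auto
      also have "\<dots> = (m + 1) * \<epsilon>1" by (simp add: distrib_right)
      also have "\<dots> = \<epsilon>" using m0 by (simp add: \<epsilon>1_def)
      finally show ?thesis .
    qed
    then have "\<bar>m * AP (wgrad \<Omega> u) (wgrad \<Omega> \<phi>) - BP u \<phi>\<bar> \<le> 0" by (rule field_le_epsilon[of _ 0, simplified])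
    then show ?thesis by simp
  qed
  have en: "energy \<Omega> a p q u = EN (wgrad \<Omega> u)" by (simp add: energy_def EN_def e_def)
  have "weak_solution \<Omega> a p q M f u"
    unfolding weak_solution_def en
  proof (intro conjI ballI u)
    fix \<phi> assume \<phi>: "\<phi> \<in> W1H0 \<Omega> a p q"
    note v = W1H0_D[OF \<phi>] and Lv = W1H0_L_integrable[OF \<phi>]
    show "integrable \<mu> (\<lambda>x. \<Phi> x (wgrad \<Omega> u x) \<bullet> wgrad \<Omega> \<phi> x)" by (rule AP_integrable[OF w(4) v(4) w(5) v(5)])
    show "integrable \<mu> (\<lambda>x. f x (u x) * \<phi> x)" by (rule BP_integrable[OF w(1) v(1) Lu Lv])
    show "M (EN (wgrad \<Omega> u)) * (\<integral>x. \<Phi> x (wgrad \<Omega> u x) \<bullet> wgrad \<Omega> \<phi> x \<partial>\<mu>) = (\<integral>x. f x (u x) * \<phi> x \<partial>\<mu>)"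
      using eq'[OF \<phi>] by (simp add: m_def AP_def BP_def)
  qed
  moreover have "\<not> (AE x in \<mu>. u x = 0)"
  proof
    assume z: "AE x in \<mu>. u x = 0"
    \<comment> \<open>The equation tested with \<open>u\<close> itself is contradictory: the right
      side is 0 and \<open>m\<close> is positive, so the modular of the gradient would vanish, and
      the energy with it.\<close>
    have "BP u u = 0" unfolding BP_def by (rule integral_eq_zero_AE) (use z in auto)
    moreover obtain \<kappa> where \<kappa>: "0 < \<kappa>" "\<And>t. EN (wgrad \<Omega> u) \<le> t \<Longrightarrow> \<kappa> \<le> M t" using M_pos[OF E] by auto
    have "0 < m" using \<kappa>(1) \<kappa>(2)[OF order_refl] by (simp add: m_def)
    ultimately have "AP (wgrad \<Omega> u) (wgrad \<Omega> u) = 0" using eq'[OF u] by simp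
    then have "(\<integral>x. H x (norm (wgrad \<Omega> u x)) \<partial>\<mu>) = 0" by (simp add: AP_def flux_self)
    then show False using EN_integrable(4)[OF w(4,5)] E by simp
  qed
  ultimately show ?thesis by blast
qed

end

theorem theorem1p1:
  fixes \<Omega> :: "'a::euclidean_space set"
    and a :: "'a \<Rightarrow> real"
    and p q \<theta> :: real
    and M :: "real \<Rightarrow> real"
    and f :: "'a \<Rightarrow> real \<Rightarrow> real"
  assumes dim: "2 \<le> DIM('a)"
    and domain: "open \<Omega>" "bounded \<Omega>" "\<Omega> \<noteq> {}" "lipschitz_boundary \<Omega>"
    and exponents: "1 < p" "p < q" "q < real DIM('a)" "q / p < 1 + 1 / real DIM('a)"
    and weight_lipschitz: "\<exists>L. L-lipschitz_on (closure \<Omega>) a"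
    and weight_nonneg: "\<forall>x\<in>closure \<Omega>. 0 \<le> a x"
    and M_continuous: "continuous_on {0..} M"
    and M_nonneg: "\<forall>t\<ge>0. 0 \<le> M t"
    and theta: "1 \<le> \<theta>" "\<theta> < critical_exponent (real DIM('a)) p / q"
    and M_growth: "\<forall>t\<ge>0. t * M t \<le> \<theta> * primitive M t"
    and M_positive: "\<forall>\<tau>>0. \<exists>\<kappa>>0. \<forall>t\<ge>\<tau>. \<kappa> \<le> M t"
    and f_caratheodory: "caratheodory \<Omega> f"
    and f_growth: "\<exists>r. q * \<theta> < r \<and> r < critical_exponent (real DIM('a)) p \<and>
      (\<forall>\<epsilon>>0. \<exists>\<delta>>0. AE x in lebesgue_on \<Omega>. \<forall>t.
         \<bar>f x t\<bar> \<le> q * \<theta> * \<epsilon> * \<bar>t\<bar> powr (q * \<theta> - 1) + r * \<delta> * \<bar>t\<bar> powr (r - 1))"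
    and f_superlinear: "\<exists>\<sigma> c t0. q * \<theta> < \<sigma> \<and> \<sigma> < critical_exponent (real DIM('a)) p \<and>
      0 < c \<and> 0 \<le> t0 \<and>
      (AE x in lebesgue_on \<Omega>. \<forall>t. t0 \<le> \<bar>t\<bar> \<longrightarrow>
         c \<le> \<sigma> * primitive (f x) t \<and> \<sigma> * primitive (f x) t \<le> t * f x t)"
  shows "\<exists>u. weak_solution \<Omega> a p q M f u \<and> \<not> (AE x in lebesgue_on \<Omega>. u x = 0)"
proof -
  let ?\<mu> = "lebesgue_on \<Omega>"
  have q\<theta>: "q \<le> q * \<theta>" "q * \<theta> < critical_exponent (real DIM('a)) p"
    using mult_left_mono[OF theta(1), of q] theta(2) exponents by (simp_all add: pos_less_divide_eq mult.commute)
  obtain L where "L-lipschitz_on (closure \<Omega>) a" using weight_lipschitz by blast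
  then have a_cont: "continuous_on (closure \<Omega>) a" by (rule lipschitz_on_continuous_on)
  have "compact (closure \<Omega>)" using domain(2) by (simp add: compact_closure)
  then have "bounded (a ` closure \<Omega>)" by (intro compact_imp_bounded compact_continuous_image a_cont)
  then obtain A where A: "0 < A" "\<And>x. x \<in> closure \<Omega> \<Longrightarrow> norm (a x) \<le> A" unfolding bounded_pos by auto
  obtain r where r: "q * \<theta> < r" "r < critical_exponent (real DIM('a)) p"
    and r_growth: "\<And>\<epsilon>. 0 < \<epsilon> \<Longrightarrow> \<exists>\<delta>>0. AE x in ?\<mu>. \<forall>t. \<bar>f x t\<bar> \<le> q * \<theta> * \<epsilon> * \<bar>t\<bar> powr (q * \<theta> - 1) + r * \<delta> * \<bar>t\<bar> powr (r - 1)"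
    using f_growth by blast
  obtain \<delta> where \<delta>: "0 < \<delta>" "AE x in ?\<mu>. \<forall>t. \<bar>f x t\<bar> \<le> q * \<theta> * 1 * \<bar>t\<bar> powr (q * \<theta> - 1) + r * \<delta> * \<bar>t\<bar> powr (r - 1)"
    using r_growth[of 1] by auto
  obtain \<sigma> c t0 where \<sigma>: "q * \<theta> < \<sigma>" and c: "0 < c" and t0: "0 \<le> t0"
    and AR: "AE x in ?\<mu>. \<forall>t. t0 \<le> \<bar>t\<bar> \<longrightarrow> c \<le> \<sigma> * primitive (f x) t \<and> \<sigma> * primitive (f x) t \<le> t * f x t"
    using f_superlinear by blast
  define good where "good x \<longleftrightarrow> continuous_on UNIV (f x) \<and>
    (\<forall>t. \<bar>f x t\<bar> \<le> q * \<theta> * 1 * \<bar>t\<bar> powr (q * \<theta> - 1) + r * \<delta> * \<bar>t\<bar> powr (r - 1)) \<and>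
    (\<forall>t. t0 \<le> \<bar>t\<bar> \<longrightarrow> c \<le> \<sigma> * primitive (f x) t \<and> \<sigma> * primitive (f x) t \<le> t * f x t)" for x
  have "AE x in ?\<mu>. continuous_on UNIV (f x)" using f_caratheodory by (simp add: caratheodory_def)
  then have good: "AE x in ?\<mu>. good x" using \<delta>(2) AR unfolding good_def by eventually_elim blast
  obtain x0 where x0: "good x0" using AE_lebesgue_on_imp_ex[OF domain(1,3) good] by blast
  \<comment> \<open>At the exceptional points \<open>f\<close> takes over its values at one good
    point, so that the conditions hold everywhere. A good point exists because
    \<open>\<Omega>\<close> is open and nonempty and thus not negligible.\<close>
  define g where "g x = (if good x then f x else f x0)" for x
  have g: "continuous_on UNIV (g x)" "\<bar>g x t\<bar> \<le> q * \<theta> * 1 * \<bar>t\<bar> powr (q * \<theta> - 1) + r * \<delta> * \<bar>t\<bar> powr (r - 1)"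
    "t0 \<le> \<bar>t\<bar> \<Longrightarrow> c \<le> \<sigma> * primitive (g x) t" "t0 \<le> \<bar>t\<bar> \<Longrightarrow> \<sigma> * primitive (g x) t \<le> t * g x t" for x t
    using x0 by (auto simp: g_def good_def)
  have gf: "AE x in ?\<mu>. g x = f x" using good by eventually_elim (simp add: g_def)
  define K where "K t = M (max 0 t)" for t
  have K: "primitive K t = primitive M t" if "0 \<le> t" for t
    by (rule primitive_cong) (use that in \<open>auto simp: K_def\<close>)
  \<comment> \<open>The constant \<open>q * \<theta> + r * \<delta>\<close> majorises both
    coefficients of the growth condition, and \<open>t0 + 1\<close> is positive, as the growth
    estimate for \<open>F\<close> divides by it.\<close>
  interpret kirchhoff_problem \<Omega> a p q A \<theta> r \<sigma> "q * \<theta> + r * \<delta>" c "t0 + 1" K g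
  proof
    show "q < critical_exponent (real DIM('a)) p" using q\<theta> by linarith
    show "a \<in> borel_measurable ?\<mu>"
      using domain(1) continuous_on_subset[OF a_cont closure_subset]
      by (intro continuous_imp_measurable_on_sets_lebesgue) (auto simp: borel_open)
    show "0 \<le> a x" "a x \<le> A" if "x \<in> \<Omega>" for x
      using weight_nonneg A(2)[of x] closure_subset that by (auto simp: abs_le_iff)
    show "continuous_on UNIV K" unfolding K_def
      by (rule continuous_on_compose2[OF M_continuous]) (auto intro!: continuous_intros)
    show "t * K t \<le> \<theta> * primitive K t" if "0 \<le> t" for t using M_growth K[OF that] that by (simp add: K_def)
    show "\<exists>\<kappa>>0. \<forall>t\<ge>\<tau>. \<kappa> \<le> K t" if \<tau>: "0 < \<tau>" for \<tau>
    proof -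
      obtain \<kappa> where "0 < \<kappa>" "\<forall>t\<ge>\<tau>. \<kappa> \<le> M t" using M_positive \<tau> by blast
      then show ?thesis using \<tau> by (intro exI[of _ \<kappa>]) (simp add: K_def)
    qed
    show "(\<lambda>x. g x t) \<in> borel_measurable ?\<mu>" for t
    proof (rule borel_measurable_lebesgue_on_AE)
      show "\<Omega> \<in> sets lebesgue" using domain(1) by simp
      show "(\<lambda>x. f x t) \<in> borel_measurable ?\<mu>" using f_caratheodory by (simp add: caratheodory_def)
      show "AE x in ?\<mu>. f x t = g x t" using gf by eventually_elim simp
    qed
    have "0 < q * \<theta>" "0 < r" using exponents q\<theta>(1) r(1) by linarith+
    then have qr: "0 < q * \<theta>" "0 < r * \<delta>" using \<delta>(1) by (auto intro: mult_pos_pos)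
    then show "0 < q * \<theta> + r * \<delta>" by simp
    show "\<bar>g x t\<bar> \<le> (q * \<theta> + r * \<delta>) * (\<bar>t\<bar> powr (q * \<theta> - 1) + \<bar>t\<bar> powr (r - 1))" for x t
    proof -
      have "\<bar>g x t\<bar> \<le> q * \<theta> * \<bar>t\<bar> powr (q * \<theta> - 1) + r * \<delta> * \<bar>t\<bar> powr (r - 1)" using g(2)[of x t] by simp
      also have "\<dots> \<le> (q * \<theta> + r * \<delta>) * \<bar>t\<bar> powr (q * \<theta> - 1) + (q * \<theta> + r * \<delta>) * \<bar>t\<bar> powr (r - 1)"
        using qr by (intro add_mono mult_right_mono) auto
      finally show ?thesis by (simp only: distrib_left)
    qed
  qed (use domain exponents theta r \<sigma> c t0 A M_nonneg g K_def in auto)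
  obtain u where u: "weak_solution \<Omega> a p q K g u" "\<not> (AE x in ?\<mu>. u x = 0)"
    using ex_nontrivial_weak_solution by blast
  \<comment> \<open>The energy is the only argument of \<open>M\<close> in the equation; as it is
    nonnegative, \<open>K\<close> and \<open>M\<close> agree there.\<close>
  have "0 \<le> energy \<Omega> a p q u"
    unfolding energy_def using p(1,2) a_bounds(1) by (intro Bochner_Integration.integral_nonneg) simp
  then have KM: "K (energy \<Omega> a p q u) = M (energy \<Omega> a p q u)" by (simp add: K_def)
  have "weak_solution \<Omega> a p q M f u"
    unfolding weak_solution_def
  proof (intro conjI ballI)
    show "u \<in> W1H0 \<Omega> a p q" using u(1) by (simp add: weak_solution_def)
    fix \<phi> assume \<phi>: "\<phi> \<in> W1H0 \<Omega> a p q"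
    note sol = u(1)[unfolded weak_solution_def KM, THEN conjunct2, rule_format, OF \<phi>]
    have ae: "AE x in ?\<mu>. f x (u x) * \<phi> x = g x (u x) * \<phi> x" using gf by eventually_elim simp
    have m: "(\<lambda>x. g x (u x) * \<phi> x) \<in> borel_measurable ?\<mu>" using sol by (intro borel_measurable_integrable) simp
    have m': "(\<lambda>x. f x (u x) * \<phi> x) \<in> borel_measurable ?\<mu>" by (rule borel_measurable_lebesgue_on_AE[OF \<Omega>_lebesgue m AE_symmetric[OF ae]])
    show "integrable ?\<mu> (\<lambda>x. flux a p q x (wgrad \<Omega> u x) \<bullet> wgrad \<Omega> \<phi> x)" using sol by simp
    show "integrable ?\<mu> (\<lambda>x. f x (u x) * \<phi> x)" using sol integrable_cong_AE[OF m' m ae] by simp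
    show "M (energy \<Omega> a p q u) * (LINT x|?\<mu>. flux a p q x (wgrad \<Omega> u x) \<bullet> wgrad \<Omega> \<phi> x) = (LINT x|?\<mu>. f x (u x) * \<phi> x)"
      using sol integral_cong_AE[OF m' m ae] by simp
  qed
  with u(2) show ?thesis by blast
qed

end
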